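(* Let $\nu>0$, $R_1=\frac{\sqrt{3}}{2\sqrt{2}}\pi$, $R_2=\frac{32\pi^4}{3(1+\sqrt{2})^4}$, and let $$\Gamma_{2d}=\left\{u\in H^1_{df}:\ \|\omega_h\|_{\dot H^{-\frac12}}\exp\left(\frac{\frac14\|u\|_{L^2}^2\|u\|_{\dot H^1}^2-6912\,\pi^4\nu^4}{R_2\nu^4}\right)<R_1\nu\right\}.$$ Then $\Gamma_{2d}$ is unbounded in $\dot H^{\frac12}$ and in $\dot B^{\frac12}_{2,\infty}$, but $\Gamma_{2d}$ is bounded in $\dot B^{-1+\frac3p}_{p,\infty}$ for all $2<p\le+\infty$.
   Context: All spaces are over $\mathbb{R}^3$. With $\hat f(\xi)=\int f(x)e^{-2\pi i x\cdot\xi}dx$, set $\|f\|_{H^s}^2=\int(1+(2\pi|\xi|)^{2s})|\hat f|^2d\xi$ and, for $-\frac32<s<\frac32$, $\|f\|_{\dot H^s}^2=\int(2\pi|\xi|)^{2s}|\hat f|^2d\xi$. $H^1_{df}$ is the space of $u\in H^1(\mathbb{R}^3;\mathbb{R}^3)$ with $\xi\cdot\hat u(\xi)=0$ a.e. For $u\in H^1_{df}$, $\omega=\nabla\times u$ and $\omega_h=(\omega_1,\omega_2,0)$. Homogeneous Besov spaces: for $s>0$, $\|f\|_{\dot B^{-s}_{p,\infty}}=\sup_{t>0}t^{s/2}\|e^{t\Delta}f\|_{L^p}$, with $e^{t\Delta}$ the heat semigroup. For nonnegative regularity index, the standard Littlewood--Paley definition is used: $\|f\|_{\dot B^{s}_{p,\infty}}=\sup_{j\in\mathbb{Z}}2^{js}\|\dot\Delta_jf\|_{L^p}$,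 where $\dot\Delta_j$ are homogeneous dyadic Fourier blocks (for negative index this norm is equivalent to the heat-semigroup norm). A set is bounded in a space if the supremum of the corresponding norm over the set is finite, and unbounded otherwise. *)

theory Defs
  imports "HOL-Analysis.Analysis" "HOL-Probability.Essential_Supremum"
begin

section \<open>Lebesgue norms\<close>

text \<open>All norms take values in the extended nonnegative reals, so that membership in a space and
  boundedness of a set are statements about finiteness.\<close>

definition enn_powr :: "ennreal \<Rightarrow> real \<Rightarrow> ennreal" where
  "enn_powr x r = (if x = \<infinity> then \<infinity> else ennreal (enn2real x powr r))"

definition Lp_norm :: "ennreal \<Rightarrow> (real^3 \<Rightarrow> 'b::real_normed_vector) \<Rightarrow> ennreal" where
  "Lp_norm p f =
     (if p = \<infinity> then esssup lborel (\<lambda>x. ennreal (norm (f x)))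
      else enn_powr (\<integral>\<^sup>+x. ennreal (norm (f x) powr enn2real p) \<partial>lborel) (1 / enn2real p))"

definition in_L2 :: "(real^3 \<Rightarrow> 'b::real_normed_vector) \<Rightarrow> bool" where
  "in_L2 f \<longleftrightarrow> f \<in> borel_measurable lborel \<and> Lp_norm 2 f < \<infinity>"


section \<open>Smooth functions and weak derivatives\<close>

primrec Ck :: "nat \<Rightarrow> (real^3 \<Rightarrow> real) \<Rightarrow> bool" where
  "Ck 0 f \<longleftrightarrow> continuous_on UNIV f"
| "Ck (Suc k) f \<longleftrightarrow>
     (\<forall>x. f differentiable (at x)) \<and> (\<forall>v. Ck k (\<lambda>x. frechet_derivative f (at x) v))"

definition smooth :: "(real^3 \<Rightarrow> real) \<Rightarrow> bool" where
  "smooth f \<longleftrightarrow> (\<forall>k. Ck k f)"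

definition test_function :: "(real^3 \<Rightarrow> real) \<Rightarrow> bool" where
  "test_function \<psi> \<longleftrightarrow> smooth \<psi> \<and> compact (closure {x. \<psi> x \<noteq> 0})"

definition pderiv3 :: "3 \<Rightarrow> (real^3 \<Rightarrow> real) \<Rightarrow> real^3 \<Rightarrow> real" where
  "pderiv3 i f x = frechet_derivative f (at x) (axis i 1)"

definition locally_integrable :: "(real^3 \<Rightarrow> real) \<Rightarrow> bool" where
  "locally_integrable g \<longleftrightarrow> (\<forall>K. compact K \<longrightarrow> set_integrable lborel K g)"

definition has_weak_pderiv :: "3 \<Rightarrow> (real^3 \<Rightarrow> real) \<Rightarrow> (real^3 \<Rightarrow> real) \<Rightarrow> bool" where
  "has_weak_pderiv i f g \<longleftrightarrow> locally_integrable f \<and> locally_integrable g \<and>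
     (\<forall>\<psi>. test_function \<psi> \<longrightarrow>
        (LINT x|lborel. g x * \<psi> x) = - (LINT x|lborel. f x * pderiv3 i \<psi> x))"

text \<open>The weak derivative is unique only up to null sets; an arbitrary representative is chosen,
  and it is used below only under integrals. It exists for the components of an
  \<open>H\<^sup>1\<close> field.\<close>

definition weak_pderiv :: "3 \<Rightarrow> (real^3 \<Rightarrow> real) \<Rightarrow> real^3 \<Rightarrow> real" where
  "weak_pderiv i f = (SOME g. has_weak_pderiv i f g)"

definition vorticity :: "(real^3 \<Rightarrow> real^3) \<Rightarrow> real^3 \<Rightarrow> real^3" where
  "vorticity u x =
     vector [weak_pderiv 2 (\<lambda>y. u y $ 3) x - weak_pderiv 3 (\<lambda>y. u y $ 2) x,
             weak_pderiv 3 (\<lambda>y. u y $ 1) x - weak_pderiv 1 (\<lambda>y. u y $ 3) x,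
             weak_pderiv 1 (\<lambda>y. u y $ 2) x - weak_pderiv 2 (\<lambda>y. u y $ 1) x]"

definition horizontal_vorticity :: "(real^3 \<Rightarrow> real^3) \<Rightarrow> real^3 \<Rightarrow> real^3" where
  "horizontal_vorticity u x = vector [vorticity u x $ 1, vorticity u x $ 2, 0]"


section \<open>Fourier transform\<close>

definition fourier_integral :: "(real^3 \<Rightarrow> real^3) \<Rightarrow> real^3 \<Rightarrow> complex^3" where
  "fourier_integral f \<xi> =
     (\<chi> i. LINT x|lborel. complex_of_real (f x $ i) * cis (- 2 * pi * (x \<bullet> \<xi>)))"

text \<open>For square integrable \<open>f\<close> the Fourier transform is the \<open>L\<^sup>2\<close> limit (Plancherel) of the
  Fourier integrals of the truncations of \<open>f\<close> to balls. It is determined up to null sets,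
  and agrees a.e. with the Fourier integral if \<open>f\<close> is also integrable.\<close>

definition has_fourier :: "(real^3 \<Rightarrow> real^3) \<Rightarrow> (real^3 \<Rightarrow> complex^3) \<Rightarrow> bool" where
  "has_fourier f g \<longleftrightarrow> g \<in> borel_measurable lborel \<and>
     ((\<lambda>R::real. Lp_norm 2 (\<lambda>\<xi>. fourier_integral (\<lambda>x. indicator (cball 0 R) x *\<^sub>R f x) \<xi> - g \<xi>))
        \<longlongrightarrow> 0) at_top"

definition fourier :: "(real^3 \<Rightarrow> real^3) \<Rightarrow> real^3 \<Rightarrow> complex^3" where
  "fourier f = (SOME g. has_fourier f g)"


section \<open>Sobolev spaces\<close>

text \<open>These norms are meaningful for \<open>f\<close> in \<open>L\<^sup>2\<close>; the homogeneous one is used for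
  exponents strictly between \<open>-3/2\<close> and \<open>3/2\<close>.\<close>

definition H_norm :: "real \<Rightarrow> (real^3 \<Rightarrow> real^3) \<Rightarrow> ennreal" where
  "H_norm s f = enn_powr
     (\<integral>\<^sup>+\<xi>. ennreal ((1 + (2 * pi * norm \<xi>) powr (2 * s)) * (norm (fourier f \<xi>))\<^sup>2) \<partial>lborel) (1/2)"

definition Hdot_norm :: "real \<Rightarrow> (real^3 \<Rightarrow> real^3) \<Rightarrow> ennreal" where
  "Hdot_norm s f = enn_powr
     (\<integral>\<^sup>+\<xi>. ennreal ((2 * pi * norm \<xi>) powr (2 * s) * (norm (fourier f \<xi>))\<^sup>2) \<partial>lborel) (1/2)"

definition H1_df :: "(real^3 \<Rightarrow> real^3) set" where
  "H1_df = {u. in_L2 u \<and> H_norm 1 u < \<infinity> \<and>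
     (AE \<xi> in lborel. (\<Sum>i\<in>UNIV. complex_of_real (\<xi> $ i) * fourier u \<xi> $ i) = 0)}"


section \<open>Homogeneous Besov norms\<close>

definition heat :: "real \<Rightarrow> (real^3 \<Rightarrow> real^3) \<Rightarrow> real^3 \<Rightarrow> real^3" where
  "heat t f x =
     (LINT y|lborel. ((4 * pi * t) powr (- 3/2) * exp (- (norm (x - y))\<^sup>2 / (4 * t))) *\<^sub>R f y)"

text \<open>A dyadic cutoff generating a homogeneous Littlewood--Paley decomposition. The annulus
  is arbitrary, which covers the different normalisations of frequency in use.\<close>

definition LP_function :: "(real^3 \<Rightarrow> real) \<Rightarrow> bool" where
  "LP_function \<phi> \<longleftrightarrow>
     smooth \<phi> \<and>
     (\<forall>\<xi>. 0 \<le> \<phi> \<xi> \<and> \<phi> \<xi> \<le> 1) \<and>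
     (\<forall>\<xi> \<eta>. norm \<xi> = norm \<eta> \<longrightarrow> \<phi> \<xi> = \<phi> \<eta>) \<and>
     (\<exists>a b. 0 < a \<and> a < b \<and> (\<forall>\<xi>. \<phi> \<xi> \<noteq> 0 \<longrightarrow> a \<le> norm \<xi> \<and> norm \<xi> \<le> b)) \<and>
     (\<forall>\<xi>. \<xi> \<noteq> 0 \<longrightarrow> ((\<lambda>j::int. \<phi> ((2 powr (- of_int j)) *\<^sub>R \<xi>)) has_sum 1) UNIV)"

text \<open>For \<open>f\<close> in \<open>L\<^sup>2\<close> the localised transform is integrable, so the inverse Fourier integral
  below converges absolutely.\<close>

definition LP_block :: "(real^3 \<Rightarrow> real) \<Rightarrow> int \<Rightarrow> (real^3 \<Rightarrow> real^3) \<Rightarrow> real^3 \<Rightarrow> complex^3" where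
  "LP_block \<phi> j f x =
     (\<chi> i. LINT \<xi>|lborel. complex_of_real (\<phi> ((2 powr (- of_int j)) *\<^sub>R \<xi>)) * fourier f \<xi> $ i
              * cis (2 * pi * (x \<bullet> \<xi>)))"

text \<open>The homogeneous Besov norm with regularity \<open>s\<close>, integrability \<open>p\<close> and third index infinity:
  heat semigroup definition for negative \<open>s\<close>, Littlewood--Paley definition otherwise.\<close>

definition besov_norm :: "(real^3 \<Rightarrow> real) \<Rightarrow> real \<Rightarrow> ennreal \<Rightarrow> (real^3 \<Rightarrow> real^3) \<Rightarrow> ennreal" where
  "besov_norm \<phi> s p f =
     (if s < 0 then (SUP t\<in>{0<..}. ennreal (t powr (- s / 2)) * Lp_norm p (heat t f))
      else (SUP j::int. ennreal (2 powr (of_int j * s)) * Lp_norm p (LP_block \<phi> j f)))"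

definition bounded_wrt :: "((real^3 \<Rightarrow> real^3) \<Rightarrow> ennreal) \<Rightarrow> (real^3 \<Rightarrow> real^3) set \<Rightarrow> bool" where
  "bounded_wrt N S \<longleftrightarrow> (SUP u\<in>S. N u) < \<infinity>"


section \<open>The set of almost two-dimensional fields\<close>

definition R1 :: real where
  "R1 = sqrt 3 / (2 * sqrt 2) * pi"

definition R2 :: real where
  "R2 = 32 * pi ^ 4 / (3 * (1 + sqrt 2) ^ 4)"

text \<open>The two norms in the exponent are finite on \<open>H1_df\<close>, so passing to real numbers there
  loses nothing.\<close>

definition Gamma_2d :: "real \<Rightarrow> (real^3 \<Rightarrow> real^3) set" where
  "Gamma_2d \<nu> = {u \<in> H1_df.
     Hdot_norm (- 1/2) (horizontal_vorticity u) *
       ennreal (exp ((1/4 * (enn2real (Lp_norm 2 u))\<^sup>2 * (enn2real (Hdot_norm 1 u))\<^sup>2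
                        - 6912 * pi ^ 4 * \<nu> ^ 4) / (R2 * \<nu> ^ 4)))
     < ennreal (R1 * \<nu>)}"

end

theory Submission
  imports Defs "HOL-Probability.Characteristic_Functions" "HOL-Real_Asymp.Real_Asymp"
begin

text \<open>
  For \<open>u\<close> in \<open>Gamma_2d \<nu>\<close> let \<open>K\<close> be the product of the
  \<open>L\<^sup>2\<close> and the homogeneous \<open>H\<^sup>1\<close> norm of \<open>u\<close>.
  Cauchy-Schwarz bounds the squared homogeneous Sobolev norm of order one half by
  \<open>K\<close>, which is not bounded on the set; but membership forces the horizontal
  vorticity to be at most a constant times \<open>exp (- c * K\<^sup>2)\<close>
  (\<open>Gamma_vorticity_decay\<close>). Everything is played on the frequency side between the
  growth of \<open>K\<close> and this decay.

  Boundedness. Because \<open>\<xi>\<close> is orthogonal to the transform \<open>U\<close> of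
  \<open>u\<close>, the horizontal vorticity controls \<open>\<xi>\<^sub>3 U\<close> in all
  components (\<open>divergence_free_vertical_bound\<close>). So with the weight
  \<open>\<bar>\<xi>\<bar>\<close> the spectrum has mass at most \<open>K\<close>, and with the
  weight \<open>\<xi>\<^sub>3\<^sup>2 / \<bar>\<xi>\<bar>\<close> it has exponentially small mass;
  interpolation with a parameter that is a negative power of \<open>1 + K\<close> makes the mass
  for the weight \<open>(\<bar>\<xi>\<bar> \<bar>\<xi>\<^sub>3\<bar>)\<close> to the power one
  half at most a constant times any prescribed negative power of \<open>1 + K\<close>. The
  reciprocal of this weight is locally integrable, with integral of order \<open>N\<^sup>2\<close>
  over the ball of radius \<open>N\<close>. By Cauchy-Schwarz the integral of
  \<open>\<bar>U\<bar>\<close> over that ball is at most \<open>B N\<close>, where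
  \<open>B\<close> can again be taken to be a constant times any prescribed negative power of
  \<open>1 + K\<close> (\<open>Gamma_low_frequency_bound\<close>).

  Such a bound on low frequencies gives \<open>L\<^sup>p\<close> bounds: to estimate the set where
  a function exceeds \<open>l\<close>, cut its spectrum at radius \<open>l / (2 B)\<close>; the
  low part stays below \<open>l / 2\<close>, and the high part is measured in
  \<open>L\<^sup>2\<close>. Integrated over \<open>l\<close>, the \<open>p\<close>-th power of the
  \<open>L\<^sup>p\<close> norm is at most a constant times \<open>B\<close> to the power \<open>p
  - 2\<close>, times the spectral mass for the weight \<open>\<bar>\<xi>\<bar>\<close> to the
  power \<open>p - 2\<close> (\<open>Lp_bound_of_low_frequency_bound\<close>). For the heat flow
  and for dyadic blocks that weight reduces to \<open>\<bar>\<xi>\<bar>\<close>, up to exactly the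
  power of the time or of the dyadic scale which the Besov norm compensates. The
  \<open>p\<close>-th power of the Besov norm is therefore at most a constant times
  \<open>B\<close> to the power \<open>p - 2\<close> times \<open>K\<close>, and \<open>B\<close>
  can beat \<open>K\<close> as soon as \<open>p > 2\<close>
  (\<open>Gamma_2d_bounded_Besov\<close>). At \<open>p = 2\<close> the factor \<open>B\<close>
  disappears.

  Unboundedness. The planar swirl with stream function \<open>exp (- \<pi> (x\<^sub>1\<^sup>2 +
  x\<^sub>2\<^sup>2 + \<epsilon>\<^sup>2 x\<^sub>3\<^sup>2))\<close> and amplitude \<open>a
  \<surd>\<epsilon>\<close> has energy and enstrophy of order \<open>a\<^sup>2\<close> uniformly
  in \<open>\<epsilon>\<close>, whereas its spectrum lives at \<open>\<xi>\<^sub>3\<close> of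
  order \<open>\<epsilon>\<close>, so that its horizontal vorticity tends to \<open>0\<close> with
  \<open>\<epsilon>\<close>. For every \<open>a\<close> a small \<open>\<epsilon>\<close> puts it
  into the set (\<open>Gamma_2d_contains_large_fields\<close>), and its spectral mass near the
  first unit vector is of order \<open>a\<^sup>2\<close>; the one-half Sobolev norm and a suitable
  dyadic block both see this mass.

  The first half of the text supplies the analysis behind these computations: the Plancherel
  theorem and the \<open>L\<^sup>2\<close> Fourier transform, and the fact that the weak
  derivatives entering the vorticity exist, are unique, and have the transform \<open>2 \<pi> \<i>
  \<xi>\<^sub>i\<close> times that of the function.
\<close>

section \<open>Square integrable functions\<close>

text \<open>The square is kept to avoid roots of extended reals; convergence in
  \<open>L\<^sup>2\<close> is expressed as \<open>L2sq\<close> of the difference tending to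
  \<open>0\<close>.\<close>

definition L2sq :: "('a::euclidean_space \<Rightarrow> 'b::real_normed_vector) \<Rightarrow> ennreal" where
  "L2sq f = (\<integral>\<^sup>+x. ennreal ((norm (f x))\<^sup>2) \<partial>lborel)"

lemma sum_square_weighted:
  fixes a b d :: real
  assumes "0 < d"
  shows "(a + b)\<^sup>2 \<le> (1 + d) * a\<^sup>2 + (1 + 1 / d) * b\<^sup>2"
proof -
  have "0 \<le> (d * a - b)\<^sup>2 / d"
    using assms by simp
  also have "(d * a - b)\<^sup>2 / d = d * a\<^sup>2 - 2 * a * b + b\<^sup>2 / d"
    using assms by (simp add: power2_eq_square field_simps)
  finally show ?thesis
    by (simp add: power2_sum algebra_simps)
qed

text \<open>A substitute for the triangle inequality of the norm that stays with squares: as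
  \<open>d\<close> tends to \<open>0\<close> the factor of the main term tends to
  \<open>1\<close>, so no constant is lost in limits.\<close>

lemma L2sq_split_weighted:
  fixes f g :: "'a::euclidean_space \<Rightarrow> 'b::{second_countable_topology, real_normed_vector}"
  assumes [measurable]: "f \<in> borel_measurable borel" "g \<in> borel_measurable borel" and d: "0 < d"
  shows "L2sq f \<le> ennreal (1 + d) * L2sq g + ennreal (1 + 1 / d) * L2sq (\<lambda>x. f x - g x)"
proof -
  have "(norm (f x))\<^sup>2 \<le> (1 + d) * (norm (g x))\<^sup>2 + (1 + 1 / d) * (norm (f x - g x))\<^sup>2" for x
  proof -
    have "norm (f x) \<le> norm (g x) + norm (f x - g x)"
      by (metis add_diff_cancel_left' diff_add_cancel norm_triangle_ineq)
    then have "(norm (f x))\<^sup>2 \<le> (norm (g x) + norm (f x - g x))\<^sup>2"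
      by (intro power_mono) auto
    then show ?thesis
      using sum_square_weighted[OF d] by (rule order_trans)
  qed
  then have "L2sq f \<le> (\<integral>\<^sup>+x. ennreal ((1 + d) * (norm (g x))\<^sup>2 + (1 + 1 / d) * (norm (f x - g x))\<^sup>2) \<partial>lborel)"
    unfolding L2sq_def by (intro nn_integral_mono ennreal_leI) auto
  also have "\<dots> = (\<integral>\<^sup>+x. ennreal (1 + d) * ennreal ((norm (g x))\<^sup>2) + ennreal (1 + 1 / d) * ennreal ((norm (f x - g x))\<^sup>2) \<partial>lborel)"
    using d by (intro nn_integral_cong) (simp add: ennreal_mult ennreal_plus)
  also have "\<dots> = ennreal (1 + d) * L2sq g + ennreal (1 + 1 / d) * L2sq (\<lambda>x. f x - g x)"
    unfolding L2sq_def by (simp add: nn_integral_add nn_integral_cmult)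
  finally show ?thesis .
qed

lemma L2sq_diff_commute: "L2sq (\<lambda>x. f x - g x) = L2sq (\<lambda>x. g x - f x)"
  by (simp add: L2sq_def norm_minus_commute)

lemma L2sq_triangle:
  fixes f g h :: "'a::euclidean_space \<Rightarrow> 'b::{second_countable_topology, real_normed_vector}"
  assumes [measurable]: "f \<in> borel_measurable borel" "g \<in> borel_measurable borel" "h \<in> borel_measurable borel"
  shows "L2sq (\<lambda>x. f x - h x) \<le> 2 * L2sq (\<lambda>x. f x - g x) + 2 * L2sq (\<lambda>x. g x - h x)"
proof -
  have "L2sq (\<lambda>x. f x - h x) \<le> ennreal (1 + 1) * L2sq (\<lambda>x. f x - g x)
      + ennreal (1 + 1 / 1) * L2sq (\<lambda>x. (f x - h x) - (f x - g x))"
    by (rule L2sq_split_weighted) auto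
  then show ?thesis
    by simp
qed

lemma L2sq_cmult:
  fixes c :: "'b::{second_countable_topology, real_normed_field}"
  assumes [measurable]: "f \<in> borel_measurable borel"
  shows "L2sq (\<lambda>x. c * f x) = ennreal ((norm c)\<^sup>2) * L2sq f"
  unfolding L2sq_def by (simp add: norm_mult power_mult_distrib ennreal_mult nn_integral_cmult)

lemma L2sq_cong_AE:
  "AE x in lborel. f x = g x \<Longrightarrow> L2sq f = L2sq g"
  unfolding L2sq_def by (intro nn_integral_cong_AE) auto

lemma L2sq_eq_0_iff:
  fixes f :: "'a::euclidean_space \<Rightarrow> 'b::{second_countable_topology, real_normed_vector}"
  assumes [measurable]: "f \<in> borel_measurable borel"
  shows "L2sq f = 0 \<longleftrightarrow> (AE x in lborel. f x = 0)"
  unfolding L2sq_def by (subst nn_integral_0_iff_AE) (auto simp: ennreal_eq_0_iff)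

lemma tendsto_ennreal_mult_null:
  fixes e :: "'i \<Rightarrow> ennreal"
  assumes "(e \<longlongrightarrow> 0) F" "c \<noteq> \<infinity>"
  shows "((\<lambda>n. c * e n) \<longlongrightarrow> 0) F"
  using ennreal_tendsto_cmult[of c e 0 F] assms by (simp add: top.not_eq_extremum)

lemma L2sq_tendsto_trans:
  fixes f g h :: "'i \<Rightarrow> 'a::euclidean_space \<Rightarrow> 'b::{second_countable_topology, real_normed_vector}"
  assumes m: "\<And>n. f n \<in> borel_measurable borel" "\<And>n. g n \<in> borel_measurable borel" "\<And>n. h n \<in> borel_measurable borel"
  assumes "((\<lambda>n. L2sq (\<lambda>x. f n x - g n x)) \<longlongrightarrow> 0) F" "((\<lambda>n. L2sq (\<lambda>x. g n x - h n x)) \<longlongrightarrow> 0) F"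
  shows "((\<lambda>n. L2sq (\<lambda>x. f n x - h n x)) \<longlongrightarrow> 0) F"
proof (rule tendsto_sandwich[OF _ _ tendsto_const])
  show "\<forall>\<^sub>F n in F. L2sq (\<lambda>x. f n x - h n x) \<le> 2 * L2sq (\<lambda>x. f n x - g n x) + 2 * L2sq (\<lambda>x. g n x - h n x)"
    using m by (intro always_eventually allI L2sq_triangle)
  have "((\<lambda>n. 2 * L2sq (\<lambda>x. f n x - g n x) + 2 * L2sq (\<lambda>x. g n x - h n x)) \<longlongrightarrow> 0 + 0) F"
    by (intro tendsto_add tendsto_ennreal_mult_null assms) auto
  then show "((\<lambda>n. 2 * L2sq (\<lambda>x. f n x - g n x) + 2 * L2sq (\<lambda>x. g n x - h n x)) \<longlongrightarrow> 0) F"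
    by simp
qed auto

lemma L2_limit_unique:
  fixes g h :: "'a::euclidean_space \<Rightarrow> 'b::{second_countable_topology, real_normed_vector}"
  assumes m: "\<And>n. f n \<in> borel_measurable borel" "g \<in> borel_measurable borel" "h \<in> borel_measurable borel"
  assumes F: "F \<noteq> bot"
    "((\<lambda>n. L2sq (\<lambda>x. f n x - g x)) \<longlongrightarrow> 0) F" "((\<lambda>n. L2sq (\<lambda>x. f n x - h x)) \<longlongrightarrow> 0) F"
  shows "AE x in lborel. g x = h x"
proof -
  have "((\<lambda>n. L2sq (\<lambda>x. g x - h x)) \<longlongrightarrow> 0) F"
    by (rule L2sq_tendsto_trans[where f="\<lambda>n. g" and g=f and h="\<lambda>n. h"])
      (use assms in \<open>auto simp: L2sq_diff_commute[of g]\<close>)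
  then have "L2sq (\<lambda>x. g x - h x) = 0"
    using F(1) tendsto_const tendsto_unique by blast
  then show ?thesis
    using m by (subst (asm) L2sq_eq_0_iff) auto
qed

text \<open>Norm inequalities pass to \<open>L\<^sup>2\<close> limits. The two sides may live on
  different spaces, because the intended use is a function on one side and its Fourier transform
  on the other.\<close>

lemma L2sq_le_of_limits:
  fixes f :: "'a::euclidean_space \<Rightarrow> 'b::{second_countable_topology, real_normed_vector}"
    and g :: "'c::euclidean_space \<Rightarrow> 'd::{second_countable_topology, real_normed_vector}"
  assumes m[measurable]: "\<And>n. fs n \<in> borel_measurable borel" "f \<in> borel_measurable borel"
     "\<And>n. gs n \<in> borel_measurable borel" "g \<in> borel_measurable borel"
  assumes F: "F \<noteq> bot"
    "((\<lambda>n. L2sq (\<lambda>x. fs n x - f x)) \<longlongrightarrow> 0) F" "((\<lambda>n. L2sq (\<lambda>x. gs n x - g x)) \<longlongrightarrow> 0) F"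
    and le: "\<And>n. L2sq (fs n) \<le> L2sq (gs n)"
  shows "L2sq f \<le> L2sq g"
proof (cases "L2sq g = \<infinity>")
  case False
  \<comment> \<open>first the limit along \<open>F\<close> for fixed \<open>d\<close>, then
      \<open>d \<rightarrow> 0\<close>\<close>
  have main: "L2sq f \<le> ennreal ((1 + d)\<^sup>2) * L2sq g" if d: "0 < d" for d
  proof (rule tendsto_lowerbound[OF _ _ F(1)])
    let ?E = "\<lambda>n. ennreal (1 + d) * (ennreal (1 + d) * L2sq g + ennreal (1 + 1 / d) * L2sq (\<lambda>x. gs n x - g x))
        + ennreal (1 + 1 / d) * L2sq (\<lambda>x. fs n x - f x)"
    have "(?E \<longlongrightarrow> ennreal (1 + d) * (ennreal (1 + d) * L2sq g + ennreal (1 + 1 / d) * 0) + ennreal (1 + 1 / d) * 0) F"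
      by (intro tendsto_add ennreal_tendsto_cmult tendsto_const F) auto
    then show "(?E \<longlongrightarrow> ennreal ((1 + d)\<^sup>2) * L2sq g) F"
      using d by (simp add: power2_eq_square ennreal_mult mult.assoc)
    show "\<forall>\<^sub>F n in F. L2sq f \<le> ?E n"
    proof (intro always_eventually allI)
      fix n
      have "L2sq f \<le> ennreal (1 + d) * L2sq (fs n) + ennreal (1 + 1 / d) * L2sq (\<lambda>x. fs n x - f x)"
        using L2sq_split_weighted[OF m(2) m(1)[of n] d] by (simp add: L2sq_diff_commute[of f])
      also have "L2sq (fs n) \<le> ennreal (1 + d) * L2sq g + ennreal (1 + 1 / d) * L2sq (\<lambda>x. gs n x - g x)"
        using le L2sq_split_weighted[OF m(3)[of n] m(4) d] by (rule order_trans)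
      finally show "L2sq f \<le> ?E n"
        by (simp add: add_mono mult_left_mono)
    qed
  qed
  have "((\<lambda>d. ennreal ((1 + d)\<^sup>2) * L2sq g) \<longlongrightarrow> ennreal ((1 + 0)\<^sup>2) * L2sq g) (at_right 0)"
    using False by (intro tendsto_mult_ennreal tendsto_ennrealI tendsto_intros tendsto_ident_at) auto
  then have "((\<lambda>d. ennreal ((1 + d)\<^sup>2) * L2sq g) \<longlongrightarrow> L2sq g) (at_right 0)"
    by simp
  then show ?thesis
    by (rule tendsto_lowerbound) (auto simp: eventually_at_right_less main intro!: eventually_at_rightI[of 0 1])
qed auto

lemma L2sq_eq_of_limits:
  fixes f :: "'a::euclidean_space \<Rightarrow> 'b::{second_countable_topology, real_normed_vector}"
    and g :: "'c::euclidean_space \<Rightarrow> 'd::{second_countable_topology, real_normed_vector}"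
  assumes "\<And>n. fs n \<in> borel_measurable borel" "f \<in> borel_measurable borel"
     "\<And>n. gs n \<in> borel_measurable borel" "g \<in> borel_measurable borel"
     "F \<noteq> bot"
    "((\<lambda>n. L2sq (\<lambda>x. fs n x - f x)) \<longlongrightarrow> 0) F" "((\<lambda>n. L2sq (\<lambda>x. gs n x - g x)) \<longlongrightarrow> 0) F"
    "\<And>n. L2sq (fs n) = L2sq (gs n)"
  shows "L2sq f = L2sq g"
  by (rule antisym; rule L2sq_le_of_limits[where F=F]) (use assms in auto)

lemma L2sq_Fatou:
  fixes f :: "nat \<Rightarrow> 'a::euclidean_space \<Rightarrow> 'b::{second_countable_topology, real_normed_vector}"
  assumes [measurable]: "\<And>n. f n \<in> borel_measurable borel" "g \<in> borel_measurable borel"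
    and lim: "AE x in lborel. (\<lambda>n. f n x) \<longlonglongrightarrow> g x"
    and le: "\<forall>\<^sub>F n in sequentially. L2sq (f n) \<le> C"
  shows "L2sq g \<le> C"
proof -
  have "L2sq g = (\<integral>\<^sup>+x. liminf (\<lambda>n. ennreal ((norm (f n x))\<^sup>2)) \<partial>lborel)"
    unfolding L2sq_def
  proof (rule nn_integral_cong_AE, use lim in eventually_elim)
    case (elim x)
    then have "(\<lambda>n. ennreal ((norm (f n x))\<^sup>2)) \<longlonglongrightarrow> ennreal ((norm (g x))\<^sup>2)"
      by (intro tendsto_ennrealI tendsto_intros)
    then show ?case
      by (simp only: lim_imp_Liminf[OF sequentially_bot])
  qed
  also have "\<dots> \<le> liminf (\<lambda>n. L2sq (f n))"
    unfolding L2sq_def by (rule nn_integral_liminf) auto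
  also have "\<dots> \<le> C"
    using le by (intro Liminf_le) auto
  finally show ?thesis .
qed

text \<open>Cauchy-Schwarz against the geometric series, in the form \<open>2 d \<le>
  2\<^sup>-\<^sup>k + 2\<^sup>k d\<^sup>2\<close>.\<close>

lemma summable_of_weighted_squares:
  fixes d :: "nat \<Rightarrow> real"
  assumes "\<And>k. 0 \<le> d k" "summable (\<lambda>k. 2 ^ k * (d k)\<^sup>2)"
  shows "summable d"
proof (rule summable_comparison_test)
  have "d k \<le> (1/2) ^ k + 2 ^ k * (d k)\<^sup>2" for k
  proof -
    have "0 \<le> ((1/2) ^ k - d k)\<^sup>2 * 2 ^ k"
      by simp
    also have "((1/2) ^ k - d k)\<^sup>2 * 2 ^ k = (1/2) ^ k - 2 * d k + 2 ^ k * (d k)\<^sup>2"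
      by (simp add: power2_diff algebra_simps power_divide power2_eq_square)
    finally show ?thesis
      using assms(1)[of k] by linarith
  qed
  then show "\<exists>N. \<forall>n\<ge>N. norm (d n) \<le> (1/2) ^ n + 2 ^ n * (d n)\<^sup>2"
    using assms(1) by simp
  show "summable (\<lambda>k. (1/2) ^ k + 2 ^ k * (d k)\<^sup>2)"
    by (intro summable_add assms summable_geometric) simp
qed

text \<open>Riesz-Fischer: a subsequence with rapidly decaying increments converges almost
  everywhere, and Fatou's lemma makes its pointwise limit the \<open>L\<^sup>2\<close> limit of
  the whole sequence.\<close>

lemma L2_complete:
  fixes f :: "nat \<Rightarrow> 'a::euclidean_space \<Rightarrow> 'b::{second_countable_topology, banach}"
  assumes m[measurable]: "\<And>n. f n \<in> borel_measurable borel"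
    and Cauchy: "\<And>e. 0 < e \<Longrightarrow> \<exists>N. \<forall>m\<ge>N. \<forall>n\<ge>N. L2sq (\<lambda>x. f m x - f n x) \<le> ennreal e"
  obtains g where "g \<in> borel_measurable borel" "(\<lambda>n. L2sq (\<lambda>x. f n x - g x)) \<longlonglongrightarrow> 0"
proof -
  have "\<forall>k. \<exists>N. \<forall>m\<ge>N. \<forall>n\<ge>N. L2sq (\<lambda>x. f m x - f n x) \<le> ennreal ((1/4) ^ k)"
    using Cauchy by simp
  then obtain N where N: "\<And>k m n. m \<ge> N k \<Longrightarrow> n \<ge> N k \<Longrightarrow> L2sq (\<lambda>x. f m x - f n x) \<le> ennreal ((1/4) ^ k)"
    by metis
  \<comment> \<open>the summand \<open>N k\<close> puts \<open>r k\<close> beyond \<open>N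
      k\<close>, and the summand \<open>k\<close> makes it at least \<open>k\<close>\<close>
  define r where "r k = k + (\<Sum>i\<le>k. N i)" for k
  have rN: "N k \<le> r k" for k
    unfolding r_def by (intro trans_le_add2 member_le_sum) auto
  have r_mono: "r k \<le> r (Suc k)" for k
    by (simp add: r_def)
  have r_id: "k \<le> r k" for k
    by (simp add: r_def)
  define d where "d k x = norm (f (r (Suc k)) x - f (r k) x)" for k x
  have [measurable]: "d k \<in> borel_measurable borel" for k
    unfolding d_def by simp
  have "(\<integral>\<^sup>+x. (\<Sum>k. ennreal (2 ^ k * (d k x)\<^sup>2)) \<partial>lborel) = (\<Sum>k. \<integral>\<^sup>+x. ennreal (2 ^ k * (d k x)\<^sup>2) \<partial>lborel)"
    by (rule nn_integral_suminf) simp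
  also have "\<dots> = (\<Sum>k. 2 ^ k * L2sq (\<lambda>x. f (r (Suc k)) x - f (r k) x))"
    unfolding L2sq_def by (simp add: ennreal_mult nn_integral_cmult d_def flip: ennreal_power)
  also have "\<dots> \<le> (\<Sum>k. ennreal ((1/2) ^ k))"
  proof (rule suminf_le)
    fix k
    have "2 ^ k * L2sq (\<lambda>x. f (r (Suc k)) x - f (r k) x) \<le> 2 ^ k * ennreal ((1/4) ^ k)"
      using rN[of k] r_mono[of k] by (intro mult_left_mono N) auto
    also have "\<dots> = ennreal (2 ^ k * (1/4) ^ k)"
      by (simp add: ennreal_mult flip: ennreal_power)
    also have "(2::real) ^ k * (1/4) ^ k = (1/2) ^ k"
      by (simp flip: power_mult_distrib)
    finally show "2 ^ k * L2sq (\<lambda>x. f (r (Suc k)) x - f (r k) x) \<le> ennreal ((1/2) ^ k)" .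
  qed auto
  also have "\<dots> = ennreal (\<Sum>k. (1/2) ^ k)"
    by (intro suminf_ennreal2 summable_geometric) auto
  also have "\<dots> < \<infinity>"
    by simp
  finally have "AE x in lborel. (\<Sum>k. ennreal (2 ^ k * (d k x)\<^sup>2)) \<noteq> \<infinity>"
    by (intro nn_integral_PInf_AE) auto
  then have conv: "AE x in lborel. convergent (\<lambda>k. f (r k) x)"
  proof eventually_elim
    case (elim x)
    then have "summable (\<lambda>k. 2 ^ k * (d k x)\<^sup>2)"
      by (intro summable_suminf_not_top) auto
    then have "summable (\<lambda>k. d k x)"
      by (rule summable_of_weighted_squares[rotated]) (simp add: d_def)
    then have "summable (\<lambda>k. f (r (Suc k)) x - f (r k) x)"
      unfolding d_def by (rule summable_norm_cancel)
    then show ?case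
      by (simp only: summable_iff_convergent sum_lessThan_telescope[of "\<lambda>k. f (r k) x"]
          convergent_diff_const_right_iff)
  qed
  define g where "g x = lim (\<lambda>k. f (r k) x)" for x
  have gm[measurable]: "g \<in> borel_measurable borel"
    unfolding g_def by measurable
  show thesis
  proof (rule that[OF gm])
    show "(\<lambda>n. L2sq (\<lambda>x. f n x - g x)) \<longlonglongrightarrow> 0"
    proof (rule order_tendstoI)
      fix a :: ennreal assume "0 < a"
      then obtain e where e: "0 < e" "ennreal e < a"
      proof -
        obtain b where b: "0 < b" "b < a"
          using dense[OF \<open>0 < a\<close>] by blast
        then obtain e where "b = ennreal e" "0 \<le> e"
          by (cases b) auto
        with b show thesis
          by (intro that[of e]) auto
      qed
      from Cauchy[OF e(1)] obtain M where M: "\<forall>m\<ge>M. \<forall>n\<ge>M. L2sq (\<lambda>x. f m x - f n x) \<le> ennreal e" ..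
      have "L2sq (\<lambda>x. f n x - g x) \<le> ennreal e" if "n \<ge> M" for n
      proof (rule L2sq_Fatou)
        show "AE x in lborel. (\<lambda>k. f n x - f (r k) x) \<longlonglongrightarrow> f n x - g x"
          using conv by eventually_elim (auto intro!: tendsto_intros simp: g_def convergent_LIMSEQ_iff)
        show "\<forall>\<^sub>F k in sequentially. L2sq (\<lambda>x. f n x - f (r k) x) \<le> ennreal e"
          unfolding eventually_sequentially using M that order_trans[OF _ r_id] by blast
      qed auto
      then show "\<forall>\<^sub>F n in sequentially. L2sq (\<lambda>x. f n x - g x) < a"
        using e(2) by (auto simp: eventually_sequentially intro!: exI[of _ M] intro: le_less_trans)
    qed auto
  qed
qed

lemma L2_dominated_convergence:
  fixes f :: "nat \<Rightarrow> 'a::euclidean_space \<Rightarrow> 'b::{second_countable_topology, banach}"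
  assumes [measurable]: "\<And>n. f n \<in> borel_measurable borel" "g \<in> borel_measurable borel" "w \<in> borel_measurable borel"
    and lim: "AE x in lborel. (\<lambda>n. f n x) \<longlonglongrightarrow> g x"
    and bound: "\<And>n. AE x in lborel. norm (f n x) \<le> w x" and w: "L2sq w < \<infinity>"
  shows "(\<lambda>n. L2sq (\<lambda>x. f n x - g x)) \<longlonglongrightarrow> 0"
proof -
  have "(\<lambda>n. L2sq (\<lambda>x. f n x - g x)) \<longlonglongrightarrow> (\<integral>\<^sup>+(x::'a). 0 \<partial>lborel)"
    unfolding L2sq_def
  proof (rule nn_integral_dominated_convergence[where w="\<lambda>x. ennreal (4 * (w x)\<^sup>2)"])
    have bound': "AE x in lborel. \<forall>n. norm (f n x) \<le> w x"
      using bound by (simp add: AE_all_countable)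
    show "AE x in lborel. ennreal ((norm (f n x - g x))\<^sup>2) \<le> ennreal (4 * (w x)\<^sup>2)" for n
      using bound' lim
    proof eventually_elim
      case (elim x)
      have "norm (g x) \<le> w x"
        using elim by (intro LIMSEQ_le_const2[OF tendsto_norm[OF elim(2)]]) auto
      then have "norm (f n x - g x) \<le> 2 * w x"
        using elim(1)[rule_format, of n] norm_triangle_ineq4[of "f n x" "g x"] by linarith
      then have "(norm (f n x - g x))\<^sup>2 \<le> (2 * w x)\<^sup>2"
        by (intro power_mono) auto
      then show ?case
        by (intro ennreal_leI) simp
    qed
    show "(\<integral>\<^sup>+x. ennreal (4 * (w x)\<^sup>2) \<partial>lborel) < \<infinity>"
      using w by (simp add: ennreal_mult nn_integral_cmult L2sq_def ennreal_mult_less_top)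
    show "AE x in lborel. (\<lambda>n. ennreal ((norm (f n x - g x))\<^sup>2)) \<longlonglongrightarrow> 0"
      using lim
    proof eventually_elim
      case (elim x)
      then have "(\<lambda>n. ennreal ((norm (f n x - g x))\<^sup>2)) \<longlonglongrightarrow> ennreal ((norm (g x - g x))\<^sup>2)"
        by (intro tendsto_ennrealI tendsto_intros)
      then show ?case by simp
    qed
  qed auto
  then show ?thesis by simp
qed

section \<open>Fourier integrals of Gaussians\<close>

definition ft :: "('a::euclidean_space \<Rightarrow> complex) \<Rightarrow> 'a \<Rightarrow> complex" where
  "ft g \<xi> = (LINT x|lborel. g x * cis (- 2 * pi * (x \<bullet> \<xi>)))"

lemma borel_measurable_cis [measurable (raw)]:
  "f \<in> borel_measurable M \<Longrightarrow> (\<lambda>x. cis (f x)) \<in> borel_measurable M"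
  by (rule measurable_compose[of f M borel cis borel])
    (auto intro!: borel_measurable_continuous_onI continuous_intros)

lemma borel_measurable_cnj [measurable (raw)]:
  "f \<in> borel_measurable M \<Longrightarrow> (\<lambda>x. cnj (f x)) \<in> borel_measurable M"
  by (rule measurable_compose[of f M borel cnj borel])
    (auto intro!: borel_measurable_continuous_onI continuous_intros)

lemma ft_measurable [measurable]:
  assumes [measurable]: "g \<in> borel_measurable borel"
  shows "ft g \<in> borel_measurable borel"
  unfolding ft_def by measurable

lemma integrable_mult_cis:
  assumes "integrable M g" and [measurable]: "h \<in> borel_measurable M"
  shows "integrable M (\<lambda>x. g x * cis (h x))"
  by (rule Bochner_Integration.integrable_bound[OF assms(1)])
    (use assms(1) in \<open>auto simp: norm_mult\<close>)

lemma norm_ft_le: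
  assumes "integrable lborel g"
  shows "norm (ft g \<xi>) \<le> (LINT x|lborel. norm (g x))"
proof -
  have "norm (ft g \<xi>) \<le> (LINT x|lborel. norm (g x * cis (- 2 * pi * (x \<bullet> \<xi>))))"
    unfolding ft_def by (rule integral_norm_bound)
  then show ?thesis
    by (simp add: norm_mult)
qed

lemma ft_diff:
  assumes "integrable lborel f" "integrable lborel g"
  shows "ft (\<lambda>x. f x - g x) \<xi> = ft f \<xi> - ft g \<xi>"
  unfolding ft_def left_diff_distrib using assms
  by (intro Bochner_Integration.integral_diff integrable_mult_cis) auto

lemma ft_cmult:  "ft (\<lambda>x. c * f x) \<xi> = c * ft f \<xi>"
  unfolding ft_def by (simp add: mult.assoc)

lemma integrable_lborel_pair_mult:
  fixes f g :: "'a::euclidean_space \<Rightarrow> complex"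
  assumes f: "integrable lborel f" and g: "integrable lborel g"
  shows "integrable (lborel \<Otimes>\<^sub>M lborel) (\<lambda>(x, y). f x * g y)"
proof (rule lborel_pair.Fubini_integrable)
  have [measurable]: "f \<in> borel_measurable borel" "g \<in> borel_measurable borel"
    using f g by auto
  show "(\<lambda>(x, y). f x * g y) \<in> borel_measurable (lborel \<Otimes>\<^sub>M lborel)"
    by measurable
  show "integrable lborel (\<lambda>x. LINT y|lborel. norm (case (x, y) of (x, y) \<Rightarrow> f x * g y))"
    using f by (simp add: norm_mult)
  show "AE x in lborel. integrable lborel (\<lambda>y. case (x, y) of (x, y) \<Rightarrow> f x * g y)"
    using g by simp
qed

text \<open>Fubini's theorem, since the kernel is symmetric in \<open>x\<close> and
  \<open>\<xi>\<close>. This is the identity from which Plancherel's theorem is obtained.\<close>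

lemma ft_multiplication_formula:
  assumes f: "integrable lborel f" and g: "integrable lborel g"
  shows "(LINT \<xi>|lborel. ft f \<xi> * g \<xi>) = (LINT x|lborel. f x * ft g x)"
proof -
  have [measurable]: "f \<in> borel_measurable borel" "g \<in> borel_measurable borel"
    using f g by auto
  have "integrable (lborel \<Otimes>\<^sub>M lborel) (\<lambda>p. (case p of (x, \<xi>) \<Rightarrow> f x * g \<xi>) * cis (- 2 * pi * (fst p \<bullet> snd p)))"
    by (rule integrable_mult_cis[OF integrable_lborel_pair_mult[OF f g]]) simp
  then have *: "integrable (lborel \<Otimes>\<^sub>M lborel) (\<lambda>(x, \<xi>). f x * g \<xi> * cis (- 2 * pi * (x \<bullet> \<xi>)))"
    by (simp add: case_prod_beta')
  have "(LINT \<xi>|lborel. ft f \<xi> * g \<xi>) = (LINT \<xi>|lborel. LINT x|lborel. f x * g \<xi> * cis (- 2 * pi * (x \<bullet> \<xi>)))"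
    unfolding ft_def by (subst Bochner_Integration.integral_mult_left_zero[symmetric])
      (simp add: mult_ac)
  also have "\<dots> = (LINT x|lborel. LINT \<xi>|lborel. f x * g \<xi> * cis (- 2 * pi * (x \<bullet> \<xi>)))"
    by (rule lborel_pair.Fubini_integral[OF *])
  also have "\<dots> = (LINT x|lborel. f x * ft g x)"
    unfolding ft_def by (subst Bochner_Integration.integral_mult_right_zero[symmetric])
      (simp add: mult_ac inner_commute)
  finally show ?thesis .
qed

text \<open>Products of functions of single coordinates reduce Gaussian integrals to dimension
  one.\<close>

lemma lborel_integral_prod_Basis:
  fixes f :: "'a::euclidean_space \<Rightarrow> real \<Rightarrow> 'b::{real_normed_field, banach, second_countable_topology}"
  assumes f: "\<And>b. b \<in> Basis \<Longrightarrow> integrable lborel (f b)"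
  shows "integrable lborel (\<lambda>x. \<Prod>b\<in>Basis. f b (x \<bullet> b))"
    and "(LINT x|lborel. (\<Prod>b\<in>Basis. f b (x \<bullet> b))) = (\<Prod>b\<in>Basis. LINT x|lborel. f b x)"
proof -
  interpret product_sigma_finite "\<lambda>_::'a. lborel :: real measure" ..
  have [measurable]: "f b \<in> borel_measurable borel" if "b \<in> Basis" for b
    using f[OF that] by auto
  have m: "(\<lambda>x. \<Prod>b\<in>Basis. f b (x \<bullet> b)) \<in> borel_measurable borel"
    by measurable
  have [measurable]: "(\<lambda>f. \<Sum>b\<in>Basis. f b *\<^sub>R b) \<in> measurable (\<Pi>\<^sub>M b\<in>Basis. lborel :: real measure) (borel :: 'a measure)"
    by measurable
  have coord: "(\<Sum>b\<in>Basis. x b *\<^sub>R b) \<bullet> i = x i" if "i \<in> Basis" for x :: "'a \<Rightarrow> real" and i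
    using that by (simp add: inner_sum_left inner_Basis if_distrib cong: if_cong)
  have eq: "(\<Prod>b\<in>Basis. f b ((\<Sum>b\<in>Basis. x b *\<^sub>R b) \<bullet> b)) = (\<Prod>b\<in>Basis. f b (x b))" for x
    by (rule prod.cong) (auto simp: coord)
  show "integrable lborel (\<lambda>x. \<Prod>b\<in>Basis. f b (x \<bullet> b))"
    by (subst lborel_eq, subst integrable_distr_eq)
      (auto simp: m eq intro!: product_integrable_prod f)
  show "(LINT x|lborel. (\<Prod>b\<in>Basis. f b (x \<bullet> b))) = (\<Prod>b\<in>Basis. LINT x|lborel. f b x)"
    by (subst lborel_eq, subst integral_distr)
      (auto simp: m eq intro!: product_integral_prod f)
qed

lemma gaussian_integrable_real:
  fixes c :: real
  assumes "0 < c"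
  shows "integrable lborel (\<lambda>x::real. exp (- c * x\<^sup>2))"
proof -
  have s: "0 < sqrt (1 / (2 * c))" "(sqrt (1 / (2 * c)))\<^sup>2 = 1 / (2 * c)"
    using assms by auto
  have "integrable lborel (\<lambda>x. sqrt (2 * pi * (1 / (2 * c))) * normal_density 0 (sqrt (1 / (2 * c))) x)"
    by (intro integrable_mult_right integrable_normal_density s)
  then show ?thesis
    unfolding normal_density_def s(2) using assms by (simp add: mult.commute)
qed

text \<open>A rescaling of the characteristic function of the standard normal distribution.\<close>

lemma gaussian_ft_real:
  assumes e: "0 < e"
  shows "(LINT x|lborel. complex_of_real (exp (- (pi * e\<^sup>2) * x\<^sup>2)) * cis (- 2 * pi * (x * z)))
    = complex_of_real (exp (- pi * z\<^sup>2 / e\<^sup>2) / e)"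
proof -
  \<comment> \<open>the substitution \<open>y = ?c x\<close> turns the Gaussian into the standard
      normal density\<close>
  let ?c = "e * sqrt (2 * pi)" and ?t = "- sqrt (2 * pi) * z / e"
  have c: "?c \<noteq> 0" using e by simp
  have "complex_of_real (exp (- (?t\<^sup>2) / 2)) = char std_normal_distribution ?t"
    by (simp add: char_std_normal_distribution)
  also have "\<dots> = (LINT y|lborel. std_normal_density y *\<^sub>R iexp (?t * y))"
    unfolding char_def by (subst integral_density) auto
  also have "\<dots> = \<bar>?c\<bar> *\<^sub>R (LINT x|lborel. std_normal_density (0 + ?c * x) *\<^sub>R iexp (?t * (0 + ?c * x)))"
    by (rule lborel_integral_real_affine[OF c])
  also have "\<dots> = \<bar>?c\<bar> *\<^sub>R (LINT x|lborel. (1 / sqrt (2 * pi)) *\<^sub>R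
      (complex_of_real (exp (- (pi * e\<^sup>2) * x\<^sup>2)) * cis (- 2 * pi * (x * z))))"
  proof -
    have "std_normal_density (0 + ?c * x) = 1 / sqrt (2 * pi) * exp (- (pi * e\<^sup>2) * x\<^sup>2)" for x
      unfolding std_normal_density_def by (simp add: power_mult_distrib)
    moreover have "?t * (0 + ?c * x) = - 2 * pi * (x * z)" for x
      using e by simp
    ultimately show ?thesis
      by (simp only: cis_conv_exp scaleR_conv_of_real of_real_mult mult.assoc)
  qed
  also have "\<dots> = e *\<^sub>R (LINT x|lborel. complex_of_real (exp (- (pi * e\<^sup>2) * x\<^sup>2)) * cis (- 2 * pi * (x * z)))"
    using e by simp
  finally have "e *\<^sub>R (LINT x|lborel. complex_of_real (exp (- (pi * e\<^sup>2) * x\<^sup>2)) * cis (- 2 * pi * (x * z)))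
      = complex_of_real (exp (- (?t\<^sup>2) / 2))" ..
  moreover have "- (?t\<^sup>2) / 2 = - pi * z\<^sup>2 / e\<^sup>2"
    by (simp add: power_mult_distrib power_divide)
  ultimately show ?thesis
    using e by (simp add: scaleR_conv_of_real field_simps)
qed

text \<open>The Fourier transform of \<open>exp (- \<pi> e\<^sup>2 \<bar>x\<bar>\<^sup>2)\<close>:
  an approximate identity as \<open>e\<close> tends to \<open>0\<close>, and the heat kernel at
  time \<open>e\<^sup>2 / (4 \<pi>)\<close>.\<close>

definition gaussian_kernel :: "real \<Rightarrow> 'a::euclidean_space \<Rightarrow> real" where
  "gaussian_kernel e z = exp (- pi * (norm z)\<^sup>2 / e\<^sup>2) / e ^ DIM('a)"

lemma norm_sq_Basis: "(norm x)\<^sup>2 = (\<Sum>b\<in>Basis. (x \<bullet> b)\<^sup>2)"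
  unfolding power2_norm_eq_inner by (subst euclidean_inner) (simp add: power2_eq_square)

lemma gaussian_integrable:
  fixes c :: real
  assumes "0 < c"
  shows "integrable lborel (\<lambda>x::'a::euclidean_space. exp (- c * (norm x)\<^sup>2))"
proof -
  have "integrable lborel (\<lambda>x::'a. \<Prod>b\<in>Basis. exp (- c * (x \<bullet> b)\<^sup>2))"
    by (rule lborel_integral_prod_Basis) (rule gaussian_integrable_real[OF assms])
  moreover have "(\<Prod>b\<in>Basis. exp (- c * (x \<bullet> b)\<^sup>2)) = exp (- c * (norm x)\<^sup>2)" for x :: 'a
    by (simp add: norm_sq_Basis sum_distrib_left exp_sum sum_negf[symmetric])
  ultimately show ?thesis by simp
qed

lemma gaussian_ft:
  fixes z :: "'a::euclidean_space"
  assumes e: "0 < e"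
  shows "ft (\<lambda>x. complex_of_real (exp (- (pi * e\<^sup>2) * (norm x)\<^sup>2))) z = complex_of_real (gaussian_kernel e z)"
proof -
  let ?f = "\<lambda>b x. complex_of_real (exp (- (pi * e\<^sup>2) * x\<^sup>2)) * cis (- 2 * pi * (x * (z \<bullet> b)))"
  have "complex_of_real (exp (- (pi * e\<^sup>2) * (norm x)\<^sup>2)) * cis (- 2 * pi * (x \<bullet> z)) = (\<Prod>b\<in>Basis. ?f b (x \<bullet> b))" for x :: 'a
    by (simp add: norm_sq_Basis euclidean_inner[of x z] sum_distrib_left exp_sum cis_conv_exp prod.distrib
        flip: sum_negf of_real_prod)
  then have "ft (\<lambda>x. complex_of_real (exp (- (pi * e\<^sup>2) * (norm x)\<^sup>2))) z = (LINT x|lborel. (\<Prod>b\<in>Basis. ?f b (x \<bullet> b)))"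
    unfolding ft_def by simp
  also have "\<dots> = (\<Prod>b\<in>Basis. (LINT x|lborel. ?f b x))"
    using e by (intro lborel_integral_prod_Basis integrable_mult_cis integrable_of_real gaussian_integrable_real) auto
  also have "\<dots> = (\<Prod>b\<in>Basis. complex_of_real (exp (- pi * (z \<bullet> b)\<^sup>2 / e\<^sup>2) / e))"
    by (simp only: gaussian_ft_real[OF e])
  also have "\<dots> = complex_of_real (\<Prod>b\<in>Basis. exp (- pi * (z \<bullet> b)\<^sup>2 / e\<^sup>2) / e)"
    by simp
  also have "(\<Prod>b\<in>Basis. exp (- pi * (z \<bullet> b)\<^sup>2 / e\<^sup>2) / e) = gaussian_kernel e z"
    by (simp add: prod_dividef gaussian_kernel_def norm_sq_Basis sum_distrib_left sum_divide_distrib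
        exp_sum flip: sum_negf)
  finally show ?thesis .
qed

section \<open>Plancherel identity for bounded continuous functions\<close>

lemma ft_modulation: "ft (\<lambda>y. g y * cis (2 * pi * (x \<bullet> y))) \<xi> = ft g (\<xi> - x)"
  unfolding ft_def
  by (intro Bochner_Integration.integral_cong)
    (simp_all add: mult.assoc cis_mult inner_diff_right inner_commute algebra_simps)

lemma gaussian_kernel_nonneg: "0 < e \<Longrightarrow> 0 \<le> gaussian_kernel e z"
  by (simp add: gaussian_kernel_def)

lemma gaussian_kernel_measurable [measurable]: "gaussian_kernel e \<in> borel_measurable borel"
  unfolding gaussian_kernel_def by measurable

text \<open>The integral is the value at frequency \<open>0\<close> of a Gaussian's transform,
  which is again a Gaussian.\<close>

lemma gaussian_kernel_integral:
  assumes e: "0 < e"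
  shows "integrable lborel (gaussian_kernel e :: 'a::euclidean_space \<Rightarrow> real)"
    and "(LINT x|lborel. gaussian_kernel e (x::'a)) = 1"
proof -
  have eq: "(gaussian_kernel e :: 'a \<Rightarrow> real) = (\<lambda>x. exp (- (pi * (1 / e)\<^sup>2) * (norm x)\<^sup>2) * (1 / e ^ DIM('a)))"
    by (auto simp: gaussian_kernel_def fun_eq_iff power_divide)
  have int: "integrable lborel (\<lambda>x::'a. exp (- (pi * (1 / e)\<^sup>2) * (norm x)\<^sup>2))"
    using e by (intro gaussian_integrable) auto
  then show "integrable lborel (gaussian_kernel e :: 'a \<Rightarrow> real)"
    unfolding eq by (rule integrable_mult_left)
  have "ft (\<lambda>x. complex_of_real (exp (- (pi * (1 / e)\<^sup>2) * (norm x)\<^sup>2))) (0::'a) = complex_of_real (gaussian_kernel (1 / e) (0::'a))"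
    using e by (intro gaussian_ft) auto
  then have "(LINT x|lborel. exp (- (pi * (1 / e)\<^sup>2) * (norm (x::'a))\<^sup>2)) = gaussian_kernel (1 / e) (0::'a)"
    unfolding ft_def by simp
  then show "(LINT x|lborel. gaussian_kernel e (x::'a)) = 1"
    unfolding eq using e by (simp add: gaussian_kernel_def power_divide)
qed

lemma lborel_integral_affine:
  fixes f :: "'a::euclidean_space \<Rightarrow> 'b::{banach, second_countable_topology}"
  assumes [measurable]: "f \<in> borel_measurable borel" and c: "c \<noteq> 0"
  shows "(LINT y|lborel. f y) = \<bar>c\<bar> ^ DIM('a) *\<^sub>R (LINT w|lborel. f (t + c *\<^sub>R w))"
  using c by (subst lborel_affine[OF c, of t], subst integral_density)
    (auto simp: integral_distr)

lemma integrable_gaussian_ft_sq: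
  fixes g :: "'a::euclidean_space \<Rightarrow> complex"
  assumes g: "integrable lborel g" and e: "0 < e"
  shows "integrable lborel (\<lambda>\<xi>. exp (- (pi * e\<^sup>2) * (norm \<xi>)\<^sup>2) * (norm (ft g \<xi>))\<^sup>2)"
proof (rule Bochner_Integration.integrable_bound)
  have [measurable]: "g \<in> borel_measurable borel" using g by auto
  show "(\<lambda>\<xi>. exp (- (pi * e\<^sup>2) * (norm \<xi>)\<^sup>2) * (norm (ft g \<xi>))\<^sup>2) \<in> borel_measurable lborel"
    by measurable
  show "integrable lborel (\<lambda>\<xi>::'a. exp (- (pi * e\<^sup>2) * (norm \<xi>)\<^sup>2) * (LINT x|lborel. norm (g x))\<^sup>2)"
    using e by (intro integrable_mult_left gaussian_integrable) auto
  show "AE \<xi> in lborel. norm (exp (- (pi * e\<^sup>2) * (norm \<xi>)\<^sup>2) * (norm (ft g \<xi>))\<^sup>2)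
      \<le> norm (exp (- (pi * e\<^sup>2) * (norm \<xi>)\<^sup>2) * (LINT x|lborel. norm (g x))\<^sup>2)"
    using norm_ft_le[OF g] by (intro AE_I2) (auto simp: abs_mult intro!: mult_left_mono power_mono)
qed

text \<open>For merely integrable \<open>g\<close> the transform need not be square integrable.
  With a Gaussian weight all integrals converge absolutely, and the multiplication formula moves
  the weight to the other side, where it becomes the convolution of \<open>g\<close> with an
  approximate identity.\<close>

lemma gaussian_regularised_plancherel:
  fixes g :: "'a::euclidean_space \<Rightarrow> complex"
  assumes g: "integrable lborel g" and e: "0 < e"
  shows "complex_of_real (LINT \<xi>|lborel. exp (- (pi * e\<^sup>2) * (norm \<xi>)\<^sup>2) * (norm (ft g \<xi>))\<^sup>2)
    = (LINT x|lborel. g x * cnj (LINT y|lborel. g y * gaussian_kernel e (y - x)))"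
proof -
  have [measurable]: "g \<in> borel_measurable borel" using g by auto
  let ?\<gamma> = "\<lambda>\<xi>::'a. complex_of_real (exp (- (pi * e\<^sup>2) * (norm \<xi>)\<^sup>2))"
  have \<gamma>: "integrable lborel ?\<gamma>"
    using e by (intro integrable_of_real gaussian_integrable) auto
  \<comment> \<open>chosen such that \<open>ft g * k\<close> is the weighted \<open>\<bar>ft
      g\<bar>\<^sup>2\<close>\<close>
  define k where "k \<xi> = ?\<gamma> \<xi> * cnj (ft g \<xi>)" for \<xi>
  have [measurable]: "k \<in> borel_measurable borel"
    unfolding k_def by measurable
  have k: "integrable lborel k"
  proof (rule Bochner_Integration.integrable_bound)
    show "integrable lborel (\<lambda>\<xi>. ?\<gamma> \<xi> * (LINT x|lborel. norm (g x)))"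
      by (rule integrable_mult_left[OF \<gamma>])
    show "AE \<xi> in lborel. norm (k \<xi>) \<le> norm (?\<gamma> \<xi> * (LINT x|lborel. norm (g x)))"
    proof (rule AE_I2)
      fix \<xi>
      have "norm (ft g \<xi>) \<le> \<bar>LINT x|lborel. norm (g x)\<bar>"
        using norm_ft_le[OF g, of \<xi>] by linarith
      then show "norm (k \<xi>) \<le> norm (?\<gamma> \<xi> * (LINT x|lborel. norm (g x)))"
        unfolding k_def norm_mult complex_mod_cnj norm_of_real by (intro mult_left_mono) auto
    qed
  qed (auto simp: k_def)
  have ftk: "ft k x = cnj (LINT y|lborel. g y * gaussian_kernel e (y - x))" for x
  proof -
    have "ft k x = cnj (LINT \<xi>|lborel. ft g \<xi> * (?\<gamma> \<xi> * cis (2 * pi * (x \<bullet> \<xi>))))"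
      by (subst Bochner_Integration.integral_cnj[symmetric], unfold ft_def[of k], rule Bochner_Integration.integral_cong)
        (simp_all add: k_def cis_cnj inner_commute mult_ac)
    also have "\<dots> = cnj (LINT y|lborel. g y * ft (\<lambda>\<xi>. ?\<gamma> \<xi> * cis (2 * pi * (x \<bullet> \<xi>))) y)"
      using \<gamma> by (subst ft_multiplication_formula[OF g]) (auto intro!: integrable_mult_cis)
    also have "\<dots> = cnj (LINT y|lborel. g y * gaussian_kernel e (y - x))"
      unfolding ft_modulation gaussian_ft[OF e] ..
    finally show ?thesis .
  qed
  have "complex_of_real (LINT \<xi>|lborel. exp (- (pi * e\<^sup>2) * (norm \<xi>)\<^sup>2) * (norm (ft g \<xi>))\<^sup>2)
      = (LINT \<xi>|lborel. complex_of_real (exp (- (pi * e\<^sup>2) * (norm \<xi>)\<^sup>2) * (norm (ft g \<xi>))\<^sup>2))"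
    by (rule integral_of_real[symmetric]) (rule integrable_gaussian_ft_sq[OF g e])
  also have "\<dots> = (LINT \<xi>|lborel. ft g \<xi> * k \<xi>)"
    unfolding k_def by (intro Bochner_Integration.integral_cong)
      (simp_all add: complex_norm_square[simplified] mult_ac)
  also have "\<dots> = (LINT x|lborel. g x * cnj (LINT y|lborel. g y * gaussian_kernel e (y - x)))"
    unfolding ft_multiplication_formula[OF g k] ftk ..
  finally show ?thesis .
qed

lemma gaussian_convolution_rescale:
  fixes g :: "'a::euclidean_space \<Rightarrow> complex"
  assumes [measurable]: "g \<in> borel_measurable borel" and e: "0 < e"
  shows "(LINT y|lborel. g y * gaussian_kernel e (y - x)) = (LINT w|lborel. g (x + e *\<^sub>R w) * gaussian_kernel 1 w)"
proof -
  have "(LINT y|lborel. g y * gaussian_kernel e (y - x)) = e ^ DIM('a) *\<^sub>R (LINT w|lborel. g (x + e *\<^sub>R w) * gaussian_kernel e (e *\<^sub>R w))"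
    using e by (subst lborel_integral_affine[of _ e x]) auto
  also have "\<dots> = (LINT w|lborel. g (x + e *\<^sub>R w) * (e ^ DIM('a) * gaussian_kernel e (e *\<^sub>R w) :: real))"
    by (subst integral_scaleR_right[symmetric]) (simp add: scaleR_conv_of_real mult_ac)
  also have "(\<lambda>w::'a. e ^ DIM('a) * gaussian_kernel e (e *\<^sub>R w)) = gaussian_kernel 1"
    using e by (simp add: gaussian_kernel_def power_mult_distrib fun_eq_iff)
  finally show ?thesis .
qed

lemma L2sq_bounded_integrable:
  fixes g :: "'a::euclidean_space \<Rightarrow> 'b::{banach, second_countable_topology}"
  assumes g: "integrable lborel g" and B: "\<And>x. norm (g x) \<le> B"
  shows "L2sq g < \<infinity>" "integrable lborel (\<lambda>x. (norm (g x))\<^sup>2)"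
proof -
  have [measurable]: "g \<in> borel_measurable borel" using g by auto
  show *: "integrable lborel (\<lambda>x. (norm (g x))\<^sup>2)"
  proof (rule Bochner_Integration.integrable_bound)
    show "integrable lborel (\<lambda>x. B * norm (g x))"
      using g by auto
    show "AE x in lborel. norm ((norm (g x))\<^sup>2) \<le> norm (B * norm (g x))"
      using order_trans[OF norm_ge_zero B] by (auto simp: power2_eq_square abs_mult B intro!: AE_I2 mult_right_mono)
  qed auto
  then show "L2sq g < \<infinity>"
    unfolding L2sq_def by (subst nn_integral_eq_integral) auto
qed

lemma L2sq_eq_integral:
  fixes g :: "'a::euclidean_space \<Rightarrow> 'b::{banach, second_countable_topology}"
  assumes "integrable lborel (\<lambda>x. (norm (g x))\<^sup>2)"
  shows "L2sq g = ennreal (LINT x|lborel. (norm (g x))\<^sup>2)"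
  using assms unfolding L2sq_def by (subst nn_integral_eq_integral) auto

text \<open>The limit \<open>e \<rightarrow> 0\<close> of the regularised identity: boundedness
  and continuity of \<open>g\<close> make the convolutions converge pointwise under a common
  bound, while the weight on the frequency side increases to \<open>1\<close>.\<close>

lemma plancherel_continuous_bounded:
  fixes g :: "'a::euclidean_space \<Rightarrow> complex"
  assumes g: "integrable lborel g" and cont: "continuous_on UNIV g" and B: "\<And>x. norm (g x) \<le> B"
  shows "L2sq (ft g) = L2sq g"
proof -
  have [measurable]: "g \<in> borel_measurable borel" using g by auto
  have g2: "integrable lborel (\<lambda>x. (norm (g x))\<^sup>2)"
    by (rule L2sq_bounded_integrable[OF g B])
  define e where "e n = 1 / real (Suc n)" for n
  have e: "0 < e n" for n by (simp add: e_def)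
  have e0: "e \<longlonglongrightarrow> 0"
    unfolding e_def by (rule LIMSEQ_Suc[OF lim_inverse_n'])
  define I where "I n \<xi> = exp (- (pi * (e n)\<^sup>2) * (norm \<xi>)\<^sup>2) * (norm (ft g \<xi>))\<^sup>2" for n and \<xi> :: 'a
  have I_meas [measurable]: "I n \<in> borel_measurable borel" for n
    unfolding I_def by measurable
  have I_nonneg: "0 \<le> I n \<xi>" for n \<xi>
    by (simp add: I_def)
  have I_int: "integrable lborel (I n)" for n
    unfolding I_def by (rule integrable_gaussian_ft_sq[OF g e])
  \<comment> \<open>the Gaussian average of \<open>g\<close> at scale \<open>e n\<close>, rescaled
      to a fixed kernel\<close>
  define J where "J n x = (LINT w|lborel. g (x + e n *\<^sub>R w) * gaussian_kernel 1 w)" for n x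
  have J_meas [measurable]: "J n \<in> borel_measurable borel" for n
    unfolding J_def by measurable
  have gk: "integrable lborel (\<lambda>w::'a. complex_of_real (gaussian_kernel 1 w))"
    by (intro integrable_of_real gaussian_kernel_integral) simp
  have J_lim: "(\<lambda>n. J n x) \<longlonglongrightarrow> g x" for x
  proof -
    have "(\<lambda>n. J n x) \<longlonglongrightarrow> (LINT w|lborel. g x * gaussian_kernel 1 (w::'a))"
      unfolding J_def
    proof (rule integral_dominated_convergence[where w="\<lambda>w. B * gaussian_kernel 1 w"])
      show "integrable lborel (\<lambda>w::'a. B * gaussian_kernel 1 w)"
        by (intro integrable_mult_right gaussian_kernel_integral) simp
      show "AE w in lborel. (\<lambda>n. g (x + e n *\<^sub>R w) * complex_of_real (gaussian_kernel 1 w)) \<longlonglongrightarrow> g x * complex_of_real (gaussian_kernel 1 w)"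
      proof (intro AE_I2 tendsto_mult tendsto_const)
        fix w :: 'a
        have "(\<lambda>n. x + e n *\<^sub>R w) \<longlonglongrightarrow> x + 0 *\<^sub>R w"
          by (intro tendsto_intros e0)
        then show "(\<lambda>n. g (x + e n *\<^sub>R w)) \<longlonglongrightarrow> g x"
          using continuous_on_tendsto_compose[OF cont, of "\<lambda>n. x + e n *\<^sub>R w" x] by simp
      qed
      show "AE w in lborel. norm (g (x + e n *\<^sub>R w) * complex_of_real (gaussian_kernel 1 w)) \<le> B * gaussian_kernel 1 w" for n
        by (intro AE_I2) (auto simp: norm_mult gaussian_kernel_nonneg intro!: mult_right_mono B)
    qed auto
    also have "(LINT w|lborel. g x * gaussian_kernel 1 (w::'a)) = g x"
      using gaussian_kernel_integral(2)[of 1, where 'a='a] by simp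
    finally show ?thesis .
  qed
  have J_bound: "norm (J n x) \<le> B" for n x
  proof -
    have "norm (J n x) \<le> (LINT w|lborel. norm (g (x + e n *\<^sub>R w) * complex_of_real (gaussian_kernel 1 w)))"
      unfolding J_def by (rule integral_norm_bound)
    also have "\<dots> \<le> (LINT w|lborel. B * gaussian_kernel 1 (w::'a))"
    proof (rule integral_mono_AE')
      show "integrable lborel (\<lambda>w::'a. B * gaussian_kernel 1 w)"
        by (intro integrable_mult_right gaussian_kernel_integral) simp
    qed (auto simp: norm_mult gaussian_kernel_nonneg order_trans[OF norm_ge_zero B] intro!: mult_right_mono B AE_I2)
    finally have "norm (J n x) \<le> (LINT w|lborel. B * gaussian_kernel 1 (w::'a))" .
    then show ?thesis
      using gaussian_kernel_integral[of 1, where 'a='a] by simp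
  qed
  have "(\<lambda>n. LINT x|lborel. g x * cnj (J n x)) \<longlonglongrightarrow> (LINT x|lborel. g x * cnj (g x))"
  proof (rule integral_dominated_convergence[where w="\<lambda>x. norm (g x) * B"])
    show "AE x in lborel. (\<lambda>n. g x * cnj (J n x)) \<longlonglongrightarrow> g x * cnj (g x)"
      by (intro AE_I2 tendsto_intros J_lim)
    show "AE x in lborel. norm (g x * cnj (J n x)) \<le> norm (g x) * B" for n
      using J_bound by (intro AE_I2) (simp add: norm_mult mult_left_mono)
  qed (use g in auto)
  also have "(\<lambda>n. LINT x|lborel. g x * cnj (J n x)) = (\<lambda>n. complex_of_real (LINT \<xi>|lborel. I n \<xi>))"
    by (simp only: J_def I_def gaussian_regularised_plancherel[OF g e] gaussian_convolution_rescale[OF \<open>g \<in> borel_measurable borel\<close> e])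
  also have "(LINT x|lborel. g x * cnj (g x)) = complex_of_real (LINT x|lborel. (norm (g x))\<^sup>2)"
    by (subst integral_of_real[symmetric]) (simp_all only: complex_norm_square g2)
  finally have "(\<lambda>n. LINT \<xi>|lborel. I n \<xi>) \<longlonglongrightarrow> (LINT x|lborel. (norm (g x))\<^sup>2)"
    by (simp add: tendsto_of_real_iff)
  then have "(\<lambda>n. ennreal (LINT \<xi>|lborel. I n \<xi>)) \<longlonglongrightarrow> L2sq g"
    unfolding L2sq_eq_integral[OF g2] by (rule tendsto_ennrealI)
  then have lim1: "(\<lambda>n. \<integral>\<^sup>+\<xi>. ennreal (I n \<xi>) \<partial>lborel) \<longlonglongrightarrow> L2sq g"
    by (subst nn_integral_eq_integral) (auto simp: I_int I_nonneg)
  have lim2: "(\<lambda>n. \<integral>\<^sup>+\<xi>. ennreal (I n \<xi>) \<partial>lborel) \<longlonglongrightarrow> L2sq (ft g)"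
    unfolding L2sq_def
  proof (rule nn_integral_LIMSEQ)
    show "incseq (\<lambda>n \<xi>. ennreal (I n \<xi>))"
    proof (intro incseq_SucI le_funI ennreal_leI)
      fix n \<xi>
      have "e (Suc n) \<le> e n"
        by (simp add: e_def frac_le)
      then have "(e (Suc n))\<^sup>2 \<le> (e n)\<^sup>2"
        using e[of "Suc n"] by (intro power_mono) auto
      then show "I n \<xi> \<le> I (Suc n) \<xi>"
        unfolding I_def by (intro mult_right_mono) (auto intro!: mult_right_mono)
    qed
    show "(\<lambda>n. ennreal (I n \<xi>)) \<longlonglongrightarrow> ennreal ((norm (ft g \<xi>))\<^sup>2)" for \<xi>
    proof (rule tendsto_ennrealI)
      have "(\<lambda>n. I n \<xi>) \<longlonglongrightarrow> exp (- (pi * 0\<^sup>2) * (norm \<xi>)\<^sup>2) * (norm (ft g \<xi>))\<^sup>2"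
        unfolding I_def by (intro tendsto_intros e0)
      then show "(\<lambda>n. I n \<xi>) \<longlonglongrightarrow> (norm (ft g \<xi>))\<^sup>2"
        by simp
    qed
  qed simp
  show ?thesis
    using LIMSEQ_unique[OF lim2 lim1] .
qed

section \<open>Plancherel identity for integrable and square integrable functions\<close>

text \<open>The continuous retraction onto the ball of radius \<open>R\<close>, written without a
  case distinction so that its continuity is immediate.\<close>

definition clamp_norm :: "real \<Rightarrow> 'b::real_normed_vector \<Rightarrow> 'b" where
  "clamp_norm R z = (1 / max 1 (norm z / R)) *\<^sub>R z"

lemma continuous_on_clamp_norm: "0 < R \<Longrightarrow> continuous_on S (clamp_norm R)"
  unfolding clamp_norm_def by (intro continuous_intros) auto

lemma norm_clamp_norm_le: "0 < R \<Longrightarrow> norm (clamp_norm R z) \<le> R"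
  by (auto simp: clamp_norm_def max_def field_simps)

lemma norm_clamp_norm_le_self: "norm (clamp_norm R z) \<le> norm z"
proof -
  have "\<bar>1 / max 1 (norm z / R)\<bar> \<le> 1"
    by (simp add: max_def)
  then show ?thesis
    unfolding clamp_norm_def norm_scaleR by (intro mult_left_le_one_le) auto
qed

lemma clamp_norm_eq: "0 < R \<Longrightarrow> norm z \<le> R \<Longrightarrow> clamp_norm R z = z"
  by (auto simp: clamp_norm_def max_def field_simps)

definition ball_cutoff :: "real \<Rightarrow> 'a::real_normed_vector \<Rightarrow> real" where
  "ball_cutoff R x = max 0 (min 1 (R + 1 - norm x))"

lemma ball_cutoff_bounds: "0 \<le> ball_cutoff R x" "ball_cutoff R x \<le> 1"
  by (auto simp: ball_cutoff_def)

lemma ball_cutoff_le_indicator: "ball_cutoff R x \<le> indicator (cball 0 (R + 1)) x"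
  by (auto simp: ball_cutoff_def indicator_def)

lemma ball_cutoff_eq_1: "norm x \<le> R \<Longrightarrow> ball_cutoff R x = 1"
  by (auto simp: ball_cutoff_def)

text \<open>A consequence of Lusin's theorem. It supplies the continuous approximants in the
  density argument below.\<close>

lemma borel_imp_AE_limit_continuous:
  fixes f :: "'a::euclidean_space \<Rightarrow> 'b::euclidean_space"
  assumes f: "f \<in> borel_measurable borel"
  obtains g where "\<And>n::nat. continuous_on UNIV (g n)" "AE x in lborel. (\<lambda>n. g n x) \<longlonglongrightarrow> f x"
proof -
  have "f \<in> borel_measurable lebesgue"
    using f by (simp add: measurable_completion)
  then have "f measurable_on UNIV"
    by (intro lebesgue_measurable_imp_measurable_on) auto
  then obtain N g where N: "negligible N" "\<And>n::nat. continuous_on UNIV (g n)"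
    "\<And>x. x \<notin> N \<Longrightarrow> (\<lambda>n. g n x) \<longlonglongrightarrow> f x"
    unfolding measurable_on_def by auto
  from N(1) have "N \<in> null_sets (completion lborel)"
    by (simp add: negligible_iff_null_sets)
  then have "AE x in completion lborel. (\<lambda>n. g n x) \<longlonglongrightarrow> f x"
    by (rule AE_I') (use N(3) in auto)
  then have "AE x in lborel. (\<lambda>n. g n x) \<longlonglongrightarrow> f x"
    by (simp add: AE_completion_iff)
  with N(2) show thesis by (rule that)
qed

definition L1norm :: "('a::euclidean_space \<Rightarrow> 'b::real_normed_vector) \<Rightarrow> ennreal" where
  "L1norm f = (\<integral>\<^sup>+x. ennreal (norm (f x)) \<partial>lborel)"

lemma L1norm_triangle:
  fixes f g h :: "'a::euclidean_space \<Rightarrow> 'b::{second_countable_topology, real_normed_vector}"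
  assumes [measurable]: "f \<in> borel_measurable borel" "g \<in> borel_measurable borel" "h \<in> borel_measurable borel"
  shows "L1norm (\<lambda>x. f x - h x) \<le> L1norm (\<lambda>x. f x - g x) + L1norm (\<lambda>x. g x - h x)"
proof -
  have "L1norm (\<lambda>x. f x - h x) \<le> (\<integral>\<^sup>+x. ennreal (norm (f x - g x)) + ennreal (norm (g x - h x)) \<partial>lborel)"
    unfolding L1norm_def
  proof (intro nn_integral_mono)
    fix x
    have "norm (f x - h x) \<le> norm (f x - g x) + norm (g x - h x)"
      by (metis norm_diff_triangle_ineq diff_add_cancel norm_triangle_sub add.commute add_diff_eq diff_add_eq_diff_diff_swap norm_triangle_ineq)
    then show "ennreal (norm (f x - h x)) \<le> ennreal (norm (f x - g x)) + ennreal (norm (g x - h x))"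
      by (simp flip: ennreal_plus)
  qed
  also have "\<dots> = L1norm (\<lambda>x. f x - g x) + L1norm (\<lambda>x. g x - h x)"
    unfolding L1norm_def by (rule nn_integral_add) auto
  finally show ?thesis .
qed

lemma L1_dominated_convergence:
  fixes f :: "nat \<Rightarrow> 'a::euclidean_space \<Rightarrow> 'b::{second_countable_topology, banach}"
  assumes [measurable]: "\<And>n. f n \<in> borel_measurable borel" "g \<in> borel_measurable borel" "w \<in> borel_measurable borel"
    and lim: "AE x in lborel. (\<lambda>n. f n x) \<longlonglongrightarrow> g x"
    and bound: "\<And>n. AE x in lborel. norm (f n x) \<le> w x" and w: "L1norm w < \<infinity>"
  shows "(\<lambda>n. L1norm (\<lambda>x. f n x - g x)) \<longlonglongrightarrow> 0"
proof -
  have "(\<lambda>n. \<integral>\<^sup>+x. ennreal (norm (g x - f n x)) \<partial>lborel) \<longlonglongrightarrow> 0"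
  proof (rule nn_integral_dominated_convergence_norm[where w="\<lambda>x. norm (w x)"])
    show "AE x in lborel. norm (f j x) \<le> norm (w x)" for j
      using bound[of j] by eventually_elim simp
  qed (use w lim in \<open>auto simp: L1norm_def\<close>)
  then show ?thesis
    by (simp add: L1norm_def norm_minus_commute)
qed

lemma integrable_iff_L1norm:
  fixes f :: "'a::euclidean_space \<Rightarrow> 'b::{second_countable_topology, banach}"
  shows "integrable lborel f \<longleftrightarrow> f \<in> borel_measurable borel \<and> L1norm f < \<infinity>"
  by (simp add: integrable_iff_bounded L1norm_def)

text \<open>After clamping the values and cutting off in space the convergence is dominated by a
  multiple of an indicator function, so it holds in \<open>L\<^sup>1\<close> and in
  \<open>L\<^sup>2\<close> at the same time.\<close>

lemma clamped_continuous_approximation: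
  fixes f :: "'a::euclidean_space \<Rightarrow> 'b::euclidean_space"
  assumes [measurable]: "f \<in> borel_measurable borel" and R: "0 < R"
  obtains h where "\<And>n::nat. continuous_on UNIV (h n)" "\<And>n. integrable lborel (h n)" "\<And>n x. norm (h n x) \<le> R"
    "(\<lambda>n. L1norm (\<lambda>x. h n x - ball_cutoff R x *\<^sub>R clamp_norm R (f x))) \<longlonglongrightarrow> 0"
    "(\<lambda>n. L2sq (\<lambda>x. h n x - ball_cutoff R x *\<^sub>R clamp_norm R (f x))) \<longlonglongrightarrow> 0"
proof -
  obtain g where g: "\<And>n::nat. continuous_on UNIV (g n)" "AE x in lborel. (\<lambda>n. g n x) \<longlonglongrightarrow> f x"
    using borel_imp_AE_limit_continuous[OF assms(1)] by blast
  define h where "h n x = ball_cutoff R x *\<^sub>R clamp_norm R (g n x)" for n x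
  have cont: "continuous_on UNIV (h n)" for n
    unfolding h_def ball_cutoff_def
    by (intro continuous_intros continuous_on_compose2[OF continuous_on_clamp_norm[OF R, of UNIV] g(1)]) auto
  then have [measurable]: "h n \<in> borel_measurable borel" for n
    by (intro borel_measurable_continuous_onI)
  have [measurable]: "clamp_norm R \<in> borel_measurable (borel :: 'b measure)" "ball_cutoff R \<in> borel_measurable (borel :: 'a measure)"
    by (auto intro!: borel_measurable_continuous_onI continuous_on_clamp_norm R continuous_intros simp: ball_cutoff_def[abs_def])
  let ?w = "\<lambda>x::'a. R * indicator (cball 0 (R + 1)) x"
  have hw: "norm (h n x) \<le> ?w x" for n x
  proof -
    have "norm (h n x) \<le> ball_cutoff R x * R"
      unfolding h_def using ball_cutoff_bounds[of R x] norm_clamp_norm_le[OF R]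
      by (auto intro!: mult_left_mono)
    also have "\<dots> \<le> ?w x"
      using ball_cutoff_le_indicator[of R x] R by (simp add: mult.commute)
    finally show ?thesis .
  qed
  have w: "integrable lborel ?w"
    by (intro integrable_mult_right integrable_real_indicator) (use emeasure_bounded_finite[OF bounded_cball, of "0::'a" "R + 1"] in auto)
  have wm: "?w \<in> borel_measurable borel"
    by (intro borel_measurable_times borel_measurable_const borel_measurable_indicator) simp
  from w have wL: "L1norm ?w < \<infinity>"
    unfolding integrable_iff_L1norm by blast
  have w_bdd: "norm (?w x) \<le> R" for x
    using R by (simp add: indicator_def)
  have hR: "norm (h n x) \<le> R" for n x
    using hw[of n x] w_bdd[of x] by simp
  have hint: "integrable lborel (h n)" for n
    by (rule Bochner_Integration.integrable_bound[OF w]) (use hw in \<open>auto intro!: AE_I2 intro: order_trans[OF _ abs_ge_self]\<close>)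
  have lim: "AE x in lborel. (\<lambda>n. h n x) \<longlonglongrightarrow> ball_cutoff R x *\<^sub>R clamp_norm R (f x)"
    using g(2) unfolding h_def
    by eventually_elim (auto intro!: tendsto_intros continuous_on_tendsto_compose[OF continuous_on_clamp_norm[OF R, of UNIV]])
  show thesis
  proof (rule that[OF cont hint hR])
    show "(\<lambda>n. L1norm (\<lambda>x. h n x - ball_cutoff R x *\<^sub>R clamp_norm R (f x))) \<longlonglongrightarrow> 0"
      by (rule L1_dominated_convergence[where w="?w", OF _ _ wm lim AE_I2[OF hw] wL]) auto
    show "(\<lambda>n. L2sq (\<lambda>x. h n x - ball_cutoff R x *\<^sub>R clamp_norm R (f x))) \<longlonglongrightarrow> 0"
      by (intro L2_dominated_convergence[where w="?w"] lim AE_I2 hw wm L2sq_bounded_integrable[OF w w_bdd]) auto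
  qed
qed

text \<open>A single sequence approximates in both norms: \<open>L\<^sup>1\<close> convergence
  gives pointwise convergence of the Fourier integrals, \<open>L\<^sup>2\<close> convergence gives
  convergence of the norms.\<close>

lemma continuous_dense_L1_L2:
  fixes f :: "'a::euclidean_space \<Rightarrow> 'b::euclidean_space"
  assumes f: "integrable lborel f" and f2: "L2sq f < \<infinity>"
  obtains h B where "\<And>n::nat. continuous_on UNIV (h n)" "\<And>n. integrable lborel (h n)" "\<And>n x. norm (h n x) \<le> B n"
    "(\<lambda>n. L1norm (\<lambda>x. h n x - f x)) \<longlonglongrightarrow> 0"
    "(\<lambda>n. L2sq (\<lambda>x. h n x - f x)) \<longlonglongrightarrow> 0"
proof -
  have [measurable]: "f \<in> borel_measurable borel" using f by auto
  define R where "R n = real (Suc n)" for n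
  have R: "0 < R n" for n by (simp add: R_def)
  define k where "k n x = ball_cutoff (R n) x *\<^sub>R clamp_norm (R n) (f x)" for n x
  have [measurable]: "clamp_norm (R n) \<in> borel_measurable (borel :: 'b measure)" "ball_cutoff (R n) \<in> borel_measurable (borel :: 'a measure)" for n
    by (auto intro!: borel_measurable_continuous_onI continuous_on_clamp_norm R continuous_intros simp: ball_cutoff_def[abs_def])
  have km[measurable]: "k n \<in> borel_measurable borel" for n
    unfolding k_def by measurable
  have kf: "norm (k n x) \<le> norm (f x)" for n x
    unfolding k_def norm_scaleR using ball_cutoff_bounds[of "R n" x] norm_clamp_norm_le_self[of "R n" "f x"]
    by (auto intro: order_trans[OF mult_left_le_one_le])
  have klim: "(\<lambda>n. k n x) \<longlonglongrightarrow> f x" for x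
  proof (rule tendsto_eventually)
    obtain N where N: "real N \<ge> max (norm x) (norm (f x))"
      using real_arch_simple by blast
    have "k n x = f x" if "n \<ge> N" for n
      using N that R[of n] unfolding k_def by (simp add: ball_cutoff_eq_1 clamp_norm_eq R_def)
    then show "\<forall>\<^sub>F n in sequentially. k n x = f x"
      by (auto simp: eventually_sequentially)
  qed
  have k1: "(\<lambda>n. L1norm (\<lambda>x. k n x - f x)) \<longlonglongrightarrow> 0"
    by (rule L1_dominated_convergence[where w="\<lambda>x. norm (f x)"]) (use f klim kf in \<open>auto simp: integrable_iff_L1norm L1norm_def\<close>)
  have k2: "(\<lambda>n. L2sq (\<lambda>x. k n x - f x)) \<longlonglongrightarrow> 0"
    by (rule L2_dominated_convergence[where w="\<lambda>x. norm (f x)"]) (use f2 klim kf in \<open>auto simp: L2sq_def\<close>)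
  have "\<exists>h. continuous_on UNIV h \<and> integrable lborel h \<and> (\<forall>x. norm (h x) \<le> R n) \<and>
      L1norm (\<lambda>x. h x - k n x) \<le> ennreal (1 / R n) \<and> L2sq (\<lambda>x. h x - k n x) \<le> ennreal (1 / R n)" for n
  proof -
    obtain h where h: "\<And>m::nat. continuous_on UNIV (h m)" "\<And>m. integrable lborel (h m)" "\<And>m x. norm (h m x) \<le> R n"
      "(\<lambda>m. L1norm (\<lambda>x. h m x - k n x)) \<longlonglongrightarrow> 0" "(\<lambda>m. L2sq (\<lambda>x. h m x - k n x)) \<longlonglongrightarrow> 0"
      using clamped_continuous_approximation[OF \<open>f \<in> borel_measurable borel\<close> R[of n]] unfolding k_def by blast
    have pos: "0 < ennreal (1 / R n)"
      using R[of n] by (simp add: ennreal_less_zero_iff)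
    from order_tendstoD(2)[OF h(4) pos] order_tendstoD(2)[OF h(5) pos]
    have "\<forall>\<^sub>F m in sequentially. L1norm (\<lambda>x. h m x - k n x) < ennreal (1 / R n) \<and> L2sq (\<lambda>x. h m x - k n x) < ennreal (1 / R n)"
      by eventually_elim simp
    then obtain m where "L1norm (\<lambda>x. h m x - k n x) < ennreal (1 / R n)" "L2sq (\<lambda>x. h m x - k n x) < ennreal (1 / R n)"
      by (auto simp: eventually_sequentially)
    with h(1-3) show ?thesis
      by (intro exI[of _ "h m"]) (auto intro: less_imp_le)
  qed
  then obtain h where h: "\<And>n. continuous_on UNIV (h n)" "\<And>n. integrable lborel (h n)" "\<And>n x. norm (h n x) \<le> R n"
      "\<And>n. L1norm (\<lambda>x. h n x - k n x) \<le> ennreal (1 / R n)" "\<And>n. L2sq (\<lambda>x. h n x - k n x) \<le> ennreal (1 / R n)"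
    by metis
  have hm[measurable]: "h n \<in> borel_measurable borel" for n
    using h(2)[of n] by auto
  have "(\<lambda>n. ennreal (1 / R n)) \<longlonglongrightarrow> ennreal 0"
    unfolding R_def by (intro tendsto_ennrealI LIMSEQ_Suc[OF lim_inverse_n'])
  then have R0: "(\<lambda>n. ennreal (1 / R n)) \<longlonglongrightarrow> 0" by simp
  have h2: "(\<lambda>n. L2sq (\<lambda>x. h n x - k n x)) \<longlonglongrightarrow> 0"
    by (rule tendsto_sandwich[OF _ _ tendsto_const R0]) (use h(5) in auto)
  show thesis
  proof (rule that[OF h(1,2,3)])
    show "(\<lambda>n. L2sq (\<lambda>x. h n x - f x)) \<longlonglongrightarrow> 0"
      by (rule L2sq_tendsto_trans[OF hm km _ h2 k2]) simp
    have "(\<lambda>n. ennreal (1 / R n) + L1norm (\<lambda>x. k n x - f x)) \<longlonglongrightarrow> 0 + 0"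
      by (intro tendsto_add R0 k1)
    then have lim: "(\<lambda>n. ennreal (1 / R n) + L1norm (\<lambda>x. k n x - f x)) \<longlonglongrightarrow> 0"
      by simp
    show "(\<lambda>n. L1norm (\<lambda>x. h n x - f x)) \<longlonglongrightarrow> 0"
    proof (rule tendsto_sandwich[OF _ _ tendsto_const lim])
      show "\<forall>\<^sub>F n in sequentially. L1norm (\<lambda>x. h n x - f x) \<le> ennreal (1 / R n) + L1norm (\<lambda>x. k n x - f x)"
      proof (intro always_eventually allI)
        fix n
        have "L1norm (\<lambda>x. h n x - f x) \<le> L1norm (\<lambda>x. h n x - k n x) + L1norm (\<lambda>x. k n x - f x)"
          by (rule L1norm_triangle) auto
        also have "\<dots> \<le> ennreal (1 / R n) + L1norm (\<lambda>x. k n x - f x)"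
          by (rule add_right_mono[OF h(4)])
        finally show "L1norm (\<lambda>x. h n x - f x) \<le> ennreal (1 / R n) + L1norm (\<lambda>x. k n x - f x)" .
      qed
    qed auto
  qed
qed

lemma norm_ft_le_L1norm:
  assumes "integrable lborel g"
  shows "ennreal (norm (ft g \<xi>)) \<le> L1norm g"
proof -
  have "L1norm g = ennreal (LINT x|lborel. norm (g x))"
    unfolding L1norm_def using assms by (subst nn_integral_eq_integral) auto
  then show ?thesis
    using norm_ft_le[OF assms] by (simp add: ennreal_leI)
qed

text \<open>For the approximants \<open>h n\<close> the transforms form a Cauchy sequence in
  \<open>L\<^sup>2\<close>, and they converge pointwise to \<open>ft f\<close>; by Fatou's lemma
  they converge to it in \<open>L\<^sup>2\<close>.\<close>

theorem plancherel_L1_L2: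
  fixes f :: "'a::euclidean_space \<Rightarrow> complex"
  assumes f: "integrable lborel f" and f2: "L2sq f < \<infinity>"
  shows "L2sq (ft f) = L2sq f"
proof -
  obtain h B where h: "\<And>n::nat. continuous_on UNIV (h n)" "\<And>n. integrable lborel (h n)" "\<And>n x. norm (h n x) \<le> B n"
    and h1: "(\<lambda>n. L1norm (\<lambda>x. h n x - f x)) \<longlonglongrightarrow> 0"
    and h2: "(\<lambda>n. L2sq (\<lambda>x. h n x - f x)) \<longlonglongrightarrow> 0"
    using continuous_dense_L1_L2[OF f f2] by blast
  have fm[measurable]: "f \<in> borel_measurable borel" using f by auto
  have hm[measurable]: "h n \<in> borel_measurable borel" for n using h(2)[of n] by auto
  have eq: "L2sq (\<lambda>\<xi>. ft (h m) \<xi> - ft (h n) \<xi>) = L2sq (\<lambda>x. h m x - h n x)" for m n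
  proof -
    have "L2sq (ft (\<lambda>x. h m x - h n x)) = L2sq (\<lambda>x. h m x - h n x)"
      by (rule plancherel_continuous_bounded[where B="B m + B n"])
        (auto intro!: continuous_intros h order_trans[OF norm_triangle_ineq4] add_mono)
    moreover have "ft (\<lambda>x. h m x - h n x) = (\<lambda>\<xi>. ft (h m) \<xi> - ft (h n) \<xi>)"
      by (rule ext) (rule ft_diff[OF h(2) h(2)])
    ultimately show ?thesis by simp
  qed
  have ptw: "(\<lambda>m. ft (h m) \<xi>) \<longlonglongrightarrow> ft f \<xi>" for \<xi>
  proof -
    have "(\<lambda>m. ennreal (norm (ft (h m) \<xi> - ft f \<xi>))) \<longlonglongrightarrow> 0"
      by (rule tendsto_sandwich[OF _ _ tendsto_const h1])
        (use norm_ft_le_L1norm[of "\<lambda>x. h _ x - f x"] h(2) f in \<open>auto simp: ft_diff\<close>)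
    then have "(\<lambda>m. norm (ft (h m) \<xi> - ft f \<xi>)) \<longlonglongrightarrow> 0"
      by (simp add: ennreal_tendsto_0_iff)
    then show ?thesis
      by (simp add: LIM_zero_iff tendsto_norm_zero_iff)
  qed
  have conv: "(\<lambda>n. L2sq (\<lambda>\<xi>. ft (h n) \<xi> - ft f \<xi>)) \<longlonglongrightarrow> 0"
  proof (rule order_tendstoI)
    fix a :: ennreal assume "0 < a"
    then obtain c where c: "0 < c" "c < a" using dense by blast
    then obtain b where b: "0 < b" "ennreal b < a"
      by (cases c) auto
    \<comment> \<open>\<open>L2sq_triangle\<close> costs a factor \<open>2\<close> for each of two
        terms\<close>
    have "0 < ennreal (b / 4)"
      using b by simp
    from order_tendstoD(2)[OF h2 this] obtain N where N: "\<And>n. n \<ge> N \<Longrightarrow> L2sq (\<lambda>x. h n x - f x) < ennreal (b / 4)"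
      by (auto simp: eventually_sequentially)
    have "L2sq (\<lambda>\<xi>. ft (h n) \<xi> - ft f \<xi>) \<le> ennreal b" if n: "n \<ge> N" for n
    proof (rule L2sq_Fatou)
      show "AE \<xi> in lborel. (\<lambda>m. ft (h n) \<xi> - ft (h m) \<xi>) \<longlonglongrightarrow> ft (h n) \<xi> - ft f \<xi>"
        by (intro AE_I2 tendsto_intros ptw)
      have "L2sq (\<lambda>\<xi>. ft (h n) \<xi> - ft (h m) \<xi>) \<le> ennreal b" if "m \<ge> N" for m
      proof -
        have "L2sq (\<lambda>x. h n x - h m x) \<le> 2 * L2sq (\<lambda>x. h n x - f x) + 2 * L2sq (\<lambda>x. f x - h m x)"
          by (rule L2sq_triangle) auto
        also have "\<dots> \<le> 2 * ennreal (b / 4) + 2 * ennreal (b / 4)"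
          using N[OF n] N[OF that] by (intro add_mono mult_left_mono) (auto simp: L2sq_diff_commute[of f])
        also have "2 * ennreal (b / 4) = ennreal (b / 2)"
          using ennreal_mult'[of 2 "b / 4"] by simp
        also have "ennreal (b / 2) + ennreal (b / 2) = ennreal b"
          using b by (subst ennreal_plus[symmetric]) auto
        finally show ?thesis unfolding eq .
      qed
      then show "\<forall>\<^sub>F m in sequentially. L2sq (\<lambda>\<xi>. ft (h n) \<xi> - ft (h m) \<xi>) \<le> ennreal b"
        by (auto simp: eventually_sequentially)
    qed auto
    then show "\<forall>\<^sub>F n in sequentially. L2sq (\<lambda>\<xi>. ft (h n) \<xi> - ft f \<xi>) < a"
      using b(2) by (auto simp: eventually_sequentially intro!: exI[of _ N] intro: le_less_trans)
  qed auto
  show ?thesis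
    by (rule L2sq_eq_of_limits[OF _ _ hm fm sequentially_bot conv h2])
      (auto intro!: plancherel_continuous_bounded h)
qed

section \<open>Fourier transform of square integrable functions\<close>

definition truncate :: "real \<Rightarrow> ('a::euclidean_space \<Rightarrow> 'b::real_normed_vector) \<Rightarrow> 'a \<Rightarrow> 'b" where
  "truncate R f x = indicator (cball 0 R) x *\<^sub>R f x"

text \<open>A relation and not a function, because the \<open>L\<^sup>2\<close> limit is
  determined only up to null sets. The truncation to balls is the one in
  \<open>has_fourier\<close>, of which this is the scalar version.\<close>

definition has_L2_ft :: "('a::euclidean_space \<Rightarrow> complex) \<Rightarrow> ('a \<Rightarrow> complex) \<Rightarrow> bool" where
  "has_L2_ft f g \<longleftrightarrow> g \<in> borel_measurable borel \<and>
     ((\<lambda>R. L2sq (\<lambda>\<xi>. ft (truncate R f) \<xi> - g \<xi>)) \<longlongrightarrow> 0) at_top"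

definition is_L2 :: "('a::euclidean_space \<Rightarrow> 'b::real_normed_vector) \<Rightarrow> bool" where
  "is_L2 f \<longleftrightarrow> f \<in> borel_measurable borel \<and> L2sq f < \<infinity>"

lemma is_L2_diff:
  fixes f g :: "'a::euclidean_space \<Rightarrow> 'b::{second_countable_topology, real_normed_vector}"
  assumes "is_L2 f" "is_L2 g"
  shows "is_L2 (\<lambda>x. f x - g x)"
proof -
  have [measurable]: "f \<in> borel_measurable borel" "g \<in> borel_measurable borel"
    using assms by (auto simp: is_L2_def)
  have "L2sq (\<lambda>x. f x - g x) \<le> 2 * L2sq (\<lambda>x. f x - 0) + 2 * L2sq (\<lambda>x. 0 - g x)"
    by (rule L2sq_triangle) auto
  also have "\<dots> < \<infinity>"
    using assms by (auto simp: is_L2_def L2sq_def ennreal_mult_less_top)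
  finally show ?thesis
    by (simp add: is_L2_def)
qed

lemma is_L2_cmult:
  fixes f :: "'a::euclidean_space \<Rightarrow> complex"
  assumes "is_L2 f"
  shows "is_L2 (\<lambda>x. c * f x)"
  using assms by (auto simp: is_L2_def L2sq_cmult ennreal_mult_less_top)

lemma is_L2_close:
  fixes f g :: "'a::euclidean_space \<Rightarrow> 'b::{second_countable_topology, real_normed_vector}"
  assumes f: "is_L2 f" and [measurable]: "g \<in> borel_measurable borel" and d: "L2sq (\<lambda>x. f x - g x) < \<infinity>"
  shows "is_L2 g"
proof -
  have "is_L2 (\<lambda>x. f x - g x)"
    using f d assms(2) by (auto simp: is_L2_def intro: borel_measurable_diff)
  from is_L2_diff[OF f this] show ?thesis by simp
qed

lemma truncate_measurable:
  "f \<in> borel_measurable borel \<Longrightarrow> truncate R f \<in> borel_measurable borel"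
  for f :: "'a::euclidean_space \<Rightarrow> 'b::{second_countable_topology, real_normed_vector}"
  unfolding truncate_def by (intro borel_measurable_scaleR borel_measurable_indicator) auto

lemma norm_truncate_le: "norm (truncate R f x) \<le> norm (f x)"
  by (simp add: truncate_def indicator_def)

lemma is_L2_truncate:
  fixes f :: "'a::euclidean_space \<Rightarrow> 'b::{second_countable_topology, real_normed_vector}"
  assumes "is_L2 f"
  shows "is_L2 (truncate R f)"
proof -
  have "L2sq (truncate R f) \<le> L2sq f"
    unfolding L2sq_def by (intro nn_integral_mono ennreal_leI power_mono norm_truncate_le) auto
  with assms show ?thesis
    by (auto simp: is_L2_def truncate_measurable intro: le_less_trans)
qed

lemma integrable_truncate:
  fixes f :: "'a::euclidean_space \<Rightarrow> 'b::{second_countable_topology, banach}"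
  assumes "is_L2 f"
  shows "integrable lborel (truncate R f)"
proof (rule Bochner_Integration.integrable_bound)
  have fin: "emeasure lborel (cball (0::'a) R) < \<infinity>"
    by (rule emeasure_bounded_finite[OF bounded_cball])
  have [measurable]: "truncate R f \<in> borel_measurable borel"
    using assms by (simp add: truncate_measurable is_L2_def)
  have "integrable lborel (\<lambda>x. (norm (truncate R f x))\<^sup>2)"
    using is_L2_truncate[OF assms, of R] by (auto simp: integrable_iff_bounded is_L2_def L2sq_def)
  then show "integrable lborel (\<lambda>x. indicator (cball 0 R) x + (norm (truncate R f x))\<^sup>2)"
    using fin by (intro Bochner_Integration.integrable_add integrable_real_indicator) auto
  show "truncate R f \<in> borel_measurable lborel" by simp
  show "AE x in lborel. norm (truncate R f x) \<le> norm (indicator (cball 0 R) x + (norm (truncate R f x))\<^sup>2 :: real)"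
  proof (rule AE_I2)
    fix x
    have "norm (f x) \<le> 1 + (norm (f x))\<^sup>2"
    proof -
      have "2 * norm (f x) \<le> (norm (f x))\<^sup>2 + 1"
        using zero_le_power2[of "norm (f x) - 1"] by (simp add: power2_diff)
      with norm_ge_zero[of "f x"] show ?thesis by linarith
    qed
    then show "norm (truncate R f x) \<le> norm (indicator (cball 0 R) x + (norm (truncate R f x))\<^sup>2 :: real)"
      by (auto simp: truncate_def indicator_def)
  qed
qed

lemma truncate_tendsto_L2:
  fixes f :: "'a::euclidean_space \<Rightarrow> 'b::{second_countable_topology, banach}"
  assumes f: "is_L2 f" and X: "filterlim X at_top sequentially"
  shows "(\<lambda>n. L2sq (\<lambda>x. truncate (X n) f x - f x)) \<longlonglongrightarrow> 0"
proof (rule L2_dominated_convergence[where w="\<lambda>x. norm (f x)"])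
  have [measurable]: "f \<in> borel_measurable borel" using f by (simp add: is_L2_def)
  show "truncate (X n) f \<in> borel_measurable borel" for n
    by (simp add: truncate_measurable)
  show "AE x in lborel. (\<lambda>n. truncate (X n) f x) \<longlonglongrightarrow> f x"
  proof (intro AE_I2 tendsto_eventually)
    fix x :: 'a
    have "\<forall>\<^sub>F n in sequentially. norm x \<le> X n"
      using X by (auto simp: filterlim_at_top)
    then show "\<forall>\<^sub>F n in sequentially. truncate (X n) f x = f x"
      by eventually_elim (simp add: truncate_def)
  qed
  show "f \<in> borel_measurable borel" "(\<lambda>x. norm (f x)) \<in> borel_measurable borel" by auto
  show "L2sq (\<lambda>x. norm (f x)) < \<infinity>"
    using f by (simp add: is_L2_def L2sq_def)
qed (simp add: norm_truncate_le)

lemma L2sq_ft_diff: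
  fixes f g :: "'a::euclidean_space \<Rightarrow> complex"
  assumes "integrable lborel f" "is_L2 f" "integrable lborel g" "is_L2 g"
  shows "L2sq (\<lambda>\<xi>. ft f \<xi> - ft g \<xi>) = L2sq (\<lambda>x. f x - g x)"
proof -
  have "(\<lambda>\<xi>. ft f \<xi> - ft g \<xi>) = ft (\<lambda>x. f x - g x)"
    using assms by (intro ext ft_diff[symmetric])
  then show ?thesis
    using assms is_L2_diff[of f g] by (simp add: plancherel_L1_L2 is_L2_def)
qed

text \<open>By Plancherel's theorem any approximating sequence of integrable functions may replace
  the truncations.\<close>

lemma has_L2_ftI:
  fixes f :: "'a::euclidean_space \<Rightarrow> complex"
  assumes f: "is_L2 f" and [measurable]: "g \<in> borel_measurable borel"
    and h: "\<And>n. integrable lborel (h n)" "\<And>n. is_L2 (h n)"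
    and hf: "(\<lambda>n. L2sq (\<lambda>x. h n x - f x)) \<longlonglongrightarrow> 0"
    and hg: "(\<lambda>n. L2sq (\<lambda>\<xi>. ft (h n) \<xi> - g \<xi>)) \<longlonglongrightarrow> 0"
  shows "has_L2_ft f g"
  unfolding has_L2_ft_def
proof (intro conjI tendsto_at_topI_sequentially)
  fix X :: "nat \<Rightarrow> real" assume X: "filterlim X at_top sequentially"
  have [measurable]: "f \<in> borel_measurable borel" "h n \<in> borel_measurable borel" "truncate (X n) f \<in> borel_measurable borel" for n
    using f h by (auto simp: is_L2_def truncate_measurable)
  have "(\<lambda>n. L2sq (\<lambda>x. truncate (X n) f x - h n x)) \<longlonglongrightarrow> 0"
    by (rule L2sq_tendsto_trans[OF _ _ _ truncate_tendsto_L2[OF f X]]) (use hf in \<open>auto simp: L2sq_diff_commute[of f]\<close>)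
  then have "(\<lambda>n. L2sq (\<lambda>\<xi>. ft (truncate (X n) f) \<xi> - ft (h n) \<xi>)) \<longlonglongrightarrow> 0"
    by (simp add: L2sq_ft_diff integrable_truncate f h is_L2_truncate)
  then show "(\<lambda>n. L2sq (\<lambda>\<xi>. ft (truncate (X n) f) \<xi> - g \<xi>)) \<longlonglongrightarrow> 0"
    by (rule L2sq_tendsto_trans[OF _ _ _ _ hg, rotated 3]) auto
qed simp

lemma has_L2_ftD:
  fixes f :: "'a::euclidean_space \<Rightarrow> complex"
  assumes f: "is_L2 f" and fg: "has_L2_ft f g"
    and h: "\<And>n. integrable lborel (h n)" "\<And>n. is_L2 (h n)"
    and hf: "(\<lambda>n. L2sq (\<lambda>x. h n x - f x)) \<longlonglongrightarrow> 0"
  shows "(\<lambda>n. L2sq (\<lambda>\<xi>. ft (h n) \<xi> - g \<xi>)) \<longlonglongrightarrow> 0"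
proof -
  have X: "filterlim real at_top sequentially"
    by (rule filterlim_real_sequentially)
  have [measurable]: "f \<in> borel_measurable borel" "h n \<in> borel_measurable borel" "truncate (real n) f \<in> borel_measurable borel"
    "g \<in> borel_measurable borel" for n
    using f h fg by (auto simp: is_L2_def truncate_measurable has_L2_ft_def)
  have "(\<lambda>n. L2sq (\<lambda>x. h n x - truncate (real n) f x)) \<longlonglongrightarrow> 0"
    by (rule L2sq_tendsto_trans[OF _ _ _ hf]) (use truncate_tendsto_L2[OF f X] in \<open>auto simp: L2sq_diff_commute[of f]\<close>)
  then have 1: "(\<lambda>n. L2sq (\<lambda>\<xi>. ft (h n) \<xi> - ft (truncate (real n) f) \<xi>)) \<longlonglongrightarrow> 0"
    by (simp add: L2sq_ft_diff integrable_truncate f h is_L2_truncate)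
  have 2: "(\<lambda>n. L2sq (\<lambda>\<xi>. ft (truncate (real n) f) \<xi> - g \<xi>)) \<longlonglongrightarrow> 0"
    using fg unfolding has_L2_ft_def by (auto intro: filterlim_compose[OF _ X])
  show ?thesis
    by (rule L2sq_tendsto_trans[OF _ _ _ 1 2]) auto
qed

lemma truncations_converge:
  fixes f :: "'a::euclidean_space \<Rightarrow> complex"
  assumes f: "is_L2 f"
  shows "\<And>n. integrable lborel (truncate (real n) f)" "\<And>n. is_L2 (truncate (real n) f)"
    "(\<lambda>n. L2sq (\<lambda>x. truncate (real n) f x - f x)) \<longlonglongrightarrow> 0"
  using integrable_truncate[OF f] is_L2_truncate[OF f] truncate_tendsto_L2[OF f filterlim_real_sequentially]
  by auto

lemma L2_Cauchy_of_convergent: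
  fixes f :: "nat \<Rightarrow> 'a::euclidean_space \<Rightarrow> 'b::{second_countable_topology, real_normed_vector}"
  assumes [measurable]: "\<And>n. f n \<in> borel_measurable borel" "g \<in> borel_measurable borel"
    and lim: "(\<lambda>n. L2sq (\<lambda>x. f n x - g x)) \<longlonglongrightarrow> 0" and e: "0 < e"
  shows "\<exists>N. \<forall>m\<ge>N. \<forall>n\<ge>N. L2sq (\<lambda>x. f m x - f n x) \<le> ennreal e"
proof -
  have "0 < ennreal (e / 4)" using e by simp
  from order_tendstoD(2)[OF lim this] obtain N where N: "\<And>n. n \<ge> N \<Longrightarrow> L2sq (\<lambda>x. f n x - g x) < ennreal (e / 4)"
    by (auto simp: eventually_sequentially)
  have "L2sq (\<lambda>x. f m x - f n x) \<le> ennreal e" if "m \<ge> N" "n \<ge> N" for m n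
  proof -
    have "L2sq (\<lambda>x. f m x - f n x) \<le> 2 * L2sq (\<lambda>x. f m x - g x) + 2 * L2sq (\<lambda>x. g x - f n x)"
      by (rule L2sq_triangle) auto
    also have "\<dots> \<le> 2 * ennreal (e / 4) + 2 * ennreal (e / 4)"
      using N[OF that(1)] N[OF that(2)] by (intro add_mono mult_left_mono) (auto simp: L2sq_diff_commute[of g])
    also have "2 * ennreal (e / 4) = ennreal (e / 2)"
      using ennreal_mult'[of 2 "e / 4"] by simp
    also have "ennreal (e / 2) + ennreal (e / 2) = ennreal e"
      using e by (subst ennreal_plus[symmetric]) auto
    finally show ?thesis .
  qed
  then show ?thesis by blast
qed

theorem has_L2_ft_exists:
  fixes f :: "'a::euclidean_space \<Rightarrow> complex"
  assumes f: "is_L2 f"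
  shows "\<exists>g. has_L2_ft f g"
proof -
  note s = truncations_converge[OF f]
  have [measurable]: "f \<in> borel_measurable borel" "truncate (real n) f \<in> borel_measurable borel" for n
    using f by (auto simp: is_L2_def truncate_measurable)
  obtain g where g: "g \<in> borel_measurable borel" "(\<lambda>n. L2sq (\<lambda>\<xi>. ft (truncate (real n) f) \<xi> - g \<xi>)) \<longlonglongrightarrow> 0"
  proof (rule L2_complete)
    show "\<exists>N. \<forall>m\<ge>N. \<forall>n\<ge>N. L2sq (\<lambda>x. ft (truncate (real m) f) x - ft (truncate (real n) f) x) \<le> ennreal e" if "0 < e" for e
      using L2_Cauchy_of_convergent[OF _ _ s(3) that] by (simp add: L2sq_ft_diff s(1,2))
  qed auto
  then show ?thesis
    by (intro exI[of _ g] has_L2_ftI[OF f _ s])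
qed

theorem has_L2_ft_plancherel:
  fixes f :: "'a::euclidean_space \<Rightarrow> complex"
  assumes f: "is_L2 f" and fg: "has_L2_ft f g"
  shows "L2sq g = L2sq f"
proof (rule L2sq_eq_of_limits[OF _ _ _ _ sequentially_bot])
  note s = truncations_converge[OF f]
  show "(\<lambda>n. L2sq (\<lambda>x. truncate (real n) f x - f x)) \<longlonglongrightarrow> 0" by (rule s)
  show "(\<lambda>n. L2sq (\<lambda>\<xi>. ft (truncate (real n) f) \<xi> - g \<xi>)) \<longlonglongrightarrow> 0" by (rule has_L2_ftD[OF f fg s])
  show "L2sq (ft (truncate (real n) f)) = L2sq (truncate (real n) f)" for n
    using s(2)[of n] by (intro plancherel_L1_L2 s(1)) (simp add: is_L2_def)
qed (use f fg in \<open>auto simp: is_L2_def truncate_measurable ft_measurable has_L2_ft_def\<close>)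

lemma has_L2_ft_is_L2:
  fixes f :: "'a::euclidean_space \<Rightarrow> complex"
  assumes "is_L2 f" "has_L2_ft f g"
  shows "is_L2 g"
  using has_L2_ft_plancherel[OF assms] assms by (auto simp: is_L2_def has_L2_ft_def)

lemma has_L2_ft_unique:
  fixes f :: "'a::euclidean_space \<Rightarrow> complex"
  assumes f: "is_L2 f" and "has_L2_ft f g" "has_L2_ft f h"
  shows "AE \<xi> in lborel. g \<xi> = h \<xi>"
  by (rule L2_limit_unique[where F=at_top and f="\<lambda>R. ft (truncate R f)"])
    (use assms in \<open>auto simp: has_L2_ft_def is_L2_def truncate_measurable ft_measurable\<close>)

lemma has_L2_ft_cong_AE:
  fixes f :: "'a::euclidean_space \<Rightarrow> complex"
  assumes "has_L2_ft f g" "AE \<xi> in lborel. g \<xi> = h \<xi>" "h \<in> borel_measurable borel"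
  shows "has_L2_ft f h"
proof -
  have "L2sq (\<lambda>\<xi>. ft (truncate R f) \<xi> - h \<xi>) = L2sq (\<lambda>\<xi>. ft (truncate R f) \<xi> - g \<xi>)" for R
    using assms(2) by (intro L2sq_cong_AE) auto
  with assms show ?thesis by (simp add: has_L2_ft_def)
qed

lemma has_L2_ft_cong_AE_left:
  fixes f :: "'a::euclidean_space \<Rightarrow> complex"
  assumes "has_L2_ft f g" "AE x in lborel. f x = f' x" "f \<in> borel_measurable borel" "f' \<in> borel_measurable borel"
  shows "has_L2_ft f' g"
proof -
  have "ft (truncate R f') = ft (truncate R f)" for R
  proof (rule ext)
    fix \<xi>
    have [measurable]: "truncate R f \<in> borel_measurable borel" "truncate R f' \<in> borel_measurable borel"
      using assms by (auto simp: truncate_measurable)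
    show "ft (truncate R f') \<xi> = ft (truncate R f) \<xi>"
      unfolding ft_def
    proof (rule integral_cong_AE)
      show "AE x in lborel. truncate R f' x * cis (- 2 * pi * (x \<bullet> \<xi>)) = truncate R f x * cis (- 2 * pi * (x \<bullet> \<xi>))"
        using assms(2) by eventually_elim (simp add: truncate_def)
    qed auto
  qed
  with assms(1) show ?thesis by (simp add: has_L2_ft_def)
qed

lemma has_L2_ft_integrable:
  fixes f :: "'a::euclidean_space \<Rightarrow> complex"
  assumes "integrable lborel f" "is_L2 f"
  shows "has_L2_ft f (ft f)"
  by (rule has_L2_ftI[where h="\<lambda>_. f"]) (use assms in \<open>auto simp: is_L2_def L2sq_def\<close>)

lemma has_L2_ft_diff:
  fixes f f' :: "'a::euclidean_space \<Rightarrow> complex"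
  assumes f: "is_L2 f" "has_L2_ft f g" and f': "is_L2 f'" "has_L2_ft f' g'"
  shows "has_L2_ft (\<lambda>x. f x - f' x) (\<lambda>\<xi>. g \<xi> - g' \<xi>)"
proof (rule has_L2_ftI)
  note s = truncations_converge[OF f(1)] and s' = truncations_converge[OF f'(1)]
  let ?h = "\<lambda>n x. truncate (real n) f x - truncate (real n) f' x"
  have [measurable]: "f \<in> borel_measurable borel" "f' \<in> borel_measurable borel" "g \<in> borel_measurable borel" "g' \<in> borel_measurable borel"
    "truncate (real n) f \<in> borel_measurable borel" "truncate (real n) f' \<in> borel_measurable borel" for n
    using f f' by (auto simp: is_L2_def truncate_measurable has_L2_ft_def)
  show "is_L2 (\<lambda>x. f x - f' x)" by (intro is_L2_diff f f')
  show "is_L2 (?h n)" for n by (intro is_L2_diff s s')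
  show "integrable lborel (?h n)" for n using s s' by auto
  have sum0: "(\<lambda>n. L2sq (\<lambda>x. (a n x - a0 x) - (b n x - b0 x))) \<longlonglongrightarrow> 0"
    if [measurable]: "\<And>n. a n \<in> borel_measurable borel" "\<And>n. b n \<in> borel_measurable borel" "a0 \<in> borel_measurable borel" "b0 \<in> borel_measurable borel"
      and "(\<lambda>n. L2sq (\<lambda>x. a n x - a0 x)) \<longlonglongrightarrow> 0" "(\<lambda>n. L2sq (\<lambda>x. b n x - b0 x)) \<longlonglongrightarrow> 0"
    for a b :: "nat \<Rightarrow> 'a \<Rightarrow> complex" and a0 b0
    by (rule L2sq_tendsto_trans[where g="\<lambda>_ _. 0"]) (use that in \<open>auto simp: L2sq_def norm_minus_commute\<close>)
  show "(\<lambda>n. L2sq (\<lambda>x. ?h n x - (f x - f' x))) \<longlonglongrightarrow> 0"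
    using sum0[OF _ _ _ _ s(3) s'(3)] by (simp add: algebra_simps)
  have "(\<lambda>n. L2sq (\<lambda>\<xi>. (ft (truncate (real n) f) \<xi> - ft (truncate (real n) f') \<xi>) - (g \<xi> - g' \<xi>))) \<longlonglongrightarrow> 0"
    using sum0[OF _ _ _ _ has_L2_ftD[OF f s] has_L2_ftD[OF f' s']] by (simp add: algebra_simps)
  then show "(\<lambda>n. L2sq (\<lambda>\<xi>. ft (?h n) \<xi> - (g \<xi> - g' \<xi>))) \<longlonglongrightarrow> 0"
    by (simp add: ft_diff s s')
qed (use f f' in \<open>auto simp: has_L2_ft_def\<close>)

lemma has_L2_ft_cmult:
  fixes f :: "'a::euclidean_space \<Rightarrow> complex"
  assumes f: "is_L2 f" "has_L2_ft f g"
  shows "has_L2_ft (\<lambda>x. c * f x) (\<lambda>\<xi>. c * g \<xi>)"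
proof (rule has_L2_ftI)
  note s = truncations_converge[OF f(1)]
  let ?h = "\<lambda>n x. c * truncate (real n) f x"
  have [measurable]: "f \<in> borel_measurable borel" "g \<in> borel_measurable borel" "truncate (real n) f \<in> borel_measurable borel" for n
    using f by (auto simp: is_L2_def truncate_measurable has_L2_ft_def)
  show "(\<lambda>n. L2sq (\<lambda>x. ?h n x - c * f x)) \<longlonglongrightarrow> 0"
    using tendsto_ennreal_mult_null[OF s(3), of "ennreal ((norm c)\<^sup>2)"]
    by (simp add: L2sq_cmult flip: right_diff_distrib)
  show "(\<lambda>n. L2sq (\<lambda>\<xi>. ft (?h n) \<xi> - c * g \<xi>)) \<longlonglongrightarrow> 0"
    using tendsto_ennreal_mult_null[OF has_L2_ftD[OF f s], of "ennreal ((norm c)\<^sup>2)"]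
    by (simp add: ft_cmult L2sq_cmult flip: right_diff_distrib)
qed (use f truncations_converge[OF f(1)] in \<open>auto simp: has_L2_ft_def intro: is_L2_cmult\<close>)

lemma nn_integral_lborel_translate:
  fixes f :: "'a::euclidean_space \<Rightarrow> ennreal"
  assumes [measurable]: "f \<in> borel_measurable borel"
  shows "(\<integral>\<^sup>+x. f (x + a) \<partial>lborel) = (\<integral>\<^sup>+x. f x \<partial>lborel)"
  by (subst (2) lborel_distr_plus[of a, symmetric], subst nn_integral_distr) (auto simp: add.commute)

lemma L2sq_translate:
  fixes f :: "'a::euclidean_space \<Rightarrow> 'b::{second_countable_topology, real_normed_vector}"
  assumes [measurable]: "f \<in> borel_measurable borel"
  shows "L2sq (\<lambda>x. f (x + a)) = L2sq f"
  unfolding L2sq_def by (rule nn_integral_lborel_translate) simp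

lemma lborel_integral_translate:
  fixes f :: "'a::euclidean_space \<Rightarrow> 'b::{banach, second_countable_topology}"
  assumes [measurable]: "f \<in> borel_measurable borel"
  shows "(LINT x|lborel. f (x + a)) = (LINT x|lborel. f x)"
  by (subst (2) lborel_distr_plus[of a, symmetric], subst integral_distr) (auto simp: add.commute)

lemma integrable_lborel_translate:
  fixes f :: "'a::euclidean_space \<Rightarrow> 'b::{banach, second_countable_topology}"
  assumes f: "integrable lborel f"
  shows "integrable lborel (\<lambda>x. f (x + a))"
proof -
  have [measurable]: "f \<in> borel_measurable borel" using f by auto
  have "integrable (distr lborel borel ((+) a)) f"
    using f by (simp add: lborel_distr_plus)
  then show ?thesis
    by (subst (asm) integrable_distr_eq) (auto simp: add.commute)
qed

lemma ft_translate:
  fixes f :: "'a::euclidean_space \<Rightarrow> complex"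
  assumes [measurable]: "f \<in> borel_measurable borel"
  shows "ft (\<lambda>x. f (x + a)) \<xi> = cis (2 * pi * (a \<bullet> \<xi>)) * ft f \<xi>"
proof -
  have "ft (\<lambda>x. f (x + a)) \<xi> = (LINT x|lborel. (\<lambda>y. f y * cis (- 2 * pi * ((y - a) \<bullet> \<xi>))) (x + a))"
    unfolding ft_def by simp
  also have "\<dots> = (LINT y|lborel. f y * cis (- 2 * pi * ((y - a) \<bullet> \<xi>)))"
    by (rule lborel_integral_translate) simp
  also have "\<dots> = (LINT y|lborel. cis (2 * pi * (a \<bullet> \<xi>)) * (f y * cis (- 2 * pi * (y \<bullet> \<xi>))))"
    by (intro Bochner_Integration.integral_cong)
      (simp_all add: mult.left_commute cis_mult inner_diff_left algebra_simps)
  finally show ?thesis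
    unfolding ft_def by simp
qed

lemma has_L2_ft_translate:
  fixes f :: "'a::euclidean_space \<Rightarrow> complex"
  assumes f: "is_L2 f" "has_L2_ft f g"
  shows "has_L2_ft (\<lambda>x. f (x + a)) (\<lambda>\<xi>. cis (2 * pi * (a \<bullet> \<xi>)) * g \<xi>)"
proof (rule has_L2_ftI)
  note s = truncations_converge[OF f(1)]
  let ?h = "\<lambda>n x. truncate (real n) f (x + a)"
  have [measurable]: "f \<in> borel_measurable borel" "g \<in> borel_measurable borel" "truncate (real n) f \<in> borel_measurable borel" for n
    using f by (auto simp: is_L2_def truncate_measurable has_L2_ft_def)
  show "is_L2 (\<lambda>x. f (x + a))" "is_L2 (?h n)" for n
    using f s(2)[of n] by (auto simp: is_L2_def L2sq_translate)
  show "integrable lborel (?h n)" for n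
    by (intro integrable_lborel_translate s)
  show "(\<lambda>\<xi>. cis (2 * pi * (a \<bullet> \<xi>)) * g \<xi>) \<in> borel_measurable borel" by measurable
  show "(\<lambda>n. L2sq (\<lambda>x. ?h n x - f (x + a))) \<longlonglongrightarrow> 0"
    using s(3) L2sq_translate[of "\<lambda>x. truncate (real _) f x - f x" a] by simp
  have "L2sq (\<lambda>\<xi>. ft (?h n) \<xi> - cis (2 * pi * (a \<bullet> \<xi>)) * g \<xi>) = L2sq (\<lambda>\<xi>. ft (truncate (real n) f) \<xi> - g \<xi>)" for n
    by (simp add: ft_translate L2sq_def norm_mult flip: right_diff_distrib)
  then show "(\<lambda>n. L2sq (\<lambda>\<xi>. ft (?h n) \<xi> - cis (2 * pi * (a \<bullet> \<xi>)) * g \<xi>)) \<longlonglongrightarrow> 0"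
    using has_L2_ftD[OF f s] by simp
qed

text \<open>The graph of the Fourier transform is closed: by Plancherel's theorem the transforms
  of \<open>fs n\<close> converge to the transform of \<open>f\<close>.\<close>

lemma has_L2_ft_closed:
  fixes f :: "'a::euclidean_space \<Rightarrow> complex"
  assumes fs: "\<And>n. is_L2 (fs n)" "\<And>n. has_L2_ft (fs n) (gs n)" and f: "is_L2 f" and g: "g \<in> borel_measurable borel"
    and lim: "(\<lambda>n. L2sq (\<lambda>x. fs n x - f x)) \<longlonglongrightarrow> 0" "(\<lambda>n. L2sq (\<lambda>\<xi>. gs n \<xi> - g \<xi>)) \<longlonglongrightarrow> 0"
  shows "has_L2_ft f g"
proof -
  obtain g' where g': "has_L2_ft f g'"
    using has_L2_ft_exists[OF f] ..
  have "L2sq (\<lambda>\<xi>. gs n \<xi> - g' \<xi>) = L2sq (\<lambda>x. fs n x - f x)" for n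
    by (rule has_L2_ft_plancherel[OF is_L2_diff[OF fs(1) f] has_L2_ft_diff[OF fs f g']])
  then have "(\<lambda>n. L2sq (\<lambda>\<xi>. gs n \<xi> - g' \<xi>)) \<longlonglongrightarrow> 0"
    using lim(1) by simp
  then have "AE \<xi> in lborel. g' \<xi> = g \<xi>"
    by (intro L2_limit_unique[OF _ _ g sequentially_bot _ lim(2)]) (use fs(2) g' in \<open>auto simp: has_L2_ft_def\<close>)
  then show ?thesis
    by (rule has_L2_ft_cong_AE[OF g' _ g])
qed

section \<open>Smooth bumps and separation by test functions\<close>

lemma Ck_imp_continuous: "Ck k f \<Longrightarrow> continuous_on UNIV f"
  by (cases k)
    (auto intro!: differentiable_imp_continuous_on simp: differentiable_on_def intro: differentiable_at_withinI)

lemma Ck_Suc_imp_Ck: "Ck (Suc k) f \<Longrightarrow> Ck k f"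
proof (induction k arbitrary: f)
  case 0
  then show ?case using Ck_imp_continuous[of "Suc 0" f] by simp
next
  case (Suc k)
  then show ?case by (metis Ck.simps(2))
qed

lemma Ck_SucI:
  assumes "\<And>x. (f has_derivative f' x) (at x)" "\<And>v. Ck k (\<lambda>x. f' x v)"
  shows "Ck (Suc k) f"
proof -
  have "frechet_derivative f (at x) = f' x" for x
    using frechet_derivative_at[OF assms(1)] by simp
  then show ?thesis
    using assms by (auto simp: differentiable_def)
qed

lemma Ck_SucD:
  assumes "Ck (Suc k) f"
  shows "(f has_derivative frechet_derivative f (at x)) (at x)" "Ck k (\<lambda>x. frechet_derivative f (at x) v)"
  using assms by (auto simp: frechet_derivative_works)

lemma Ck_const: "Ck k (\<lambda>_. c)"
proof (induction k arbitrary: c)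
  case (Suc k)
  show ?case by (rule Ck_SucI[OF has_derivative_const]) (rule Suc)
qed simp

lemma Ck_add: "Ck k f \<Longrightarrow> Ck k g \<Longrightarrow> Ck k (\<lambda>x. f x + g x)"
proof (induction k arbitrary: f g)
  case (Suc k)
  show ?case
    by (rule Ck_SucI[OF has_derivative_add[OF Ck_SucD(1)[OF Suc.prems(1)] Ck_SucD(1)[OF Suc.prems(2)]]])
      (intro Suc.IH Ck_SucD(2) Suc.prems)
qed (simp add: continuous_on_add)

lemma Ck_mult: "Ck k f \<Longrightarrow> Ck k g \<Longrightarrow> Ck k (\<lambda>x. f x * g x)"
proof (induction k arbitrary: f g)
  case (Suc k)
  show ?case
    by (rule Ck_SucI[OF has_derivative_mult[OF Ck_SucD(1)[OF Suc.prems(1)] Ck_SucD(1)[OF Suc.prems(2)]]])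
      (intro Ck_add Suc.IH Ck_SucD(2) Suc.prems Ck_Suc_imp_Ck)
qed (simp add: continuous_on_mult)

lemma Ck_prod: "finite I \<Longrightarrow> (\<And>i. i \<in> I \<Longrightarrow> Ck k (f i)) \<Longrightarrow> Ck k (\<lambda>x. \<Prod>i\<in>I. f i x)"
  by (induction I rule: finite_induct) (auto intro: Ck_const Ck_mult)

text \<open>The family of smooth functions vanishing to infinite order at \<open>0\<close> which
  contains \<open>exp (- 1 / t)\<close> and is closed under differentiation up to linear
  combinations; that makes smoothness an induction.\<close>

definition flat :: "nat \<Rightarrow> real \<Rightarrow> real" where
  "flat m t = (if t \<le> 0 then 0 else (1 / t) ^ m * exp (- (1 / t)))"

lemma flat_tendsto_0: "(flat m \<longlongrightarrow> 0) (at_right 0)"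
proof -
  have "((\<lambda>t::real. (inverse t) ^ m / exp (inverse t)) \<longlongrightarrow> 0) (at_right 0)"
    by (rule filterlim_compose[OF tendsto_power_div_exp_0 filterlim_inverse_at_top_right])
  then show ?thesis
    by (rule Lim_transform_eventually)
      (auto simp: flat_def eventually_at_filter exp_minus field_simps)
qed

lemma flat_has_derivative: "(flat m has_real_derivative (- real m * flat (m + 1) t + flat (m + 2) t)) (at t)"
proof -
  consider "t < 0" | "t = 0" | "0 < t" by linarith
  then show ?thesis
  proof cases
    case 1
    have "((\<lambda>_. 0) has_real_derivative 0) (at t)" by simp
    then have "(flat m has_real_derivative 0) (at t)"
      by (rule has_field_derivative_transform_within_open[where S="{..<0}"]) (use 1 in \<open>auto simp: flat_def\<close>)
    with 1 show ?thesis by (simp add: flat_def)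
  next
    case 2
    have right: "((\<lambda>h. (flat m (0 + h) - flat m 0) / h) \<longlongrightarrow> 0) (at_right 0)"
      by (rule Lim_transform_eventually[OF flat_tendsto_0[of "Suc m"]])
        (auto simp: flat_def eventually_at_filter field_simps)
    have left: "((\<lambda>h. (flat m (0 + h) - flat m 0) / h) \<longlongrightarrow> 0) (at_left 0)"
      by (rule tendsto_eventually) (auto simp: flat_def eventually_at_filter)
    have "((\<lambda>h. (flat m (0 + h) - flat m 0) / h) \<longlongrightarrow> 0) (at 0)"
      using left right by (simp add: filterlim_split_at)
    then have "(flat m has_real_derivative 0) (at 0)"
      unfolding has_field_derivative_def DERIV_def[symmetric] by (simp add: DERIV_def)
    with 2 show ?thesis by (simp add: flat_def)
  next
    case 3
    have "((\<lambda>t. (1 / t) ^ m * exp (- (1 / t))) has_real_derivative (- real m * flat (m + 1) t + flat (m + 2) t)) (at t)"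
    proof -
      have inv: "((\<lambda>t. 1 / t) has_real_derivative - ((1 / t)\<^sup>2)) (at t)"
        using 3 by (auto intro!: derivative_eq_intros simp: power2_eq_square)
      have pw: "real m * (- (a\<^sup>2) * a ^ (m - Suc 0)) = - real m * a ^ (m + 1)" for a :: real
        by (cases m) (simp_all add: power2_eq_square algebra_simps)
      have pow_deriv: "((\<lambda>t. (1 / t) ^ m) has_real_derivative - real m * (1 / t) ^ (m + 1)) (at t)"
        using DERIV_power[OF inv, of m] unfolding pw .
      have ex: "((\<lambda>t. exp (- (1 / t))) has_real_derivative exp (- (1 / t)) * (1 / t)\<^sup>2) (at t)"
        using DERIV_fun_exp[OF DERIV_minus[OF inv]] by simp
      have "- real m * flat (m + 1) t + flat (m + 2) t
          = - real m * (1 / t) ^ (m + 1) * exp (- (1 / t)) + exp (- (1 / t)) * (1 / t)\<^sup>2 * (1 / t) ^ m"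
        using 3 by (simp add: flat_def power2_eq_square mult_ac)
      with DERIV_mult[OF pow_deriv ex] show ?thesis by simp
    qed
    then show ?thesis
      by (rule has_field_derivative_transform_within_open[where S="{0<..}"]) (use 3 in \<open>auto simp: flat_def\<close>)
  qed
qed

text \<open>By \<open>flat_has_derivative\<close> every derivative is a combination of members of
  the same family, so the induction has to run over all \<open>m\<close> at once.\<close>

lemma Ck_flat: "Ck k (\<lambda>x. flat m (c * x $ i + d))"
proof (induction k arbitrary: m)
  case 0
  have "continuous_on UNIV (flat m)"
    using flat_has_derivative[of m] by (auto intro!: DERIV_continuous_on)
  moreover have "continuous_on UNIV (\<lambda>x::real^3. c * x $ i + d)"
    by (intro continuous_intros)
  ultimately show ?case
    by (auto intro: continuous_on_compose2)
next
  case (Suc k)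
  show ?case
  proof (rule Ck_SucI)
    fix x :: "real^3"
    have "((\<lambda>x::real^3. c * x $ i + d) has_derivative (\<lambda>v. c * v $ i)) (at x)"
      by (auto intro!: derivative_eq_intros bounded_linear.has_derivative[OF bounded_linear_vec_nth])
    from has_derivative_compose[OF this flat_has_derivative[THEN has_field_derivative_imp_has_derivative]]
    show "((\<lambda>x. flat m (c * x $ i + d)) has_derivative
        (\<lambda>v. (- real m * flat (m + 1) (c * x $ i + d) + flat (m + 2) (c * x $ i + d)) * (c * v $ i))) (at x)"
      by (simp add: o_def)
    show "Ck k (\<lambda>x. (- real m * flat (m + 1) (c * x $ i + d) + flat (m + 2) (c * x $ i + d)) * (c * v $ i))" for v :: "real^3"
      by (intro Ck_mult Ck_add Ck_const Suc.IH)
  qed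
qed

text \<open>For \<open>n > 0\<close> positive exactly on the open box; as \<open>n\<close> grows
  the functions increase to its indicator.\<close>

definition box_bump :: "real^3 \<Rightarrow> real^3 \<Rightarrow> nat \<Rightarrow> real^3 \<Rightarrow> real" where
  "box_bump a b n x = (\<Prod>i\<in>UNIV. flat 0 (real n * x $ i + (- real n * a $ i)) * flat 0 (- real n * x $ i + real n * b $ i))"

lemma box_bump_eq_0: "x \<notin> box a b \<Longrightarrow> box_bump a b n x = 0"
proof -
  assume "x \<notin> box a b"
  then obtain i where "x $ i \<le> a $ i \<or> b $ i \<le> x $ i"
    by (auto simp: mem_box_cart not_less)
  then have "real n * x $ i + (- real n * a $ i) \<le> 0 \<or> - real n * x $ i + real n * b $ i \<le> 0"
    by (auto intro: mult_left_mono)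
  then show ?thesis
    unfolding box_bump_def by (intro prod_zero bexI[of _ i]) (auto simp: flat_def)
qed

lemma box_bump_test_function: "test_function (box_bump a b n)"
  unfolding test_function_def smooth_def
proof (intro conjI allI)
  show "Ck k (box_bump a b n)" for k
    unfolding box_bump_def[abs_def] by (intro Ck_prod Ck_mult Ck_flat) auto
  have "{x. box_bump a b n x \<noteq> 0} \<subseteq> box a b"
    using box_bump_eq_0[of _ a b n] by auto
  then show "compact (closure {x. box_bump a b n x \<noteq> 0})"
    unfolding compact_closure using bounded_box bounded_subset by blast
qed

lemma flat_0_bounds: "0 \<le> flat 0 t" "flat 0 t \<le> 1"
  by (auto simp: flat_def)

lemma box_bump_bounds: "0 \<le> box_bump a b n x" "box_bump a b n x \<le> 1"
  unfolding box_bump_def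
  by (auto intro!: prod_nonneg prod_le_1 mult_nonneg_nonneg mult_le_one flat_0_bounds)

lemma flat_0_scaled_tendsto: "0 < s \<Longrightarrow> (\<lambda>n. flat 0 (real n * s)) \<longlonglongrightarrow> 1"
proof -
  assume s: "0 < s"
  have "(\<lambda>n. exp (- (1 / real (Suc n) * (1 / s)))) \<longlonglongrightarrow> exp (- (0 * (1 / s)))"
    by (intro tendsto_intros LIMSEQ_Suc[OF lim_inverse_n'])
  then have "(\<lambda>n. flat 0 (real (Suc n) * s)) \<longlonglongrightarrow> 1"
    using s by (simp add: flat_def not_le[symmetric] mult_le_0_iff)
  then show ?thesis by (rule LIMSEQ_imp_Suc)
qed

lemma box_bump_tendsto: "(\<lambda>n. box_bump a b n x) \<longlonglongrightarrow> indicator (box a b) x"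
proof (cases "x \<in> box a b")
  case True
  then have ab: "0 < x $ i - a $ i" "0 < b $ i - x $ i" for i
    by (auto simp: mem_box_cart)
  have "(\<lambda>n. \<Prod>i\<in>UNIV. flat 0 (real n * (x $ i - a $ i)) * flat 0 (real n * (b $ i - x $ i))) \<longlonglongrightarrow> (\<Prod>i\<in>(UNIV::3 set). 1 * 1)"
    by (intro tendsto_intros flat_0_scaled_tendsto ab)
  then show ?thesis
    using True by (simp add: box_bump_def algebra_simps)
qed (simp add: box_bump_eq_0)

lemma locally_integrable_measurable:
  assumes "locally_integrable g"
  shows "g \<in> borel_measurable borel"
proof (rule borel_measurable_LIMSEQ_real)
  show "(\<lambda>x. indicator (cball 0 (real n)) x * g x) \<in> borel_measurable borel" for n
    using assms unfolding locally_integrable_def set_integrable_def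
    by (auto dest!: spec[of _ "cball 0 (real n)"] borel_measurable_integrable)
  show "(\<lambda>n. indicator (cball 0 (real n)) x * g x) \<longlonglongrightarrow> g x" for x
  proof (rule tendsto_eventually)
    obtain N where "norm x \<le> real N" using real_arch_simple by blast
    then show "\<forall>\<^sub>F n in sequentially. indicator (cball 0 (real n)) x * g x = g x"
      by (auto simp: eventually_sequentially indicator_def intro!: exI[of _ N])
  qed
qed

text \<open>The measures with densities \<open>g\<^sup>+\<close> and \<open>g\<^sup>-\<close>
  agree on boxes, which form an intersection-stable generator of the Borel sets; so the two
  densities are equal almost everywhere.\<close>

lemma AE_zero_of_box_integrals:
  fixes g :: "'a::euclidean_space \<Rightarrow> real"
  assumes m[measurable]: "g \<in> borel_measurable borel"
    and int: "\<And>a b. set_integrable lborel (box a b) g"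
    and zero: "\<And>a b. (LINT x:box a b|lborel. g x) = 0"
  shows "AE x in lborel. g x = 0"
proof -
  let ?p = "\<lambda>x. ennreal (g x)" and ?q = "\<lambda>x. ennreal (- g x)"
  let ?E = "range (\<lambda>(a, b). box a b :: 'a set)"
  have box_eq: "emeasure (density lborel ?p) (box a b) = emeasure (density lborel ?q) (box a b)"
    and box_fin: "emeasure (density lborel ?p) (box a b) \<noteq> \<infinity>" for a b
  proof -
    let ?f = "\<lambda>x. indicator (box a b) x *\<^sub>R g x"
    have f: "integrable lborel ?f"
      using int unfolding set_integrable_def .
    have p: "emeasure (density lborel ?p) (box a b) = ennreal (LINT x|lborel. max 0 (?f x))"
    proof -
      have "emeasure (density lborel ?p) (box a b) = (\<integral>\<^sup>+x. ennreal (max 0 (?f x)) \<partial>lborel)"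
        by (auto simp: emeasure_density indicator_def max_def ennreal_neg intro!: nn_integral_cong)
      also have "\<dots> = ennreal (LINT x|lborel. max 0 (?f x))"
        using f by (intro nn_integral_eq_integral integrable_max) auto
      finally show ?thesis .
    qed
    have q: "emeasure (density lborel ?q) (box a b) = ennreal (LINT x|lborel. max 0 (- ?f x))"
    proof -
      have "emeasure (density lborel ?q) (box a b) = (\<integral>\<^sup>+x. ennreal (max 0 (- ?f x)) \<partial>lborel)"
        by (auto simp: emeasure_density indicator_def max_def ennreal_neg intro!: nn_integral_cong)
      also have "\<dots> = ennreal (LINT x|lborel. max 0 (- ?f x))"
        using f by (intro nn_integral_eq_integral integrable_max) auto
      finally show ?thesis .
    qed
    have "(LINT x|lborel. max 0 (?f x)) - (LINT x|lborel. max 0 (- ?f x)) = (LINT x|lborel. max 0 (?f x) - max 0 (- ?f x))"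
      using f by (intro Bochner_Integration.integral_diff[symmetric] integrable_max) auto
    also have "\<dots> = (LINT x|lborel. ?f x)"
      by (intro Bochner_Integration.integral_cong) (auto simp: max_def)
    also have "\<dots> = 0"
      using zero unfolding set_lebesgue_integral_def .
    finally show "emeasure (density lborel ?p) (box a b) = emeasure (density lborel ?q) (box a b)"
      unfolding p q by simp
    show "emeasure (density lborel ?p) (box a b) \<noteq> \<infinity>"
      unfolding p by simp
  qed
  have "density lborel ?p = density lborel ?q"
  proof (rule measure_eqI_generator_eq)
    show "Int_stable ?E"
      by (auto simp: Int_stable_def box_Int_box)
    show "?E \<subseteq> Pow UNIV" "sets (density lborel ?p) = sigma_sets UNIV ?E" "sets (density lborel ?q) = sigma_sets UNIV ?E"
      by (simp_all add: borel_eq_box)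
    let ?A = "\<lambda>n::nat. box (- (real n *\<^sub>R One)) (real n *\<^sub>R One) :: 'a set"
    show "range ?A \<subseteq> ?E" "(\<Union>i. ?A i) = UNIV"
      unfolding UN_box_eq_UNIV by auto
    show "emeasure (density lborel ?p) (?A i) \<noteq> \<infinity>" for i
      by (rule box_fin)
    show "emeasure (density lborel ?p) X = emeasure (density lborel ?q) X" if "X \<in> ?E" for X
      using that box_eq by auto
  qed
  then have "AE x in lborel. ?p x = ?q x"
    by (subst (asm) sigma_finite_measure.density_unique_iff[OF sigma_finite_lborel]) auto
  then show ?thesis
  proof eventually_elim
    case (elim x)
    then show ?case
      by (cases "0 \<le> g x") (auto simp: ennreal_neg ennreal_eq_0_iff)
  qed
qed

text \<open>The fundamental lemma of the calculus of variations: bumps converge to indicators of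
  boxes, so all box integrals of \<open>g\<close> vanish.\<close>

theorem test_functions_separate:
  assumes g: "locally_integrable g"
    and zero: "\<And>\<psi>. test_function \<psi> \<Longrightarrow> (LINT x|lborel. g x * \<psi> x) = 0"
  shows "AE x in lborel. g x = 0"
proof (rule AE_zero_of_box_integrals)
  show [measurable]: "g \<in> borel_measurable borel"
    by (rule locally_integrable_measurable[OF g])
  fix a b :: "real^3"
  have c: "set_integrable lborel (cbox a b) g"
    using g by (auto simp: locally_integrable_def)
  then show "set_integrable lborel (box a b) g"
    by (rule set_integrable_subset) (auto simp: box_subset_cbox)
  have bm[measurable]: "box_bump a b n \<in> borel_measurable borel" for n
    using box_bump_test_function[of a b n]
    by (auto simp: test_function_def smooth_def intro!: borel_measurable_continuous_onI Ck_imp_continuous[of 0])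
  have "(\<lambda>n. LINT x|lborel. g x * box_bump a b n x) \<longlonglongrightarrow> (LINT x|lborel. indicator (box a b) x *\<^sub>R g x)"
  proof (rule integral_dominated_convergence[where w="\<lambda>x. norm (indicator (cbox a b) x *\<^sub>R g x)"])
    show "integrable lborel (\<lambda>x. norm (indicator (cbox a b) x *\<^sub>R g x))"
      using c unfolding set_integrable_def by (rule integrable_norm)
    show "AE x in lborel. (\<lambda>n. g x * box_bump a b n x) \<longlonglongrightarrow> indicator (box a b) x *\<^sub>R g x"
      by (auto intro!: AE_I2 tendsto_eq_intros box_bump_tendsto)
    show "AE x in lborel. norm (g x * box_bump a b n x) \<le> norm (indicator (cbox a b) x *\<^sub>R g x)" for n
    proof (rule AE_I2)
      fix x
      show "norm (g x * box_bump a b n x) \<le> norm (indicator (cbox a b) x *\<^sub>R g x)"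
      proof (cases "x \<in> box a b")
        case True
        then have "x \<in> cbox a b" using box_subset_cbox by blast
        then show ?thesis
          using box_bump_bounds[of a b n x] by (simp add: abs_mult mult_left_le)
      qed (simp add: box_bump_eq_0)
    qed
  qed auto
  then show "(LINT x:box a b|lborel. g x) = 0"
    using zero[OF box_bump_test_function] unfolding set_lebesgue_integral_def
    by (simp add: LIMSEQ_const_iff)
qed

section \<open>Pairing of square integrable functions\<close>

text \<open>The Cauchy-Schwarz inequality, together with the integrability it presupposes.\<close>

lemma is_L2_mult_integrable:
  fixes a b :: "'a::euclidean_space \<Rightarrow> 'b::{real_normed_field, second_countable_topology, banach}"
  assumes a: "is_L2 a" and b: "is_L2 b"
  shows "integrable lborel (\<lambda>x. a x * b x)"
    and "ennreal ((norm (LINT x|lborel. a x * b x))\<^sup>2) \<le> L2sq a * L2sq b"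
proof -
  have [measurable]: "a \<in> borel_measurable borel" "b \<in> borel_measurable borel"
    using a b by (auto simp: is_L2_def)
  have CS: "(\<integral>\<^sup>+x. ennreal (norm (a x)) * ennreal (norm (b x)) \<partial>lborel)\<^sup>2 \<le> L2sq a * L2sq b"
    using Cauchy_Schwarz_nn_integral[of "\<lambda>x. ennreal (norm (a x))" lborel "\<lambda>x. ennreal (norm (b x))"]
    by (simp add: L2sq_def ennreal_power)
  also have "\<dots> < \<infinity>"
    using a b by (auto simp: is_L2_def ennreal_mult_less_top)
  finally have fin: "(\<integral>\<^sup>+x. ennreal (norm (a x)) * ennreal (norm (b x)) \<partial>lborel) < \<infinity>"
    by (auto simp: power_less_top_ennreal)
  then show int: "integrable lborel (\<lambda>x. a x * b x)"
    by (auto simp: integrable_iff_bounded norm_mult ennreal_mult)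
  have "ennreal (norm (LINT x|lborel. a x * b x)) \<le> (\<integral>\<^sup>+x. ennreal (norm (a x)) * ennreal (norm (b x)) \<partial>lborel)"
    using integral_norm_bound_ennreal[OF int] by (simp add: norm_mult ennreal_mult)
  then have "ennreal (norm (LINT x|lborel. a x * b x)) ^ 2 \<le> (\<integral>\<^sup>+x. ennreal (norm (a x)) * ennreal (norm (b x)) \<partial>lborel)\<^sup>2"
    by (rule power_mono_ennreal)
  also note CS
  finally show "ennreal ((norm (LINT x|lborel. a x * b x))\<^sup>2) \<le> L2sq a * L2sq b"
    by (simp add: ennreal_power)
qed

lemma L2_weak_convergence:
  fixes a :: "'a::euclidean_space \<Rightarrow> 'b::{real_normed_field, second_countable_topology, banach}"
  assumes an: "\<And>n. is_L2 (as n)" and a: "is_L2 a" and b: "is_L2 b"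
    and lim: "(\<lambda>n. L2sq (\<lambda>x. as n x - a x)) \<longlonglongrightarrow> 0"
  shows "(\<lambda>n. LINT x|lborel. as n x * b x) \<longlonglongrightarrow> (LINT x|lborel. a x * b x)"
proof -
  have *: "(LINT x|lborel. (as n x - a x) * b x) = (LINT x|lborel. as n x * b x) - (LINT x|lborel. a x * b x)" for n
    unfolding left_diff_distrib
    by (intro Bochner_Integration.integral_diff is_L2_mult_integrable an a b)
  have "(\<lambda>n. ennreal ((norm (LINT x|lborel. (as n x - a x) * b x))\<^sup>2)) \<longlonglongrightarrow> 0"
  proof (rule tendsto_sandwich[OF _ _ tendsto_const])
    show "\<forall>\<^sub>F n in sequentially. ennreal ((norm (LINT x|lborel. (as n x - a x) * b x))\<^sup>2) \<le> L2sq b * L2sq (\<lambda>x. as n x - a x)"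
      using is_L2_mult_integrable(2)[OF is_L2_diff[OF an a] b] by (simp add: mult.commute)
    show "(\<lambda>n. L2sq b * L2sq (\<lambda>x. as n x - a x)) \<longlonglongrightarrow> 0"
      using b by (intro tendsto_ennreal_mult_null lim) (auto simp: is_L2_def)
  qed auto
  then have "(\<lambda>n. (norm (LINT x|lborel. (as n x - a x) * b x))\<^sup>2) \<longlonglongrightarrow> 0"
    by (simp add: ennreal_tendsto_0_iff)
  from tendsto_real_sqrt[OF this] have "(\<lambda>n. norm (LINT x|lborel. (as n x - a x) * b x)) \<longlonglongrightarrow> 0"
    by simp
  then show ?thesis
    unfolding * by (simp add: LIM_zero_iff tendsto_norm_zero_iff)
qed

section \<open>Test functions\<close>

lemma test_function_support:
  assumes "test_function \<psi>"
  obtains r where "0 < r" "\<And>x. r < norm x \<Longrightarrow> \<psi> x = 0"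
proof -
  have "bounded {x. \<psi> x \<noteq> 0}"
    using assms by (simp add: test_function_def compact_closure)
  then obtain r where "0 < r" "\<And>x. \<psi> x \<noteq> 0 \<Longrightarrow> norm x \<le> r"
    by (auto simp: bounded_pos)
  then show thesis
    by (intro that[of r]) (auto simp: not_le[symmetric])
qed

lemma test_function_has_derivative:
  assumes "test_function \<psi>"
  shows "(\<psi> has_derivative frechet_derivative \<psi> (at x)) (at x)"
proof -
  have "Ck (Suc 0) \<psi>"
    using assms unfolding test_function_def smooth_def by blast
  then show ?thesis by (rule Ck_SucD(1))
qed

lemma test_function_continuous:
  assumes "test_function \<psi>"
  shows "continuous_on UNIV \<psi>" "continuous_on UNIV (pderiv3 i \<psi>)"
proof -
  have "Ck (Suc 0) \<psi>" "Ck 0 \<psi>"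
    using assms unfolding test_function_def smooth_def by blast+
  then show "continuous_on UNIV \<psi>" "continuous_on UNIV (pderiv3 i \<psi>)"
    using Ck_SucD(2)[of 0 \<psi> "axis i 1"] by (auto simp: pderiv3_def[abs_def])
qed

lemma test_function_line_derivative:
  assumes "test_function \<psi>"
  shows "((\<lambda>t. \<psi> (x + t *\<^sub>R axis i 1)) has_real_derivative pderiv3 i \<psi> (x + t *\<^sub>R axis i 1)) (at t)"
proof -
  let ?e = "axis i 1 :: real^3"
  have "((\<lambda>t. x + t *\<^sub>R ?e) has_derivative (\<lambda>s. s *\<^sub>R ?e)) (at t)"
    by (auto intro!: derivative_eq_intros)
  from has_derivative_compose[OF this test_function_has_derivative[OF assms]]
  have "((\<lambda>t. \<psi> (x + t *\<^sub>R ?e)) has_derivative (\<lambda>s. frechet_derivative \<psi> (at (x + t *\<^sub>R ?e)) (s *\<^sub>R ?e))) (at t)" .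
  moreover have "frechet_derivative \<psi> (at (x + t *\<^sub>R ?e)) (s *\<^sub>R ?e) = pderiv3 i \<psi> (x + t *\<^sub>R ?e) * s" for s
    using linear_scale[OF has_derivative_linear[OF test_function_has_derivative[OF assms]]]
    by (simp add: pderiv3_def mult.commute)
  ultimately show ?thesis
    by (simp add: has_field_derivative_def)
qed

lemma pderiv3_support:
  assumes \<psi>: "test_function \<psi>" and r: "\<And>x. r < norm x \<Longrightarrow> \<psi> x = 0" and x: "r < norm x"
  shows "pderiv3 i \<psi> x = 0"
proof -
  have "(\<psi> has_derivative (\<lambda>_. 0)) (at x)"
    by (rule has_derivative_transform_within_open[of "\<lambda>_. 0" _ _ _ "{x. r < norm x}"])
      (use x r in \<open>auto intro!: open_Collect_less continuous_intros\<close>)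
  then have "frechet_derivative \<psi> (at x) = (\<lambda>_. 0)"
    by (rule frechet_derivative_at[symmetric])
  then show ?thesis by (simp add: pderiv3_def)
qed

lemma test_function_bounded:
  assumes \<psi>: "test_function \<psi>"
  obtains B where "\<And>x. \<bar>pderiv3 i \<psi> x\<bar> \<le> B" "\<And>x. \<bar>\<psi> x\<bar> \<le> B"
proof -
  obtain r where r: "0 < r" "\<And>x. r < norm x \<Longrightarrow> \<psi> x = 0"
    using test_function_support[OF \<psi>] by blast
  have bdd: "\<exists>B. \<forall>x. \<bar>f x\<bar> \<le> B" if "continuous_on UNIV f" "\<And>x. r < norm x \<Longrightarrow> f x = 0" for f :: "real^3 \<Rightarrow> real"
  proof -
    have "bounded (f ` cball 0 r)"
      by (intro compact_imp_bounded compact_continuous_image continuous_on_subset[OF that(1)]) auto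
    then obtain B where B: "0 < B" "\<And>x. norm x \<le> r \<Longrightarrow> \<bar>f x\<bar> \<le> B"
      by (auto simp: bounded_pos)
    then show ?thesis
      by (intro exI[of _ B]) (metis abs_zero less_imp_le not_le that(2))
  qed
  have "pderiv3 i \<psi> x = 0" if "r < norm x" for x
    using pderiv3_support[OF \<psi> r(2) that] .
  then obtain B where "\<And>x. \<bar>pderiv3 i \<psi> x\<bar> \<le> B"
    using bdd[OF test_function_continuous(2)[OF \<psi>]] by blast
  moreover obtain B' where "\<And>x. \<bar>\<psi> x\<bar> \<le> B'"
    using bdd[OF test_function_continuous(1)[OF \<psi>] r(2)] by blast
  ultimately show thesis
    by (intro that[of "max B B'"]) (auto simp: le_max_iff_disj)
qed

lemma test_function_is_L2:
  assumes \<psi>: "test_function \<psi>"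
  shows "is_L2 \<psi>" "is_L2 (pderiv3 i \<psi>)"
proof -
  obtain r where r: "0 < r" "\<And>x. r < norm x \<Longrightarrow> \<psi> x = 0"
    using test_function_support[OF \<psi>] by blast
  obtain B where B: "\<And>x. \<bar>pderiv3 i \<psi> x\<bar> \<le> B" "\<And>x. \<bar>\<psi> x\<bar> \<le> B"
    using test_function_bounded[OF \<psi>] by blast
  have *: "is_L2 f" if f: "continuous_on UNIV f" and z: "\<And>x. r < norm x \<Longrightarrow> f x = 0" and b: "\<And>x. \<bar>f x\<bar> \<le> B" for f :: "real^3 \<Rightarrow> real"
  proof -
    have [measurable]: "f \<in> borel_measurable borel"
      by (rule borel_measurable_continuous_onI[OF f])
    have "integrable lborel (\<lambda>x::real^3. B * indicator (cball 0 r) x)"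
      using emeasure_bounded_finite[OF bounded_cball, of "0::real^3" r]
      by (intro integrable_mult_right integrable_real_indicator) auto
    then have "integrable lborel f"
    proof (rule Bochner_Integration.integrable_bound)
      show "AE x in lborel. norm (f x) \<le> norm (B * indicator (cball 0 r) x)"
      proof (rule AE_I2)
        fix x show "norm (f x) \<le> norm (B * indicator (cball 0 r) x)"
          using b[of x] z[of x] by (cases "r < norm x") (auto simp: indicator_def)
      qed
    qed simp
    with b show ?thesis
      using L2sq_bounded_integrable(1)[of f B] by (simp add: is_L2_def)
  qed
  show "is_L2 \<psi>" "is_L2 (pderiv3 i \<psi>)"
    by (intro * test_function_continuous \<psi> r(2) B pderiv3_support[OF \<psi> r(2)]; assumption)+
qed

lemma is_L2_locally_integrable:
  assumes f: "is_L2 f"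
  shows "locally_integrable f"
  unfolding locally_integrable_def
proof (intro allI impI)
  fix K :: "(real^3) set" assume K: "compact K"
  obtain R where R: "K \<subseteq> cball 0 R"
  proof -
    obtain R where "\<forall>x\<in>K. norm x \<le> R"
      using compact_imp_bounded[OF K] unfolding bounded_iff by blast
    then show thesis by (intro that[of R]) auto
  qed
  have "set_integrable lborel (cball 0 R) f"
    using integrable_truncate[OF f, of R] by (simp add: set_integrable_def truncate_def[abs_def])
  then show "set_integrable lborel K f"
    using K R by (intro set_integrable_subset[of lborel "cball 0 R" f K]) (simp_all add: borel_compact)
qed

text \<open>The mean value theorem bounds the difference quotients by the derivative of
  \<open>\<psi>\<close>, so dominated convergence applies. The quotients step backwards because
  they arise by moving a translation from \<open>f\<close> to \<open>\<psi>\<close>.\<close>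

lemma test_function_quotient_tendsto:
  assumes \<psi>: "test_function \<psi>" and f: "is_L2 f" and h: "\<And>n. 0 < h n" "\<And>n. h n \<le> 1" "h \<longlonglongrightarrow> 0"
  shows "(\<lambda>n. LINT x|lborel. f x * ((\<psi> (x - h n *\<^sub>R axis i 1) - \<psi> x) / h n)) \<longlonglongrightarrow> (LINT x|lborel. f x * - pderiv3 i \<psi> x)"
proof -
  let ?e = "axis i 1 :: real^3"
  obtain r where r: "0 < r" "\<And>x. r < norm x \<Longrightarrow> \<psi> x = 0"
    using test_function_support[OF \<psi>] by blast
  obtain B where B: "\<And>x. \<bar>pderiv3 i \<psi> x\<bar> \<le> B" 
    using test_function_bounded[OF \<psi>] by blast
  have [measurable]: "f \<in> borel_measurable borel" "\<psi> \<in> borel_measurable borel" "pderiv3 i \<psi> \<in> borel_measurable borel"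
    using f test_function_is_L2[OF \<psi>] by (auto simp: is_L2_def)
  have B0: "0 \<le> B" using B[of 0] by linarith
  show ?thesis
  \<comment> \<open>steps are at most \<open>1\<close>, so the quotients vanish outside the ball
      of radius \<open>r + 1\<close>\<close>
  proof (rule integral_dominated_convergence[where w="\<lambda>x. B * norm (truncate (r + 1) f x)"])
    show "integrable lborel (\<lambda>x. B * norm (truncate (r + 1) f x))"
      by (intro integrable_mult_right integrable_norm integrable_truncate f)
    show "AE x in lborel. (\<lambda>n. f x * ((\<psi> (x - h n *\<^sub>R ?e) - \<psi> x) / h n)) \<longlonglongrightarrow> f x * - pderiv3 i \<psi> x"
    proof (intro AE_I2 tendsto_mult tendsto_const)
      fix x
      have "((\<lambda>t. \<psi> (x + t *\<^sub>R ?e)) has_real_derivative pderiv3 i \<psi> x) (at 0)"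
        using test_function_line_derivative[OF \<psi>, of x i 0] by simp
      then have "((\<lambda>s. (\<psi> (x + s *\<^sub>R ?e) - \<psi> x) / s) \<longlongrightarrow> pderiv3 i \<psi> x) (at 0)"
        by (simp add: has_field_derivative_iff)
      moreover have "filterlim (\<lambda>n. - h n) (at 0) sequentially"
        using tendsto_minus[OF h(3)] h(1) by (auto simp: filterlim_at intro!: always_eventually less_imp_neq[symmetric])
      ultimately have "(\<lambda>n. (\<psi> (x + (- h n) *\<^sub>R ?e) - \<psi> x) / (- h n)) \<longlonglongrightarrow> pderiv3 i \<psi> x"
        by (rule filterlim_compose)
      from tendsto_minus[OF this] show "(\<lambda>n. (\<psi> (x - h n *\<^sub>R ?e) - \<psi> x) / h n) \<longlonglongrightarrow> - pderiv3 i \<psi> x"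
        by simp
    qed
    show "AE x in lborel. norm (f x * ((\<psi> (x - h n *\<^sub>R ?e) - \<psi> x) / h n)) \<le> B * norm (truncate (r + 1) f x)" for n
    proof (rule AE_I2)
      fix x
      show "norm (f x * ((\<psi> (x - h n *\<^sub>R ?e) - \<psi> x) / h n)) \<le> B * norm (truncate (r + 1) f x)"
      proof (cases "norm x \<le> r + 1")
        case True
        have "\<exists>z. 0 < z \<and> z < h n \<and> \<psi> (x - h n *\<^sub>R ?e + h n *\<^sub>R ?e) - \<psi> (x - h n *\<^sub>R ?e + 0 *\<^sub>R ?e) = (h n - 0) * pderiv3 i \<psi> (x - h n *\<^sub>R ?e + z *\<^sub>R ?e)"
          by (rule MVT2[OF h(1)]) (rule test_function_line_derivative[OF \<psi>])
        then obtain z where z: "\<psi> x - \<psi> (x - h n *\<^sub>R ?e) = h n * pderiv3 i \<psi> (x - h n *\<^sub>R ?e + z *\<^sub>R ?e)"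
          by auto
        then have "\<psi> (x - h n *\<^sub>R ?e) - \<psi> x = - (h n * pderiv3 i \<psi> (x - h n *\<^sub>R ?e + z *\<^sub>R ?e))"
          by simp
        then have "\<bar>(\<psi> (x - h n *\<^sub>R ?e) - \<psi> x) / h n\<bar> \<le> B"
          using B[of "x - h n *\<^sub>R ?e + z *\<^sub>R ?e"] h(1)[of n] by simp
        then have "\<bar>f x\<bar> * \<bar>(\<psi> (x - h n *\<^sub>R ?e) - \<psi> x) / h n\<bar> \<le> \<bar>f x\<bar> * B"
          by (rule mult_left_mono) simp
        then show ?thesis
          using True by (simp add: truncate_def abs_mult mult.commute)
      next
        case False
        have "norm x \<le> norm (x - h n *\<^sub>R ?e) + norm (h n *\<^sub>R ?e)"
          by (metis diff_add_cancel norm_triangle_ineq)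
        then have "r < norm (x - h n *\<^sub>R ?e)"
          using False h(1)[of n] h(2)[of n] by simp
        with False r show ?thesis
          by (simp add: B0)
      qed
    qed
  qed auto
qed

section \<open>Weak derivatives of square integrable functions\<close>

text \<open>Summation by parts for difference quotients, by translation invariance.\<close>

lemma integral_translate_mult:
  fixes f \<psi> :: "'a::euclidean_space \<Rightarrow> real"
  assumes f: "is_L2 f" and \<psi>: "is_L2 \<psi>"
  shows "(LINT x|lborel. (f (x + a) - f x) / h * \<psi> x) = (LINT x|lborel. f x * ((\<psi> (x - a) - \<psi> x) / h))"
proof -
  have [measurable]: "f \<in> borel_measurable borel" "\<psi> \<in> borel_measurable borel"
    using assms by (auto simp: is_L2_def)
  have sh: "is_L2 (\<lambda>x. f (x + a))" "is_L2 (\<lambda>x. \<psi> (x - a))"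
    using f \<psi> L2sq_translate[of \<psi> "- a"] by (auto simp: is_L2_def L2sq_translate)
  have "(LINT x|lborel. (f (x + a) - f x) / h * \<psi> x) = (LINT x|lborel. (f (x + a) * \<psi> x - f x * \<psi> x) / h)"
    by (intro Bochner_Integration.integral_cong) (auto simp: field_simps)
  also have "\<dots> = ((LINT x|lborel. f (x + a) * \<psi> x) - (LINT x|lborel. f x * \<psi> x)) / h"
    by (subst integral_divide_zero, subst Bochner_Integration.integral_diff) (auto intro: is_L2_mult_integrable sh f \<psi>)
  also have "(LINT x|lborel. f (x + a) * \<psi> x) = (LINT x|lborel. f x * \<psi> (x - a))"
    using lborel_integral_translate[of "\<lambda>x. f x * \<psi> (x - a)" a] by simp
  also have "((LINT x|lborel. f x * \<psi> (x - a)) - (LINT x|lborel. f x * \<psi> x)) / h = (LINT x|lborel. (f x * \<psi> (x - a) - f x * \<psi> x) / h)"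
    by (subst integral_divide_zero, subst Bochner_Integration.integral_diff) (auto intro: is_L2_mult_integrable sh f \<psi>)
  also have "\<dots> = (LINT x|lborel. f x * ((\<psi> (x - a) - \<psi> x) / h))"
    by (intro Bochner_Integration.integral_cong) (auto simp: field_simps)
  finally show ?thesis .
qed

lemma norm_cis_minus_1_le: "norm (cis t - 1) \<le> \<bar>t\<bar>"
proof -
  have "norm (cis t - 1) = 2 * \<bar>sin (t / 2)\<bar>"
  proof -
    have "(norm (cis t - 1))\<^sup>2 = (cos t - 1)\<^sup>2 + (sin t)\<^sup>2"
      by (simp add: cmod_power2)
    also have "\<dots> = 2 - 2 * cos (2 * (t / 2))"
      using sin_cos_squared_add[of t] by (simp add: power2_diff)
    also have "\<dots> = (2 * \<bar>sin (t / 2)\<bar>)\<^sup>2"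
      unfolding cos_double_sin by (simp add: power_mult_distrib)
    finally show ?thesis
      by (rule power2_eq_imp_eq) auto
  qed
  also have "\<dots> \<le> \<bar>t\<bar>"
    using abs_sin_x_le_abs_x[of "t / 2"] by simp
  finally show ?thesis .
qed

text \<open>The difference quotients of \<open>f\<close> have transforms \<open>m n * g\<close>
  with \<open>m n \<xi> \<longrightarrow> 2 \<pi> \<i> \<xi>\<^sub>i\<close>, dominated by
  \<open>2 \<pi> \<bar>\<xi>\<^sub>i\<bar>\<close>. So the transforms converge in
  \<open>L\<^sup>2\<close>, hence so do the quotients; their limit is the weak derivative, as
  pairing with a test function shows.\<close>

theorem weak_derivative_exists:
  fixes f :: "real^3 \<Rightarrow> real"
  assumes f: "is_L2 f" and g: "has_L2_ft (\<lambda>x. complex_of_real (f x)) g"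
    and fin: "L2sq (\<lambda>\<xi>. complex_of_real (\<xi> $ i) * g \<xi>) < \<infinity>"
  obtains D where "is_L2 D" "has_L2_ft (\<lambda>x. complex_of_real (D x)) (\<lambda>\<xi>. 2 * pi * \<i> * (\<xi> $ i) * g \<xi>)"
    "has_weak_pderiv i f D"
proof -
  let ?e = "axis i 1 :: real^3"
  have [measurable]: "f \<in> borel_measurable borel" "g \<in> borel_measurable borel"
    using f g by (auto simp: is_L2_def has_L2_ft_def)
  have fc: "is_L2 (\<lambda>x. complex_of_real (f x))"
    using f by (simp add: is_L2_def L2sq_def)
  define h where "h n = 1 / real (Suc n)" for n
  have h: "0 < h n" "h n \<le> 1" for n by (auto simp: h_def)
  have h0: "h \<longlonglongrightarrow> 0"
    unfolding h_def by (rule LIMSEQ_Suc[OF lim_inverse_n'])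
  define D where "D n x = (f (x + h n *\<^sub>R ?e) - f x) / h n" for n x
  define m where "m n \<xi> = (1 / h n) * (cis (2 * pi * (h n * \<xi> $ i)) - 1)" for n and \<xi> :: "real^3"
  have [measurable]: "D n \<in> borel_measurable borel" "m n \<in> borel_measurable borel" for n
    unfolding D_def m_def by measurable
  have D_L2: "is_L2 (D n)" for n
  proof -
    have "is_L2 (\<lambda>x. f (x + h n *\<^sub>R ?e) - f x)"
      using f by (intro is_L2_diff) (auto simp: is_L2_def L2sq_translate)
    then show ?thesis
      unfolding D_def[abs_def] is_L2_def
      using L2sq_cmult[of "\<lambda>x. f (x + h n *\<^sub>R ?e) - f x" "1 / h n"] by (auto simp: ennreal_mult_less_top)
  qed
  have D_ft: "has_L2_ft (\<lambda>x. complex_of_real (D n x)) (\<lambda>\<xi>. m n \<xi> * g \<xi>)" for n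
  proof -
    have tr: "is_L2 (\<lambda>x. complex_of_real (f (x + h n *\<^sub>R ?e)))"
      using fc L2sq_translate[of "\<lambda>x. complex_of_real (f x)" "h n *\<^sub>R ?e"] by (simp add: is_L2_def)
    have "has_L2_ft (\<lambda>x. complex_of_real (1 / h n) * (complex_of_real (f (x + h n *\<^sub>R ?e)) - complex_of_real (f x)))
        (\<lambda>\<xi>. complex_of_real (1 / h n) * (cis (2 * pi * (h n *\<^sub>R ?e \<bullet> \<xi>)) * g \<xi> - g \<xi>))"
      by (rule has_L2_ft_cmult[OF is_L2_diff[OF tr fc] has_L2_ft_diff[OF tr has_L2_ft_translate[OF fc g] fc g]])
    then show ?thesis
      by (simp add: D_def m_def inner_axis' left_diff_distrib mult.assoc right_diff_distrib diff_divide_distrib)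
  qed
  have mg_lim: "(\<lambda>n. L2sq (\<lambda>\<xi>. m n \<xi> * g \<xi> - 2 * pi * \<i> * (\<xi> $ i) * g \<xi>)) \<longlonglongrightarrow> 0"
  proof (rule L2_dominated_convergence[where w="\<lambda>\<xi>. 2 * pi * norm (complex_of_real (\<xi> $ i) * g \<xi>)"])
    show "AE \<xi> in lborel. (\<lambda>n. m n \<xi> * g \<xi>) \<longlonglongrightarrow> 2 * pi * \<i> * (\<xi> $ i) * g \<xi>"
    proof (intro AE_I2 tendsto_mult tendsto_const)
      fix \<xi> :: "real^3"
      let ?w = "2 * pi * \<i> * (\<xi> $ i)"
      have "((\<lambda>s. exp (?w * s)) has_field_derivative ?w) (at 0)"
        by (auto intro!: derivative_eq_intros)
      then have "((\<lambda>s. (exp (?w * s) - 1) / s) \<longlongrightarrow> ?w) (at 0)"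
        by (simp add: has_field_derivative_iff)
      moreover have "filterlim (\<lambda>n. complex_of_real (h n)) (at 0) sequentially"
        using tendsto_of_real[OF h0, where 'a=complex] h(1) by (auto simp: filterlim_at intro!: always_eventually less_imp_neq[symmetric])
      ultimately have "(\<lambda>n. (exp (?w * h n) - 1) / h n) \<longlonglongrightarrow> ?w"
        by (rule filterlim_compose)
      then show "(\<lambda>n. m n \<xi>) \<longlonglongrightarrow> ?w"
        by (simp add: m_def cis_conv_exp mult_ac)
    qed
    show "AE \<xi> in lborel. norm (m n \<xi> * g \<xi>) \<le> 2 * pi * norm (complex_of_real (\<xi> $ i) * g \<xi>)" for n
    proof (rule AE_I2)
      fix \<xi> :: "real^3"
      have "norm (m n \<xi>) = norm (cis (2 * pi * (h n * \<xi> $ i)) - 1) / h n"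
        using h(1)[of n] by (simp add: m_def norm_divide norm_mult)
      also have "\<dots> \<le> \<bar>2 * pi * (h n * \<xi> $ i)\<bar> / h n"
        using h(1)[of n] by (intro divide_right_mono norm_cis_minus_1_le) auto
      also have "\<dots> = 2 * pi * \<bar>\<xi> $ i\<bar>"
        using h(1)[of n] by (simp add: abs_mult)
      finally show "norm (m n \<xi> * g \<xi>) \<le> 2 * pi * norm (complex_of_real (\<xi> $ i) * g \<xi>)"
        by (simp add: norm_mult mult_right_mono flip: mult.assoc)
    qed
    show "L2sq (\<lambda>\<xi>. 2 * pi * norm (complex_of_real (\<xi> $ i) * g \<xi>)) < \<infinity>"
      using fin L2sq_cmult[of "\<lambda>\<xi>. norm (complex_of_real (\<xi> $ i) * g \<xi>)" "2 * pi"]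
      by (auto simp: L2sq_def ennreal_mult_less_top)
  qed auto
  have diff_eq: "L2sq (\<lambda>x. D k x - D n x) = L2sq (\<lambda>\<xi>. m k \<xi> * g \<xi> - m n \<xi> * g \<xi>)" for k n
  proof -
    have c: "is_L2 (\<lambda>x. complex_of_real (D k x))" for k
      using D_L2[of k] by (simp add: is_L2_def L2sq_def)
    have "L2sq (\<lambda>\<xi>. m k \<xi> * g \<xi> - m n \<xi> * g \<xi>) = L2sq (\<lambda>x. complex_of_real (D k x) - complex_of_real (D n x))"
      by (rule has_L2_ft_plancherel[OF is_L2_diff[OF c c] has_L2_ft_diff[OF c D_ft c D_ft]])
    then show ?thesis
      by (simp add: L2sq_def flip: of_real_diff)
  qed
  \<comment> \<open>completeness yields a real valued limit of the quotients, whose transform is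
      then known\<close>
  obtain D' where D': "D' \<in> borel_measurable borel" "(\<lambda>n. L2sq (\<lambda>x. D n x - D' x)) \<longlonglongrightarrow> 0"
  proof (rule L2_complete)
    show "\<exists>N. \<forall>m\<ge>N. \<forall>n\<ge>N. L2sq (\<lambda>x. D m x - D n x) \<le> ennreal e" if "0 < e" for e
      unfolding diff_eq by (rule L2_Cauchy_of_convergent[OF _ _ mg_lim that]) auto
  qed auto
  have D'_L2: "is_L2 D'"
  proof -
    from order_tendstoD(2)[OF D'(2), of 1] obtain n where "L2sq (\<lambda>x. D n x - D' x) < 1"
      by (auto simp: eventually_sequentially)
    then show ?thesis
      by (intro is_L2_close[OF D_L2[of n] D'(1)]) (auto intro: less_trans)
  qed
  show thesis
  proof (rule that[OF D'_L2])
    show "has_L2_ft (\<lambda>x. complex_of_real (D' x)) (\<lambda>\<xi>. 2 * pi * \<i> * (\<xi> $ i) * g \<xi>)"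
    proof (rule has_L2_ft_closed[OF _ D_ft _ _ _ mg_lim])
      show "(\<lambda>n. L2sq (\<lambda>x. complex_of_real (D n x) - complex_of_real (D' x))) \<longlonglongrightarrow> 0"
        using D'(2) by (simp add: L2sq_def flip: of_real_diff)
    qed (use D_L2 D'_L2 in \<open>auto simp: is_L2_def L2sq_def\<close>)
    show "has_weak_pderiv i f D'"
      unfolding has_weak_pderiv_def
    proof (intro conjI allI impI is_L2_locally_integrable f D'_L2)
      fix \<psi> assume \<psi>: "test_function \<psi>"
      have "(\<lambda>n. LINT x|lborel. D n x * \<psi> x) \<longlonglongrightarrow> (LINT x|lborel. D' x * \<psi> x)"
        by (rule L2_weak_convergence[OF D_L2 D'_L2 test_function_is_L2(1)[OF \<psi>] D'(2)])
      moreover have "(\<lambda>n. LINT x|lborel. D n x * \<psi> x) \<longlonglongrightarrow> (LINT x|lborel. f x * - pderiv3 i \<psi> x)"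
        unfolding D_def integral_translate_mult[OF f test_function_is_L2(1)[OF \<psi>]]
        by (rule test_function_quotient_tendsto[OF \<psi> f h h0])
      ultimately show "(LINT x|lborel. D' x * \<psi> x) = - (LINT x|lborel. f x * pderiv3 i \<psi> x)"
        by (simp add: LIMSEQ_unique)
    qed
  qed
qed

lemma weak_pderiv_unique:
  assumes f: "has_weak_pderiv i f g" and f': "has_weak_pderiv i f g'"
  shows "AE x in lborel. g x = g' x"
proof -
  have g: "locally_integrable g" "locally_integrable g'"
    using assms unfolding has_weak_pderiv_def by blast+
  have "AE x in lborel. g x - g' x = 0"
  proof (rule test_functions_separate)
    show "locally_integrable (\<lambda>x. g x - g' x)"
      using g unfolding locally_integrable_def by (auto intro: set_integral_diff)
    fix \<psi> assume \<psi>: "test_function \<psi>"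
    obtain r where r: "0 < r" "\<And>x. r < norm x \<Longrightarrow> \<psi> x = 0"
      using test_function_support[OF \<psi>] by blast
    obtain B where B: "\<And>x. \<bar>\<psi> x\<bar> \<le> B"
      using test_function_bounded[OF \<psi>] by blast
    have int: "integrable lborel (\<lambda>x. k x * \<psi> x)" if k: "locally_integrable k" for k
    proof -
      have [measurable]: "k \<in> borel_measurable borel" "\<psi> \<in> borel_measurable borel"
        using locally_integrable_measurable[OF k] test_function_is_L2[OF \<psi>] by (auto simp: is_L2_def)
      have "integrable lborel (\<lambda>x. indicator (cball 0 r) x *\<^sub>R k x)"
        using k by (auto simp: locally_integrable_def set_integrable_def)
      then have "integrable lborel (\<lambda>x. B * (indicator (cball 0 r) x *\<^sub>R k x))"
        by (rule integrable_mult_right)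
      then show ?thesis
      proof (rule Bochner_Integration.integrable_bound)
        show "AE x in lborel. norm (k x * \<psi> x) \<le> norm (B * (indicator (cball 0 r) x *\<^sub>R k x))"
        proof (rule AE_I2)
          fix x
          have "\<bar>\<psi> x\<bar> \<le> \<bar>B\<bar>" using B[of x] by linarith
          then show "norm (k x * \<psi> x) \<le> norm (B * (indicator (cball 0 r) x *\<^sub>R k x))"
            using r(2)[of x] by (cases "r < norm x") (auto simp: abs_mult mult.commute intro!: mult_right_mono)
        qed
      qed simp
    qed
    have "(LINT x|lborel. (g x - g' x) * \<psi> x) = (LINT x|lborel. g x * \<psi> x) - (LINT x|lborel. g' x * \<psi> x)"
      unfolding left_diff_distrib by (intro Bochner_Integration.integral_diff int g)
    also have "\<dots> = 0"
    proof -
      have "(LINT x|lborel. g x * \<psi> x) = - (LINT x|lborel. f x * pderiv3 i \<psi> x)"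
        "(LINT x|lborel. g' x * \<psi> x) = - (LINT x|lborel. f x * pderiv3 i \<psi> x)"
        using assms \<psi> unfolding has_weak_pderiv_def by blast+
      then show ?thesis by simp
    qed
    finally show "(LINT x|lborel. (g x - g' x) * \<psi> x) = 0" .
  qed
  then show ?thesis by eventually_elim simp
qed

text \<open>Uniqueness of weak derivatives transfers the transform from the derivative constructed
  above to the representative chosen by \<open>weak_pderiv\<close>.\<close>

theorem weak_pderiv_fourier:
  fixes f :: "real^3 \<Rightarrow> real"
  assumes f: "is_L2 f" and g: "has_L2_ft (\<lambda>x. complex_of_real (f x)) g"
    and fin: "L2sq (\<lambda>\<xi>. complex_of_real (\<xi> $ i) * g \<xi>) < \<infinity>"
  shows "is_L2 (weak_pderiv i f)" 
    and "has_L2_ft (\<lambda>x. complex_of_real (weak_pderiv i f x)) (\<lambda>\<xi>. 2 * pi * \<i> * (\<xi> $ i) * g \<xi>)"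
proof -
  obtain D where D: "is_L2 D" "has_L2_ft (\<lambda>x. complex_of_real (D x)) (\<lambda>\<xi>. 2 * pi * \<i> * (\<xi> $ i) * g \<xi>)"
    "has_weak_pderiv i f D"
    using weak_derivative_exists[OF assms] by blast
  from D(3) have w: "has_weak_pderiv i f (weak_pderiv i f)"
    unfolding weak_pderiv_def by (rule someI[of "has_weak_pderiv i f"])
  then have wm: "weak_pderiv i f \<in> borel_measurable borel"
    by (intro locally_integrable_measurable) (simp add: has_weak_pderiv_def)
  have eq: "AE x in lborel. D x = weak_pderiv i f x"
    by (rule weak_pderiv_unique[OF D(3) w])
  show "is_L2 (weak_pderiv i f)"
    using D(1) wm L2sq_cong_AE[OF eq] by (simp add: is_L2_def)
  show "has_L2_ft (\<lambda>x. complex_of_real (weak_pderiv i f x)) (\<lambda>\<xi>. 2 * pi * \<i> * (\<xi> $ i) * g \<xi>)"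
  proof (rule has_L2_ft_cong_AE_left[OF D(2)])
    show "AE x in lborel. complex_of_real (D x) = complex_of_real (weak_pderiv i f x)"
      using eq by eventually_elim simp
  qed (use D(1) wm in \<open>auto simp: is_L2_def\<close>)
qed

section \<open>Fourier transform of a vector field and of its vorticity\<close>

lemma norm_sq_vec: "(norm v)\<^sup>2 = (\<Sum>i\<in>UNIV. (norm (v $ i))\<^sup>2)"
  by (simp add: norm_vec_def L2_set_def real_sqrt_pow2 sum_nonneg)

lemma borel_measurable_vec_nth:
  fixes f :: "'a \<Rightarrow> ('b::euclidean_space)^'n"
  assumes "f \<in> borel_measurable M"
  shows "(\<lambda>x. f x $ i) \<in> borel_measurable M"
  by (rule measurable_compose[OF assms])
    (auto intro!: borel_measurable_continuous_onI continuous_intros)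

lemma borel_measurable_vec:
  fixes f :: "'a \<Rightarrow> ('b::euclidean_space)^'n"
  assumes "\<And>i. (\<lambda>x. f x $ i) \<in> borel_measurable M"
  shows "f \<in> borel_measurable M"
proof (subst borel_measurable_euclidean_space, intro ballI)
  fix b :: "'b^'n" assume "b \<in> Basis"
  then obtain i u where b: "b = axis i u" "u \<in> Basis"
    by (auto simp: Basis_vec_def)
  show "(\<lambda>x. f x \<bullet> b) \<in> borel_measurable M"
    unfolding b(1) inner_axis using assms[of i] by (intro borel_measurable_inner) auto
qed

lemma L2sq_vec:
  fixes v :: "'a::euclidean_space \<Rightarrow> ('b::euclidean_space)^'n"
  assumes "v \<in> borel_measurable borel"
  shows "L2sq v = (\<Sum>i\<in>UNIV. L2sq (\<lambda>x. v x $ i))"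
proof -
  have [measurable]: "(\<lambda>x. v x $ i) \<in> borel_measurable borel" for i
    by (rule borel_measurable_vec_nth[OF assms])
  show ?thesis
    unfolding L2sq_def norm_sq_vec
    by (simp add: nn_integral_sum flip: sum_ennreal)
qed

lemma enn_powr_half_sq: "(enn_powr x (1/2))\<^sup>2 = x"
proof (cases x)
  case (real r)
  then have "(r powr (1/2))\<^sup>2 = r"
    by (simp add: powr_half_sqrt)
  with real show ?thesis
    by (simp add: enn_powr_def ennreal_power)
qed (simp add: enn_powr_def power2_eq_square ennreal_top_mult)

lemma enn_powr_half_less_top_iff: "enn_powr x (1/2) < \<infinity> \<longleftrightarrow> x < \<infinity>"
  by (cases x) (auto simp: enn_powr_def)

lemma enn_powr_half_tendsto_0_iff:
  "((\<lambda>n. enn_powr (a n) (1/2)) \<longlongrightarrow> 0) F \<longleftrightarrow> (a \<longlongrightarrow> 0) F"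
proof
  assume l: "((\<lambda>n. enn_powr (a n) (1/2)) \<longlongrightarrow> 0) F"
  have "((\<lambda>n. enn_powr (a n) (1/2) * enn_powr (a n) (1/2)) \<longlongrightarrow> 0 * 0) F"
    by (intro tendsto_mult_ennreal l) auto
  then show "(a \<longlongrightarrow> 0) F"
    by (simp add: power2_eq_square[symmetric] enn_powr_half_sq)
next
  assume l: "(a \<longlongrightarrow> 0) F"
  show "((\<lambda>n. enn_powr (a n) (1/2)) \<longlongrightarrow> 0) F"
  proof (rule order_tendstoI)
    fix e :: ennreal assume e: "0 < e"
    then have "0 < e\<^sup>2"
      by (simp add: power2_eq_square ennreal_zero_less_mult_iff)
    from order_tendstoD(2)[OF l this] show "\<forall>\<^sub>F n in F. enn_powr (a n) (1/2) < e"
    proof eventually_elim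
      case (elim n)
      show ?case
      proof (rule ccontr)
        assume "\<not> enn_powr (a n) (1/2) < e"
        then have "e\<^sup>2 \<le> (enn_powr (a n) (1/2))\<^sup>2"
          by (intro power_mono_ennreal) auto
        with elim show False
          by (simp add: enn_powr_half_sq)
      qed
    qed
  qed auto
qed

lemma Lp_norm_2: "Lp_norm 2 f = enn_powr (L2sq f) (1/2)"
  by (simp add: Lp_norm_def L2sq_def)

lemma in_L2_iff: "in_L2 f \<longleftrightarrow> is_L2 f"
  by (simp add: in_L2_def is_L2_def Lp_norm_2 enn_powr_half_less_top_iff del: infinity_ennreal_def)

lemma is_L2_component:
  fixes u :: "real^3 \<Rightarrow> real^3"
  assumes u: "is_L2 u"
  shows "is_L2 (\<lambda>x. u x $ i)" "is_L2 (\<lambda>x. complex_of_real (u x $ i))"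
proof -
  have m[measurable]: "(\<lambda>x. u x $ i) \<in> borel_measurable borel" for i
    using u by (intro borel_measurable_vec_nth) (simp add: is_L2_def)
  have "L2sq (\<lambda>x. u x $ i) \<le> L2sq u"
    unfolding L2sq_def
    by (intro nn_integral_mono ennreal_leI power_mono component_le_norm_cart[unfolded real_norm_def[symmetric]]) auto
  also have "\<dots> < \<infinity>" using u by (simp add: is_L2_def)
  finally show "is_L2 (\<lambda>x. u x $ i)"
    using m by (simp add: is_L2_def)
  then show "is_L2 (\<lambda>x. complex_of_real (u x $ i))"
    by (simp add: is_L2_def L2sq_def)
qed

lemma fourier_integral_component:
  "fourier_integral f \<xi> $ i = ft (\<lambda>x. complex_of_real (f x $ i)) \<xi>"
  by (simp add: fourier_integral_def ft_def)

lemma ennreal_sum_tendsto_0_iff: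
  fixes a :: "'j \<Rightarrow> 'i \<Rightarrow> ennreal"
  assumes "finite J"
  shows "((\<lambda>n. \<Sum>j\<in>J. a j n) \<longlongrightarrow> 0) F \<longleftrightarrow> (\<forall>j\<in>J. (a j \<longlongrightarrow> 0) F)"
proof (intro iffI ballI)
  fix j assume l: "((\<lambda>n. \<Sum>j\<in>J. a j n) \<longlongrightarrow> 0) F" and j: "j \<in> J"
  show "(a j \<longlongrightarrow> 0) F"
    by (rule tendsto_sandwich[OF _ _ tendsto_const l])
      (auto intro!: always_eventually member_le_sum j assms)
next
  assume "\<forall>j\<in>J. (a j \<longlongrightarrow> 0) F"
  then have "((\<lambda>n. \<Sum>j\<in>J. a j n) \<longlongrightarrow> (\<Sum>j\<in>J. 0)) F"
    by (intro tendsto_sum) auto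
  then show "((\<lambda>n. \<Sum>j\<in>J. a j n) \<longlongrightarrow> 0) F" by simp
qed

text \<open>Convergence in \<open>L\<^sup>2\<close> of vector fields is convergence of each
  component, so everything about \<open>fourier\<close> reduces to the scalar transform.\<close>

lemma has_fourier_iff:
  assumes u: "is_L2 u"
  shows "has_fourier u g \<longleftrightarrow> (\<forall>i. has_L2_ft (\<lambda>x. complex_of_real (u x $ i)) (\<lambda>\<xi>. g \<xi> $ i))"
proof -
  let ?F = "\<lambda>R. fourier_integral (\<lambda>x. indicator (cball 0 R) x *\<^sub>R u x)"
  have comp: "?F R \<xi> $ i = ft (truncate R (\<lambda>x. complex_of_real (u x $ i))) \<xi>" for R \<xi> i
  proof -
    have "(\<lambda>x. complex_of_real ((indicator (cball 0 R) x *\<^sub>R u x) $ i)) = truncate R (\<lambda>x. complex_of_real (u x $ i))"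
      by (auto simp: truncate_def fun_eq_iff indicator_def)
    then show ?thesis
      unfolding fourier_integral_component by simp
  qed
  have um: "(\<lambda>x. complex_of_real (u x $ i)) \<in> borel_measurable borel" for i
    using is_L2_component(2)[OF u] by (simp add: is_L2_def)
  have Fm: "(\<lambda>\<xi>. ?F R \<xi> $ i) \<in> borel_measurable borel" for R i
    unfolding comp by (intro ft_measurable truncate_measurable um)
  have gm: "g \<in> borel_measurable borel \<longleftrightarrow> (\<forall>i. (\<lambda>\<xi>. g \<xi> $ i) \<in> borel_measurable borel)"
    using borel_measurable_vec_nth[of g borel] borel_measurable_vec[of g borel] by blast
  have "((\<lambda>R. Lp_norm 2 (\<lambda>\<xi>. ?F R \<xi> - g \<xi>)) \<longlongrightarrow> 0) at_top \<longleftrightarrow>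
      (\<forall>i. ((\<lambda>R. L2sq (\<lambda>\<xi>. ft (truncate R (\<lambda>x. complex_of_real (u x $ i))) \<xi> - g \<xi> $ i)) \<longlongrightarrow> 0) at_top)"
    if g: "g \<in> borel_measurable borel"
  proof -
    have "L2sq (\<lambda>\<xi>. ?F R \<xi> - g \<xi>) = (\<Sum>i\<in>UNIV. L2sq (\<lambda>\<xi>. ft (truncate R (\<lambda>x. complex_of_real (u x $ i))) \<xi> - g \<xi> $ i))" for R
    proof (subst L2sq_vec)
      show "(\<lambda>\<xi>. ?F R \<xi> - g \<xi>) \<in> borel_measurable borel"
        by (intro borel_measurable_diff borel_measurable_vec[OF Fm] g)
    qed (simp add: comp)
    then show ?thesis
      unfolding Lp_norm_2 enn_powr_half_tendsto_0_iff by (simp add: ennreal_sum_tendsto_0_iff)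
  qed
  then show ?thesis
    unfolding has_fourier_def has_L2_ft_def using gm by auto
qed

lemma has_fourier_fourier:
  assumes u: "is_L2 u"
  shows "has_fourier u (fourier u)"
proof -
  have "\<forall>i. \<exists>h. has_L2_ft (\<lambda>x. complex_of_real (u x $ i)) h"
    by (intro allI has_L2_ft_exists is_L2_component u)
  then obtain h where h: "\<And>i. has_L2_ft (\<lambda>x. complex_of_real (u x $ i)) (h i)"
    by metis
  have "has_fourier u (\<lambda>\<xi>. \<chi> i. h i \<xi>)"
    unfolding has_fourier_iff[OF u] using h by simp
  then show ?thesis
    unfolding fourier_def by (rule someI[of "has_fourier u"])
qed

lemma fourier_component:
  assumes u: "is_L2 u"
  shows "has_L2_ft (\<lambda>x. complex_of_real (u x $ i)) (\<lambda>\<xi>. fourier u \<xi> $ i)"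
  using has_fourier_fourier[OF u] unfolding has_fourier_iff[OF u] by blast

lemma fourier_measurable: "is_L2 u \<Longrightarrow> fourier u \<in> borel_measurable borel"
  using has_fourier_fourier[of u] by (simp add: has_fourier_def)

text \<open>Identifies the arbitrary representative \<open>fourier u\<close> with any transform
  computed by other means.\<close>

lemma fourier_AE_eq:
  assumes u: "is_L2 u" and g: "\<And>i. has_L2_ft (\<lambda>x. complex_of_real (u x $ i)) (g i)"
  shows "AE \<xi> in lborel. \<forall>i. fourier u \<xi> $ i = g i \<xi>"
proof -
  have "AE \<xi> in lborel. fourier u \<xi> $ i = g i \<xi>" for i
    by (rule has_L2_ft_unique[OF is_L2_component(2)[OF u] fourier_component[OF u] g])
  then show ?thesis
    by (rule eventually_all_finite)
qed

theorem fourier_plancherel: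
  assumes u: "is_L2 u"
  shows "L2sq (fourier u) = L2sq u"
proof -
  have um: "u \<in> borel_measurable borel" using u by (simp add: is_L2_def)
  have "L2sq (\<lambda>\<xi>. fourier u \<xi> $ i) = L2sq (\<lambda>x. u x $ i)" for i
    using has_L2_ft_plancherel[OF is_L2_component(2)[OF u] fourier_component[OF u]] by (simp add: L2sq_def)
  then show ?thesis
    by (simp add: L2sq_vec[OF um] L2sq_vec[OF fourier_measurable[OF u]])
qed

text \<open>The form in which the regularity of \<open>u\<close> is used: all products
  \<open>\<xi>\<^sub>i * fourier u \<xi>\<close> are square integrable.\<close>

lemma H_norm_1_finite:
  assumes u: "is_L2 u" and H: "H_norm 1 u < \<infinity>"
  shows "(\<integral>\<^sup>+\<xi>. ennreal ((norm \<xi>)\<^sup>2 * (norm (fourier u \<xi>))\<^sup>2) \<partial>lborel) < \<infinity>"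
proof -
  have [measurable]: "fourier u \<in> borel_measurable borel" by (rule fourier_measurable[OF u])
  have "(\<integral>\<^sup>+\<xi>. ennreal ((norm \<xi>)\<^sup>2 * (norm (fourier u \<xi>))\<^sup>2) \<partial>lborel)
      \<le> (\<integral>\<^sup>+\<xi>. ennreal ((1 + (2 * pi * norm \<xi>) powr (2 * 1)) * (norm (fourier u \<xi>))\<^sup>2) \<partial>lborel)"
  proof (intro nn_integral_mono ennreal_leI mult_right_mono)
    fix \<xi> :: "real^3"
    have "norm \<xi> \<le> 2 * pi * norm \<xi>"
      using pi_gt3 mult_right_mono[of 1 "2 * pi" "norm \<xi>"] by simp
    then have "(norm \<xi>)\<^sup>2 \<le> (2 * pi * norm \<xi>)\<^sup>2"
      by (intro power_mono) auto
    then show "(norm \<xi>)\<^sup>2 \<le> 1 + (2 * pi * norm \<xi>) powr (2 * 1)"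
      by (simp add: add_increasing)
  qed auto
  also have "\<dots> < \<infinity>"
    using H unfolding H_norm_def enn_powr_half_less_top_iff .
  finally show ?thesis .
qed

text \<open>Finite enstrophy makes all components have square integrable weak derivatives, so that
  the curl can be read off on the Fourier side.\<close>

theorem fourier_horizontal_vorticity:
  assumes u: "is_L2 u" and fin: "(\<integral>\<^sup>+\<xi>. ennreal ((norm \<xi>)\<^sup>2 * (norm (fourier u \<xi>))\<^sup>2) \<partial>lborel) < \<infinity>"
  shows "is_L2 (horizontal_vorticity u)"
    and "AE \<xi> in lborel. fourier (horizontal_vorticity u) \<xi> =
     vector [2 * pi * \<i> * (\<xi> $ 2 * fourier u \<xi> $ 3 - \<xi> $ 3 * fourier u \<xi> $ 2),
             2 * pi * \<i> * (\<xi> $ 3 * fourier u \<xi> $ 1 - \<xi> $ 1 * fourier u \<xi> $ 3), 0]"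
proof -
  have [measurable]: "fourier u \<in> borel_measurable borel" by (rule fourier_measurable[OF u])
  have finj: "L2sq (\<lambda>\<xi>. complex_of_real (\<xi> $ j) * fourier u \<xi> $ k) < \<infinity>" for j k
  proof -
    have "L2sq (\<lambda>\<xi>. complex_of_real (\<xi> $ j) * fourier u \<xi> $ k) \<le> (\<integral>\<^sup>+\<xi>. ennreal ((norm \<xi>)\<^sup>2 * (norm (fourier u \<xi>))\<^sup>2) \<partial>lborel)"
      unfolding L2sq_def
    proof (intro nn_integral_mono ennreal_leI)
      fix \<xi> :: "real^3"
      have "norm (complex_of_real (\<xi> $ j) * fourier u \<xi> $ k) \<le> norm \<xi> * norm (fourier u \<xi>)"
        unfolding norm_mult using component_le_norm_cart[of \<xi> j] Finite_Cartesian_Product.norm_nth_le[of "fourier u \<xi>" k]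
        by (intro mult_mono) auto
      then have "(norm (complex_of_real (\<xi> $ j) * fourier u \<xi> $ k))\<^sup>2 \<le> (norm \<xi> * norm (fourier u \<xi>))\<^sup>2"
        by (intro power_mono) auto
      then show "(norm (complex_of_real (\<xi> $ j) * fourier u \<xi> $ k))\<^sup>2 \<le> (norm \<xi>)\<^sup>2 * (norm (fourier u \<xi>))\<^sup>2"
        by (simp add: power_mult_distrib)
    qed
    with fin show ?thesis by (rule le_less_trans[rotated])
  qed
  let ?D = "\<lambda>j k. weak_pderiv j (\<lambda>y. u y $ k)"
  note D = weak_pderiv_fourier[OF is_L2_component(1)[OF u] fourier_component[OF u] finj]
  have Dc: "is_L2 (\<lambda>x. complex_of_real (?D j k x))" for j k
    using D(1)[of j k] by (auto simp: is_L2_def L2sq_def)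
  define w where "w = horizontal_vorticity u"
  have w: "w x $ 1 = ?D 2 3 x - ?D 3 2 x" "w x $ 2 = ?D 3 1 x - ?D 1 3 x" "w x $ 3 = 0" for x
    by (simp_all add: w_def horizontal_vorticity_def vorticity_def)
  have wc: "is_L2 (\<lambda>x. w x $ i)" for i
    using exhaust_3[of i] by (auto simp: w intro!: is_L2_diff D(1)) (simp add: is_L2_def L2sq_def)
  have wm: "w \<in> borel_measurable borel"
    using wc by (intro borel_measurable_vec) (simp add: is_L2_def)
  have wL: "is_L2 w"
    using wc by (auto simp: is_L2_def wm L2sq_vec)
  let ?g = "\<lambda>(i::3) \<xi>. if i = 1 then 2 * pi * \<i> * (\<xi> $ 2) * fourier u \<xi> $ 3 - 2 * pi * \<i> * (\<xi> $ 3) * fourier u \<xi> $ 2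
      else if i = 2 then 2 * pi * \<i> * (\<xi> $ 3) * fourier u \<xi> $ 1 - 2 * pi * \<i> * (\<xi> $ 1) * fourier u \<xi> $ 3 else 0"
  have "has_L2_ft (\<lambda>x. complex_of_real (w x $ i)) (?g i)" for i
  proof -
    have z: "has_L2_ft (\<lambda>x::real^3. 0) (\<lambda>\<xi>. 0)"
      by (simp add: has_L2_ft_def ft_def truncate_def L2sq_def)
    have 1: "has_L2_ft (\<lambda>x. complex_of_real (?D 2 3 x) - complex_of_real (?D 3 2 x)) (?g 1)"
      using has_L2_ft_diff[OF Dc D(2) Dc D(2), of 2 3 3 2] by simp
    have 2: "has_L2_ft (\<lambda>x. complex_of_real (?D 3 1 x) - complex_of_real (?D 1 3 x)) (?g 2)"
      using has_L2_ft_diff[OF Dc D(2) Dc D(2), of 3 1 1 3] by simp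
    show ?thesis
      using exhaust_3[of i] 1 2 z by (auto simp: w)
  qed
  note AE_eq = fourier_AE_eq[OF wL this]
  show "is_L2 (horizontal_vorticity u)"
    using wL unfolding w_def .
  from AE_eq show "AE \<xi> in lborel. fourier (horizontal_vorticity u) \<xi> =
     vector [2 * pi * \<i> * (\<xi> $ 2 * fourier u \<xi> $ 3 - \<xi> $ 3 * fourier u \<xi> $ 2),
             2 * pi * \<i> * (\<xi> $ 3 * fourier u \<xi> $ 1 - \<xi> $ 1 * fourier u \<xi> $ 3), 0]"
    unfolding w_def[symmetric]
  proof eventually_elim
    case (elim \<xi>)
    then show ?case
      by (simp add: vec_eq_iff forall_3 algebra_simps)
  qed
qed

section \<open>Lebesgue norms from low frequency bounds\<close>

lemma sets_borel_cball [measurable]: "cball (a::'a::euclidean_space) r \<in> sets borel"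
  by (simp add: borel_closed)

lemma nn_integral_powr_from_0:
  assumes a: "- 1 < a" and c: "0 \<le> c"
  shows "(\<integral>\<^sup>+t. ennreal (t powr a * indicator {0..c} t) \<partial>lborel) = ennreal (c powr (a + 1) / (a + 1))"
proof (rule nn_integral_has_integral_lborel)
  have "((\<lambda>x. if x \<in> {0..c} then x powr a else 0) has_integral (c powr (a + 1) / (a + 1))) UNIV"
    unfolding has_integral_restrict_UNIV by (rule has_integral_powr_from_0[OF a c])
  moreover have "(\<lambda>x. if x \<in> {0..c} then x powr a else 0) = (\<lambda>t. t powr a * indicator {0..c} t)"
    by (auto simp: fun_eq_iff)
  ultimately show "((\<lambda>t. t powr a * indicator {0..c} t) has_integral (c powr (a + 1) / (a + 1))) UNIV"
    by simp
qed auto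

lemma nn_integral_lborel_reflect:
  fixes f :: "'a::euclidean_space \<Rightarrow> ennreal"
  assumes [measurable]: "f \<in> borel_measurable borel"
  shows "(\<integral>\<^sup>+x. f (- x) \<partial>lborel) = (\<integral>\<^sup>+x. f x \<partial>lborel)"
  by (subst (2) lborel_affine[of "-1" 0], simp, subst nn_integral_density)
    (auto simp: nn_integral_distr)

lemma L2sq_reflect:
  fixes f :: "'a::euclidean_space \<Rightarrow> 'b::{second_countable_topology, real_normed_vector}"
  assumes [measurable]: "f \<in> borel_measurable borel"
  shows "L2sq (\<lambda>x. f (- x)) = L2sq f"
  unfolding L2sq_def by (rule nn_integral_lborel_reflect) simp

text \<open>The layer-cake formula \<open>c\<^sup>p = (p - 2) c\<^sup>2
  \<integral>\<^sub>0\<^sup>c l\<^sup>p\<^sup>-\<^sup>3 dl\<close>, in which \<open>c\<close> is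
  bounded by \<open>2 H l\<close>. In the application \<open>H l\<close> is the part of a function
  above a cut-off frequency depending on the level \<open>l\<close>.\<close>

lemma powr_le_integral_high_part:
  fixes p c :: real
  assumes p: "2 < p" and c: "0 \<le> c" and H: "\<And>l. 0 \<le> l \<Longrightarrow> l \<le> c \<Longrightarrow> c / 2 \<le> H l"
    and [measurable]: "H \<in> borel_measurable borel"
  shows "ennreal (c powr p) \<le> (\<integral>\<^sup>+l. ennreal (4 * (p - 2) * (l powr (p - 3) * (H l)\<^sup>2 * indicator {0..} l)) \<partial>lborel)"
proof (cases "c = 0")
  case False
  with c have c: "0 < c" by simp
  have "ennreal (c powr p) = ennreal ((p - 2) * c\<^sup>2) * ennreal (c powr (p - 3 + 1) / (p - 3 + 1))"
  proof -
    have "c powr p = c\<^sup>2 * c powr (p - 2)"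
      using c by (simp add: powr_add[symmetric] flip: powr_numeral)
    then have "c powr p = (p - 2) * c\<^sup>2 * (c powr (p - 3 + 1) / (p - 3 + 1))"
      using p by simp
    then show ?thesis
      using p by (subst ennreal_mult[symmetric]) auto
  qed
  also have "\<dots> = ennreal ((p - 2) * c\<^sup>2) * (\<integral>\<^sup>+l. ennreal (l powr (p - 3) * indicator {0..c} l) \<partial>lborel)"
    using p c by (subst nn_integral_powr_from_0) auto
  also have "\<dots> = (\<integral>\<^sup>+l. ennreal ((p - 2) * c\<^sup>2) * ennreal (l powr (p - 3) * indicator {0..c} l) \<partial>lborel)"
    by (rule nn_integral_cmult[symmetric]) auto
  also have "\<dots> \<le> (\<integral>\<^sup>+l. ennreal (4 * (p - 2) * (l powr (p - 3) * (H l)\<^sup>2 * indicator {0..} l)) \<partial>lborel)"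
  proof (rule nn_integral_mono)
    fix l
    show "ennreal ((p - 2) * c\<^sup>2) * ennreal (l powr (p - 3) * indicator {0..c} l) \<le> ennreal (4 * (p - 2) * (l powr (p - 3) * (H l)\<^sup>2 * indicator {0..} l))"
    proof (cases "0 \<le> l \<and> l \<le> c")
      case True
      then have "(c / 2)\<^sup>2 \<le> (H l)\<^sup>2"
        using c by (intro power_mono H) auto
      then have "(p - 2) * l powr (p - 3) * c\<^sup>2 \<le> (p - 2) * l powr (p - 3) * (4 * (H l)\<^sup>2)"
        using p by (intro mult_left_mono) (auto simp: power_divide)
      then have "(p - 2) * c\<^sup>2 * (l powr (p - 3)) \<le> 4 * (p - 2) * (l powr (p - 3) * (H l)\<^sup>2)"
        by (simp only: mult_ac)
      then have "ennreal ((p - 2) * c\<^sup>2 * (l powr (p - 3))) \<le> ennreal (4 * (p - 2) * (l powr (p - 3) * (H l)\<^sup>2))"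
        by (rule ennreal_leI)
      moreover have "ennreal ((p - 2) * c\<^sup>2) * ennreal (l powr (p - 3)) = ennreal ((p - 2) * c\<^sup>2 * (l powr (p - 3)))"
        using p by (intro ennreal_mult[symmetric]) auto
      moreover have "indicator {0..c} l = (1::real)" "indicator {0..} l = (1::real)"
        using True by auto
      ultimately show ?thesis
        by (simp only: mult_1_right)
    next
      case False
      then show ?thesis by (auto simp: indicator_def)
    qed
  qed
  finally show ?thesis .
qed auto

text \<open>At level \<open>l\<close> the spectrum is cut at radius \<open>l / (2 B)\<close>. The
  low part contributes at most \<open>l / 2\<close>, so where the function exceeds
  \<open>l\<close> its high part \<open>H l\<close> is at least half of it. Plancherel's theorem
  turns the \<open>L\<^sup>2\<close> norm of the high part into an integral over \<open>l < 2 B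
  \<bar>\<xi>\<bar>\<close>, and integrating in \<open>l\<close> first produces the weight
  \<open>(2 B \<bar>\<xi>\<bar>)\<^sup>p\<^sup>-\<^sup>2\<close>. This converges because \<open>p
  > 2\<close>.\<close>

theorem Lp_bound_of_low_frequency_bound:
  fixes g :: "'a::euclidean_space \<Rightarrow> complex"
  assumes p: "2 < p" and B: "0 < B"
    and g: "integrable lborel g" "is_L2 g"
    and low: "\<And>N. 0 < N \<Longrightarrow> (\<integral>\<^sup>+\<xi>. ennreal (indicator (cball 0 N) \<xi> * norm (g \<xi>)) \<partial>lborel) \<le> ennreal (B * N)"
  shows "(\<integral>\<^sup>+x. ennreal (norm (ft g (- x)) powr p) \<partial>lborel)
    \<le> ennreal (2 powr p * B powr (p - 2)) * (\<integral>\<^sup>+\<xi>. ennreal (norm \<xi> powr (p - 2) * (norm (g \<xi>))\<^sup>2) \<partial>lborel)"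
proof -
  have [measurable]: "g \<in> borel_measurable borel" using g by auto
  define G where "G l \<xi> = (if l / (2 * B) < norm \<xi> then g \<xi> else 0)" for l and \<xi> :: 'a
  have G_meas[measurable]: "G l \<in> borel_measurable borel" for l
    unfolding G_def by measurable
  have G_int: "integrable lborel (G l)" for l
    by (rule Bochner_Integration.integrable_bound[OF g(1)]) (auto simp: G_def)
  have "L2sq (G l) \<le> L2sq g" for l
    unfolding L2sq_def G_def by (intro nn_integral_mono) auto
  then have G_L2: "L2sq (G l) < \<infinity>" for l
    using g(2) by (auto simp: is_L2_def intro: le_less_trans)
  define H where "H l x = norm (ft (G l) (- x))" for l x
  have [measurable]: "(\<lambda>(l, x). H l x) \<in> borel_measurable (lborel \<Otimes>\<^sub>M lborel)"
    unfolding H_def ft_def G_def by measurable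
  have [measurable]: "(\<lambda>(x, l). H l x) \<in> borel_measurable (lborel \<Otimes>\<^sub>M lborel)"
    unfolding H_def ft_def G_def by measurable
  have Hm[measurable]: "(\<lambda>l. H l x) \<in> borel_measurable borel" for x
    unfolding H_def ft_def G_def by measurable
  let ?K = "\<lambda>l. 4 * (p - 2) * l powr (p - 3) * indicator {0..} l"
  have K0: "0 \<le> ?K l" for l using p by simp
  have ptw: "norm (ft g (- x)) / 2 \<le> H l x" if l: "0 \<le> l" "l \<le> norm (ft g (- x))" for x l
  \<comment> \<open>at level \<open>0\<close> nothing is cut off but the origin, which is a null
      set\<close>
  proof (cases "l = 0")
    case True
    have "ft (G l) (- x) = ft g (- x)"
    proof -
      have "AE \<xi> in lborel. (\<xi>::'a) \<noteq> 0"
        by (rule AE_lborel_singleton)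
      then have "AE \<xi> in lborel. G l \<xi> * cis (- 2 * pi * (\<xi> \<bullet> - x)) = g \<xi> * cis (- 2 * pi * (\<xi> \<bullet> - x))"
        by eventually_elim (use True B in \<open>auto simp: G_def\<close>)
      then show ?thesis
        unfolding ft_def by (intro integral_cong_AE) auto
    qed
    then show ?thesis by (simp add: H_def)
  next
    case False
    with l have l0: "0 < l" by simp
    have "norm (ft (\<lambda>\<xi>. g \<xi> - G l \<xi>) (- x)) \<le> (LINT \<xi>|lborel. norm (g \<xi> - G l \<xi>))"
      using g G_int by (intro norm_ft_le) auto
    moreover have "ennreal (LINT \<xi>|lborel. norm (g \<xi> - G l \<xi>)) \<le> ennreal (l / 2)"
    proof -
      have "ennreal (LINT \<xi>|lborel. norm (g \<xi> - G l \<xi>)) = (\<integral>\<^sup>+\<xi>. ennreal (norm (g \<xi> - G l \<xi>)) \<partial>lborel)"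
        using g G_int[of l] by (intro nn_integral_eq_integral[symmetric]) auto
      also have "\<dots> = (\<integral>\<^sup>+\<xi>. ennreal (indicator (cball 0 (l / (2 * B))) \<xi> * norm (g \<xi>)) \<partial>lborel)"
        by (intro nn_integral_cong) (auto simp: G_def indicator_def)
      also have "\<dots> \<le> ennreal (B * (l / (2 * B)))"
        using l0 B by (intro low) auto
      also have "B * (l / (2 * B)) = l / 2"
        using B by simp
      finally show ?thesis .
    qed
    ultimately have "norm (ft (\<lambda>\<xi>. g \<xi> - G l \<xi>) (- x)) \<le> l / 2"
      using l0 by (simp add: ennreal_le_iff)
    then have "norm (ft g (- x) - ft (G l) (- x)) \<le> l / 2"
      using ft_diff[OF g(1) G_int[of l], of "- x"] by simp
    moreover have "norm (ft g (- x)) \<le> norm (ft g (- x) - ft (G l) (- x)) + norm (ft (G l) (- x))"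
      by (metis diff_add_cancel norm_triangle_ineq)
    ultimately show ?thesis
      using l unfolding H_def by linarith
  qed
  have "(\<integral>\<^sup>+x. ennreal (norm (ft g (- x)) powr p) \<partial>lborel)
      \<le> (\<integral>\<^sup>+x. (\<integral>\<^sup>+l. ennreal (?K l) * ennreal ((H l x)\<^sup>2) \<partial>lborel) \<partial>lborel)"
  proof (rule nn_integral_mono)
    fix x
    have "ennreal (norm (ft g (- x)) powr p) \<le> (\<integral>\<^sup>+l. ennreal (4 * (p - 2) * (l powr (p - 3) * (H l x)\<^sup>2 * indicator {0..} l)) \<partial>lborel)"
      by (rule powr_le_integral_high_part[OF p _ ptw]) auto
    also have "\<dots> = (\<integral>\<^sup>+l. ennreal (?K l) * ennreal ((H l x)\<^sup>2) \<partial>lborel)"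
      using K0 by (intro nn_integral_cong) (simp add: mult_ac flip: ennreal_mult)
    finally show "ennreal (norm (ft g (- x)) powr p) \<le> (\<integral>\<^sup>+l. ennreal (?K l) * ennreal ((H l x)\<^sup>2) \<partial>lborel)" .
  qed
  also have "\<dots> = (\<integral>\<^sup>+l. (\<integral>\<^sup>+x. ennreal (?K l) * ennreal ((H l x)\<^sup>2) \<partial>lborel) \<partial>lborel)"
    by (rule lborel_pair.Fubini') measurable
  also have "\<dots> = (\<integral>\<^sup>+l. (\<integral>\<^sup>+\<xi>. ennreal (?K l) * ennreal ((norm (G l \<xi>))\<^sup>2) \<partial>lborel) \<partial>lborel)"
  proof (rule nn_integral_cong)
    fix l
    have "L2sq (\<lambda>x. ft (G l) (- x)) = L2sq (G l)"
      by (simp add: L2sq_reflect plancherel_L1_L2[OF G_int G_L2])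
    then have "(\<integral>\<^sup>+x. ennreal ((H l x)\<^sup>2) \<partial>lborel) = (\<integral>\<^sup>+\<xi>. ennreal ((norm (G l \<xi>))\<^sup>2) \<partial>lborel)"
      by (simp add: L2sq_def H_def)
    then show "(\<integral>\<^sup>+x. ennreal (?K l) * ennreal ((H l x)\<^sup>2) \<partial>lborel) = (\<integral>\<^sup>+\<xi>. ennreal (?K l) * ennreal ((norm (G l \<xi>))\<^sup>2) \<partial>lborel)"
      by (subst (1 2) nn_integral_cmult) (auto simp: H_def)
  qed
  also have "\<dots> = (\<integral>\<^sup>+\<xi>. (\<integral>\<^sup>+l. ennreal (?K l) * ennreal ((norm (G l \<xi>))\<^sup>2) \<partial>lborel) \<partial>lborel)"
    by (rule lborel_pair.Fubini') (unfold G_def, measurable)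
  also have "\<dots> \<le> (\<integral>\<^sup>+\<xi>. ennreal (2 powr p * B powr (p - 2)) * ennreal (norm \<xi> powr (p - 2) * (norm (g \<xi>))\<^sup>2) \<partial>lborel)"
  proof (rule nn_integral_mono)
    fix \<xi> :: 'a
    have "(\<integral>\<^sup>+l. ennreal (?K l) * ennreal ((norm (G l \<xi>))\<^sup>2) \<partial>lborel)
        \<le> (\<integral>\<^sup>+l. ennreal (4 * (p - 2) * (norm (g \<xi>))\<^sup>2) * ennreal (l powr (p - 3) * indicator {0..2 * B * norm \<xi>} l) \<partial>lborel)"
    proof (rule nn_integral_mono)
      fix l
      show "ennreal (?K l) * ennreal ((norm (G l \<xi>))\<^sup>2) \<le> ennreal (4 * (p - 2) * (norm (g \<xi>))\<^sup>2) * ennreal (l powr (p - 3) * indicator {0..2 * B * norm \<xi>} l)"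
      proof (cases "0 \<le> l \<and> l / (2 * B) < norm \<xi>")
        case True
        then have "l \<le> 2 * B * norm \<xi>"
          using B by (simp add: field_simps)
        with True show ?thesis
          using p by (simp add: G_def mult_ac flip: ennreal_mult)
      next
        case False
        then show ?thesis by (auto simp: G_def indicator_def)
      qed
    qed
    also have "\<dots> = ennreal (4 * (p - 2) * (norm (g \<xi>))\<^sup>2) * ennreal ((2 * B * norm \<xi>) powr (p - 3 + 1) / (p - 3 + 1))"
      using p B by (subst nn_integral_cmult) (auto simp: nn_integral_powr_from_0)
    also have "\<dots> = ennreal (2 powr p * B powr (p - 2)) * ennreal (norm \<xi> powr (p - 2) * (norm (g \<xi>))\<^sup>2)"
    proof -
      have two: "2 powr p = 4 * 2 powr (p - 2)"
        using powr_add[of 2 2 "p - 2"] by simp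
      have cancel: "4 * q * X * (Y / q) = 4 * X * Y" if "q \<noteq> 0" for q X Y :: real
        using that by simp
      have "4 * (p - 2) * (norm (g \<xi>))\<^sup>2 * ((2 * B * norm \<xi>) powr (p - 2) / (p - 2))
          = 4 * (norm (g \<xi>))\<^sup>2 * (2 * B * norm \<xi>) powr (p - 2)"
        using p by (intro cancel) simp
      also have "\<dots> = 2 powr p * B powr (p - 2) * (norm \<xi> powr (p - 2) * (norm (g \<xi>))\<^sup>2)"
        using B by (simp add: two powr_mult)
      finally have "4 * (p - 2) * (norm (g \<xi>))\<^sup>2 * ((2 * B * norm \<xi>) powr (p - 3 + 1) / (p - 3 + 1))
          = 2 powr p * B powr (p - 2) * (norm \<xi> powr (p - 2) * (norm (g \<xi>))\<^sup>2)"
        by simp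
      then show ?thesis
        using p by (simp flip: ennreal_mult)
    qed
    finally show "(\<integral>\<^sup>+l. ennreal (?K l) * ennreal ((norm (G l \<xi>))\<^sup>2) \<partial>lborel)
        \<le> ennreal (2 powr p * B powr (p - 2)) * ennreal (norm \<xi> powr (p - 2) * (norm (g \<xi>))\<^sup>2)" .
  qed
  also have "\<dots> = ennreal (2 powr p * B powr (p - 2)) * (\<integral>\<^sup>+\<xi>. ennreal (norm \<xi> powr (p - 2) * (norm (g \<xi>))\<^sup>2) \<partial>lborel)"
    by (rule nn_integral_cmult) simp
  finally show ?thesis .
qed

lemma exp_gaussian_le_sum_indicators:
  fixes s :: real
  assumes s: "0 < s" and r: "0 \<le> r"
  shows "ennreal (exp (- (s\<^sup>2 * r\<^sup>2))) \<le> (\<Sum>k. ennreal (exp (- real k) * indicator {..(real k + 1) / s} r))"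
proof -
  define f where "f k = ennreal (exp (- real k) * indicator {..(real k + 1) / s} r)" for k
  \<comment> \<open>one summand is enough: the index of the shell containing \<open>r\<close>\<close>
  define k where "k = nat \<lfloor>s * r\<rfloor>"
  have k: "real k \<le> s * r" "s * r \<le> real k + 1"
    using s r by (auto simp: k_def)
  have "real k \<le> (real k)\<^sup>2"
    by (cases k) (auto simp: power2_eq_square)
  also have "\<dots> \<le> (s * r)\<^sup>2"
    using k by (intro power_mono) auto
  finally have "exp (- (s\<^sup>2 * r\<^sup>2)) \<le> exp (- real k) * indicator {..(real k + 1) / s} r"
    using k s by (simp add: power_mult_distrib field_simps)
  then have "ennreal (exp (- (s\<^sup>2 * r\<^sup>2))) \<le> f k"
    unfolding f_def by (rule ennreal_leI)
  also have "f k \<le> (\<Sum>k. f k)"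
    using sum_le_suminf[of f "{k}"] by simp
  finally show ?thesis
    unfolding f_def .
qed

lemma summable_Suc_exp_minus: "summable (\<lambda>k. (real k + 1) * exp (- real k))"
proof (rule summable_ratio_test[where c="3/4" and N=1])
  fix n :: nat assume n: "1 \<le> n"
  have "exp (- 1) \<le> (1/2::real)"
    using exp_ge_add_one_self[of "1::real"] by (simp add: exp_minus field_simps)
  then have "(real (Suc n) + 1) * exp (- 1) \<le> (3/2 * (real n + 1)) * (1/2)"
    using n by (intro mult_mono) auto
  then have "(real (Suc n) + 1) * exp (- 1) * exp (- real n) \<le> 3/4 * (real n + 1) * exp (- real n)"
    by (intro mult_right_mono) auto
  moreover have "exp (- real (Suc n)) = exp (- 1) * exp (- real n)"
    by (simp flip: exp_add)
  ultimately show "norm ((real (Suc n) + 1) * exp (- real (Suc n))) \<le> 3/4 * norm ((real n + 1) * exp (- real n))"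
    by (simp add: abs_mult mult_ac)
qed simp

text \<open>The Gaussian is dominated by a sum of indicators of balls with radii \<open>(k + 1) /
  s\<close> and exponentially decaying coefficients, and each ball is covered by the hypothesis.\<close>

lemma gaussian_weight_bound_of_low_frequency_bound:
  fixes F :: "'a::euclidean_space \<Rightarrow> real"
  assumes F[measurable]: "F \<in> borel_measurable borel" and F0: "\<And>\<xi>. 0 \<le> F \<xi>" and s: "0 < s" and B: "0 \<le> B"
    and low: "\<And>N. 0 < N \<Longrightarrow> (\<integral>\<^sup>+\<xi>. ennreal (indicator (cball 0 N) \<xi> * F \<xi>) \<partial>lborel) \<le> ennreal (B * N)"
  shows "(\<integral>\<^sup>+\<xi>. ennreal (exp (- (s\<^sup>2 * (norm \<xi>)\<^sup>2)) * F \<xi>) \<partial>lborel)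
     \<le> ennreal (B / s * (\<Sum>k. (real k + 1) * exp (- real k)))"
proof -
  have "(\<integral>\<^sup>+\<xi>. ennreal (exp (- (s\<^sup>2 * (norm \<xi>)\<^sup>2)) * F \<xi>) \<partial>lborel)
      \<le> (\<integral>\<^sup>+\<xi>. (\<Sum>k. ennreal (exp (- real k)) * ennreal (indicator (cball 0 ((real k + 1) / s)) \<xi> * F \<xi>)) \<partial>lborel)"
  proof (rule nn_integral_mono)
    fix \<xi> :: 'a
    have "ennreal (exp (- (s\<^sup>2 * (norm \<xi>)\<^sup>2)) * F \<xi>) = ennreal (exp (- (s\<^sup>2 * (norm \<xi>)\<^sup>2))) * ennreal (F \<xi>)"
      using F0 by (simp add: ennreal_mult)
    also have "\<dots> \<le> (\<Sum>k. ennreal (exp (- real k) * indicator {..(real k + 1) / s} (norm \<xi>))) * ennreal (F \<xi>)"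
      by (intro mult_right_mono exp_gaussian_le_sum_indicators s) auto
    also have "\<dots> = (\<Sum>k. ennreal (exp (- real k) * indicator {..(real k + 1) / s} (norm \<xi>)) * ennreal (F \<xi>))"
      by simp
    also have "\<dots> = (\<Sum>k. ennreal (exp (- real k)) * ennreal (indicator (cball 0 ((real k + 1) / s)) \<xi> * F \<xi>))"
      using F0 by (intro suminf_cong) (auto simp: indicator_def ennreal_mult)
    finally show "ennreal (exp (- (s\<^sup>2 * (norm \<xi>)\<^sup>2)) * F \<xi>)
        \<le> (\<Sum>k. ennreal (exp (- real k)) * ennreal (indicator (cball 0 ((real k + 1) / s)) \<xi> * F \<xi>))" .
  qed
  also have "\<dots> = (\<Sum>k. ennreal (exp (- real k)) * (\<integral>\<^sup>+\<xi>. ennreal (indicator (cball 0 ((real k + 1) / s)) \<xi> * F \<xi>) \<partial>lborel))"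
    by (subst nn_integral_suminf) (auto intro!: suminf_cong nn_integral_cmult)
  also have "\<dots> \<le> (\<Sum>k. ennreal (B / s * ((real k + 1) * exp (- real k))))"
  proof (rule suminf_le)
    fix k
    have "ennreal (exp (- real k)) * (\<integral>\<^sup>+\<xi>. ennreal (indicator (cball 0 ((real k + 1) / s)) \<xi> * F \<xi>) \<partial>lborel) \<le> ennreal (exp (- real k)) * ennreal (B * ((real k + 1) / s))"
      using s by (intro mult_left_mono low) auto
    also have "\<dots> = ennreal (B / s * ((real k + 1) * exp (- real k)))"
      using B s by (simp add: mult_ac flip: ennreal_mult)
    finally show "ennreal (exp (- real k)) * (\<integral>\<^sup>+\<xi>. ennreal (indicator (cball 0 ((real k + 1) / s)) \<xi> * F \<xi>) \<partial>lborel) \<le> ennreal (B / s * ((real k + 1) * exp (- real k)))" .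
  qed auto
  also have "\<dots> = ennreal (\<Sum>k. B / s * ((real k + 1) * exp (- real k)))"
    using B s by (intro suminf_ennreal2 summable_mult summable_Suc_exp_minus) auto
  also have "(\<Sum>k. B / s * ((real k + 1) * exp (- real k))) = B / s * (\<Sum>k. (real k + 1) * exp (- real k))"
    by (intro suminf_mult summable_Suc_exp_minus)
  finally show ?thesis .
qed

section \<open>An anisotropic low frequency estimate\<close>

lemma AE_component_nonzero: "AE \<xi> in lborel. (\<xi> :: real^'n) $ k \<noteq> 0"
proof -
  have "{\<xi> :: real^'n. \<xi> $ k = 0} \<in> null_sets (completion lborel)"
    using negligible_standard_hyperplane_cart[of k] by (simp add: negligible_iff_null_sets)
  then have "AE \<xi> in completion lborel. (\<xi> :: real^'n) $ k \<noteq> 0"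
    by (rule AE_I') auto
  then show ?thesis
    by (simp add: AE_completion_iff)
qed

lemma nn_integral_lborel_cart_prod:
  fixes f :: "'n::finite \<Rightarrow> real \<Rightarrow> ennreal"
  assumes [measurable]: "\<And>i. f i \<in> borel_measurable borel"
  shows "(\<integral>\<^sup>+x. (\<Prod>i\<in>UNIV. f i (x $ i)) \<partial>(lborel :: (real^'n) measure)) = (\<Prod>i\<in>UNIV. \<integral>\<^sup>+t. f i t \<partial>lborel)"
proof -
  define idx :: "real^'n \<Rightarrow> 'n" where "idx b = (THE i. b = axis i 1)" for b
  have idx: "idx (axis i 1) = i" for i
    unfolding idx_def by (rule the_equality) (auto simp: axis_eq_axis)
  have Basis: "(Basis :: (real^'n) set) = (\<lambda>i. axis i 1) ` UNIV"
    by (auto simp: Basis_vec_def)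
  have inj: "inj_on (\<lambda>i. axis i 1 :: real^'n) UNIV"
    by (auto simp: inj_on_def axis_eq_axis)
  have re: "(\<Prod>b\<in>Basis. F b) = (\<Prod>i\<in>UNIV. F (axis i 1))" for F :: "real^'n \<Rightarrow> ennreal"
    unfolding Basis by (subst prod.reindex[OF inj]) simp
  have "(\<integral>\<^sup>+x. (\<Prod>b\<in>Basis. f (idx b) (x \<bullet> b)) \<partial>(lborel :: (real^'n) measure)) = (\<Prod>b\<in>Basis. \<integral>\<^sup>+t. f (idx b) t \<partial>lborel)"
    by (rule nn_integral_lborel_prod) auto
  then show ?thesis
    unfolding re by (simp add: idx cart_eq_inner_axis)
qed

text \<open>The singularity \<open>\<bar>t\<bar>\<^sup>-\<^sup>1\<^sup>/\<^sup>2\<close> is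
  integrable, and by symmetry its integral is twice that over the positive half.\<close>

lemma nn_integral_abs_inverse_sqrt:
  assumes N: "0 < N"
  shows "(\<integral>\<^sup>+t. ennreal (indicator {-N..N} t * \<bar>t\<bar> powr (-1/2)) \<partial>lborel) \<le> ennreal (4 * N powr (1/2))"
proof -
  let ?h = "\<lambda>t. ennreal (t powr (-1/2) * indicator {0..N} t)"
  have "(\<integral>\<^sup>+t. ennreal (indicator {-N..N} t * \<bar>t\<bar> powr (-1/2)) \<partial>lborel) \<le> (\<integral>\<^sup>+t. ?h t + ?h (- t) \<partial>lborel)"
    by (intro nn_integral_mono) (auto simp: indicator_def)
  also have "\<dots> = (\<integral>\<^sup>+t. ?h t \<partial>lborel) + (\<integral>\<^sup>+t. ?h (- t) \<partial>lborel)"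
    by (rule nn_integral_add) auto
  also have "(\<integral>\<^sup>+t. ?h (- t) \<partial>lborel) = (\<integral>\<^sup>+t. ?h t \<partial>lborel)"
    by (rule nn_integral_lborel_reflect) auto
  also have "(\<integral>\<^sup>+t. ?h t \<partial>lborel) = ennreal (N powr (-1/2 + 1) / (-1/2 + 1))"
    using N by (intro nn_integral_powr_from_0) auto
  also have "\<dots> + \<dots> = ennreal (4 * N powr (1/2))"
    by (simp flip: ennreal_plus)
  finally show ?thesis .
qed

lemma prod_UNIV_3: "prod f (UNIV :: 3 set) = f 1 * f 2 * f 3"
  unfolding UNIV_3 by (simp add: ac_simps)

text \<open>The order \<open>N\<^sup>2\<close> is the one required by scaling. The exponent one
  half keeps the weight integrable both at the origin and across the plane \<open>\<xi>\<^sub>3 =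
  0\<close>.\<close>

lemma anisotropic_weight_integral:
  assumes N: "0 < N"
  shows "(\<integral>\<^sup>+\<xi>. ennreal (indicator (cball 0 N) \<xi> * (norm \<xi> * \<bar>\<xi> $ 3\<bar>) powr (-1/2)) \<partial>(lborel :: (real^3) measure))
     \<le> ennreal (32 * N\<^sup>2)"
proof -
  let ?w = "\<lambda>t. ennreal (indicator {-N..N} t * \<bar>t\<bar> powr (-1/2))"
  \<comment> \<open>bounding \<open>\<bar>\<xi>\<bar>\<close> below by
      \<open>\<bar>\<xi>\<^sub>1\<bar>\<close> and the ball by a cube leaves a product of
      functions of single coordinates\<close>
  define f :: "3 \<Rightarrow> real \<Rightarrow> ennreal" where "f i = (if i = 2 then (\<lambda>t. ennreal (indicator {-N..N} t)) else ?w)" for i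
  have [measurable]: "f i \<in> borel_measurable borel" for i
    unfolding f_def by simp
  have "(\<integral>\<^sup>+\<xi>. ennreal (indicator (cball 0 N) \<xi> * (norm \<xi> * \<bar>\<xi> $ 3\<bar>) powr (-1/2)) \<partial>(lborel :: (real^3) measure))
      \<le> (\<integral>\<^sup>+\<xi>. (\<Prod>i\<in>UNIV. f i (\<xi> $ i)) \<partial>(lborel :: (real^3) measure))"
  proof (rule nn_integral_mono_AE)
    show "AE \<xi> in (lborel :: (real^3) measure). ennreal (indicator (cball 0 N) \<xi> * (norm \<xi> * \<bar>\<xi> $ 3\<bar>) powr (-1/2)) \<le> (\<Prod>i\<in>UNIV. f i (\<xi> $ i))"
      using AE_component_nonzero[of 1]
    proof eventually_elim
      case (elim \<xi>)
      show ?case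
      proof (cases "norm \<xi> \<le> N")
        case True
        have c: "\<xi> $ i \<in> {-N..N}" for i
          using component_le_norm_cart[of \<xi> i] True by auto
        have "norm \<xi> powr (-1/2) \<le> \<bar>\<xi> $ 1\<bar> powr (-1/2)"
          using elim component_le_norm_cart[of \<xi> 1] by (intro powr_mono2') auto
        then have "(norm \<xi> * \<bar>\<xi> $ 3\<bar>) powr (-1/2) \<le> \<bar>\<xi> $ 1\<bar> powr (-1/2) * \<bar>\<xi> $ 3\<bar> powr (-1/2)"
          by (subst powr_mult) (auto intro: mult_right_mono)
        then have "ennreal ((norm \<xi> * \<bar>\<xi> $ 3\<bar>) powr (-1/2)) \<le> ennreal (\<bar>\<xi> $ 1\<bar> powr (-1/2)) * ennreal (\<bar>\<xi> $ 3\<bar> powr (-1/2))"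
          by (subst ennreal_mult[symmetric]) (auto intro: ennreal_leI)
        then show ?thesis
          using True c by (simp add: prod_UNIV_3 f_def)
      qed simp
    qed
  qed
  also have "\<dots> = (\<Prod>i\<in>UNIV. \<integral>\<^sup>+t. f i t \<partial>lborel)"
    by (rule nn_integral_lborel_cart_prod) simp
  also have "\<dots> = (\<integral>\<^sup>+t. ?w t \<partial>lborel) * (\<integral>\<^sup>+t. ennreal (indicator {-N..N} t) \<partial>lborel) * (\<integral>\<^sup>+t. ?w t \<partial>lborel)"
    by (simp add: prod_UNIV_3 f_def)
  also have "(\<integral>\<^sup>+t. ennreal (indicator {-N..N} t) \<partial>lborel) = ennreal (2 * N)"
    using N by (simp add: ennreal_indicator)
  also have "(\<integral>\<^sup>+t. ?w t \<partial>lborel) * ennreal (2 * N) * (\<integral>\<^sup>+t. ?w t \<partial>lborel) \<le> ennreal (4 * N powr (1/2)) * ennreal (2 * N) * ennreal (4 * N powr (1/2))"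
    by (intro mult_mono nn_integral_abs_inverse_sqrt N) auto
  also have "\<dots> = ennreal (32 * N * (N powr (1/2) * N powr (1/2)))"
    using N by (simp add: mult_ac flip: ennreal_mult)
  also have "32 * N * (N powr (1/2) * N powr (1/2)) = 32 * N\<^sup>2"
    using N by (simp add: power2_eq_square flip: powr_add)
  finally show ?thesis .
qed

lemma ennreal_power2_le_imp_le:
  fixes a b :: ennreal
  assumes "a\<^sup>2 \<le> b\<^sup>2"
  shows "a \<le> b"
proof (cases b)
  case b: (real s)
  show ?thesis
  proof (cases a)
    case (real r)
    with b assms show ?thesis
      by (auto simp: ennreal_power intro: power2_le_imp_le ennreal_leI)
  next
    case top
    with b assms show ?thesis
      by (simp add: power2_eq_square ennreal_top_mult top_unique flip: ennreal_mult)
  qed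
qed simp

text \<open>Cauchy-Schwarz with the weight \<open>(\<bar>\<xi>\<bar>
  \<bar>\<xi>\<^sub>3\<bar>)\<^sup>1\<^sup>/\<^sup>2\<close> and its reciprocal.\<close>

lemma low_frequency_bound:
  fixes E :: "real^3 \<Rightarrow> real"
  assumes [measurable]: "E \<in> borel_measurable borel" and E0: "\<And>\<xi>. 0 \<le> E \<xi>"
    and a: "0 \<le> a" "(\<integral>\<^sup>+\<xi>. ennreal ((norm \<xi> * \<bar>\<xi> $ 3\<bar>) powr (1/2) * (E \<xi>)\<^sup>2) \<partial>lborel) \<le> ennreal a"
    and N: "0 < N"
  shows "(\<integral>\<^sup>+\<xi>. ennreal (indicator (cball 0 N) \<xi> * E \<xi>) \<partial>lborel) \<le> ennreal (sqrt (32 * a) * N)"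
proof -
  let ?r = "\<lambda>\<xi>::real^3. norm \<xi> * \<bar>\<xi> $ 3\<bar>"
  let ?f = "\<lambda>\<xi>. ennreal (indicator (cball 0 N) \<xi> * ?r \<xi> powr (-1/4))" and ?g = "\<lambda>\<xi>. ennreal (?r \<xi> powr (1/4) * E \<xi>)"
  have "(\<integral>\<^sup>+\<xi>. ennreal (indicator (cball 0 N) \<xi> * E \<xi>) \<partial>lborel) = (\<integral>\<^sup>+\<xi>. ?f \<xi> * ?g \<xi> \<partial>lborel)"
  proof (rule nn_integral_cong_AE)
    show "AE \<xi> in (lborel :: (real^3) measure). ennreal (indicator (cball 0 N) \<xi> * E \<xi>) = ?f \<xi> * ?g \<xi>"
      using AE_component_nonzero[of 3]
    proof eventually_elim
      case (elim \<xi>)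
      then have "\<xi> \<noteq> 0"
        by auto
      with elim have "0 < ?r \<xi>"
        by simp
      moreover have "r powr (-1/4) * r powr (1/4) = 1" if "0 < r" for r :: real
        using that by (simp flip: powr_add)
      ultimately have "?r \<xi> powr (-1/4) * ?r \<xi> powr (1/4) = 1"
        by blast
      then have "indicator (cball 0 N) \<xi> * E \<xi> = (indicator (cball 0 N) \<xi> * ?r \<xi> powr (-1/4)) * (?r \<xi> powr (1/4) * E \<xi>)"
        by (simp add: indicator_def)
      moreover have "?f \<xi> * ?g \<xi> = ennreal ((indicator (cball 0 N) \<xi> * ?r \<xi> powr (-1/4)) * (?r \<xi> powr (1/4) * E \<xi>))"
        using E0 by (intro ennreal_mult[symmetric]) auto
      ultimately show ?case
        by (simp only:)
    qed
  qed
  then have "(\<integral>\<^sup>+\<xi>. ennreal (indicator (cball 0 N) \<xi> * E \<xi>) \<partial>lborel)\<^sup>2 \<le> (\<integral>\<^sup>+\<xi>. (?f \<xi>)\<^sup>2 \<partial>lborel) * (\<integral>\<^sup>+\<xi>. (?g \<xi>)\<^sup>2 \<partial>lborel)"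
    using Cauchy_Schwarz_nn_integral[of ?f lborel ?g] by simp
  also have "(\<integral>\<^sup>+\<xi>. (?f \<xi>)\<^sup>2 \<partial>lborel) = (\<integral>\<^sup>+\<xi>. ennreal (indicator (cball 0 N) \<xi> * ?r \<xi> powr (-1/2)) \<partial>lborel)"
  proof (intro nn_integral_cong)
    fix \<xi> :: "real^3"
    have "(?r \<xi> powr (-1/4))\<^sup>2 = ?r \<xi> powr (-1/2)"
      by (simp add: power2_eq_square flip: powr_add)
    then show "(?f \<xi>)\<^sup>2 = ennreal (indicator (cball 0 N) \<xi> * ?r \<xi> powr (-1/2))"
      by (simp add: ennreal_power indicator_def)
  qed
  also have "(\<integral>\<^sup>+\<xi>. (?g \<xi>)\<^sup>2 \<partial>lborel) = (\<integral>\<^sup>+\<xi>. ennreal (?r \<xi> powr (1/2) * (E \<xi>)\<^sup>2) \<partial>lborel)"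
  proof (intro nn_integral_cong)
    fix \<xi> :: "real^3"
    have "(?r \<xi> powr (1/4))\<^sup>2 = ?r \<xi> powr (1/2)"
      by (simp add: power2_eq_square flip: powr_add)
    then show "(?g \<xi>)\<^sup>2 = ennreal (?r \<xi> powr (1/2) * (E \<xi>)\<^sup>2)"
      using E0[of \<xi>] by (simp add: ennreal_power power_mult_distrib)
  qed
  also have "(\<integral>\<^sup>+\<xi>. ennreal (indicator (cball 0 N) \<xi> * ?r \<xi> powr (-1/2)) \<partial>lborel) * (\<integral>\<^sup>+\<xi>. ennreal (?r \<xi> powr (1/2) * (E \<xi>)\<^sup>2) \<partial>lborel)
      \<le> ennreal (32 * N\<^sup>2) * ennreal a"
    by (intro mult_mono anisotropic_weight_integral N a) auto
  also have "\<dots> = (ennreal (sqrt (32 * a) * N))\<^sup>2"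
    using a(1) N by (simp add: ennreal_power power_mult_distrib mult_ac flip: ennreal_mult)
  finally show ?thesis
    by (rule ennreal_power2_le_imp_le)
qed

section \<open>Heat flow and dyadic blocks as Fourier multipliers\<close>

lemma gaussian_kernel_le: "0 < e \<Longrightarrow> gaussian_kernel e (z::'a::euclidean_space) \<le> 1 / e ^ DIM('a)"
  by (simp add: gaussian_kernel_def divide_right_mono)

text \<open>For truncations of \<open>f\<close> this is the multiplication formula; both sides are
  continuous in \<open>L\<^sup>2\<close>.\<close>

lemma gaussian_kernel_convolution_formula:
  fixes f g :: "'a::euclidean_space \<Rightarrow> complex"
  assumes f: "is_L2 f" "has_L2_ft f g" and e: "0 < e"
  shows "(LINT y|lborel. f y * gaussian_kernel e (y - x)) = ft (\<lambda>\<xi>. exp (- (pi * e\<^sup>2) * (norm \<xi>)\<^sup>2) * g \<xi>) (- x)"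
proof -
  note s = truncations_converge[OF f(1)]
  let ?\<gamma> = "\<lambda>\<xi>::'a. complex_of_real (exp (- (pi * e\<^sup>2) * (norm \<xi>)\<^sup>2)) * cis (2 * pi * (x \<bullet> \<xi>))"
  let ?k = "\<lambda>y. complex_of_real (gaussian_kernel e (y - x))"
  have \<gamma>: "integrable lborel ?\<gamma>"
    using e by (intro integrable_mult_cis integrable_of_real gaussian_integrable) auto
  have \<gamma>2: "is_L2 ?\<gamma>"
    using borel_measurable_integrable[OF \<gamma>] L2sq_bounded_integrable(1)[OF \<gamma>, of 1] by (simp add: is_L2_def norm_mult)
  have k: "integrable lborel ?k"
    using integrable_lborel_translate[OF gaussian_kernel_integral(1)[OF e], of "- x"] by simp
  have k2: "is_L2 ?k"
  proof -
    have "norm (?k y) \<le> 1 / e ^ DIM('a)" for y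
      using gaussian_kernel_nonneg[OF e, of "y - x"] gaussian_kernel_le[OF e, of "y - x"] by simp
    then show ?thesis
      using borel_measurable_integrable[OF k] L2sq_bounded_integrable(1)[OF k, of "1 / e ^ DIM('a)"] by (simp add: is_L2_def)
  qed
  have ft_fm: "is_L2 (ft (truncate (real n) f))" for n
    by (rule has_L2_ft_is_L2[OF s(2) has_L2_ft_integrable[OF s(1,2)]])
  have eq: "(LINT y|lborel. truncate (real n) f y * ?k y) = (LINT \<xi>|lborel. ft (truncate (real n) f) \<xi> * ?\<gamma> \<xi>)" for n
    unfolding ft_multiplication_formula[OF s(1) \<gamma>] ft_modulation gaussian_ft[OF e] ..
  have "(\<lambda>n. LINT y|lborel. truncate (real n) f y * ?k y) \<longlonglongrightarrow> (LINT y|lborel. f y * ?k y)"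
    by (rule L2_weak_convergence[OF s(2) f(1) k2 s(3)])
  moreover have "(\<lambda>n. LINT \<xi>|lborel. ft (truncate (real n) f) \<xi> * ?\<gamma> \<xi>) \<longlonglongrightarrow> (LINT \<xi>|lborel. g \<xi> * ?\<gamma> \<xi>)"
    by (rule L2_weak_convergence[OF ft_fm has_L2_ft_is_L2[OF f] \<gamma>2 has_L2_ftD[OF f s]])
  ultimately have "(LINT y|lborel. f y * ?k y) = (LINT \<xi>|lborel. g \<xi> * ?\<gamma> \<xi>)"
    unfolding eq by (rule LIMSEQ_unique)
  also have "\<dots> = ft (\<lambda>\<xi>. exp (- (pi * e\<^sup>2) * (norm \<xi>)\<^sup>2) * g \<xi>) (- x)"
    unfolding ft_def by (intro Bochner_Integration.integral_cong) (auto simp: mult_ac inner_commute exp_of_real[symmetric])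
  finally show ?thesis .
qed

text \<open>The heat kernel at time \<open>t\<close> is \<open>gaussian_kernel e\<close> with
  \<open>e\<^sup>2 = 4 \<pi> t\<close>. The inverse transform is written as \<open>ft\<close> at
  \<open>- x\<close>.\<close>

lemma heat_component:
  assumes u: "is_L2 u" and t: "0 < t"
  shows "complex_of_real (heat t u x $ i) = ft (\<lambda>\<xi>. complex_of_real (exp (- (4 * pi\<^sup>2 * t) * (norm \<xi>)\<^sup>2)) * fourier u \<xi> $ i) (- x)"
proof -
  define e where "e = sqrt (4 * pi * t)"
  have e: "0 < e" "e\<^sup>2 = 4 * pi * t"
    using t by (auto simp: e_def)
  have e3: "(4 * pi * t) powr (- 3/2) = 1 / e ^ 3"
  proof -
    have "(4 * pi * t) powr (- 3/2) = inverse ((4 * pi * t) powr (1/2)) ^ 3"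
      using t by (simp add: powr_minus powr_power[symmetric] powr_powr power_inverse flip: powr_numeral)
    then show ?thesis
      using t by (simp add: e_def powr_half_sqrt inverse_eq_divide power_divide)
  qed
  have kern: "(4 * pi * t) powr (- 3/2) * exp (- (norm (x - y))\<^sup>2 / (4 * t)) = gaussian_kernel e (y - x)" for y :: "real^3"
    using t unfolding gaussian_kernel_def e(2) e3 by (simp add: norm_minus_commute)
  have k: "integrable lborel (\<lambda>y::real^3. gaussian_kernel e (y - x))"
    using integrable_lborel_translate[OF gaussian_kernel_integral(1)[OF e(1)], of "- x"] by simp
  have k2: "is_L2 (\<lambda>y::real^3. gaussian_kernel e (y - x))"
  proof -
    have "norm (gaussian_kernel e (y - x)) \<le> 1 / e ^ 3" for y :: "real^3"
      using gaussian_kernel_nonneg[OF e(1), of "y - x"] gaussian_kernel_le[OF e(1), of "y - x"] by simp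
    then show ?thesis
      using borel_measurable_integrable[OF k] L2sq_bounded_integrable(1)[OF k, of "1 / e ^ 3"] by (simp add: is_L2_def)
  qed
  have um: "u \<in> borel_measurable borel" using u by (simp add: is_L2_def)
  have "integrable lborel (\<lambda>y. gaussian_kernel e (y - x) * norm (u y))"
    using u by (intro is_L2_mult_integrable k2) (auto simp: is_L2_def L2sq_def)
  then have int: "integrable lborel (\<lambda>y. gaussian_kernel e (y - x) *\<^sub>R u y)"
    by (rule Bochner_Integration.integrable_bound) (use um in auto)
  have "heat t u x $ i = (LINT y|lborel. gaussian_kernel e (y - x) * u y $ i)"
    unfolding heat_def kern using integral_bounded_linear[OF bounded_linear_vec_nth[of i] int] by simp
  then have "complex_of_real (heat t u x $ i) = (LINT y|lborel. complex_of_real (u y $ i) * gaussian_kernel e (y - x))"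
    by (simp add: mult.commute flip: of_real_mult)
  also have "\<dots> = ft (\<lambda>\<xi>. exp (- (pi * e\<^sup>2) * (norm \<xi>)\<^sup>2) * fourier u \<xi> $ i) (- x)"
    by (rule gaussian_kernel_convolution_formula[OF is_L2_component(2)[OF u] fourier_component[OF u] e(1)])
  finally show ?thesis
    unfolding e(2) by (simp add: power2_eq_square mult_ac)
qed

lemma LP_block_component:
  "LP_block \<phi> j u x $ i = ft (\<lambda>\<xi>. complex_of_real (\<phi> ((2 powr (- of_int j)) *\<^sub>R \<xi>)) * fourier u \<xi> $ i) (- x)"
  by (simp add: LP_block_def ft_def inner_commute)

lemma powr_sum3_le:
  fixes a :: "3 \<Rightarrow> real"
  assumes "\<And>i. 0 \<le> a i" "0 \<le> p"
  shows "(\<Sum>i\<in>UNIV. a i) powr p \<le> 3 powr p * (\<Sum>i\<in>UNIV. a i powr p)"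
proof -
  have "Max (range a) \<in> range a"
    by (intro Max_in) auto
  then obtain m where "Max (range a) = a m"
    by (rule rangeE)
  then have m: "a i \<le> a m" for i
    using Max_ge[of "range a" "a i"] by simp
  have "(\<Sum>i\<in>UNIV. a i) \<le> (\<Sum>i\<in>(UNIV::3 set). a m)"
    by (intro sum_mono m)
  then have "(\<Sum>i\<in>UNIV. a i) powr p \<le> (3 * a m) powr p"
    using assms by (intro powr_mono2 sum_nonneg) auto
  also have "\<dots> = 3 powr p * a m powr p"
    by (rule powr_mult)
  also have "\<dots> \<le> 3 powr p * (\<Sum>i\<in>UNIV. a i powr p)"
    by (intro mult_left_mono member_le_sum) auto
  finally show ?thesis .
qed

text \<open>The scalar bound applied to each component. It is stated for any \<open>h\<close>
  dominated by the transforms of the components, so as to cover the real valued heat flow and the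
  complex valued dyadic blocks alike.\<close>

theorem multiplier_Lp_bound:
  fixes U :: "real^3 \<Rightarrow> complex^3" and m :: "real^3 \<Rightarrow> real"
  assumes p: "2 < p" and B: "0 < B" and U: "is_L2 U"
    and [measurable]: "m \<in> borel_measurable borel" and m: "\<And>\<xi>. 0 \<le> m \<xi>" "\<And>\<xi>. m \<xi> \<le> 1"
    and fin: "(\<integral>\<^sup>+\<xi>. ennreal (m \<xi> * norm (U \<xi>)) \<partial>lborel) < \<infinity>"
    and low: "\<And>N. 0 < N \<Longrightarrow> (\<integral>\<^sup>+\<xi>. ennreal (indicator (cball 0 N) \<xi> * norm (U \<xi>)) \<partial>lborel) \<le> ennreal (B * N)"
    and h: "\<And>x. norm (h x) \<le> (\<Sum>i\<in>UNIV. norm (ft (\<lambda>\<xi>. complex_of_real (m \<xi>) * U \<xi> $ i) (- x)))"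
  shows "(\<integral>\<^sup>+x. ennreal (norm (h x) powr p) \<partial>lborel)
    \<le> ennreal (3 * 3 powr p * 2 powr p * B powr (p - 2)) * (\<integral>\<^sup>+\<xi>. ennreal (norm \<xi> powr (p - 2) * (m \<xi> * norm (U \<xi>))\<^sup>2) \<partial>lborel)"
proof -
  have Um[measurable]: "U \<in> borel_measurable borel" using U by (simp add: is_L2_def)
  have [measurable]: "(\<lambda>\<xi>. U \<xi> $ i) \<in> borel_measurable borel" for i
    by (rule borel_measurable_vec_nth[OF Um])
  define g where "g i \<xi> = complex_of_real (m \<xi>) * U \<xi> $ i" for i \<xi>
  have [measurable]: "g i \<in> borel_measurable borel" for i
    unfolding g_def by measurable
  have g_le: "norm (g i \<xi>) \<le> m \<xi> * norm (U \<xi>)" for i \<xi>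
    using m(1)[of \<xi>] Finite_Cartesian_Product.norm_nth_le[of "U \<xi>" i] by (simp add: g_def norm_mult mult_left_mono)
  have mU_le: "m \<xi> * norm (U \<xi>) \<le> norm (U \<xi>)" for \<xi>
    using m by (simp add: mult_left_le_one_le)
  have g_int: "integrable lborel (g i)" for i
    unfolding integrable_iff_bounded
  proof
    have "(\<integral>\<^sup>+\<xi>. ennreal (norm (g i \<xi>)) \<partial>lborel) \<le> (\<integral>\<^sup>+\<xi>. ennreal (m \<xi> * norm (U \<xi>)) \<partial>lborel)"
      by (intro nn_integral_mono ennreal_leI g_le)
    with fin show "(\<integral>\<^sup>+\<xi>. ennreal (norm (g i \<xi>)) \<partial>lborel) < \<infinity>"
      by (rule le_less_trans[rotated])
  qed simp
  have g_L2: "is_L2 (g i)" for i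
  proof -
    have "L2sq (g i) \<le> L2sq U"
      unfolding L2sq_def by (intro nn_integral_mono ennreal_leI power_mono order_trans[OF g_le mU_le]) auto
    with U show ?thesis
      by (auto simp: is_L2_def intro: le_less_trans)
  qed
  have g_low: "(\<integral>\<^sup>+\<xi>. ennreal (indicator (cball 0 N) \<xi> * norm (g i \<xi>)) \<partial>lborel) \<le> ennreal (B * N)" if "0 < N" for N i
    by (rule order_trans[OF nn_integral_mono low[OF that]])
      (intro ennreal_leI mult_left_mono order_trans[OF g_le mU_le], auto)
  define J where "J = (\<integral>\<^sup>+\<xi>. ennreal (norm \<xi> powr (p - 2) * (m \<xi> * norm (U \<xi>))\<^sup>2) \<partial>lborel)"
  have each: "(\<integral>\<^sup>+x. ennreal (norm (ft (g i) (- x)) powr p) \<partial>lborel) \<le> ennreal (2 powr p * B powr (p - 2)) * J" for i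
  proof -
    have "(\<integral>\<^sup>+x. ennreal (norm (ft (g i) (- x)) powr p) \<partial>lborel)
        \<le> ennreal (2 powr p * B powr (p - 2)) * (\<integral>\<^sup>+\<xi>. ennreal (norm \<xi> powr (p - 2) * (norm (g i \<xi>))\<^sup>2) \<partial>lborel)"
      by (rule Lp_bound_of_low_frequency_bound[OF p B g_int g_L2 g_low])
    also have "\<dots> \<le> ennreal (2 powr p * B powr (p - 2)) * J"
      unfolding J_def by (intro mult_left_mono nn_integral_mono ennreal_leI power_mono g_le) auto
    finally show ?thesis .
  qed
  have "(\<integral>\<^sup>+x. ennreal (norm (h x) powr p) \<partial>lborel) \<le> (\<integral>\<^sup>+x. ennreal (3 powr p) * (\<Sum>i\<in>UNIV. ennreal (norm (ft (g i) (- x)) powr p)) \<partial>lborel)"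
  proof (rule nn_integral_mono)
    fix x
    have "norm (h x) powr p \<le> (\<Sum>i\<in>UNIV. norm (ft (g i) (- x))) powr p"
      using h[of x] p by (intro powr_mono2) (auto simp: g_def[abs_def])
    also have "\<dots> \<le> 3 powr p * (\<Sum>i\<in>UNIV. norm (ft (g i) (- x)) powr p)"
      using p by (intro powr_sum3_le) auto
    finally have "ennreal (norm (h x) powr p) \<le> ennreal (3 powr p * (\<Sum>i\<in>UNIV. norm (ft (g i) (- x)) powr p))"
      by (rule ennreal_leI)
    then show "ennreal (norm (h x) powr p) \<le> ennreal (3 powr p) * (\<Sum>i\<in>UNIV. ennreal (norm (ft (g i) (- x)) powr p))"
      by (simp add: ennreal_mult sum_nonneg)
  qed
  also have "\<dots> = ennreal (3 powr p) * (\<Sum>i\<in>UNIV. \<integral>\<^sup>+x. ennreal (norm (ft (g i) (- x)) powr p) \<partial>lborel)"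
    by (simp add: nn_integral_cmult nn_integral_sum del: sum_ennreal)
  also have "\<dots> \<le> ennreal (3 powr p) * (\<Sum>i\<in>(UNIV::3 set). ennreal (2 powr p * B powr (p - 2)) * J)"
    by (intro mult_left_mono sum_mono each) auto
  also have "\<dots> = ennreal (3 * 3 powr p * 2 powr p * B powr (p - 2)) * J"
  proof -
    have "ennreal (3 powr p) * (3 * (ennreal (2 powr p * B powr (p - 2)) * J)) = (ennreal 3 * ennreal (3 powr p) * ennreal (2 powr p * B powr (p - 2))) * J"
      by (simp add: mult_ac)
    also have "ennreal 3 * ennreal (3 powr p) * ennreal (2 powr p * B powr (p - 2)) = ennreal (3 * 3 powr p * (2 powr p * B powr (p - 2)))"
      by (subst ennreal_mult, simp, simp, subst ennreal_mult) auto
    finally show ?thesis by (simp add: mult.assoc)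
  qed
  finally show ?thesis unfolding J_def .
qed

section \<open>Besov norms of frequency controlled fields\<close>

text \<open>A continuous function on the half line that tends to \<open>0\<close> at infinity.\<close>

lemma powr_times_gaussian_bounded:
  fixes q c :: real
  assumes q: "0 \<le> q" and c: "0 < c"
  obtains C where "0 < C" "\<And>y. 0 \<le> y \<Longrightarrow> y powr q * exp (- (c * y\<^sup>2)) \<le> C"
proof -
  have "((\<lambda>y. y powr q * exp (- (c * y\<^sup>2))) \<longlongrightarrow> 0) at_top"
    using q c by real_asymp
  then have "\<forall>\<^sub>F y in at_top. y powr q * exp (- (c * y\<^sup>2)) < 1"
    by (rule order_tendstoD) simp
  then obtain Y where Y: "\<And>y. Y \<le> y \<Longrightarrow> y powr q * exp (- (c * y\<^sup>2)) < 1"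
    by (auto simp: eventually_at_top_linorder)
  have "y powr q * exp (- (c * y\<^sup>2)) \<le> max 1 (Y powr q)" if y: "0 \<le> y" for y
  proof (cases "Y \<le> y")
    case True
    with Y[of y] show ?thesis by simp
  next
    case False
    then have "y powr q \<le> Y powr q"
      using q y by (intro powr_mono2) auto
    moreover have "y powr q * exp (- (c * y\<^sup>2)) \<le> y powr q * 1"
      using c by (intro mult_left_mono) auto
    ultimately show ?thesis by simp
  qed
  then show thesis
    by (intro that[of "max 1 (Y powr q)"]) auto
qed

lemma enn2real_enn_powr_half:
  assumes "x < \<infinity>"
  shows "ennreal ((enn2real (enn_powr x (1/2)))\<^sup>2) = x"
proof -
  have "enn_powr x (1/2) < \<infinity>"
    using assms by (simp add: enn_powr_half_less_top_iff del: infinity_ennreal_def)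
  then have "enn_powr x (1/2) = ennreal (enn2real (enn_powr x (1/2)))"
    by simp
  then show ?thesis
    by (metis enn2real_nonneg enn_powr_half_sq ennreal_power)
qed

lemma enn_powr_le:
  assumes "I \<le> ennreal r" "0 \<le> r" "0 \<le> q"
  shows "enn_powr I q \<le> ennreal (r powr q)"
proof -
  have "I \<noteq> \<infinity>" using assms(1) by (auto simp: top_unique)
  moreover have "enn2real I powr q \<le> r powr q"
    using assms by (intro powr_mono2 enn2real_leI) auto
  ultimately show ?thesis
    by (simp add: enn_powr_def ennreal_leI)
qed

lemma Lp_norm_le:
  assumes "0 < p" "0 \<le> r" "(\<integral>\<^sup>+x. ennreal (norm (f x) powr p) \<partial>lborel) \<le> ennreal r"
  shows "Lp_norm (ennreal p) f \<le> ennreal (r powr (1 / p))"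
  using assms by (simp add: Lp_norm_def enn_powr_le)

lemma fourier_norm_measurable: "is_L2 u \<Longrightarrow> (\<lambda>\<xi>. norm (fourier u \<xi>)) \<in> borel_measurable borel"
  using fourier_measurable[of u] by simp

lemma fourier_is_L2: "is_L2 u \<Longrightarrow> is_L2 (fourier u)"
  using fourier_plancherel[of u] fourier_measurable[of u] by (simp add: is_L2_def)

lemma norm_heat_le:
  assumes u: "is_L2 u" and t: "0 < t"
  shows "norm (heat t u x) \<le> (\<Sum>i\<in>UNIV. norm (ft (\<lambda>\<xi>. complex_of_real (exp (- (4 * pi\<^sup>2 * t) * (norm \<xi>)\<^sup>2)) * fourier u \<xi> $ i) (- x)))"
  unfolding heat_component[OF u t, symmetric] by (simp add: norm_le_l1_cart)

lemma norm_LP_block_le: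
  "norm (LP_block \<phi> j u x) \<le> (\<Sum>i\<in>UNIV. norm (ft (\<lambda>\<xi>. complex_of_real (\<phi> ((2 powr (- of_int j)) *\<^sub>R \<xi>)) * fourier u \<xi> $ i) (- x)))"
  unfolding LP_block_component[symmetric] norm_vec_def by (rule L2_set_le_sum) auto

text \<open>The case \<open>s = 2 \<pi> \<surd>t\<close> of the Gaussian estimate; besides the
  bound in \<open>L\<^sup>\<infinity>\<close> it gives the absolute convergence needed for the
  \<open>L\<^sup>p\<close> estimate.\<close>

lemma heat_multiplier_integral:
  assumes u: "is_L2 u" and t: "0 < t" and B: "0 < B"
    and low: "\<And>N. 0 < N \<Longrightarrow> (\<integral>\<^sup>+\<xi>. ennreal (indicator (cball 0 N) \<xi> * norm (fourier u \<xi>)) \<partial>lborel) \<le> ennreal (B * N)"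
  shows "(\<integral>\<^sup>+\<xi>. ennreal (exp (- (4 * pi\<^sup>2 * t) * (norm \<xi>)\<^sup>2) * norm (fourier u \<xi>)) \<partial>lborel)
    \<le> ennreal (B / (2 * pi * sqrt t) * (\<Sum>k. (real k + 1) * exp (- real k)))"
proof -
  have "(2 * pi * sqrt t)\<^sup>2 = 4 * pi\<^sup>2 * t"
    using t by (simp add: power_mult_distrib)
  then show ?thesis
    using gaussian_weight_bound_of_low_frequency_bound[OF fourier_norm_measurable[OF u], of "2 * pi * sqrt t" B] t B low
    by simp
qed

text \<open>The two quantities to which all Besov estimates reduce: \<open>B\<close> bounds the
  low frequencies at the scaling of the critical space with \<open>p = \<infinity>\<close>, and
  \<open>k\<close> bounds the square of the Sobolev norm of order one half, up to the factor
  \<open>2 \<pi>\<close>. The point is that \<open>B\<close> may be small while \<open>k\<close>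
  is large.\<close>

definition frequency_controlled :: "(real^3 \<Rightarrow> real^3) \<Rightarrow> real \<Rightarrow> real \<Rightarrow> bool" where
  "frequency_controlled u B k \<longleftrightarrow> is_L2 u \<and> 0 < B \<and> 0 \<le> k \<and>
     (\<forall>N>0. (\<integral>\<^sup>+\<xi>. ennreal (indicator (cball 0 N) \<xi> * norm (fourier u \<xi>)) \<partial>lborel) \<le> ennreal (B * N)) \<and>
     (\<integral>\<^sup>+\<xi>. ennreal (norm \<xi> * (norm (fourier u \<xi>))\<^sup>2) \<partial>lborel) \<le> ennreal k"

text \<open>For \<open>p > 3\<close> the regularity is negative. The Gaussian multiplier absorbs
  \<open>\<bar>\<xi>\<bar>\<^sup>p\<^sup>-\<^sup>3\<close> at the price of
  \<open>t\<^sup>-\<^sup>(\<^sup>p\<^sup>-\<^sup>3\<^sup>)\<^sup>/\<^sup>2\<close>, which cancels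
  against the \<open>p\<close>-th power of the factor in the Besov norm.\<close>

lemma besov_heat_bound:
  fixes p :: real
  assumes p: "3 < p"
  shows "\<exists>C>0. \<forall>\<phi> u B k. frequency_controlled u B k \<longrightarrow>
      besov_norm \<phi> (- 1 + 3 / p) (ennreal p) u \<le> ennreal ((C * (B powr (p - 2) * k)) powr (1 / p))"
proof -
  obtain c where c: "0 < c" "\<And>y. 0 \<le> y \<Longrightarrow> y powr (p - 3) * exp (- (1 * y\<^sup>2)) \<le> c"
    using powr_times_gaussian_bounded[of "p - 3" 1] p by auto
  define C where "C = 3 * 3 powr p * 2 powr p * c"
  show ?thesis
  proof (intro exI[of _ C] conjI allI impI)
    show "0 < C" using c by (simp add: C_def)
    fix \<phi> :: "real^3 \<Rightarrow> real" and u B and k :: real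
    assume "frequency_controlled u B k"
    then have u: "is_L2 u" and B: "0 < B" and k: "0 \<le> k"
      and low: "\<And>N. 0 < N \<Longrightarrow> (\<integral>\<^sup>+\<xi>. ennreal (indicator (cball 0 N) \<xi> * norm (fourier u \<xi>)) \<partial>lborel) \<le> ennreal (B * N)"
      and K: "(\<integral>\<^sup>+\<xi>. ennreal (norm \<xi> * (norm (fourier u \<xi>))\<^sup>2) \<partial>lborel) \<le> ennreal k"
      by (auto simp: frequency_controlled_def)
    define Q where "Q = C * (B powr (p - 2) * k)"
    have Q: "0 \<le> Q" using c k by (simp add: Q_def C_def)
    have [measurable]: "(\<lambda>\<xi>. norm (fourier u \<xi>)) \<in> borel_measurable borel" by (rule fourier_norm_measurable[OF u])
    have each: "ennreal (t powr (- (- 1 + 3 / p) / 2)) * Lp_norm (ennreal p) (heat t u) \<le> ennreal (Q powr (1 / p))" if t: "0 < t" for t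
    proof -
      let ?m = "\<lambda>\<xi>::real^3. exp (- (4 * pi\<^sup>2 * t) * (norm \<xi>)\<^sup>2)"
      have J: "(\<integral>\<^sup>+\<xi>. ennreal (norm \<xi> powr (p - 2) * (?m \<xi> * norm (fourier u \<xi>))\<^sup>2) \<partial>lborel) \<le> ennreal (c * t powr (- ((p - 3) / 2))) * ennreal k"
      proof -
        have "(\<integral>\<^sup>+\<xi>. ennreal (norm \<xi> powr (p - 2) * (?m \<xi> * norm (fourier u \<xi>))\<^sup>2) \<partial>lborel)
          \<le> (\<integral>\<^sup>+\<xi>. ennreal (c * t powr (- ((p - 3) / 2))) * ennreal (norm \<xi> * (norm (fourier u \<xi>))\<^sup>2) \<partial>lborel)"
        proof (rule nn_integral_mono)
          fix \<xi> :: "real^3"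
          let ?r = "norm \<xi>"
          have "(sqrt t * ?r) powr (p - 3) = t powr ((p - 3) / 2) * ?r powr (p - 3)"
            using t by (simp add: powr_mult powr_half_sqrt[symmetric] powr_powr)
          moreover have "(?m \<xi>)\<^sup>2 \<le> exp (- (1 * (sqrt t * ?r)\<^sup>2))"
          proof -
            \<comment> \<open>a slack of the constants: the multiplier decays faster than
                \<open>exp (- t \<bar>\<xi>\<bar>\<^sup>2)\<close>\<close>
            have "(1::real) \<le> 2 * (4 * pi\<^sup>2)"
              using pi_gt3 power_mono[of 3 pi 2] by simp
            then have "1 * (t * ?r\<^sup>2) \<le> 2 * (4 * pi\<^sup>2) * (t * ?r\<^sup>2)"
              using t by (intro mult_right_mono) auto
            then show ?thesis
              using t by (simp add: power_mult_distrib mult_ac flip: exp_double exp_of_nat_mult)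
          qed
          ultimately have "t powr ((p - 3) / 2) * ?r powr (p - 3) * (?m \<xi>)\<^sup>2 \<le> (sqrt t * ?r) powr (p - 3) * exp (- (1 * (sqrt t * ?r)\<^sup>2))"
            by (simp add: mult_left_mono)
          also have "\<dots> \<le> c"
            using t by (intro c) auto
          finally have "t powr (- ((p - 3) / 2)) * (t powr ((p - 3) / 2) * ?r powr (p - 3) * (?m \<xi>)\<^sup>2) \<le> t powr (- ((p - 3) / 2)) * c"
            by (rule mult_left_mono) simp
          then have "?r powr (p - 3) * (?m \<xi>)\<^sup>2 \<le> c * t powr (- ((p - 3) / 2))"
            using t by (simp add: powr_minus field_simps)
          then have "?r * (?r powr (p - 3) * (?m \<xi>)\<^sup>2) * (norm (fourier u \<xi>))\<^sup>2 \<le> ?r * (c * t powr (- ((p - 3) / 2))) * (norm (fourier u \<xi>))\<^sup>2"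
            by (intro mult_right_mono mult_left_mono) auto
          moreover have "?r powr (p - 2) = ?r * ?r powr (p - 3)"
            using p powr_mult_base[of ?r "p - 3"] by simp
          ultimately have "?r powr (p - 2) * (?m \<xi> * norm (fourier u \<xi>))\<^sup>2 \<le> (c * t powr (- ((p - 3) / 2))) * (?r * (norm (fourier u \<xi>))\<^sup>2)"
            by (simp only: power_mult_distrib mult_ac)
          then show "ennreal (?r powr (p - 2) * (?m \<xi> * norm (fourier u \<xi>))\<^sup>2) \<le> ennreal (c * t powr (- ((p - 3) / 2))) * ennreal (?r * (norm (fourier u \<xi>))\<^sup>2)"
            using c(1) by (subst ennreal_mult[symmetric]) (auto intro: ennreal_leI)
        qed
        also have "\<dots> = ennreal (c * t powr (- ((p - 3) / 2))) * (\<integral>\<^sup>+\<xi>. ennreal (norm \<xi> * (norm (fourier u \<xi>))\<^sup>2) \<partial>lborel)"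
          by (rule nn_integral_cmult) simp
        also have "\<dots> \<le> ennreal (c * t powr (- ((p - 3) / 2))) * ennreal k"
          by (intro mult_left_mono K) auto
        finally show ?thesis .
      qed
      have "(\<integral>\<^sup>+x. ennreal (norm (heat t u x) powr p) \<partial>lborel)
        \<le> ennreal (3 * 3 powr p * 2 powr p * B powr (p - 2)) * (\<integral>\<^sup>+\<xi>. ennreal (norm \<xi> powr (p - 2) * (?m \<xi> * norm (fourier u \<xi>))\<^sup>2) \<partial>lborel)"
      proof (rule multiplier_Lp_bound[OF _ B fourier_is_L2[OF u] _ _ _ _ low])
        show "(\<integral>\<^sup>+\<xi>. ennreal (?m \<xi> * norm (fourier u \<xi>)) \<partial>lborel) < \<infinity>"
          by (rule le_less_trans[OF heat_multiplier_integral[OF u t B low]]) auto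
        show "norm (heat t u x) \<le> (\<Sum>i\<in>UNIV. norm (ft (\<lambda>\<xi>. complex_of_real (?m \<xi>) * fourier u \<xi> $ i) (- x)))" for x
          by (rule norm_heat_le[OF u t])
      qed (use p t in auto)
      also have "\<dots> \<le> ennreal (3 * 3 powr p * 2 powr p * B powr (p - 2)) * (ennreal (c * t powr (- ((p - 3) / 2))) * ennreal k)"
        by (intro mult_left_mono J) auto
      also have "\<dots> = ennreal (Q * t powr (- ((p - 3) / 2)))"
        using c(1) k by (simp add: Q_def C_def mult_ac flip: ennreal_mult)
      finally have "Lp_norm (ennreal p) (heat t u) \<le> ennreal ((Q * t powr (- ((p - 3) / 2))) powr (1 / p))"
        using p Q by (intro Lp_norm_le) auto
      then have "ennreal (t powr (- (- 1 + 3 / p) / 2)) * Lp_norm (ennreal p) (heat t u)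
          \<le> ennreal (t powr (- (- 1 + 3 / p) / 2)) * ennreal ((Q * t powr (- ((p - 3) / 2))) powr (1 / p))"
        by (rule mult_left_mono) simp
      also have "\<dots> = ennreal (t powr (- (- 1 + 3 / p) / 2) * (Q * t powr (- ((p - 3) / 2))) powr (1 / p))"
        by (rule ennreal_mult[symmetric]) auto
      also have "t powr (- (- 1 + 3 / p) / 2) * (Q * t powr (- ((p - 3) / 2))) powr (1 / p) = Q powr (1 / p)"
      proof -
        have e: "- (- 1 + 3 / p) / 2 + - ((p - 3) / 2) * (1 / p) = 0"
          using p by (simp add: field_simps)
        have "t powr (- (- 1 + 3 / p) / 2) * (Q * t powr (- ((p - 3) / 2))) powr (1 / p)
            = Q powr (1 / p) * (t powr (- (- 1 + 3 / p) / 2) * t powr (- ((p - 3) / 2) * (1 / p)))"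
          by (simp only: powr_mult powr_powr mult_ac)
        also have "t powr (- (- 1 + 3 / p) / 2) * t powr (- ((p - 3) / 2) * (1 / p)) = 1"
          unfolding powr_add[symmetric] e using t by simp
        finally show ?thesis by simp
      qed
      finally show ?thesis .
    qed
    have "- 1 + 3 / p < 0" using p by (simp add: field_simps)
    then show "besov_norm \<phi> (- 1 + 3 / p) (ennreal p) u \<le> ennreal ((C * (B powr (p - 2) * k)) powr (1 / p))"
      using each unfolding besov_norm_def Q_def by (auto intro!: SUP_least)
  qed
qed

text \<open>The supremum of the heat flow is at most the absolute integral of its transform, which
  is of order \<open>B / \<surd>t\<close>.\<close>

lemma besov_heat_infinity_bound:
  "\<exists>C>0. \<forall>\<phi> u B k. frequency_controlled u B k \<longrightarrow> besov_norm \<phi> (- 1) \<infinity> u \<le> ennreal (C * B)"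
proof -
  define S where "S = (\<Sum>k. (real k + 1) * exp (- real k))"
  have S0: "0 < S"
    unfolding S_def by (intro suminf_pos summable_Suc_exp_minus) auto
  show ?thesis
  proof (intro exI[of _ "3 * S / (2 * pi)"] conjI allI impI)
    show "0 < 3 * S / (2 * pi)" using S0 by simp
    fix \<phi> :: "real^3 \<Rightarrow> real" and u B and k :: real
    assume "frequency_controlled u B k"
    then have u: "is_L2 u" and B: "0 < B" 
      and low: "\<And>N. 0 < N \<Longrightarrow> (\<integral>\<^sup>+\<xi>. ennreal (indicator (cball 0 N) \<xi> * norm (fourier u \<xi>)) \<partial>lborel) \<le> ennreal (B * N)"
      by (auto simp: frequency_controlled_def)
    have [measurable]: "fourier u \<in> borel_measurable borel" "(\<lambda>\<xi>. norm (fourier u \<xi>)) \<in> borel_measurable borel"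
      by (rule fourier_measurable[OF u], rule fourier_norm_measurable[OF u])
    have [measurable]: "(\<lambda>\<xi>. fourier u \<xi> $ i) \<in> borel_measurable borel" for i
      by (rule borel_measurable_vec_nth) simp
    have each: "ennreal (t powr (- (- 1) / 2)) * Lp_norm \<infinity> (heat t u) \<le> ennreal (3 * S / (2 * pi) * B)" if t: "0 < t" for t
    proof -
      let ?m = "\<lambda>\<xi>::real^3. exp (- (4 * pi\<^sup>2 * t) * (norm \<xi>)\<^sup>2)"
      let ?g = "\<lambda>i \<xi>. complex_of_real (?m \<xi>) * fourier u \<xi> $ i"
      have m: "(\<lambda>x. heat t u x) \<in> borel_measurable borel"
      proof (rule borel_measurable_vec)
        fix i :: 3
        have "(\<lambda>x. heat t u x $ i) = (\<lambda>x. Re (ft (?g i) (- x)))"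
          using heat_component[OF u t, symmetric] by (simp add: fun_eq_iff)
        then show "(\<lambda>x. heat t u x $ i) \<in> borel_measurable borel"
          by simp
      qed
      have g: "norm (ft (?g i) (- x)) \<le> B / (2 * pi * sqrt t) * S" for i x
      proof -
        have fin: "L1norm (?g i) \<le> ennreal (B / (2 * pi * sqrt t) * S)"
        proof -
          have "L1norm (?g i) \<le> (\<integral>\<^sup>+\<xi>. ennreal (?m \<xi> * norm (fourier u \<xi>)) \<partial>lborel)"
            unfolding L1norm_def
            by (intro nn_integral_mono ennreal_leI) (simp add: norm_mult mult_left_mono Finite_Cartesian_Product.norm_nth_le)
          also have "\<dots> \<le> ennreal (B / (2 * pi * sqrt t) * S)"
            unfolding S_def by (rule heat_multiplier_integral[OF u t B low])
          finally show ?thesis .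
        qed
        then have "integrable lborel (?g i)"
          unfolding integrable_iff_L1norm by (auto intro: le_less_trans)
        from order_trans[OF norm_ft_le_L1norm[OF this] fin] show ?thesis
          using B t S0 by (simp add: ennreal_le_iff)
      qed
      have bound: "norm (heat t u x) \<le> 3 * (B / (2 * pi * sqrt t) * S)" for x
      proof -
        have "norm (heat t u x) \<le> (\<Sum>i\<in>(UNIV::3 set). B / (2 * pi * sqrt t) * S)"
          by (rule order_trans[OF norm_heat_le[OF u t]]) (intro sum_mono g)
        then show ?thesis by simp
      qed
      have "Lp_norm \<infinity> (heat t u) \<le> ennreal (3 * (B / (2 * pi * sqrt t) * S))"
        unfolding Lp_norm_def by (simp, intro esssup_I) (use m bound in \<open>auto intro!: ennreal_leI\<close>)
      then have "ennreal (t powr (- (- 1) / 2)) * Lp_norm \<infinity> (heat t u) \<le> ennreal (sqrt t) * ennreal (3 * (B / (2 * pi * sqrt t) * S))"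
        using t by (intro mult_mono) (auto simp: powr_half_sqrt)
      also have "\<dots> = ennreal (3 * S / (2 * pi) * B)"
        using t B S0 by (simp flip: ennreal_mult)
      finally show ?thesis .
    qed
    then show "besov_norm \<phi> (- 1) \<infinity> u \<le> ennreal (3 * S / (2 * pi) * B)"
      unfolding besov_norm_def by (auto intro!: SUP_least)
  qed
qed

lemma LP_function_measurable:
  assumes "LP_function \<phi>"
  shows "\<phi> \<in> borel_measurable borel"
proof -
  have "Ck 0 \<phi>" using assms unfolding LP_function_def smooth_def by blast
  then show ?thesis by (intro borel_measurable_continuous_onI) simp
qed

text \<open>For \<open>2 < p \<le> 3\<close> the regularity is nonnegative and the dyadic
  definition is in force. On the support of the \<open>j\<close>-th block
  \<open>\<bar>\<xi>\<bar>\<close> is at least \<open>a 2\<^sup>j\<close>, so the nonpositive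
  power \<open>\<bar>\<xi>\<bar>\<^sup>p\<^sup>-\<^sup>3\<close> is at most \<open>(a
  2\<^sup>j)\<^sup>p\<^sup>-\<^sup>3\<close>, and the scale cancels against the factor in the
  norm.\<close>

lemma besov_LP_bound:
  fixes p :: real
  assumes p: "2 < p" "p \<le> 3" and \<phi>: "LP_function \<phi>"
  shows "\<exists>C>0. \<forall>u B k. frequency_controlled u B k \<longrightarrow>
      besov_norm \<phi> (- 1 + 3 / p) (ennreal p) u \<le> ennreal ((C * (B powr (p - 2) * k)) powr (1 / p))"
proof -
  obtain a b where ab: "0 < a" "a < b" "\<And>\<xi>. \<phi> \<xi> \<noteq> 0 \<Longrightarrow> a \<le> norm \<xi> \<and> norm \<xi> \<le> b"
    and \<phi>01: "\<And>\<xi>. 0 \<le> \<phi> \<xi>" "\<And>\<xi>. \<phi> \<xi> \<le> 1"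
    using \<phi> unfolding LP_function_def by blast
  have [measurable]: "\<phi> \<in> borel_measurable borel" by (rule LP_function_measurable[OF \<phi>])
  define C where "C = 3 * 3 powr p * 2 powr p * a powr (p - 3)"
  show ?thesis
  proof (intro exI[of _ C] conjI allI impI)
    show "0 < C" using ab by (simp add: C_def)
    fix u B and k :: real
    assume "frequency_controlled u B k"
    then have u: "is_L2 u" and B: "0 < B" and k: "0 \<le> k"
      and low: "\<And>N. 0 < N \<Longrightarrow> (\<integral>\<^sup>+\<xi>. ennreal (indicator (cball 0 N) \<xi> * norm (fourier u \<xi>)) \<partial>lborel) \<le> ennreal (B * N)"
      and K: "(\<integral>\<^sup>+\<xi>. ennreal (norm \<xi> * (norm (fourier u \<xi>))\<^sup>2) \<partial>lborel) \<le> ennreal k"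
      by (auto simp: frequency_controlled_def)
    define Q where "Q = C * (B powr (p - 2) * k)"
    have Q: "0 \<le> Q" using k by (simp add: Q_def C_def)
    have [measurable]: "(\<lambda>\<xi>. norm (fourier u \<xi>)) \<in> borel_measurable borel" by (rule fourier_norm_measurable[OF u])
    have each: "ennreal (2 powr (of_int j * (- 1 + 3 / p))) * Lp_norm (ennreal p) (LP_block \<phi> j u) \<le> ennreal (Q powr (1 / p))" for j :: int
    proof -
      let ?l = "(2::real) powr of_int j"
      let ?m = "\<lambda>\<xi>::real^3. \<phi> ((2 powr (- of_int j)) *\<^sub>R \<xi>)"
      have supp: "a * ?l \<le> norm \<xi> \<and> norm \<xi> \<le> b * ?l" if "?m \<xi> \<noteq> 0" for \<xi>
        using ab(3)[OF that] by (simp add: powr_minus field_simps)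
      have J: "(\<integral>\<^sup>+\<xi>. ennreal (norm \<xi> powr (p - 2) * (?m \<xi> * norm (fourier u \<xi>))\<^sup>2) \<partial>lborel) \<le> ennreal ((a * ?l) powr (p - 3)) * ennreal k"
      proof -
        have "(\<integral>\<^sup>+\<xi>. ennreal (norm \<xi> powr (p - 2) * (?m \<xi> * norm (fourier u \<xi>))\<^sup>2) \<partial>lborel)
          \<le> (\<integral>\<^sup>+\<xi>. ennreal ((a * ?l) powr (p - 3)) * ennreal (norm \<xi> * (norm (fourier u \<xi>))\<^sup>2) \<partial>lborel)"
        proof (rule nn_integral_mono)
          fix \<xi> :: "real^3"
          let ?r = "norm \<xi>"
          have "?r powr (p - 2) * (?m \<xi> * norm (fourier u \<xi>))\<^sup>2 \<le> (a * ?l) powr (p - 3) * (?r * (norm (fourier u \<xi>))\<^sup>2)"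
          proof (cases "?m \<xi> = 0")
            case False
            then have r: "a * ?l \<le> ?r" using supp by simp
            have "?r powr (p - 3) \<le> (a * ?l) powr (p - 3)"
              using p ab r by (intro powr_mono2') auto
            moreover have "(?m \<xi>)\<^sup>2 \<le> 1"
              using \<phi>01 by (simp add: power_le_one)
            ultimately have "?r powr (p - 3) * (?m \<xi>)\<^sup>2 \<le> (a * ?l) powr (p - 3) * 1"
              by (intro mult_mono) auto
            then have "?r * (?r powr (p - 3) * (?m \<xi>)\<^sup>2) * (norm (fourier u \<xi>))\<^sup>2 \<le> ?r * ((a * ?l) powr (p - 3) * 1) * (norm (fourier u \<xi>))\<^sup>2"
              by (intro mult_right_mono mult_left_mono) auto
            moreover have "?r powr (p - 2) = ?r * ?r powr (p - 3)"
              using powr_mult_base[of ?r "p - 3"] by simp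
            ultimately show ?thesis
              by (simp only: power_mult_distrib mult_ac mult_1_right)
          qed simp
          then show "ennreal (?r powr (p - 2) * (?m \<xi> * norm (fourier u \<xi>))\<^sup>2) \<le> ennreal ((a * ?l) powr (p - 3)) * ennreal (?r * (norm (fourier u \<xi>))\<^sup>2)"
            by (subst ennreal_mult[symmetric]) (auto intro: ennreal_leI)
        qed
        also have "\<dots> = ennreal ((a * ?l) powr (p - 3)) * (\<integral>\<^sup>+\<xi>. ennreal (norm \<xi> * (norm (fourier u \<xi>))\<^sup>2) \<partial>lborel)"
          by (rule nn_integral_cmult) simp
        also have "\<dots> \<le> ennreal ((a * ?l) powr (p - 3)) * ennreal k"
          by (intro mult_left_mono K) auto
        finally show ?thesis .
      qed
      have "(\<integral>\<^sup>+x. ennreal (norm (LP_block \<phi> j u x) powr p) \<partial>lborel)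
        \<le> ennreal (3 * 3 powr p * 2 powr p * B powr (p - 2)) * (\<integral>\<^sup>+\<xi>. ennreal (norm \<xi> powr (p - 2) * (?m \<xi> * norm (fourier u \<xi>))\<^sup>2) \<partial>lborel)"
      proof (rule multiplier_Lp_bound[OF p(1) B fourier_is_L2[OF u] _ _ _ _ low])
        have "(\<integral>\<^sup>+\<xi>. ennreal (?m \<xi> * norm (fourier u \<xi>)) \<partial>lborel) \<le> (\<integral>\<^sup>+\<xi>. ennreal (indicator (cball 0 (b * ?l)) \<xi> * norm (fourier u \<xi>)) \<partial>lborel)"
        proof (intro nn_integral_mono ennreal_leI mult_right_mono)
          show "?m \<xi> \<le> indicator (cball 0 (b * ?l)) \<xi>" for \<xi>
            using supp[of \<xi>] \<phi>01(2)[of "(2 powr (- of_int j)) *\<^sub>R \<xi>"] by (cases "?m \<xi> = 0") (auto simp: indicator_def)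
        qed auto
        also have "\<dots> \<le> ennreal (B * (b * ?l))"
          using ab by (intro low) auto
        finally show "(\<integral>\<^sup>+\<xi>. ennreal (?m \<xi> * norm (fourier u \<xi>)) \<partial>lborel) < \<infinity>"
          by (rule le_less_trans) simp
        show "norm (LP_block \<phi> j u x) \<le> (\<Sum>i\<in>UNIV. norm (ft (\<lambda>\<xi>. complex_of_real (?m \<xi>) * fourier u \<xi> $ i) (- x)))" for x
          by (rule norm_LP_block_le)
      qed (use \<phi>01 in auto)
      also have "\<dots> \<le> ennreal (3 * 3 powr p * 2 powr p * B powr (p - 2)) * (ennreal ((a * ?l) powr (p - 3)) * ennreal k)"
        by (intro mult_left_mono J) auto
      also have "\<dots> = ennreal (Q * ?l powr (p - 3))"
        using k ab by (simp add: Q_def C_def mult_ac powr_mult flip: ennreal_mult)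
      finally have "Lp_norm (ennreal p) (LP_block \<phi> j u) \<le> ennreal ((Q * ?l powr (p - 3)) powr (1 / p))"
        using p Q by (intro Lp_norm_le) auto
      then have "ennreal (2 powr (of_int j * (- 1 + 3 / p))) * Lp_norm (ennreal p) (LP_block \<phi> j u)
          \<le> ennreal (2 powr (of_int j * (- 1 + 3 / p))) * ennreal ((Q * ?l powr (p - 3)) powr (1 / p))"
        by (rule mult_left_mono) simp
      also have "\<dots> = ennreal (2 powr (of_int j * (- 1 + 3 / p)) * (Q * ?l powr (p - 3)) powr (1 / p))"
        by (rule ennreal_mult[symmetric]) auto
      also have "2 powr (of_int j * (- 1 + 3 / p)) * (Q * ?l powr (p - 3)) powr (1 / p) = Q powr (1 / p)"
      proof -
        have e: "of_int j * (- 1 + 3 / p) + of_int j * (p - 3) * (1 / p) = (0::real)"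
          using p by (simp add: field_simps)
        have "2 powr (of_int j * (- 1 + 3 / p)) * (Q * ?l powr (p - 3)) powr (1 / p)
            = Q powr (1 / p) * (2 powr (of_int j * (- 1 + 3 / p)) * 2 powr (of_int j * (p - 3) * (1 / p)))"
          by (simp only: powr_mult powr_powr mult_ac)
        also have "(2::real) powr (of_int j * (- 1 + 3 / p)) * 2 powr (of_int j * (p - 3) * (1 / p)) = 1"
          unfolding powr_add[symmetric] e by simp
        finally show ?thesis by simp
      qed
      finally show ?thesis .
    qed
    have "\<not> - 1 + 3 / p < 0" using p by (simp add: field_simps)
    then show "besov_norm \<phi> (- 1 + 3 / p) (ennreal p) u \<le> ennreal ((C * (B powr (p - 2) * k)) powr (1 / p))"
      using each unfolding besov_norm_def Q_def by (auto intro!: SUP_least)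
  qed
qed

section \<open>Low frequencies of almost two-dimensional fields\<close>

text \<open>Here \<open>w1\<close> and \<open>w2\<close> are the horizontal components of
  \<open>\<xi> \<times> v\<close>. With \<open>\<xi>\<close> orthogonal to \<open>v\<close> they
  determine \<open>v\<^sub>3\<close>, and then \<open>\<xi>\<^sub>3 v\<^sub>1\<close> and
  \<open>\<xi>\<^sub>3 v\<^sub>2\<close>. Only for \<open>\<xi>\<^sub>3 = 0\<close> can
  \<open>w1\<close> and \<open>w2\<close> both vanish with \<open>v \<noteq> 0\<close>.\<close>

lemma divergence_free_vertical_bound:
  fixes \<xi> :: "real^3" and v :: "complex^3"
  assumes div: "(\<Sum>i\<in>UNIV. complex_of_real (\<xi> $ i) * v $ i) = 0"
  defines "w1 \<equiv> \<xi> $ 2 * v $ 3 - \<xi> $ 3 * v $ 2" and "w2 \<equiv> \<xi> $ 3 * v $ 1 - \<xi> $ 1 * v $ 3"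
  shows "(\<xi> $ 3)\<^sup>2 * (norm v)\<^sup>2 \<le> 12 * ((norm w1)\<^sup>2 + (norm w2)\<^sup>2)"
proof (cases "\<xi> = 0")
  case False
  let ?W = "(norm w1)\<^sup>2 + (norm w2)\<^sup>2"
  define s where "s = norm w1 + norm w2"
  have s0: "0 \<le> s" by (simp add: s_def)
  have s2: "s\<^sup>2 \<le> 2 * ?W"
    using sum_square_weighted[of 1 "norm w1" "norm w2"] by (simp add: s_def)
  have d: "\<xi> $ 3 * v $ 3 = - (\<xi> $ 1 * v $ 1 + \<xi> $ 2 * v $ 2)"
    using div by (simp add: sum_3 add_eq_0_iff2 add.commute)
  have nsq: "(norm \<xi>)\<^sup>2 = (\<xi> $ 1)\<^sup>2 + (\<xi> $ 2)\<^sup>2 + (\<xi> $ 3)\<^sup>2"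
    by (simp add: norm_sq_vec sum_3)
  \<comment> \<open>third component of the identity \<open>\<xi> \<times> (\<xi> \<times> v) = -
      \<bar>\<xi>\<bar>\<^sup>2 v\<close> for \<open>v\<close> orthogonal to \<open>\<xi>\<close>\<close>
  have "complex_of_real ((norm \<xi>)\<^sup>2) * v $ 3 = \<xi> $ 2 * w1 - \<xi> $ 1 * w2"
  proof -
    have "complex_of_real ((norm \<xi>)\<^sup>2) * v $ 3 = \<xi> $ 1 * (\<xi> $ 1 * v $ 3) + \<xi> $ 2 * (\<xi> $ 2 * v $ 3) + \<xi> $ 3 * (\<xi> $ 3 * v $ 3)"
      unfolding nsq by (simp add: power2_eq_square algebra_simps)
    then show ?thesis
      unfolding d w1_def w2_def by (simp add: algebra_simps)
  qed
  then have "(norm \<xi>)\<^sup>2 * norm (v $ 3) = norm (\<xi> $ 2 * w1 - \<xi> $ 1 * w2)"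
    by (metis abs_of_nonneg norm_mult norm_of_real zero_le_power2)
  also have "\<dots> \<le> \<bar>\<xi> $ 2\<bar> * norm w1 + \<bar>\<xi> $ 1\<bar> * norm w2"
    by (rule order_trans[OF norm_triangle_ineq4]) (simp add: norm_mult)
  also have "\<dots> \<le> norm \<xi> * norm w1 + norm \<xi> * norm w2"
    by (intro add_mono mult_right_mono component_le_norm_cart) auto
  finally have "norm \<xi> * (norm \<xi> * norm (v $ 3)) \<le> norm \<xi> * s"
    by (simp add: s_def power2_eq_square distrib_left mult.assoc)
  then have v3: "norm \<xi> * norm (v $ 3) \<le> s"
    using False by simp
  have comp: "\<bar>\<xi> $ i\<bar> * norm (v $ 3) \<le> s" for i
    using mult_right_mono[OF component_le_norm_cart[of \<xi> i], of "norm (v $ 3)"] v3 by simp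
  have 1: "\<bar>\<xi> $ 3\<bar> * norm (v $ 1) \<le> norm w2 + s"
  proof -
    have "\<xi> $ 3 * v $ 1 = w2 + \<xi> $ 1 * v $ 3" by (simp add: w2_def)
    then have "norm (\<xi> $ 3 * v $ 1) \<le> norm w2 + norm (\<xi> $ 1 * v $ 3)"
      using norm_triangle_ineq by metis
    then show ?thesis using comp[of 1] by (simp add: norm_mult)
  qed
  have 2: "\<bar>\<xi> $ 3\<bar> * norm (v $ 2) \<le> norm w1 + s"
  proof -
    have "\<xi> $ 3 * v $ 2 = \<xi> $ 2 * v $ 3 - w1" by (simp add: w1_def)
    then have "norm (\<xi> $ 3 * v $ 2) \<le> norm (\<xi> $ 2 * v $ 3) + norm w1"
      using norm_triangle_ineq4 by metis
    then show ?thesis using comp[of 2] by (simp add: norm_mult)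
  qed
  have sq: "(\<xi> $ 3)\<^sup>2 * (norm z)\<^sup>2 \<le> a\<^sup>2" if "\<bar>\<xi> $ 3\<bar> * norm z \<le> a" for z :: complex and a
    using power_mono[OF that, of 2] by (simp add: power_mult_distrib)
  have "(\<xi> $ 3)\<^sup>2 * (norm v)\<^sup>2 = (\<xi> $ 3)\<^sup>2 * (norm (v $ 1))\<^sup>2 + (\<xi> $ 3)\<^sup>2 * (norm (v $ 2))\<^sup>2 + (\<xi> $ 3)\<^sup>2 * (norm (v $ 3))\<^sup>2"
    by (simp add: norm_sq_vec sum_3 algebra_simps)
  also have "\<dots> \<le> (norm w2 + s)\<^sup>2 + (norm w1 + s)\<^sup>2 + s\<^sup>2"
    by (intro add_mono sq 1 2 comp)
  also have "\<dots> \<le> (2 * (norm w2)\<^sup>2 + 2 * s\<^sup>2) + (2 * (norm w1)\<^sup>2 + 2 * s\<^sup>2) + s\<^sup>2"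
    using sum_square_weighted[of 1 "norm w2" s] sum_square_weighted[of 1 "norm w1" s] by simp
  also have "\<dots> \<le> 12 * ?W"
    using s2 by simp
  finally show ?thesis .
qed simp

text \<open>Used with \<open>r = \<bar>\<xi>\<bar>\<close> and \<open>s =
  \<bar>\<xi>\<^sub>3\<bar>\<close>. In terms of \<open>q = (s /
  r)\<^sup>1\<^sup>/\<^sup>2\<close> it says \<open>q \<le> \<eta> + q\<^sup>4 /
  \<eta>\<^sup>3\<close>, which is clear according to whether \<open>q \<le> \<eta>\<close>.\<close>

lemma anisotropic_weight_interpolation:
  fixes r s \<eta> :: real
  assumes s: "0 \<le> s" "s \<le> r" and \<eta>: "0 < \<eta>"
  shows "(r * s) powr (1/2) \<le> \<eta> * r + 1 / \<eta> ^ 3 * (s\<^sup>2 / r)"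
proof (cases "r = 0")
  case False
  with s have r: "0 < r" by simp
  define q where "q = sqrt (s / r)"
  have q: "0 \<le> q" "q\<^sup>2 = s / r"
    using s r by (auto simp: q_def)
  have "(r * s) powr (1/2) = sqrt (r\<^sup>2 * (s / r))"
    using s r by (simp add: powr_half_sqrt power2_eq_square)
  also have "\<dots> = r * q"
    using r unfolding q_def by (simp only: real_sqrt_mult real_sqrt_abs abs_of_pos)
  also have "r * q \<le> r * (\<eta> + 1 / \<eta> ^ 3 * q ^ 4)"
  proof (intro mult_left_mono)
    show "q \<le> \<eta> + 1 / \<eta> ^ 3 * q ^ 4"
    proof (cases "q \<le> \<eta>")
      case True
      then show ?thesis using \<eta> by (simp add: add_increasing2)
    next
      case False
      then have "\<eta> ^ 3 * q \<le> q ^ 3 * q"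
        using \<eta> q by (intro mult_right_mono power_mono) auto
      then have "q \<le> 1 / \<eta> ^ 3 * q ^ 4"
        using \<eta> by (simp add: field_simps power_Suc[symmetric] numeral_eq_Suc)
      then show ?thesis using \<eta> by simp
    qed
  qed (use r in simp)
  also have "q ^ 4 = (s / r)\<^sup>2"
    unfolding q(2)[symmetric] by simp
  also have "r * (\<eta> + 1 / \<eta> ^ 3 * (s / r)\<^sup>2) = \<eta> * r + 1 / \<eta> ^ 3 * (s\<^sup>2 / r)"
    using r by (simp add: field_simps power2_eq_square)
  finally show ?thesis .
qed (use s \<eta> in auto)

lemma H1_dfD:
  assumes "u \<in> H1_df"
  shows "is_L2 u" "(\<integral>\<^sup>+\<xi>. ennreal ((norm \<xi>)\<^sup>2 * (norm (fourier u \<xi>))\<^sup>2) \<partial>lborel) < \<infinity>"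
    "AE \<xi> in lborel. (\<Sum>i\<in>UNIV. complex_of_real (\<xi> $ i) * fourier u \<xi> $ i) = 0"
proof -
  show L: "is_L2 u"
    using assms unfolding H1_df_def in_L2_iff by blast
  show "(\<integral>\<^sup>+\<xi>. ennreal ((norm \<xi>)\<^sup>2 * (norm (fourier u \<xi>))\<^sup>2) \<partial>lborel) < \<infinity>"
    using assms by (intro H_norm_1_finite[OF L]) (simp add: H1_df_def)
  show "AE \<xi> in lborel. (\<Sum>i\<in>UNIV. complex_of_real (\<xi> $ i) * fourier u \<xi> $ i) = 0"
    using assms unfolding H1_df_def by blast
qed

lemma Hdot_1_sq:
  "(Hdot_norm 1 u)\<^sup>2 = ennreal (4 * pi\<^sup>2) * (\<integral>\<^sup>+\<xi>. ennreal ((norm \<xi>)\<^sup>2 * (norm (fourier u \<xi>))\<^sup>2) \<partial>lborel)"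
  if "is_L2 u"
proof -
  have [measurable]: "(\<lambda>\<xi>. norm (fourier u \<xi>)) \<in> borel_measurable borel" by (rule fourier_norm_measurable[OF that])
  have "(Hdot_norm 1 u)\<^sup>2 = (\<integral>\<^sup>+\<xi>. ennreal ((2 * pi * norm \<xi>) powr (2 * 1) * (norm (fourier u \<xi>))\<^sup>2) \<partial>lborel)"
    unfolding Hdot_norm_def enn_powr_half_sq ..
  also have "\<dots> = (\<integral>\<^sup>+\<xi>. ennreal (4 * pi\<^sup>2) * ennreal ((norm \<xi>)\<^sup>2 * (norm (fourier u \<xi>))\<^sup>2) \<partial>lborel)"
    by (intro nn_integral_cong) (simp add: power_mult_distrib mult.assoc flip: ennreal_mult)
  also have "\<dots> = ennreal (4 * pi\<^sup>2) * (\<integral>\<^sup>+\<xi>. ennreal ((norm \<xi>)\<^sup>2 * (norm (fourier u \<xi>))\<^sup>2) \<partial>lborel)"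
    by (rule nn_integral_cmult) simp
  finally show ?thesis .
qed

text \<open>Cauchy-Schwarz between the energy and the enstrophy.\<close>

lemma half_derivative_interpolation:
  assumes u: "u \<in> H1_df"
  shows "(\<integral>\<^sup>+\<xi>. ennreal (norm \<xi> * (norm (fourier u \<xi>))\<^sup>2) \<partial>lborel)
    \<le> ennreal (enn2real (Lp_norm 2 u) * enn2real (Hdot_norm 1 u))"
proof -
  note H = H1_dfD[OF u]
  have [measurable]: "(\<lambda>\<xi>. norm (fourier u \<xi>)) \<in> borel_measurable borel" by (rule fourier_norm_measurable[OF H(1)])
  have L: "Lp_norm 2 u < \<infinity>"
    using H(1) by (simp add: Lp_norm_2 enn_powr_half_less_top_iff is_L2_def del: infinity_ennreal_def)
  have D: "Hdot_norm 1 u < \<infinity>"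
  proof -
    have "(Hdot_norm 1 u)\<^sup>2 < \<infinity>"
      unfolding Hdot_1_sq[OF H(1)] using H(2) by (auto simp: ennreal_mult_less_top)
    then show ?thesis by (auto simp: power_less_top_ennreal)
  qed
  have "(\<integral>\<^sup>+\<xi>. ennreal (norm \<xi> * (norm (fourier u \<xi>))\<^sup>2) \<partial>lborel)\<^sup>2
      = (\<integral>\<^sup>+\<xi>. ennreal (norm (fourier u \<xi>)) * ennreal (norm \<xi> * norm (fourier u \<xi>)) \<partial>lborel)\<^sup>2"
    by (simp add: power2_eq_square mult_ac flip: ennreal_mult)
  also have "\<dots> \<le> (\<integral>\<^sup>+\<xi>. (ennreal (norm (fourier u \<xi>)))\<^sup>2 \<partial>lborel) * (\<integral>\<^sup>+\<xi>. (ennreal (norm \<xi> * norm (fourier u \<xi>)))\<^sup>2 \<partial>lborel)"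
    by (rule Cauchy_Schwarz_nn_integral) auto
  also have "\<dots> = L2sq u * (\<integral>\<^sup>+\<xi>. ennreal ((norm \<xi>)\<^sup>2 * (norm (fourier u \<xi>))\<^sup>2) \<partial>lborel)"
    using fourier_plancherel[OF H(1)] by (simp add: ennreal_power L2sq_def power_mult_distrib)
  also have "\<dots> \<le> L2sq u * (ennreal (4 * pi\<^sup>2) * (\<integral>\<^sup>+\<xi>. ennreal ((norm \<xi>)\<^sup>2 * (norm (fourier u \<xi>))\<^sup>2) \<partial>lborel))"
  proof -
    have "(1::real) \<le> 4 * pi\<^sup>2"
      using pi_gt3 power_mono[of 3 pi 2] by simp
    then have "1 \<le> ennreal (4 * pi\<^sup>2)"
      using ennreal_leI[of 1 "4 * pi\<^sup>2"] by simp
    then show ?thesis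
      using mult_right_mono[of 1 "ennreal (4 * pi\<^sup>2)"] by (intro mult_left_mono) auto
  qed
  also have "\<dots> = (Lp_norm 2 u)\<^sup>2 * (Hdot_norm 1 u)\<^sup>2"
    unfolding Hdot_1_sq[OF H(1)] Lp_norm_2 enn_powr_half_sq ..
  also have "\<dots> = (ennreal (enn2real (Lp_norm 2 u)) * ennreal (enn2real (Hdot_norm 1 u)))\<^sup>2"
    using L D by (simp add: power_mult_distrib)
  also have "\<dots> = (ennreal (enn2real (Lp_norm 2 u) * enn2real (Hdot_norm 1 u)))\<^sup>2"
    by (subst ennreal_mult) auto
  finally show ?thesis
    by (rule ennreal_power2_le_imp_le)
qed

text \<open>The pointwise bound on \<open>\<xi>\<^sub>3 * fourier u \<xi>\<close>, integrated with
  the weight \<open>1 / \<bar>\<xi>\<bar>\<close> of the Sobolev norm of order minus one half.\<close>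

lemma vertical_derivative_bound:
  assumes u: "u \<in> H1_df"
  shows "(\<integral>\<^sup>+\<xi>. ennreal ((\<xi> $ 3)\<^sup>2 / norm \<xi> * (norm (fourier u \<xi>))\<^sup>2) \<partial>lborel) \<le> 2 * (Hdot_norm (-1/2) (horizontal_vorticity u))\<^sup>2"
proof -
  note H = H1_dfD[OF u]
  let ?w = "\<lambda>\<xi>. fourier (horizontal_vorticity u) \<xi>"
  have "(\<integral>\<^sup>+\<xi>. ennreal ((\<xi> $ 3)\<^sup>2 / norm \<xi> * (norm (fourier u \<xi>))\<^sup>2) \<partial>lborel)
      \<le> (\<integral>\<^sup>+\<xi>. 2 * ennreal ((2 * pi * norm \<xi>) powr (2 * (-1/2)) * (norm (?w \<xi>))\<^sup>2) \<partial>lborel)"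
  proof (rule nn_integral_mono_AE)
    show "AE \<xi> in lborel. ennreal ((\<xi> $ 3)\<^sup>2 / norm \<xi> * (norm (fourier u \<xi>))\<^sup>2)
        \<le> 2 * ennreal ((2 * pi * norm \<xi>) powr (2 * (-1/2)) * (norm (?w \<xi>))\<^sup>2)"
      using H(3) fourier_horizontal_vorticity(2)[OF H(1,2)]
    proof eventually_elim
      case (elim \<xi>)
      let ?w1 = "\<xi> $ 2 * fourier u \<xi> $ 3 - \<xi> $ 3 * fourier u \<xi> $ 2" and ?w2 = "\<xi> $ 3 * fourier u \<xi> $ 1 - \<xi> $ 1 * fourier u \<xi> $ 3"
      let ?W = "(norm ?w1)\<^sup>2 + (norm ?w2)\<^sup>2"
      have "(norm (?w \<xi>))\<^sup>2 = 4 * pi\<^sup>2 * ?W"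
        unfolding elim(2) norm_sq_vec by (simp add: sum_3 norm_mult power_mult_distrib distrib_left)
      have "(\<xi> $ 3)\<^sup>2 / norm \<xi> * (norm (fourier u \<xi>))\<^sup>2 \<le> 12 * ?W / norm \<xi>"
        using divergence_free_vertical_bound[OF elim(1)] by (simp add: divide_right_mono)
      \<comment> \<open>\<open>12 \<le> 4 \<pi>\<close>, which leaves the clean factor
          \<open>2\<close>\<close>
      also have "\<dots> \<le> 4 * pi * ?W / norm \<xi>"
        using pi_gt3 by (intro divide_right_mono mult_right_mono) auto
      also have "\<dots> = 2 * ((2 * pi * norm \<xi>) powr (2 * (-1/2)) * (norm (?w \<xi>))\<^sup>2)"
        unfolding \<open>(norm (?w \<xi>))\<^sup>2 = 4 * pi\<^sup>2 * ?W\<close>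
        by (cases "\<xi> = 0") (simp_all add: powr_minus power2_eq_square field_simps)
      finally have "ennreal ((\<xi> $ 3)\<^sup>2 / norm \<xi> * (norm (fourier u \<xi>))\<^sup>2) \<le> ennreal (2 * ((2 * pi * norm \<xi>) powr (2 * (-1/2)) * (norm (?w \<xi>))\<^sup>2))"
        by (rule ennreal_leI)
      then show ?case
        by (subst (asm) (1) ennreal_mult) auto
    qed
  qed
  also have "\<dots> = 2 * (\<integral>\<^sup>+\<xi>. ennreal ((2 * pi * norm \<xi>) powr (2 * (-1/2)) * (norm (?w \<xi>))\<^sup>2) \<partial>lborel)"
    using fourier_norm_measurable[OF fourier_horizontal_vorticity(1)[OF H(1,2)]] by (intro nn_integral_cmult) simp
  also have "\<dots> = 2 * (Hdot_norm (-1/2) (horizontal_vorticity u))\<^sup>2"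
    unfolding Hdot_norm_def enn_powr_half_sq ..
  finally show ?thesis .
qed

lemma R1_pos: "0 < R1" and R2_pos: "0 < R2"
proof -
  show "0 < R1" by (simp add: R1_def)
  have "0 < 1 + sqrt 2" by (simp add: add_pos_pos)
  then show "0 < R2" by (simp add: R2_def)
qed

text \<open>The exponent in the definition of the set is a positive multiple of
  \<open>K\<^sup>2\<close> minus a constant.\<close>

lemma Gamma_vorticity_decay:
  assumes \<nu>: "0 < \<nu>"
  obtains M c where "0 < M" "0 < c"
    "\<And>u. u \<in> Gamma_2d \<nu> \<Longrightarrow> (Hdot_norm (-1/2) (horizontal_vorticity u))\<^sup>2
       \<le> ennreal (M * exp (- (c * (enn2real (Lp_norm 2 u) * enn2real (Hdot_norm 1 u))\<^sup>2)))"
proof -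
  define b where "b = R2 * \<nu> ^ 4"
  have b: "0 < b" using R2_pos \<nu> by (simp add: b_def)
  define C0 where "C0 = 6912 * pi ^ 4 * \<nu> ^ 4 / b"
  show thesis
  proof (rule that[of "(R1 * \<nu> * exp C0)\<^sup>2" "1 / (2 * b)"])
    show "0 < (R1 * \<nu> * exp C0)\<^sup>2" "0 < 1 / (2 * b)"
      using R1_pos \<nu> b by auto
    fix u assume u: "u \<in> Gamma_2d \<nu>"
    let ?H = "Hdot_norm (-1/2) (horizontal_vorticity u)"
    let ?K = "enn2real (Lp_norm 2 u) * enn2real (Hdot_norm 1 u)"
    define e where "e = (1/4 * (enn2real (Lp_norm 2 u))\<^sup>2 * (enn2real (Hdot_norm 1 u))\<^sup>2 - 6912 * pi ^ 4 * \<nu> ^ 4) / (R2 * \<nu> ^ 4)"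
    have e_eq: "e = ?K\<^sup>2 / (4 * b) - C0"
      by (simp add: e_def b_def[symmetric] C0_def diff_divide_distrib power_mult_distrib)
    have lt: "?H * ennreal (exp e) < ennreal (R1 * \<nu>)"
      using u unfolding Gamma_2d_def e_def by simp
    have fin: "?H \<noteq> \<infinity>"
      using lt by (auto simp: ennreal_top_mult)
    then obtain h where h: "?H = ennreal h" "0 \<le> h"
      by (cases ?H) auto
    from lt have "h * exp e < R1 * \<nu>"
      using h by (simp add: ennreal_less_iff flip: ennreal_mult)
    then have "h \<le> R1 * \<nu> * exp (- e)"
      by (simp add: exp_minus field_simps)
    also have "exp (- e) = exp C0 * exp (- (?K\<^sup>2 / (4 * b)))"
      by (simp add: e_eq flip: exp_add)
    finally have "h\<^sup>2 \<le> (R1 * \<nu> * (exp C0 * exp (- (?K\<^sup>2 / (4 * b)))))\<^sup>2"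
      using h(2) by (intro power_mono) auto
    also have "\<dots> = (R1 * \<nu> * exp C0)\<^sup>2 * (exp (- (?K\<^sup>2 / (4 * b))))\<^sup>2"
      by (simp only: power_mult_distrib mult.assoc)
    also have "(exp (- (?K\<^sup>2 / (4 * b))))\<^sup>2 = exp (- (?K\<^sup>2 / (4 * b)) * 2)"
      by (simp only: exp_double[symmetric] mult.commute[of 2])
    also have "- (?K\<^sup>2 / (4 * b)) * 2 = - (1 / (2 * b) * ?K\<^sup>2)"
      using b by (simp add: field_simps)
    finally have "ennreal (h\<^sup>2) \<le> ennreal ((R1 * \<nu> * exp C0)\<^sup>2 * exp (- (1 / (2 * b) * ?K\<^sup>2)))"
      by (rule ennreal_leI)
    then show "?H\<^sup>2 \<le> ennreal ((R1 * \<nu> * exp C0)\<^sup>2 * exp (- (1 / (2 * b) * ?K\<^sup>2)))"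
      unfolding h(1) using h(2) by (simp add: ennreal_power)
  qed
qed

text \<open>The spectral mass for the weight \<open>(\<bar>\<xi>\<bar>
  \<bar>\<xi>\<^sub>3\<bar>)\<^sup>1\<^sup>/\<^sup>2\<close> is at most \<open>\<eta> k + D /
  \<eta>\<^sup>3\<close>, where \<open>k\<close> bounds the half derivative and \<open>D\<close>
  is exponentially small in \<open>k\<^sup>2\<close>. So \<open>\<eta>\<close> may be any negative
  power of \<open>1 + k\<close>, and \<open>q\<close> is arbitrary.\<close>

theorem Gamma_low_frequency_bound:
  assumes \<nu>: "0 < \<nu>" and q: "0 \<le> q"
  shows "\<exists>C>0. \<forall>u\<in>Gamma_2d \<nu>. \<exists>k. frequency_controlled u (C * (1 + k) powr (- q)) k"
proof -
  obtain M c where M: "0 < M" "0 < c"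
    "\<And>u. u \<in> Gamma_2d \<nu> \<Longrightarrow> (Hdot_norm (-1/2) (horizontal_vorticity u))\<^sup>2
       \<le> ennreal (M * exp (- (c * (enn2real (Lp_norm 2 u) * enn2real (Hdot_norm 1 u))\<^sup>2)))"
    using Gamma_vorticity_decay[OF \<nu>] by blast
  \<comment> \<open>the power left over by \<open>\<eta>\<^sup>-\<^sup>3\<close>: \<open>3 (2 q +
      1) = - 2 q + (8 q + 3)\<close>\<close>
  obtain C1 where C1: "0 < C1" "\<And>y. 0 \<le> y \<Longrightarrow> y powr (8 * q + 3) * exp (- (c / 2 * y\<^sup>2)) \<le> C1"
    using powr_times_gaussian_bounded[of "8 * q + 3" "c / 2"] q M(2) by auto
  define C2 where "C2 = 1 + 2 * M * (exp c * C1)"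
  have C2: "0 < C2" using M C1 by (simp add: C2_def add_pos_nonneg)
  show ?thesis
  proof (rule exI[of _ "sqrt (32 * C2)"], intro conjI ballI)
    show "0 < sqrt (32 * C2)" using C2 by simp
    fix u assume u: "u \<in> Gamma_2d \<nu>"
    then have uH: "u \<in> H1_df" by (simp add: Gamma_2d_def)
    note H = H1_dfD[OF uH]
    have [measurable]: "(\<lambda>\<xi>. norm (fourier u \<xi>)) \<in> borel_measurable borel" by (rule fourier_norm_measurable[OF H(1)])
    define k where "k = enn2real (Lp_norm 2 u) * enn2real (Hdot_norm 1 u)"
    have k: "0 \<le> k" by (simp add: k_def)
    have K1: "(\<integral>\<^sup>+\<xi>. ennreal (norm \<xi> * (norm (fourier u \<xi>))\<^sup>2) \<partial>lborel) \<le> ennreal k"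
      unfolding k_def by (rule half_derivative_interpolation[OF uH])
    define D where "D = 2 * (M * exp (- (c * k\<^sup>2)))"
    have D0: "0 \<le> D" using M by (simp add: D_def)
    have K3: "(\<integral>\<^sup>+\<xi>. ennreal ((\<xi> $ 3)\<^sup>2 / norm \<xi> * (norm (fourier u \<xi>))\<^sup>2) \<partial>lborel) \<le> ennreal D"
    proof -
      have "2 * (Hdot_norm (-1/2) (horizontal_vorticity u))\<^sup>2 \<le> 2 * ennreal (M * exp (- (c * k\<^sup>2)))"
        using M(3)[OF u] unfolding k_def by (rule mult_left_mono) simp
      also have "\<dots> = ennreal D"
        using M by (simp add: D_def ennreal_mult)
      finally show ?thesis
        using vertical_derivative_bound[OF uH] by (rule order_trans[rotated])
    qed
    \<comment> \<open>the extra \<open>1\<close> in the exponent absorbs the factor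
        \<open>k\<close> in \<open>\<eta> k\<close>\<close>
    define \<eta> where "\<eta> = (1 + k) powr (- (2 * q + 1))"
    have \<eta>: "0 < \<eta>" using k by (simp add: \<eta>_def)
    define a where "a = C2 * (1 + k) powr (- (2 * q))"
    have a0: "0 \<le> a" using C2 by (simp add: a_def)
    have a_ge: "\<eta> * k + 1 / \<eta> ^ 3 * D \<le> a"
    proof -
      let ?L = "1 + k"
      have L: "0 < ?L" using k by simp
      have 1: "\<eta> * k \<le> ?L powr (- (2 * q))"
      proof -
        have "\<eta> * k \<le> \<eta> * ?L" using \<eta> by simp
        also have "\<dots> = ?L powr (- (2 * q + 1) + 1)"
          using L unfolding \<eta>_def powr_add by simp
        finally show ?thesis by simp
      qed
      have "\<eta> ^ 3 = ?L powr (- (3 * (2 * q + 1)))"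
        using L by (simp add: \<eta>_def powr_power algebra_simps)
      then have "1 / \<eta> ^ 3 = ?L powr (3 * (2 * q + 1))"
        by (simp only: powr_minus_divide) simp
      also have "\<dots> = ?L powr (- (2 * q)) * ?L powr (8 * q + 3)"
        by (simp add: algebra_simps flip: powr_add)
      finally have \<eta>3: "1 / \<eta> ^ 3 = ?L powr (- (2 * q)) * ?L powr (8 * q + 3)" .
      \<comment> \<open>replaces \<open>k\<close> by \<open>1 + k\<close> in the Gaussian, at the
          cost of half the rate\<close>
      have "exp (- (c * k\<^sup>2)) \<le> exp (c + - (c / 2 * ?L\<^sup>2))"
      proof -
        have "0 \<le> (k - 1)\<^sup>2" by simp
        then have "?L\<^sup>2 / 2 - 1 \<le> k\<^sup>2"
          by (simp add: power2_eq_square algebra_simps)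
        then have "c * (?L\<^sup>2 / 2 - 1) \<le> c * k\<^sup>2"
          using M(2) by (intro mult_left_mono) auto
        then show ?thesis by (simp add: algebra_simps)
      qed
      then have "?L powr (8 * q + 3) * exp (- (c * k\<^sup>2)) \<le> ?L powr (8 * q + 3) * (exp c * exp (- (c / 2 * ?L\<^sup>2)))"
        by (intro mult_left_mono) (auto simp flip: exp_add)
      also have "\<dots> \<le> exp c * C1"
        using C1(2)[of ?L] L by (simp add: mult.left_commute mult_left_mono)
      finally have "?L powr (8 * q + 3) * exp (- (c * k\<^sup>2)) \<le> exp c * C1" .
      then have "(?L powr (- (2 * q)) * (2 * M)) * (?L powr (8 * q + 3) * exp (- (c * k\<^sup>2))) \<le> (?L powr (- (2 * q)) * (2 * M)) * (exp c * C1)"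
        using M(1) by (intro mult_left_mono) auto
      then have 2: "1 / \<eta> ^ 3 * D \<le> ?L powr (- (2 * q)) * (2 * M * (exp c * C1))"
        unfolding \<eta>3 D_def by (simp only: mult_ac)
      from add_mono[OF 1 2] show ?thesis
        by (simp add: a_def C2_def algebra_simps)
    qed
    have A: "(\<integral>\<^sup>+\<xi>. ennreal ((norm \<xi> * \<bar>\<xi> $ 3\<bar>) powr (1/2) * (norm (fourier u \<xi>))\<^sup>2) \<partial>lborel) \<le> ennreal a"
    proof -
      have "(\<integral>\<^sup>+\<xi>. ennreal ((norm \<xi> * \<bar>\<xi> $ 3\<bar>) powr (1/2) * (norm (fourier u \<xi>))\<^sup>2) \<partial>lborel)
          \<le> (\<integral>\<^sup>+\<xi>. ennreal \<eta> * ennreal (norm \<xi> * (norm (fourier u \<xi>))\<^sup>2) + ennreal (1 / \<eta> ^ 3) * ennreal ((\<xi> $ 3)\<^sup>2 / norm \<xi> * (norm (fourier u \<xi>))\<^sup>2) \<partial>lborel)"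
      proof (rule nn_integral_mono)
        fix \<xi> :: "real^3"
        have "(norm \<xi> * \<bar>\<xi> $ 3\<bar>) powr (1/2) \<le> \<eta> * norm \<xi> + 1 / \<eta> ^ 3 * ((\<xi> $ 3)\<^sup>2 / norm \<xi>)"
          using anisotropic_weight_interpolation[OF _ component_le_norm_cart \<eta>, of \<xi> 3] by simp
        then have "(norm \<xi> * \<bar>\<xi> $ 3\<bar>) powr (1/2) * (norm (fourier u \<xi>))\<^sup>2 \<le> (\<eta> * norm \<xi> + 1 / \<eta> ^ 3 * ((\<xi> $ 3)\<^sup>2 / norm \<xi>)) * (norm (fourier u \<xi>))\<^sup>2"
          by (rule mult_right_mono) simp
        also have "\<dots> = \<eta> * (norm \<xi> * (norm (fourier u \<xi>))\<^sup>2) + 1 / \<eta> ^ 3 * ((\<xi> $ 3)\<^sup>2 / norm \<xi> * (norm (fourier u \<xi>))\<^sup>2)"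
          by (simp add: distrib_right)
        finally have "ennreal ((norm \<xi> * \<bar>\<xi> $ 3\<bar>) powr (1/2) * (norm (fourier u \<xi>))\<^sup>2) \<le> ennreal \<dots>"
          by (rule ennreal_leI)
        also have "\<dots> = ennreal \<eta> * ennreal (norm \<xi> * (norm (fourier u \<xi>))\<^sup>2) + ennreal (1 / \<eta> ^ 3) * ennreal ((\<xi> $ 3)\<^sup>2 / norm \<xi> * (norm (fourier u \<xi>))\<^sup>2)"
          using \<eta> by (subst ennreal_plus) (auto simp: ennreal_mult[symmetric])
        finally show "ennreal ((norm \<xi> * \<bar>\<xi> $ 3\<bar>) powr (1/2) * (norm (fourier u \<xi>))\<^sup>2)
           \<le> ennreal \<eta> * ennreal (norm \<xi> * (norm (fourier u \<xi>))\<^sup>2) + ennreal (1 / \<eta> ^ 3) * ennreal ((\<xi> $ 3)\<^sup>2 / norm \<xi> * (norm (fourier u \<xi>))\<^sup>2)" .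
      qed
      also have "\<dots> = ennreal \<eta> * (\<integral>\<^sup>+\<xi>. ennreal (norm \<xi> * (norm (fourier u \<xi>))\<^sup>2) \<partial>lborel)
          + ennreal (1 / \<eta> ^ 3) * (\<integral>\<^sup>+\<xi>. ennreal ((\<xi> $ 3)\<^sup>2 / norm \<xi> * (norm (fourier u \<xi>))\<^sup>2) \<partial>lborel)"
        by (simp add: nn_integral_add nn_integral_cmult)
      also have "\<dots> \<le> ennreal \<eta> * ennreal k + ennreal (1 / \<eta> ^ 3) * ennreal D"
        by (intro add_mono mult_left_mono K1 K3) auto
      also have "\<dots> = ennreal (\<eta> * k + 1 / \<eta> ^ 3 * D)"
        using \<eta> k D0 by (subst ennreal_plus) (auto simp: ennreal_mult[symmetric])
      also have "\<dots> \<le> ennreal a"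
        by (rule ennreal_leI[OF a_ge])
      finally show ?thesis .
    qed
    have "(\<integral>\<^sup>+\<xi>. ennreal (indicator (cball 0 N) \<xi> * norm (fourier u \<xi>)) \<partial>lborel) \<le> ennreal (sqrt (32 * C2) * (1 + k) powr (- q) * N)" if N: "0 < N" for N
    proof -
      have "(\<integral>\<^sup>+\<xi>. ennreal (indicator (cball 0 N) \<xi> * norm (fourier u \<xi>)) \<partial>lborel) \<le> ennreal (sqrt (32 * a) * N)"
        by (rule low_frequency_bound[OF _ _ a0 A N]) auto
      also have "sqrt (32 * a) = sqrt (32 * C2) * sqrt ((1 + k) powr (- (2 * q)))"
        by (simp add: a_def real_sqrt_mult)
      also have "sqrt ((1 + k) powr (- (2 * q))) = (1 + k) powr (- q)"
        using k by (simp add: powr_half_sqrt[symmetric] powr_powr)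
      finally show ?thesis .
    qed
    then have "frequency_controlled u (sqrt (32 * C2) * (1 + k) powr (- q)) k"
      unfolding frequency_controlled_def using H(1) k K1 C2 by simp
    then show "\<exists>k. frequency_controlled u (sqrt (32 * C2) * (1 + k) powr (- q)) k" ..
  qed
qed

text \<open>With \<open>B\<close> of order \<open>(1 +
  k)\<^sup>-\<^sup>1\<^sup>/\<^sup>(\<^sup>q\<^sup>-\<^sup>2\<^sup>)\<close> the product of
  \<open>B\<^sup>q\<^sup>-\<^sup>2\<close> and \<open>k\<close> is bounded; at \<open>p =
  \<infinity>\<close> the norm is linear in \<open>B\<close>, and no decay of \<open>B\<close> is
  called for.\<close>

theorem Gamma_2d_bounded_Besov:
  assumes \<nu>: "0 < \<nu>" and \<phi>: "LP_function \<phi>" and p: "2 < (p::ennreal)"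
  shows "bounded_wrt (besov_norm \<phi> (- 1 + enn2real (3 / p)) p) (Gamma_2d \<nu>)"
proof (cases p)
  case (real q)
  then have q: "2 < q"
    using p by (simp add: ennreal_less_iff flip: ennreal_numeral)
  have s: "enn2real (3 / p) = 3 / q"
    using real q divide_ennreal[of 3 q] by simp
  have "\<exists>C>0. \<forall>u B k. frequency_controlled u B k \<longrightarrow>
      besov_norm \<phi> (- 1 + 3 / q) (ennreal q) u \<le> ennreal ((C * (B powr (q - 2) * k)) powr (1 / q))"
    using besov_heat_bound[of q] besov_LP_bound[OF q _ \<phi>] by (cases "3 < q") (blast, simp)
  then obtain C where C: "0 < C" "\<And>u B k. frequency_controlled u B k \<Longrightarrow>
      besov_norm \<phi> (- 1 + 3 / q) (ennreal q) u \<le> ennreal ((C * (B powr (q - 2) * k)) powr (1 / q))"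
    by blast
  obtain C' where C': "0 < C'" "\<And>u. u \<in> Gamma_2d \<nu> \<Longrightarrow> \<exists>k. frequency_controlled u (C' * (1 + k) powr (- (1 / (q - 2)))) k"
    using Gamma_low_frequency_bound[OF \<nu>, of "1 / (q - 2)"] q by auto
  have "besov_norm \<phi> (- 1 + 3 / q) (ennreal q) u \<le> ennreal ((C * C' powr (q - 2)) powr (1 / q))" if u: "u \<in> Gamma_2d \<nu>" for u
  proof -
    obtain k where fc: "frequency_controlled u (C' * (1 + k) powr (- (1 / (q - 2)))) k"
      using C'(2)[OF u] by blast
    then have k: "0 \<le> k" by (simp add: frequency_controlled_def)
    let ?B = "C' * (1 + k) powr (- (1 / (q - 2)))"
    have "besov_norm \<phi> (- 1 + 3 / q) (ennreal q) u \<le> ennreal ((C * (?B powr (q - 2) * k)) powr (1 / q))"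
      by (rule C(2)[OF fc])
    also have "\<dots> \<le> ennreal ((C * C' powr (q - 2)) powr (1 / q))"
    proof (intro ennreal_leI powr_mono2)
      have "?B powr (q - 2) * k = C' powr (q - 2) * (k / (1 + k))"
      proof -
        have "?B powr (q - 2) = C' powr (q - 2) * (1 + k) powr (- (1 / (q - 2)) * (q - 2))"
          by (simp only: powr_mult powr_powr)
        also have "- (1 / (q - 2)) * (q - 2) = - 1"
          using q by simp
        finally show ?thesis
          using k by (simp add: powr_minus divide_inverse mult_ac)
      qed
      also have "\<dots> \<le> C' powr (q - 2) * 1"
        using k by (intro mult_left_mono) auto
      finally show "C * (?B powr (q - 2) * k) \<le> C * C' powr (q - 2)"
        using C(1) by simp
    qed (use q C(1) k in auto)
    finally show ?thesis .
  qed
  then have "(SUP u\<in>Gamma_2d \<nu>. besov_norm \<phi> (- 1 + enn2real (3 / p)) p u) \<le> ennreal ((C * C' powr (q - 2)) powr (1 / q))"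
    unfolding s using real by (intro SUP_least) simp
  then show ?thesis
    unfolding bounded_wrt_def by (rule le_less_trans) simp
next
  case top
  obtain C where C: "0 < C" "\<And>u B k. frequency_controlled u B k \<Longrightarrow> besov_norm \<phi> (- 1) \<infinity> u \<le> ennreal (C * B)"
    using besov_heat_infinity_bound by blast
  obtain C' where C': "0 < C'" "\<And>u. u \<in> Gamma_2d \<nu> \<Longrightarrow> \<exists>k. frequency_controlled u (C' * (1 + k) powr (- 0)) k"
    using Gamma_low_frequency_bound[OF \<nu>, of 0] by blast
  have "besov_norm \<phi> (- 1) \<infinity> u \<le> ennreal (C * C')" if u: "u \<in> Gamma_2d \<nu>" for u
  proof -
    obtain k where k: "frequency_controlled u (C' * (1 + k) powr (- 0)) k"
      using C'(2)[OF u] by blast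
    then have "0 \<le> k" by (simp add: frequency_controlled_def)
    with C(2)[OF k] show ?thesis by simp
  qed
  then have "(SUP u\<in>Gamma_2d \<nu>. besov_norm \<phi> (- 1 + enn2real (3 / p)) p u) \<le> ennreal (C * C')"
    unfolding top by (intro SUP_least) simp
  then show ?thesis
    unfolding bounded_wrt_def by (rule le_less_trans) simp
qed

section \<open>Vertically stretched swirls\<close>

definition squeeze :: "real \<Rightarrow> real^3 \<Rightarrow> real^3" where
  "squeeze \<epsilon> x = (\<chi> i. if i = 3 then \<epsilon> * x $ 3 else x $ i)"

lemma squeeze_nth [simp]: "squeeze \<epsilon> x $ 1 = x $ 1" "squeeze \<epsilon> x $ 2 = x $ 2" "squeeze \<epsilon> x $ 3 = \<epsilon> * x $ 3"
  by (simp_all add: squeeze_def)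

lemma norm_sq_real3: "(norm (x :: real^3))\<^sup>2 = (x $ 1)\<^sup>2 + (x $ 2)\<^sup>2 + (x $ 3)\<^sup>2"
  by (simp add: norm_sq_vec sum_3)

lemma norm_squeeze_le:
  assumes "0 \<le> \<epsilon>" "\<epsilon> \<le> 1"
  shows "norm (squeeze \<epsilon> x) \<le> norm x"
proof (rule power2_le_imp_le)
  have "(\<epsilon> * x $ 3)\<^sup>2 \<le> (x $ 3)\<^sup>2"
    using assms by (simp add: power_mult_distrib mult_left_le_one_le power_le_one)
  then show "(norm (squeeze \<epsilon> x))\<^sup>2 \<le> (norm x)\<^sup>2"
    by (simp add: norm_sq_real3)
qed simp

lemma squeeze_measurable [measurable]: "squeeze \<epsilon> \<in> borel_measurable borel"
proof (rule borel_measurable_vec)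
  show "(\<lambda>x. squeeze \<epsilon> x $ i) \<in> borel_measurable borel" for i
    using exhaust_3[of i] by auto
qed

text \<open>The linear change of variables with determinant \<open>\<epsilon>\<close>.\<close>

lemma nn_integral_squeeze:
  fixes f :: "real^3 \<Rightarrow> ennreal"
  assumes [measurable]: "f \<in> borel_measurable borel" and \<epsilon>: "0 < \<epsilon>"
  shows "(\<integral>\<^sup>+x. f x \<partial>lborel) = ennreal \<epsilon> * (\<integral>\<^sup>+x. f (squeeze \<epsilon> x) \<partial>lborel)"
proof -
  define c where "c b = (if b = axis 3 1 then \<epsilon> else 1)" for b :: "real^3"
  have inj: "inj_on (\<lambda>i. axis i 1 :: real^3) UNIV"
    by (auto simp: inj_on_def axis_eq_axis)
  have Basis: "(Basis :: (real^3) set) = (\<lambda>i. axis i 1) ` UNIV"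
    by (auto simp: Basis_vec_def)
  have T: "0 + (\<Sum>j\<in>Basis. (c j * (x \<bullet> j)) *\<^sub>R j) = squeeze \<epsilon> x" for x
    unfolding Basis sum.reindex[OF inj] 
    by (simp add: vec_eq_iff forall_3 sum_3 c_def axis_eq_axis cart_eq_inner_axis[symmetric]) (simp add: axis_def)
  have P: "(\<Prod>j\<in>Basis. \<bar>c j\<bar>) = \<epsilon>"
    unfolding Basis prod.reindex[OF inj] using \<epsilon> by (simp add: prod_UNIV_3 c_def axis_eq_axis)
  have "lborel = density (distr lborel borel (\<lambda>x. 0 + (\<Sum>j\<in>Basis. (c j * (x \<bullet> j)) *\<^sub>R j))) (\<lambda>_. (\<Prod>j\<in>Basis. \<bar>c j\<bar>))"
    using \<epsilon> by (intro lborel_affine_euclidean) (auto simp: c_def)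
  then have "lborel = density (distr lborel borel (squeeze \<epsilon>)) (\<lambda>_. ennreal \<epsilon>)"
    unfolding T P by simp
  then have "(\<integral>\<^sup>+x. f x \<partial>lborel) = (\<integral>\<^sup>+x. f x \<partial>density (distr lborel borel (squeeze \<epsilon>)) (\<lambda>_. ennreal \<epsilon>))"
    by simp
  also have "\<dots> = ennreal \<epsilon> * (\<integral>\<^sup>+x. f (squeeze \<epsilon> x) \<partial>lborel)"
    by (simp add: nn_integral_density nn_integral_distr nn_integral_cmult)
  finally show ?thesis .
qed

text \<open>The squared modulus of the transform of the planar swirl with Gaussian stream function
  \<open>exp (- \<pi> \<bar>x\<bar>\<^sup>2)\<close>, that is for \<open>\<epsilon> = 1\<close>
  and \<open>a = 1\<close>.\<close>

definition profile :: "real^3 \<Rightarrow> real" where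
  "profile \<eta> = 4 * pi\<^sup>2 * ((\<eta> $ 1)\<^sup>2 + (\<eta> $ 2)\<^sup>2) * exp (- 2 * pi * (norm \<eta>)\<^sup>2)"

lemma profile_nonneg: "0 \<le> profile \<eta>"
  by (simp add: profile_def)

lemma profile_measurable [measurable]: "profile \<in> borel_measurable borel"
  unfolding profile_def by measurable

lemma profile_moment_finite:
  obtains c where "0 < c" "(\<integral>\<^sup>+\<eta>. ennreal ((1 + (norm \<eta>)\<^sup>2) * profile \<eta>) \<partial>lborel) \<le> ennreal c"
proof -
  obtain C where C: "0 < C" "\<And>y::real. 0 \<le> y \<Longrightarrow> y powr 4 * exp (- (1 * y\<^sup>2)) \<le> C"
    by (rule powr_times_gaussian_bounded[of 4 1]) auto
  have "(1 + (norm \<eta>)\<^sup>2) * profile \<eta> \<le> 4 * pi\<^sup>2 * (1 + 2 * C) * exp (- 1 * (norm \<eta>)\<^sup>2)" for \<eta> :: "real^3"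
  proof -
    let ?r = "norm \<eta>"
    have "?r ^ 4 * exp (- ?r\<^sup>2) \<le> C"
      using C(2)[of ?r] by simp
    moreover have "exp (- ?r\<^sup>2) \<le> 1" by simp
    moreover have "(1 + 2 * ?r ^ 4) * exp (- ?r\<^sup>2) = exp (- ?r\<^sup>2) + 2 * (?r ^ 4 * exp (- ?r\<^sup>2))"
      by (simp add: algebra_simps)
    ultimately have b: "(1 + 2 * ?r ^ 4) * exp (- ?r\<^sup>2) \<le> 1 + 2 * C"
      by linarith
    have r2: "?r\<^sup>2 \<le> 1 + ?r ^ 4"
      using sum_square_weighted[of 1 "?r\<^sup>2" "-1"] zero_le_power2[of "?r\<^sup>2 - 1"] zero_le_power2[of "?r\<^sup>2"]
      by (simp add: power2_diff)
    have "(1 + ?r\<^sup>2) * ((\<eta> $ 1)\<^sup>2 + (\<eta> $ 2)\<^sup>2) \<le> (1 + ?r\<^sup>2) * ?r\<^sup>2"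
      by (intro mult_left_mono) (auto simp: norm_sq_real3)
    also have "\<dots> \<le> 1 + 2 * ?r ^ 4"
      using r2 by (simp add: algebra_simps flip: power_add)
    finally have a: "(1 + ?r\<^sup>2) * ((\<eta> $ 1)\<^sup>2 + (\<eta> $ 2)\<^sup>2) \<le> 1 + 2 * ?r ^ 4" .
    have "2 * ?r\<^sup>2 \<le> 2 * pi * ?r\<^sup>2"
      using pi_gt3 by (intro mult_right_mono) auto
    then have e: "exp (- 2 * pi * ?r\<^sup>2) \<le> exp (- ?r\<^sup>2) * exp (- ?r\<^sup>2)"
      by (simp flip: exp_add)
    have "((1 + ?r\<^sup>2) * ((\<eta> $ 1)\<^sup>2 + (\<eta> $ 2)\<^sup>2)) * exp (- 2 * pi * ?r\<^sup>2) \<le> (1 + 2 * ?r ^ 4) * (exp (- ?r\<^sup>2) * exp (- ?r\<^sup>2))"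
      by (intro mult_mono a e) auto
    also have "\<dots> \<le> (1 + 2 * C) * exp (- ?r\<^sup>2)"
      using mult_right_mono[OF b, of "exp (- ?r\<^sup>2)"] by (simp add: mult.assoc)
    finally have "4 * pi\<^sup>2 * (((1 + ?r\<^sup>2) * ((\<eta> $ 1)\<^sup>2 + (\<eta> $ 2)\<^sup>2)) * exp (- 2 * pi * ?r\<^sup>2)) \<le> 4 * pi\<^sup>2 * ((1 + 2 * C) * exp (- ?r\<^sup>2))"
      by (intro mult_left_mono) auto
    then show ?thesis
      by (simp add: profile_def mult_ac)
  qed
  then have "(\<integral>\<^sup>+\<eta>. ennreal ((1 + (norm \<eta>)\<^sup>2) * profile \<eta>) \<partial>lborel) \<le> (\<integral>\<^sup>+\<eta>. ennreal (4 * pi\<^sup>2 * (1 + 2 * C) * exp (- 1 * (norm (\<eta>::real^3))\<^sup>2)) \<partial>lborel)"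
    by (intro nn_integral_mono ennreal_leI)
  also have "\<dots> = ennreal (LINT \<eta>|lborel. 4 * pi\<^sup>2 * (1 + 2 * C) * exp (- 1 * (norm (\<eta>::real^3))\<^sup>2))"
    using C(1) by (intro nn_integral_eq_integral integrable_mult_right gaussian_integrable) auto
  also have "\<dots> \<le> ennreal (max 1 (LINT \<eta>|lborel. 4 * pi\<^sup>2 * (1 + 2 * C) * exp (- 1 * (norm (\<eta>::real^3))\<^sup>2)))"
    by (rule ennreal_leI) simp
  finally show thesis
    by (intro that) auto
qed

text \<open>On a ball of radius at most \<open>1/2\<close> about the first unit vector
  \<open>\<eta>\<^sub>1 \<ge> 1/2\<close>, so the factor \<open>\<eta>\<^sub>1\<^sup>2 +
  \<eta>\<^sub>2\<^sup>2\<close> does not degenerate.\<close>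

lemma profile_ball_positive:
  assumes r: "0 < r" "r \<le> 1/2"
  obtains p where "0 < p" "ennreal p \<le> (\<integral>\<^sup>+\<eta>. ennreal (indicator (ball (axis 1 1) r) \<eta> * profile \<eta>) \<partial>lborel)"
proof -
  let ?e = "axis 1 1 :: real^3"
  let ?p0 = "pi\<^sup>2 * exp (- 2 * pi * 4)"
  have lower: "?p0 \<le> profile \<eta>" if "\<eta> \<in> ball ?e r" for \<eta>
  proof -
    have d: "norm (\<eta> - ?e) < 1/2"
      using that r by (simp add: dist_norm norm_minus_commute)
    have "\<bar>(\<eta> - ?e) $ 1\<bar> < 1/2"
      using component_le_norm_cart[of "\<eta> - ?e" 1] d by linarith
    then have "\<bar>\<eta> $ 1 - 1\<bar> < 1/2" by (simp add: axis_def)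
    then have "1/2 \<le> \<eta> $ 1" by linarith
    then have "(1/2)\<^sup>2 \<le> (\<eta> $ 1)\<^sup>2"
      by (intro power_mono) auto
    then have a: "1 \<le> 4 * ((\<eta> $ 1)\<^sup>2 + (\<eta> $ 2)\<^sup>2)"
    proof -
      have "1/4 \<le> (\<eta> $ 1)\<^sup>2"
        using \<open>(1/2)\<^sup>2 \<le> (\<eta> $ 1)\<^sup>2\<close> by (simp add: power_divide)
      with zero_le_power2[of "\<eta> $ 2"] show ?thesis
        by argo
    qed
    have "norm \<eta> \<le> norm (\<eta> - ?e) + norm ?e"
      by (metis diff_add_cancel norm_triangle_ineq)
    then have "norm \<eta> \<le> 2" using d by simp
    then have "(norm \<eta>)\<^sup>2 \<le> 2\<^sup>2" by (intro power_mono) auto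
    then have "2 * pi * (norm \<eta>)\<^sup>2 \<le> 2 * pi * 4"
      by (intro mult_left_mono) auto
    then have b: "exp (- 2 * pi * 4) \<le> exp (- 2 * pi * (norm \<eta>)\<^sup>2)"
      by simp
    have "pi\<^sup>2 * (1 * exp (- 2 * pi * 4)) \<le> pi\<^sup>2 * ((4 * ((\<eta> $ 1)\<^sup>2 + (\<eta> $ 2)\<^sup>2)) * exp (- 2 * pi * (norm \<eta>)\<^sup>2))"
      by (intro mult_left_mono mult_mono a b) auto
    also have "\<dots> = profile \<eta>"
      by (simp only: profile_def mult_ac)
    finally show ?thesis by simp
  qed
  have fin: "emeasure lborel (ball ?e r) < \<infinity>"
    by (rule emeasure_bounded_finite) simp
  have pos: "0 < measure lborel (ball ?e r)"
    using content_ball_pos[OF r(1), of ?e] by simp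
  have "ennreal (?p0 * measure lborel (ball ?e r)) = ennreal ?p0 * emeasure lborel (ball ?e r)"
    using fin by (subst emeasure_eq_ennreal_measure) (auto simp: ennreal_mult)
  also have "\<dots> = (\<integral>\<^sup>+\<eta>. ennreal ?p0 * indicator (ball ?e r) \<eta> \<partial>lborel)"
    by (subst nn_integral_cmult_indicator) auto
  also have "\<dots> \<le> (\<integral>\<^sup>+\<eta>. ennreal (indicator (ball ?e r) \<eta> * profile \<eta>) \<partial>lborel)"
    using lower by (intro nn_integral_mono) (auto simp: indicator_def ennreal_leI)
  finally show thesis
    using pos by (intro that[of "?p0 * measure lborel (ball ?e r)"]) auto
qed

lemma anisotropic_gaussian:
  assumes \<epsilon>: "0 < \<epsilon>"
  defines "G \<equiv> \<lambda>x::real^3. exp (- (pi * (norm (squeeze \<epsilon> x))\<^sup>2))"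
  shows "is_L2 G" "has_L2_ft (\<lambda>x. complex_of_real (G x)) (\<lambda>\<xi>. complex_of_real (exp (- (pi * (norm (squeeze (1 / \<epsilon>) \<xi>))\<^sup>2)) / \<epsilon>))"
proof -
  define c where "c b = (if b = axis 3 1 then \<epsilon> else 1)" for b :: "real^3"
  have c: "0 < c b" for b using \<epsilon> by (simp add: c_def)
  have inj: "inj_on (\<lambda>i. axis i 1 :: real^3) UNIV"
    by (auto simp: inj_on_def axis_eq_axis)
  have Basis: "(Basis :: (real^3) set) = (\<lambda>i. axis i 1) ` UNIV"
    by (auto simp: Basis_vec_def)
  have pr: "(\<Prod>b\<in>Basis. F b) = F (axis 1 1) * F (axis 2 1) * F (axis 3 1)" for F :: "real^3 \<Rightarrow> complex"
    unfolding Basis prod.reindex[OF inj] by (simp add: prod_UNIV_3)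
  let ?f = "\<lambda>b x. complex_of_real (exp (- (pi * (c b)\<^sup>2) * x\<^sup>2))"
  have f: "integrable lborel (?f b)" for b
    using c[of b] by (intro integrable_of_real gaussian_integrable_real) auto
  have Geq: "complex_of_real (G x) = (\<Prod>b\<in>Basis. ?f b (x \<bullet> b))" for x
    unfolding pr G_def
    by (simp add: c_def axis_eq_axis cart_eq_inner_axis[symmetric] norm_sq_real3 power_mult_distrib algebra_simps
        flip: of_real_mult exp_add)
  have int: "integrable lborel (\<lambda>x. complex_of_real (G x))"
    unfolding Geq by (rule lborel_integral_prod_Basis(1)[OF f])
  have "norm (complex_of_real (G x)) \<le> 1" for x by (simp add: G_def)
  from L2sq_bounded_integrable(1)[OF int this] have L2: "is_L2 (\<lambda>x. complex_of_real (G x))"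
    using borel_measurable_integrable[OF int] by (simp add: is_L2_def)
  have "G \<in> borel_measurable borel"
    unfolding G_def by measurable
  with L2 show "is_L2 G"
    by (simp add: is_L2_def L2sq_def)
  have ft: "ft (\<lambda>x. complex_of_real (G x)) \<xi> = complex_of_real (exp (- (pi * (norm (squeeze (1 / \<epsilon>) \<xi>))\<^sup>2)) / \<epsilon>)" for \<xi>
  proof -
    have "ft (\<lambda>x. complex_of_real (G x)) \<xi> = (LINT x|lborel. (\<Prod>b\<in>Basis. ?f b (x \<bullet> b) * cis (- 2 * pi * (x \<bullet> b * (\<xi> \<bullet> b)))))"
    proof -
      have "cis (- 2 * pi * (x \<bullet> \<xi>)) = (\<Prod>b\<in>Basis. cis (- 2 * pi * (x \<bullet> b * (\<xi> \<bullet> b))))" for x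
      proof -
        have "x \<bullet> \<xi> = x $ 1 * \<xi> $ 1 + x $ 2 * \<xi> $ 2 + x $ 3 * \<xi> $ 3"
          by (simp add: inner_vec_def sum_3)
        then show ?thesis
          unfolding pr cis_mult cart_eq_inner_axis[symmetric] by (simp add: algebra_simps)
      qed
      then show ?thesis
        unfolding ft_def Geq prod.distrib by simp
    qed
    also have "\<dots> = (\<Prod>b\<in>Basis. LINT x|lborel. ?f b x * cis (- 2 * pi * (x * (\<xi> \<bullet> b))))"
      by (intro lborel_integral_prod_Basis integrable_mult_cis f) auto
    also have "\<dots> = (\<Prod>b\<in>Basis. complex_of_real (exp (- pi * (\<xi> \<bullet> b)\<^sup>2 / (c b)\<^sup>2) / c b))"
      by (simp only: gaussian_ft_real[OF c])
    also have "\<dots> = complex_of_real (\<Prod>b\<in>Basis. exp (- pi * (\<xi> \<bullet> b)\<^sup>2 / (c b)\<^sup>2) / c b)"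
      by (simp only: of_real_prod)
    also have "(\<Prod>b\<in>Basis. exp (- pi * (\<xi> \<bullet> b)\<^sup>2 / (c b)\<^sup>2) / c b) = exp (- (pi * (norm (squeeze (1 / \<epsilon>) \<xi>))\<^sup>2)) / \<epsilon>"
      unfolding Basis prod.reindex[OF inj]
      by (simp add: prod_UNIV_3 c_def axis_eq_axis cart_eq_inner_axis[symmetric] norm_sq_real3 power_divide
          algebra_simps flip: exp_add)
    finally show ?thesis .
  qed
  show "has_L2_ft (\<lambda>x. complex_of_real (G x)) (\<lambda>\<xi>. complex_of_real (exp (- (pi * (norm (squeeze (1 / \<epsilon>) \<xi>))\<^sup>2)) / \<epsilon>))"
    using has_L2_ft_integrable[OF int L2] unfolding ft .
qed

text \<open>Only these spectral properties of the swirl enter later: it is horizontal,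
  horizontally divergence free, and all its weighted spectral masses are integrals against one
  fixed profile with \<open>\<xi>\<^sub>3\<close> shrunk by \<open>\<epsilon>\<close>. The
  amplitude is normalised so that \<open>\<epsilon>\<close> enters through the weight alone.\<close>

definition swirl_spectrum :: "real \<Rightarrow> real \<Rightarrow> (real^3 \<Rightarrow> real^3) \<Rightarrow> bool" where
  "swirl_spectrum a \<epsilon> u \<longleftrightarrow> is_L2 u \<and>
     (AE \<xi> in lborel. fourier u \<xi> $ 3 = 0 \<and>
        complex_of_real (\<xi> $ 1) * fourier u \<xi> $ 1 + complex_of_real (\<xi> $ 2) * fourier u \<xi> $ 2 = 0) \<and>
     (\<forall>w. w \<in> borel_measurable borel \<and> (\<forall>\<xi>. 0 \<le> w \<xi>) \<longrightarrow>
        (\<integral>\<^sup>+\<xi>. ennreal (w \<xi> * (norm (fourier u \<xi>))\<^sup>2) \<partial>lborel)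
          = (\<integral>\<^sup>+\<eta>. ennreal (a\<^sup>2 * (w (squeeze \<epsilon> \<eta>) * profile \<eta>)) \<partial>lborel))"

text \<open>The field is \<open>a \<surd>\<epsilon> (\<partial>\<^sub>2 G, - \<partial>\<^sub>1 G,
  0)\<close> for the stretched Gaussian \<open>G\<close>. Its transform has size \<open>1 /
  \<epsilon>\<close> on a set of height \<open>\<epsilon>\<close>, hence squared mass of order
  \<open>1 / \<epsilon>\<close>, which the amplitude compensates.\<close>

lemma swirl_field_exists:
  assumes a: "0 < a" and \<epsilon>: "0 < \<epsilon>"
  shows "\<exists>u. swirl_spectrum a \<epsilon> u"
proof -
  define \<gamma> where "\<gamma> \<xi> = exp (- (pi * (norm (squeeze (1 / \<epsilon>) \<xi>))\<^sup>2)) / \<epsilon>" for \<xi>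
  define G where "G = (\<lambda>x::real^3. exp (- (pi * (norm (squeeze \<epsilon> x))\<^sup>2)))"
  have GG: "is_L2 G" "has_L2_ft (\<lambda>x. complex_of_real (G x)) (\<lambda>\<xi>. complex_of_real (\<gamma> \<xi>))"
    using anisotropic_gaussian[OF \<epsilon>] unfolding G_def \<gamma>_def by blast+
  have [measurable]: "\<gamma> \<in> borel_measurable borel"
    unfolding \<gamma>_def by measurable
  have sq: "squeeze (1 / \<epsilon>) (squeeze \<epsilon> \<eta>) = \<eta>" for \<eta>
    using \<epsilon> by (simp add: vec_eq_iff forall_3)
  have \<gamma>2: "4 * pi\<^sup>2 * ((\<xi> $ 1)\<^sup>2 + (\<xi> $ 2)\<^sup>2) * (\<gamma> \<xi>)\<^sup>2 = profile (squeeze (1 / \<epsilon>) \<xi>) / \<epsilon>\<^sup>2" for \<xi>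
    by (simp add: \<gamma>_def profile_def power_divide mult_ac flip: exp_double)
  have scale: "(\<integral>\<^sup>+\<xi>. ennreal (w \<xi> * (profile (squeeze (1 / \<epsilon>) \<xi>) / \<epsilon>\<^sup>2)) \<partial>lborel)
      = (\<integral>\<^sup>+\<eta>. ennreal (1 / \<epsilon> * (w (squeeze \<epsilon> \<eta>) * profile \<eta>)) \<partial>lborel)"
    if [measurable]: "w \<in> borel_measurable borel" and w: "\<And>\<xi>. 0 \<le> w \<xi>" for w :: "real^3 \<Rightarrow> real"
  proof -
    have "(\<integral>\<^sup>+\<xi>. ennreal (w \<xi> * (profile (squeeze (1 / \<epsilon>) \<xi>) / \<epsilon>\<^sup>2)) \<partial>lborel)
        = ennreal \<epsilon> * (\<integral>\<^sup>+\<eta>. ennreal (w (squeeze \<epsilon> \<eta>) * (profile \<eta> / \<epsilon>\<^sup>2)) \<partial>lborel)"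
      by (subst nn_integral_squeeze[OF _ \<epsilon>]) (simp_all add: sq)
    also have "\<dots> = (\<integral>\<^sup>+\<eta>. ennreal \<epsilon> * ennreal (w (squeeze \<epsilon> \<eta>) * (profile \<eta> / \<epsilon>\<^sup>2)) \<partial>lborel)"
      by (rule nn_integral_cmult[symmetric]) simp
    also have "\<dots> = (\<integral>\<^sup>+\<eta>. ennreal (1 / \<epsilon> * (w (squeeze \<epsilon> \<eta>) * profile \<eta>)) \<partial>lborel)"
      using \<epsilon> w profile_nonneg by (intro nn_integral_cong) (simp add: power2_eq_square mult_ac flip: ennreal_mult)
    finally show ?thesis .
  qed
  obtain c where c: "0 < c" "(\<integral>\<^sup>+\<eta>. ennreal ((1 + (norm \<eta>)\<^sup>2) * profile \<eta>) \<partial>lborel) \<le> ennreal c"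
    using profile_moment_finite by blast
  have mass: "(\<integral>\<^sup>+\<eta>. ennreal (1 / \<epsilon> * (1 * profile \<eta>)) \<partial>lborel) < \<infinity>"
  proof -
    have "(\<integral>\<^sup>+\<eta>. ennreal (1 / \<epsilon> * (1 * profile \<eta>)) \<partial>lborel) \<le> (\<integral>\<^sup>+\<eta>. ennreal (1 / \<epsilon>) * ennreal ((1 + (norm \<eta>)\<^sup>2) * profile \<eta>) \<partial>lborel)"
    proof (rule nn_integral_mono)
      fix \<eta> :: "real^3"
      have "1 / \<epsilon> * (1 * profile \<eta>) \<le> 1 / \<epsilon> * ((1 + (norm \<eta>)\<^sup>2) * profile \<eta>)"
        using \<epsilon> profile_nonneg by (intro mult_left_mono mult_right_mono) auto
      then have "ennreal (1 / \<epsilon> * (1 * profile \<eta>)) \<le> ennreal (1 / \<epsilon> * ((1 + (norm \<eta>)\<^sup>2) * profile \<eta>))"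
        by (rule ennreal_leI)
      also have "\<dots> = ennreal (1 / \<epsilon>) * ennreal ((1 + (norm \<eta>)\<^sup>2) * profile \<eta>)"
        using \<epsilon> profile_nonneg by (intro ennreal_mult) auto
      finally show "ennreal (1 / \<epsilon> * (1 * profile \<eta>)) \<le> ennreal (1 / \<epsilon>) * ennreal ((1 + (norm \<eta>)\<^sup>2) * profile \<eta>)" .
    qed
    also have "\<dots> = ennreal (1 / \<epsilon>) * (\<integral>\<^sup>+\<eta>. ennreal ((1 + (norm \<eta>)\<^sup>2) * profile \<eta>) \<partial>lborel)"
      by (rule nn_integral_cmult) simp
    also have "\<dots> \<le> ennreal (1 / \<epsilon>) * ennreal c"
      by (intro mult_left_mono c) auto
    also have "\<dots> < \<infinity>"
      by (simp add: ennreal_mult_less_top)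
    finally show ?thesis .
  qed
  have fin: "L2sq (\<lambda>\<xi>. complex_of_real (\<xi> $ i) * complex_of_real (\<gamma> \<xi>)) < \<infinity>" if i: "i = 1 \<or> i = 2" for i :: 3
  proof -
    have "L2sq (\<lambda>\<xi>. complex_of_real (\<xi> $ i) * complex_of_real (\<gamma> \<xi>)) \<le> (\<integral>\<^sup>+\<xi>. ennreal (1 * (profile (squeeze (1 / \<epsilon>) \<xi>) / \<epsilon>\<^sup>2)) \<partial>lborel)"
      unfolding L2sq_def
    proof (intro nn_integral_mono ennreal_leI)
      fix \<xi> :: "real^3"
      have "1 \<le> 4 * pi\<^sup>2"
        using pi_gt3 power_mono[of 3 pi 2] by simp
      moreover have "(\<xi> $ i)\<^sup>2 \<le> (\<xi> $ 1)\<^sup>2 + (\<xi> $ 2)\<^sup>2"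
        using i by auto
      ultimately have "1 * (\<xi> $ i)\<^sup>2 * (\<gamma> \<xi>)\<^sup>2 \<le> 4 * pi\<^sup>2 * ((\<xi> $ 1)\<^sup>2 + (\<xi> $ 2)\<^sup>2) * (\<gamma> \<xi>)\<^sup>2"
        by (intro mult_right_mono mult_mono) auto
      then show "(norm (complex_of_real (\<xi> $ i) * complex_of_real (\<gamma> \<xi>)))\<^sup>2 \<le> 1 * (profile (squeeze (1 / \<epsilon>) \<xi>) / \<epsilon>\<^sup>2)"
        unfolding \<gamma>2 by (simp add: norm_mult power_mult_distrib)
    qed
    also have "\<dots> < \<infinity>"
      by (subst scale) (use mass in auto)
    finally show ?thesis .
  qed
  obtain D1 where D1: "is_L2 D1" "has_L2_ft (\<lambda>x. complex_of_real (D1 x)) (\<lambda>\<xi>. 2 * pi * \<i> * (\<xi> $ 1) * complex_of_real (\<gamma> \<xi>))"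
    by (rule weak_derivative_exists[OF GG fin[OF disjI1[OF refl]]]) auto
  obtain D2 where D2: "is_L2 D2" "has_L2_ft (\<lambda>x. complex_of_real (D2 x)) (\<lambda>\<xi>. 2 * pi * \<i> * (\<xi> $ 2) * complex_of_real (\<gamma> \<xi>))"
    by (rule weak_derivative_exists[OF GG fin[OF disjI2[OF refl]]]) auto
  \<comment> \<open>squared, this is \<open>a\<^sup>2 \<epsilon>\<close>, which cancels the
      \<open>1 / \<epsilon>\<close> in \<open>scale\<close>\<close>
  define s where "s = a * sqrt \<epsilon>"
  define u :: "real^3 \<Rightarrow> real^3" where "u x = vector [s * D2 x, - s * D1 x, 0]" for x
  have Dc: "is_L2 (\<lambda>x. complex_of_real (D1 x))" "is_L2 (\<lambda>x. complex_of_real (D2 x))"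
    using D1(1) D2(1) by (auto simp: is_L2_def L2sq_def)
  let ?U = "\<lambda>(i::3) \<xi>. if i = 1 then complex_of_real s * (2 * pi * \<i> * (\<xi> $ 2) * complex_of_real (\<gamma> \<xi>))
      else if i = 2 then complex_of_real (- s) * (2 * pi * \<i> * (\<xi> $ 1) * complex_of_real (\<gamma> \<xi>)) else 0"
  have uft: "has_L2_ft (\<lambda>x. complex_of_real (u x $ i)) (?U i)" for i
  proof -
    have "has_L2_ft (\<lambda>x::real^3. 0) (\<lambda>\<xi>. 0)"
      by (simp add: has_L2_ft_def ft_def truncate_def L2sq_def)
    then show ?thesis
      using exhaust_3[of i] has_L2_ft_cmult[OF Dc(2) D2(2), of "complex_of_real s"] has_L2_ft_cmult[OF Dc(1) D1(2), of "complex_of_real (- s)"]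
      by (auto simp: u_def)
  qed
  have uc: "is_L2 (\<lambda>x. complex_of_real (u x $ i))" for i
  proof -
    have "is_L2 (\<lambda>x::real^3. 0::complex)" by (simp add: is_L2_def L2sq_def)
    then show ?thesis
      using exhaust_3[of i] is_L2_cmult[OF Dc(2), of "complex_of_real s"] is_L2_cmult[OF Dc(1), of "complex_of_real (- s)"]
      by (auto simp: u_def)
  qed
  have um: "u \<in> borel_measurable borel"
  proof (rule borel_measurable_vec)
    fix i
    have "D1 \<in> borel_measurable borel" "D2 \<in> borel_measurable borel"
      using D1(1) D2(1) by (auto simp: is_L2_def)
    then show "(\<lambda>x. u x $ i) \<in> borel_measurable borel"
      using exhaust_3[of i] by (auto simp: u_def)
  qed
  have uL: "is_L2 u"
  proof -
    have "L2sq (\<lambda>x. u x $ i) = L2sq (\<lambda>x. complex_of_real (u x $ i))" for i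
      by (simp add: L2sq_def)
    then show ?thesis
      using uc um by (auto simp: is_L2_def L2sq_vec)
  qed
  note AE = fourier_AE_eq[OF uL uft]
  have "swirl_spectrum a \<epsilon> u"
    unfolding swirl_spectrum_def
  proof (intro conjI uL allI impI)
    show "AE \<xi> in lborel. fourier u \<xi> $ 3 = 0 \<and> complex_of_real (\<xi> $ 1) * fourier u \<xi> $ 1 + complex_of_real (\<xi> $ 2) * fourier u \<xi> $ 2 = 0"
      using AE by eventually_elim (simp add: algebra_simps)
    fix w :: "real^3 \<Rightarrow> real" assume "w \<in> borel_measurable borel \<and> (\<forall>\<xi>. 0 \<le> w \<xi>)"
    then have w[measurable]: "w \<in> borel_measurable borel" and w0: "\<And>\<xi>. 0 \<le> w \<xi>"
      by auto
    have "(\<integral>\<^sup>+\<xi>. ennreal (w \<xi> * (norm (fourier u \<xi>))\<^sup>2) \<partial>lborel)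
        = (\<integral>\<^sup>+\<xi>. ennreal ((s\<^sup>2 * w \<xi>) * (profile (squeeze (1 / \<epsilon>) \<xi>) / \<epsilon>\<^sup>2)) \<partial>lborel)"
    proof (rule nn_integral_cong_AE)
      show "AE \<xi> in lborel. ennreal (w \<xi> * (norm (fourier u \<xi>))\<^sup>2) = ennreal ((s\<^sup>2 * w \<xi>) * (profile (squeeze (1 / \<epsilon>) \<xi>) / \<epsilon>\<^sup>2))"
        using AE
      proof eventually_elim
        case (elim \<xi>)
        have "(norm (fourier u \<xi>))\<^sup>2 = s\<^sup>2 * (4 * pi\<^sup>2 * ((\<xi> $ 1)\<^sup>2 + (\<xi> $ 2)\<^sup>2) * (\<gamma> \<xi>)\<^sup>2)"
          unfolding norm_sq_vec using elim by (simp add: sum_3 norm_mult power_mult_distrib algebra_simps)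
        then show ?case
          unfolding \<gamma>2 by (simp add: mult_ac)
      qed
    qed
    also have "\<dots> = (\<integral>\<^sup>+\<eta>. ennreal (1 / \<epsilon> * ((s\<^sup>2 * w (squeeze \<epsilon> \<eta>)) * profile \<eta>)) \<partial>lborel)"
      using w0 by (intro scale) auto
    also have "\<dots> = (\<integral>\<^sup>+\<eta>. ennreal (a\<^sup>2 * (w (squeeze \<epsilon> \<eta>) * profile \<eta>)) \<partial>lborel)"
      using \<epsilon> by (intro nn_integral_cong) (simp add: s_def power_mult_distrib)
    finally show "(\<integral>\<^sup>+\<xi>. ennreal (w \<xi> * (norm (fourier u \<xi>))\<^sup>2) \<partial>lborel)
        = (\<integral>\<^sup>+\<eta>. ennreal (a\<^sup>2 * (w (squeeze \<epsilon> \<eta>) * profile \<eta>)) \<partial>lborel)" .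
  qed
  then show ?thesis by (rule exI[of _ u])
qed

section \<open>Large fields in the set\<close>

text \<open>A lower bound for all weighted spectral masses at once, because two different weights
  are used: that of a Sobolev norm and the square of a dyadic cutoff. The vector \<open>axis 1
  1\<close> stands for any point of the plane \<open>\<xi>\<^sub>3 = 0\<close> at which
  \<open>profile\<close> is positive; for \<open>\<epsilon>\<close> between \<open>0\<close> and
  \<open>1\<close>, \<open>squeeze \<epsilon>\<close> maps balls about it into themselves.\<close>

definition spectral_mass_near_e1 :: "real \<Rightarrow> (real^3 \<Rightarrow> real^3) \<Rightarrow> bool" where
  "spectral_mass_near_e1 m u \<longleftrightarrow> (\<forall>w \<delta> r. w \<in> borel_measurable borel \<and> (\<forall>\<xi>. 0 \<le> w \<xi>) \<and> 0 < \<delta> \<and>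
       (\<forall>\<xi>\<in>ball (axis 1 1) r. \<delta> \<le> w \<xi>) \<longrightarrow>
     ennreal (m * \<delta>) * (\<integral>\<^sup>+\<eta>. ennreal (indicator (ball (axis 1 1) r) \<eta> * profile \<eta>) \<partial>lborel)
       \<le> (\<integral>\<^sup>+\<xi>. ennreal (w \<xi> * (norm (fourier u \<xi>))\<^sup>2) \<partial>lborel))"

lemma spectral_mass_near_e1D:
  assumes "spectral_mass_near_e1 m u" "w \<in> borel_measurable borel" "\<And>\<xi>. 0 \<le> w \<xi>" "0 < \<delta>"
    "\<And>\<xi>. \<xi> \<in> ball (axis 1 1) r \<Longrightarrow> \<delta> \<le> w \<xi>"
  shows "ennreal (m * \<delta>) * (\<integral>\<^sup>+\<eta>. ennreal (indicator (ball (axis 1 1) r) \<eta> * profile \<eta>) \<partial>lborel)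
       \<le> (\<integral>\<^sup>+\<xi>. ennreal (w \<xi> * (norm (fourier u \<xi>))\<^sup>2) \<partial>lborel)"
proof -
  have "w \<in> borel_measurable borel \<and> (\<forall>\<xi>. 0 \<le> w \<xi>) \<and> 0 < \<delta> \<and> (\<forall>\<xi>\<in>ball (axis 1 1) r. \<delta> \<le> w \<xi>)"
    by (intro conjI allI ballI assms(2-5))
  with assms(1)[unfolded spectral_mass_near_e1_def, THEN spec, THEN spec, THEN spec] show ?thesis
    by (rule mp)
qed

text \<open>The energy and the enstrophy of the swirl, and with them the exponent in the
  definition of the set, are bounded independently of \<open>\<epsilon>\<close>, while the squared
  vorticity norm is at most a constant times \<open>\<epsilon>\<close>.\<close>

lemma Gamma_2d_contains_large_fields:
  assumes \<nu>: "0 < \<nu>" and a: "0 < a"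
  shows "\<exists>u\<in>Gamma_2d \<nu>. is_L2 u \<and> spectral_mass_near_e1 (a\<^sup>2) u"
proof -
  obtain c where c: "0 < c" "(\<integral>\<^sup>+\<eta>. ennreal ((1 + (norm \<eta>)\<^sup>2) * profile \<eta>) \<partial>lborel) \<le> ennreal c"
    using profile_moment_finite by blast
  \<comment> \<open>\<open>e0\<close> bounds the exponent for all \<open>\<epsilon> \<le>
      1\<close>, and \<open>\<epsilon> Q\<close> bounds the square of the left side of the
      defining inequality\<close>
  define e0 where "e0 = (pi\<^sup>2 * (a\<^sup>2 * c)\<^sup>2) / (R2 * \<nu> ^ 4)"
  define Q where "Q = 2 * pi * a\<^sup>2 * c * (exp e0)\<^sup>2"
  define \<epsilon> where "\<epsilon> = min 1 ((R1 * \<nu>)\<^sup>2 / (2 * Q))"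
  have Q: "0 < Q" using a c by (simp add: Q_def)
  have \<epsilon>: "0 < \<epsilon>" "\<epsilon> \<le> 1" using Q \<nu> R1_pos by (auto simp: \<epsilon>_def)
  have \<epsilon>Q: "\<epsilon> * Q < (R1 * \<nu>)\<^sup>2"
  proof -
    have "\<epsilon> * Q \<le> (R1 * \<nu>)\<^sup>2 / (2 * Q) * Q"
      using Q by (intro mult_right_mono) (auto simp: \<epsilon>_def)
    also have "\<dots> < (R1 * \<nu>)\<^sup>2"
      using Q \<nu> R1_pos by (simp add: zero_less_mult_iff)
    finally show ?thesis .
  qed
  obtain u where "swirl_spectrum a \<epsilon> u"
    using swirl_field_exists[OF a \<epsilon>(1)] ..
  then have uL: "is_L2 u"
    and uAE: "AE \<xi> in lborel. fourier u \<xi> $ 3 = 0 \<and> complex_of_real (\<xi> $ 1) * fourier u \<xi> $ 1 + complex_of_real (\<xi> $ 2) * fourier u \<xi> $ 2 = 0"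
    and uint: "\<And>w. w \<in> borel_measurable borel \<Longrightarrow> (\<And>\<xi>. 0 \<le> w \<xi>) \<Longrightarrow> (\<integral>\<^sup>+\<xi>. ennreal (w \<xi> * (norm (fourier u \<xi>))\<^sup>2) \<partial>lborel)
        = (\<integral>\<^sup>+\<eta>. ennreal (a\<^sup>2 * (w (squeeze \<epsilon> \<eta>) * profile \<eta>)) \<partial>lborel)"
    unfolding swirl_spectrum_def by simp_all
  have [measurable]: "(\<lambda>\<xi>. norm (fourier u \<xi>)) \<in> borel_measurable borel" by (rule fourier_norm_measurable[OF uL])
  have upper: "(\<integral>\<^sup>+\<xi>. ennreal (w \<xi> * (norm (fourier u \<xi>))\<^sup>2) \<partial>lborel) \<le> ennreal (a\<^sup>2 * b * c)"
    if w: "w \<in> borel_measurable borel" "\<And>\<xi>. 0 \<le> w \<xi>" and wb: "\<And>\<eta>. w (squeeze \<epsilon> \<eta>) \<le> b * (1 + (norm \<eta>)\<^sup>2)" and b: "0 \<le> b" for w b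
  proof -
    have "(\<integral>\<^sup>+\<xi>. ennreal (w \<xi> * (norm (fourier u \<xi>))\<^sup>2) \<partial>lborel) \<le> (\<integral>\<^sup>+\<eta>. ennreal (a\<^sup>2 * b) * ennreal ((1 + (norm \<eta>)\<^sup>2) * profile \<eta>) \<partial>lborel)"
      unfolding uint[OF w]
    proof (rule nn_integral_mono)
      fix \<eta> :: "real^3"
      have "a\<^sup>2 * (w (squeeze \<epsilon> \<eta>) * profile \<eta>) \<le> a\<^sup>2 * (b * (1 + (norm \<eta>)\<^sup>2) * profile \<eta>)"
        by (intro mult_left_mono mult_right_mono wb profile_nonneg) auto
      then have "ennreal (a\<^sup>2 * (w (squeeze \<epsilon> \<eta>) * profile \<eta>)) \<le> ennreal (a\<^sup>2 * b * ((1 + (norm \<eta>)\<^sup>2) * profile \<eta>))"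
        by (intro ennreal_leI) (simp only: mult_ac)
      also have "\<dots> = ennreal (a\<^sup>2 * b) * ennreal ((1 + (norm \<eta>)\<^sup>2) * profile \<eta>)"
        using b profile_nonneg by (intro ennreal_mult) auto
      finally show "ennreal (a\<^sup>2 * (w (squeeze \<epsilon> \<eta>) * profile \<eta>)) \<le> ennreal (a\<^sup>2 * b) * ennreal ((1 + (norm \<eta>)\<^sup>2) * profile \<eta>)" .
    qed
    also have "\<dots> = ennreal (a\<^sup>2 * b) * (\<integral>\<^sup>+\<eta>. ennreal ((1 + (norm \<eta>)\<^sup>2) * profile \<eta>) \<partial>lborel)"
      by (rule nn_integral_cmult) simp
    also have "\<dots> \<le> ennreal (a\<^sup>2 * b) * ennreal c"
      by (intro mult_left_mono c) auto
    also have "\<dots> = ennreal (a\<^sup>2 * b * c)"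
      using b c by (intro ennreal_mult[symmetric]) auto
    finally show ?thesis .
  qed
  have sqn: "(norm (squeeze \<epsilon> \<eta>))\<^sup>2 \<le> (norm \<eta>)\<^sup>2" for \<eta>
    using norm_squeeze_le[of \<epsilon> \<eta>] \<epsilon> by (intro power_mono) auto
  have energy: "L2sq u \<le> ennreal (a\<^sup>2 * 1 * c)"
    using upper[of "\<lambda>_. 1" 1] fourier_plancherel[OF uL] by (simp add: L2sq_def)
  have enstrophy: "(\<integral>\<^sup>+\<xi>. ennreal ((norm \<xi>)\<^sup>2 * (norm (fourier u \<xi>))\<^sup>2) \<partial>lborel) \<le> ennreal (a\<^sup>2 * 1 * c)"
  proof (rule upper)
    show "(norm (squeeze \<epsilon> \<eta>))\<^sup>2 \<le> 1 * (1 + (norm \<eta>)\<^sup>2)" for \<eta>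
      by (rule order_trans[OF sqn]) simp
  qed auto
  have fin: "(\<integral>\<^sup>+\<xi>. ennreal ((norm \<xi>)\<^sup>2 * (norm (fourier u \<xi>))\<^sup>2) \<partial>lborel) < \<infinity>"
    by (rule le_less_trans[OF enstrophy]) simp
  have uH: "u \<in> H1_df"
  proof -
    have "(\<integral>\<^sup>+\<xi>. ennreal ((1 + (2 * pi * norm \<xi>) powr (2 * 1)) * (norm (fourier u \<xi>))\<^sup>2) \<partial>lborel) \<le> ennreal (a\<^sup>2 * (1 + 4 * pi\<^sup>2) * c)"
    proof (rule upper)
      fix \<eta> :: "real^3"
      have "1 + 4 * pi\<^sup>2 * (norm (squeeze \<epsilon> \<eta>))\<^sup>2 \<le> 1 + 4 * pi\<^sup>2 * (norm \<eta>)\<^sup>2"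
        by (intro add_left_mono mult_left_mono sqn) auto
      also have "\<dots> \<le> (1 + 4 * pi\<^sup>2) * (1 + (norm \<eta>)\<^sup>2)"
        by (simp add: algebra_simps)
      finally show "1 + (2 * pi * norm (squeeze \<epsilon> \<eta>)) powr (2 * 1) \<le> (1 + 4 * pi\<^sup>2) * (1 + (norm \<eta>)\<^sup>2)"
        by (simp add: power_mult_distrib)
    qed auto
    then have "H_norm 1 u < \<infinity>"
      unfolding H_norm_def enn_powr_half_less_top_iff by (rule le_less_trans) simp
    moreover have "AE \<xi> in lborel. (\<Sum>i\<in>UNIV. complex_of_real (\<xi> $ i) * fourier u \<xi> $ i) = 0"
      using uAE by eventually_elim (simp add: sum_3)
    ultimately show ?thesis
      using uL by (simp add: H1_df_def in_L2_iff)
  qed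
  have vort: "(Hdot_norm (-1/2) (horizontal_vorticity u))\<^sup>2 \<le> ennreal (a\<^sup>2 * (2 * pi * \<epsilon>) * c)"
  proof -
    have "(Hdot_norm (-1/2) (horizontal_vorticity u))\<^sup>2 = (\<integral>\<^sup>+\<xi>. ennreal ((2 * pi * norm \<xi>) powr (2 * (-1/2)) * (norm (fourier (horizontal_vorticity u) \<xi>))\<^sup>2) \<partial>lborel)"
      unfolding Hdot_norm_def enn_powr_half_sq ..
    also have "\<dots> \<le> (\<integral>\<^sup>+\<xi>. ennreal (2 * pi * \<bar>\<xi> $ 3\<bar> * (norm (fourier u \<xi>))\<^sup>2) \<partial>lborel)"
    proof (rule nn_integral_mono_AE)
      show "AE \<xi> in lborel. ennreal ((2 * pi * norm \<xi>) powr (2 * (-1/2)) * (norm (fourier (horizontal_vorticity u) \<xi>))\<^sup>2)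
          \<le> ennreal (2 * pi * \<bar>\<xi> $ 3\<bar> * (norm (fourier u \<xi>))\<^sup>2)"
        using uAE fourier_horizontal_vorticity(2)[OF uL fin]
      proof eventually_elim
        case (elim \<xi>)
        have w: "(norm (fourier (horizontal_vorticity u) \<xi>))\<^sup>2 = 4 * pi\<^sup>2 * ((\<xi> $ 3)\<^sup>2 * (norm (fourier u \<xi>))\<^sup>2)"
          unfolding elim(2) norm_sq_vec using elim(1) by (simp add: sum_3 norm_mult power_mult_distrib algebra_simps)
        have "(\<xi> $ 3)\<^sup>2 \<le> \<bar>\<xi> $ 3\<bar> * norm \<xi>"
        proof -
          have "(\<xi> $ 3)\<^sup>2 = \<bar>\<xi> $ 3\<bar> * \<bar>\<xi> $ 3\<bar>"
            by (simp add: power2_eq_square)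
          also have "\<dots> \<le> \<bar>\<xi> $ 3\<bar> * norm \<xi>"
            by (intro mult_left_mono component_le_norm_cart) simp
          finally show ?thesis .
        qed
        then have x: "(\<xi> $ 3)\<^sup>2 / norm \<xi> \<le> \<bar>\<xi> $ 3\<bar>"
          by (cases "\<xi> = 0") (auto simp: divide_le_eq)
        have "(2 * pi * norm \<xi>) powr (2 * (-1/2)) * (norm (fourier (horizontal_vorticity u) \<xi>))\<^sup>2
            = 2 * pi * ((\<xi> $ 3)\<^sup>2 / norm \<xi>) * (norm (fourier u \<xi>))\<^sup>2"
          unfolding w by (cases "\<xi> = 0") (simp_all add: powr_minus power2_eq_square field_simps)
        also have "\<dots> \<le> 2 * pi * \<bar>\<xi> $ 3\<bar> * (norm (fourier u \<xi>))\<^sup>2"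
          by (intro mult_right_mono mult_left_mono x) auto
        finally show ?case by (rule ennreal_leI)
      qed
    qed
    also have "\<dots> \<le> ennreal (a\<^sup>2 * (2 * pi * \<epsilon>) * c)"
    proof (rule upper)
      fix \<eta> :: "real^3"
      have "\<bar>\<eta> $ 3\<bar> \<le> 1 + (norm \<eta>)\<^sup>2"
      proof -
        have "0 \<le> (norm \<eta> - 1)\<^sup>2" by simp
        then have "2 * norm \<eta> \<le> 1 + (norm \<eta>)\<^sup>2" by (simp add: power2_diff)
        then show ?thesis using component_le_norm_cart[of \<eta> 3] norm_ge_zero[of \<eta>] by linarith
      qed
      then have "2 * pi * \<epsilon> * \<bar>\<eta> $ 3\<bar> \<le> 2 * pi * \<epsilon> * (1 + (norm \<eta>)\<^sup>2)"
        using \<epsilon> by (intro mult_left_mono) auto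
      then show "2 * pi * \<bar>squeeze \<epsilon> \<eta> $ 3\<bar> \<le> 2 * pi * \<epsilon> * (1 + (norm \<eta>)\<^sup>2)"
        using \<epsilon> by (simp add: abs_mult mult_ac)
    qed (use \<epsilon> in auto)
    finally show ?thesis .
  qed
  have "u \<in> Gamma_2d \<nu>"
  proof -
    let ?H = "Hdot_norm (-1/2) (horizontal_vorticity u)"
    define e where "e = (1/4 * (enn2real (Lp_norm 2 u))\<^sup>2 * (enn2real (Hdot_norm 1 u))\<^sup>2 - 6912 * pi ^ 4 * \<nu> ^ 4) / (R2 * \<nu> ^ 4)"
    have L: "(enn2real (Lp_norm 2 u))\<^sup>2 \<le> a\<^sup>2 * c"
    proof -
      have "ennreal ((enn2real (Lp_norm 2 u))\<^sup>2) \<le> ennreal (a\<^sup>2 * 1 * c)"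
        using enn2real_enn_powr_half[of "L2sq u"] uL energy by (simp add: Lp_norm_2 is_L2_def)
      then show ?thesis using c by (simp add: ennreal_le_iff)
    qed
    have D: "(enn2real (Hdot_norm 1 u))\<^sup>2 \<le> 4 * pi\<^sup>2 * (a\<^sup>2 * c)"
    proof -
      have "(Hdot_norm 1 u)\<^sup>2 \<le> ennreal (4 * pi\<^sup>2) * ennreal (a\<^sup>2 * 1 * c)"
        unfolding Hdot_1_sq[OF uL] by (intro mult_left_mono enstrophy) auto
      also have "\<dots> = ennreal (4 * pi\<^sup>2 * (a\<^sup>2 * c))"
        using c by (simp flip: ennreal_mult)
      finally have *: "(Hdot_norm 1 u)\<^sup>2 \<le> ennreal (4 * pi\<^sup>2 * (a\<^sup>2 * c))" .
      then have "(Hdot_norm 1 u)\<^sup>2 < \<infinity>" by (rule le_less_trans) simp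
      then have "Hdot_norm 1 u < \<infinity>" by (auto simp: power_less_top_ennreal)
      then have "(Hdot_norm 1 u)\<^sup>2 = ennreal ((enn2real (Hdot_norm 1 u))\<^sup>2)"
        by (metis ennreal_enn2real ennreal_power enn2real_nonneg infinity_ennreal_def)
      with * show ?thesis using c by (simp add: ennreal_le_iff)
    qed
    have "1/4 * (enn2real (Lp_norm 2 u))\<^sup>2 * (enn2real (Hdot_norm 1 u))\<^sup>2 \<le> 1/4 * (a\<^sup>2 * c) * (4 * pi\<^sup>2 * (a\<^sup>2 * c))"
      using L D c by (intro mult_mono) auto
    also have "\<dots> = pi\<^sup>2 * (a\<^sup>2 * c)\<^sup>2"
      by (simp add: power2_eq_square)
    finally have "1/4 * (enn2real (Lp_norm 2 u))\<^sup>2 * (enn2real (Hdot_norm 1 u))\<^sup>2 - 6912 * pi ^ 4 * \<nu> ^ 4 \<le> pi\<^sup>2 * (a\<^sup>2 * c)\<^sup>2"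
      using \<nu> zero_le_power[of pi 4] by (smt (verit) mult_nonneg_nonneg pi_ge_zero zero_le_power)
    then have e: "e \<le> e0"
      unfolding e_def e0_def using R2_pos \<nu> by (intro divide_right_mono) auto
    have "(?H * ennreal (exp e))\<^sup>2 \<le> ennreal (a\<^sup>2 * (2 * pi * \<epsilon>) * c) * ennreal ((exp e0)\<^sup>2)"
      unfolding power_mult_distrib using e
      by (intro mult_mono vort) (auto simp: ennreal_power intro!: ennreal_leI power_mono)
    also have "\<dots> = ennreal (\<epsilon> * Q)"
      using \<epsilon> c by (simp add: Q_def mult_ac flip: ennreal_mult)
    also have "\<dots> < ennreal ((R1 * \<nu>)\<^sup>2)"
    proof (rule ennreal_lessI)
      have "0 < R1 * \<nu>" using R1_pos \<nu> by simp
      then show "0 < (R1 * \<nu>)\<^sup>2" by (rule zero_less_power)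
    qed (fact \<epsilon>Q)
    also have "\<dots> = (ennreal (R1 * \<nu>))\<^sup>2"
      using R1_pos \<nu> by (simp add: ennreal_power)
    finally have "?H * ennreal (exp e) < ennreal (R1 * \<nu>)"
      using power_mono_ennreal[of "ennreal (R1 * \<nu>)" "?H * ennreal (exp e)" 2] by (meson not_le)
    then show ?thesis
      using uH unfolding Gamma_2d_def e_def by simp
  qed
  moreover have "spectral_mass_near_e1 (a\<^sup>2) u"
    unfolding spectral_mass_near_e1_def
  proof (intro allI impI)
    fix w :: "real^3 \<Rightarrow> real" and \<delta> r :: real
    assume "w \<in> borel_measurable borel \<and> (\<forall>\<xi>. 0 \<le> w \<xi>) \<and> 0 < \<delta> \<and> (\<forall>\<xi>\<in>ball (axis 1 1) r. \<delta> \<le> w \<xi>)"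
    then have w: "w \<in> borel_measurable borel" "\<And>\<xi>. 0 \<le> w \<xi>" and \<delta>: "0 < \<delta>" "\<And>\<xi>. \<xi> \<in> ball (axis 1 1) r \<Longrightarrow> \<delta> \<le> w \<xi>"
      by blast+
    have inball: "squeeze \<epsilon> \<eta> \<in> ball (axis 1 1) r" if "\<eta> \<in> ball (axis 1 1) r" for \<eta>
    proof -
      have "squeeze \<epsilon> \<eta> - axis 1 1 = squeeze \<epsilon> (\<eta> - axis 1 1)"
        by (simp add: vec_eq_iff forall_3 axis_def)
      then have "norm (squeeze \<epsilon> \<eta> - axis 1 1) \<le> norm (\<eta> - axis 1 1)"
        using norm_squeeze_le[of \<epsilon>] \<epsilon> by simp
      with that show ?thesis
        by (simp add: dist_norm norm_minus_commute)
    qed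
    have "(\<lambda>\<eta>. indicator (ball (axis 1 1) r) \<eta> * profile \<eta>) \<in> borel_measurable borel"
      by (intro borel_measurable_times borel_measurable_indicator profile_measurable) simp
    note [measurable] = this
    have "ennreal (a\<^sup>2 * \<delta>) * (\<integral>\<^sup>+\<eta>. ennreal (indicator (ball (axis 1 1) r) \<eta> * profile \<eta>) \<partial>lborel)
        = (\<integral>\<^sup>+\<eta>. ennreal (a\<^sup>2 * \<delta>) * ennreal (indicator (ball (axis 1 1) r) \<eta> * profile \<eta>) \<partial>lborel)"
      by (rule nn_integral_cmult[symmetric]) measurable
    also have "\<dots> \<le> (\<integral>\<^sup>+\<eta>. ennreal (a\<^sup>2 * (w (squeeze \<epsilon> \<eta>) * profile \<eta>)) \<partial>lborel)"
    proof (rule nn_integral_mono)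
      fix \<eta>
      show "ennreal (a\<^sup>2 * \<delta>) * ennreal (indicator (ball (axis 1 1) r) \<eta> * profile \<eta>) \<le> ennreal (a\<^sup>2 * (w (squeeze \<epsilon> \<eta>) * profile \<eta>))"
      proof (cases "\<eta> \<in> ball (axis 1 1) r")
        case True
        have "a\<^sup>2 * (\<delta> * profile \<eta>) \<le> a\<^sup>2 * (w (squeeze \<epsilon> \<eta>) * profile \<eta>)"
          using \<delta>(2)[OF inball[OF True]] by (intro mult_left_mono mult_right_mono profile_nonneg) auto
        then show ?thesis
          using True \<delta>(1) profile_nonneg by (simp add: mult.assoc ennreal_leI flip: ennreal_mult)
      qed simp
    qed
    also have "\<dots> = (\<integral>\<^sup>+\<xi>. ennreal (w \<xi> * (norm (fourier u \<xi>))\<^sup>2) \<partial>lborel)"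
      by (rule uint[OF w, symmetric])
    finally show "ennreal (a\<^sup>2 * \<delta>) * (\<integral>\<^sup>+\<eta>. ennreal (indicator (ball (axis 1 1) r) \<eta> * profile \<eta>) \<partial>lborel)
        \<le> (\<integral>\<^sup>+\<xi>. ennreal (w \<xi> * (norm (fourier u \<xi>))\<^sup>2) \<partial>lborel)" .
  qed
  ultimately show ?thesis
    using uL by blast
qed

lemma not_bounded_wrtI:
  assumes k: "0 < k" and lower: "\<And>a. 0 < a \<Longrightarrow> \<exists>u\<in>S. ennreal (a\<^sup>2 * k) \<le> (N u)\<^sup>2"
  shows "\<not> bounded_wrt N S"
proof
  assume "bounded_wrt N S"
  then obtain r where r: "(SUP u\<in>S. N u) = ennreal r" "0 \<le> r"
    unfolding bounded_wrt_def by (cases "SUP u\<in>S. N u") auto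
  \<comment> \<open>makes \<open>a\<^sup>2 k = (r + 1)\<^sup>2\<close>, beyond the supposed bound\<close>
  define a where "a = (r + 1) / sqrt k"
  have a: "0 < a" using k r by (simp add: a_def)
  obtain u where u: "u \<in> S" "ennreal (a\<^sup>2 * k) \<le> (N u)\<^sup>2"
    using lower[OF a] by blast
  have "N u \<le> ennreal r"
    using u(1) unfolding r(1)[symmetric] by (rule SUP_upper)
  then have "(N u)\<^sup>2 \<le> (ennreal r)\<^sup>2"
    by (rule power_mono_ennreal)
  also have "(ennreal r)\<^sup>2 = ennreal (r\<^sup>2)"
    using r(2) by (rule ennreal_power)
  finally have "ennreal (a\<^sup>2 * k) \<le> ennreal (r\<^sup>2)"
    using u(2) by (rule order_trans[rotated])
  then have "a\<^sup>2 * k \<le> r\<^sup>2"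
    by (simp add: ennreal_le_iff)
  moreover have "a\<^sup>2 * k = (r + 1)\<^sup>2"
    using k by (simp add: a_def power_divide)
  ultimately show False
    using r(2) by (simp add: power2_eq_square algebra_simps)
qed

text \<open>Within distance \<open>1/2\<close> of the first unit vector the weight of the norm is
  at least \<open>1\<close>.\<close>

theorem Gamma_2d_unbounded_Hdot:
  assumes \<nu>: "0 < \<nu>"
  shows "\<not> bounded_wrt (Hdot_norm (1/2)) (Gamma_2d \<nu>)"
proof -
  obtain p where p: "0 < p" "ennreal p \<le> (\<integral>\<^sup>+\<eta>. ennreal (indicator (ball (axis 1 1) (1/2)) \<eta> * profile \<eta>) \<partial>lborel)"
    using profile_ball_positive[of "1/2"] by auto
  show ?thesis
  proof (rule not_bounded_wrtI[OF p(1)])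
    fix a :: real assume a: "0 < a"
    obtain u where u: "u \<in> Gamma_2d \<nu>" "is_L2 u" and mass: "spectral_mass_near_e1 (a\<^sup>2) u"
      using Gamma_2d_contains_large_fields[OF \<nu> a] by blast
    have "ennreal (a\<^sup>2 * p) = ennreal (a\<^sup>2 * 1) * ennreal p"
      using p by (simp add: ennreal_mult)
    also have "\<dots> \<le> ennreal (a\<^sup>2 * 1) * (\<integral>\<^sup>+\<eta>. ennreal (indicator (ball (axis 1 1) (1/2)) \<eta> * profile \<eta>) \<partial>lborel)"
      by (intro mult_left_mono p) auto
    also have "\<dots> \<le> (\<integral>\<^sup>+\<xi>. ennreal ((2 * pi * norm \<xi>) powr (2 * (1/2)) * (norm (fourier u \<xi>))\<^sup>2) \<partial>lborel)"
    proof (rule spectral_mass_near_e1D[OF mass])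
      fix \<xi> :: "real^3" assume "\<xi> \<in> ball (axis 1 1) (1/2)"
      moreover have "norm (axis 1 1 :: real^3) \<le> norm (axis 1 1 - \<xi>) + norm \<xi>"
        by (metis diff_add_cancel norm_triangle_ineq)
      ultimately have "1/2 \<le> norm \<xi>" by (simp add: dist_norm)
      then have "2 * 3 * (1/2) \<le> 2 * pi * norm \<xi>"
        using pi_gt3 by (intro mult_mono) auto
      then show "1 \<le> (2 * pi * norm \<xi>) powr (2 * (1/2))" by simp
    qed auto
    also have "\<dots> = (Hdot_norm (1/2) u)\<^sup>2"
      unfolding Hdot_norm_def enn_powr_half_sq ..
    finally show "\<exists>u\<in>Gamma_2d \<nu>. ennreal (a\<^sup>2 * p) \<le> (Hdot_norm (1/2) u)\<^sup>2"
      using u(1) by blast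
  qed
qed

text \<open>Plancherel's theorem for the localised transform, which is integrable because its
  support is bounded.\<close>

lemma LP_block_L2:
  assumes u: "is_L2 u" and \<phi>: "LP_function \<phi>"
  shows "(Lp_norm 2 (LP_block \<phi> j u))\<^sup>2 = (\<integral>\<^sup>+\<xi>. ennreal ((\<phi> ((2 powr (- of_int j)) *\<^sub>R \<xi>))\<^sup>2 * (norm (fourier u \<xi>))\<^sup>2) \<partial>lborel)"
proof -
  let ?m = "\<lambda>\<xi>. \<phi> ((2 powr (- of_int j)) *\<^sub>R \<xi>)"
  let ?g = "\<lambda>i \<xi>. complex_of_real (?m \<xi>) * fourier u \<xi> $ i"
  obtain a b where ab: "0 < a" "a < b" "\<And>\<xi>. \<phi> \<xi> \<noteq> 0 \<Longrightarrow> a \<le> norm \<xi> \<and> norm \<xi> \<le> b"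
    and \<phi>01: "\<And>\<xi>. 0 \<le> \<phi> \<xi>" "\<And>\<xi>. \<phi> \<xi> \<le> 1"
    using \<phi> unfolding LP_function_def by blast
  have [measurable]: "\<phi> \<in> borel_measurable borel" by (rule LP_function_measurable[OF \<phi>])
  have fm[measurable]: "fourier u \<in> borel_measurable borel" by (rule fourier_measurable[OF u])
  have [measurable]: "(\<lambda>\<xi>. fourier u \<xi> $ i) \<in> borel_measurable borel" for i by (rule borel_measurable_vec_nth[OF fm])
  define R where "R = b * 2 powr of_int j"
  have supp: "norm \<xi> \<le> R" if "?m \<xi> \<noteq> 0" for \<xi>
    using ab(3)[OF that] by (simp add: R_def powr_minus field_simps)
  have mint: "integrable lborel (\<lambda>\<xi>. complex_of_real (?m \<xi>))"
  proof (rule Bochner_Integration.integrable_bound)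
    show "integrable lborel (indicator (cball 0 R) :: real^3 \<Rightarrow> real)"
      using emeasure_bounded_finite[OF bounded_cball, of "0::real^3" R] by (intro integrable_real_indicator) auto
    show "AE \<xi> in lborel. norm (complex_of_real (?m \<xi>)) \<le> norm (indicator (cball 0 R) \<xi> :: real)"
    proof (rule AE_I2)
      fix \<xi> :: "real^3"
      show "norm (complex_of_real (?m \<xi>)) \<le> norm (indicator (cball 0 R) \<xi> :: real)"
        using supp[of \<xi>] \<phi>01(1)[of "(2 powr (- of_int j)) *\<^sub>R \<xi>"] \<phi>01(2)[of "(2 powr (- of_int j)) *\<^sub>R \<xi>"]
        by (cases "?m \<xi> = 0") (auto simp: indicator_def)
    qed
  qed simp
  have mL2: "is_L2 (\<lambda>\<xi>. complex_of_real (?m \<xi>))"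
    using borel_measurable_integrable[OF mint] L2sq_bounded_integrable(1)[OF mint, of 1] \<phi>01 by (simp add: is_L2_def)
  have fL2: "is_L2 (\<lambda>\<xi>. fourier u \<xi> $ i)" for i
    by (rule has_L2_ft_is_L2[OF is_L2_component(2)[OF u] fourier_component[OF u]])
  have g_int: "integrable lborel (?g i)" for i
    by (rule is_L2_mult_integrable(1)[OF mL2 fL2])
  have g_L2: "is_L2 (?g i)" for i
  proof -
    have "L2sq (?g i) \<le> L2sq (\<lambda>\<xi>. fourier u \<xi> $ i)"
      unfolding L2sq_def
    proof (intro nn_integral_mono ennreal_leI power_mono)
      show "norm (?g i \<xi>) \<le> norm (fourier u \<xi> $ i)" for \<xi>
        using \<phi>01 by (simp add: norm_mult mult_left_le_one_le)
    qed simp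
    with fL2[of i] show ?thesis by (auto simp: is_L2_def intro: le_less_trans)
  qed
  have comp: "LP_block \<phi> j u x $ i = ft (?g i) (- x)" for x i
    by (rule LP_block_component)
  have bm: "LP_block \<phi> j u \<in> borel_measurable borel"
    by (rule borel_measurable_vec) (simp add: comp)
  have "L2sq (LP_block \<phi> j u) = (\<Sum>i\<in>UNIV. L2sq (\<lambda>x. ft (?g i) (- x)))"
    by (simp add: L2sq_vec[OF bm] comp)
  also have "\<dots> = (\<Sum>i\<in>UNIV. L2sq (?g i))"
    using g_L2 by (intro sum.cong) (auto simp: L2sq_reflect plancherel_L1_L2 g_int is_L2_def)
  also have "\<dots> = (\<integral>\<^sup>+\<xi>. (\<Sum>i\<in>UNIV. ennreal ((norm (?g i \<xi>))\<^sup>2)) \<partial>lborel)"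
    unfolding L2sq_def by (rule nn_integral_sum[symmetric]) simp
  also have "\<dots> = (\<integral>\<^sup>+\<xi>. ennreal ((?m \<xi>)\<^sup>2 * (norm (fourier u \<xi>))\<^sup>2) \<partial>lborel)"
    by (intro nn_integral_cong) (simp add: norm_mult power_mult_distrib norm_sq_vec sum_distrib_left)
  finally show ?thesis
    unfolding Lp_norm_2 enn_powr_half_sq .
qed

text \<open>Since the dyadic dilates of \<open>\<phi>\<close> add up to \<open>1\<close>, some
  block is positive at the first unit vector, hence by continuity near it. A single block is
  enough for a supremum.\<close>

theorem Gamma_2d_unbounded_Besov:
  assumes \<nu>: "0 < \<nu>" and \<phi>: "LP_function \<phi>"
  shows "\<not> bounded_wrt (besov_norm \<phi> (1/2) 2) (Gamma_2d \<nu>)"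
proof -
  let ?e = "axis 1 1 :: real^3"
  have \<phi>0: "\<And>\<xi>. 0 \<le> \<phi> \<xi>" and Ck: "Ck 0 \<phi>"
    and hs: "((\<lambda>j::int. \<phi> ((2 powr (- of_int j)) *\<^sub>R ?e)) has_sum 1) UNIV"
  proof -
    have "?e \<noteq> 0" by (simp add: axis_eq_0_iff)
    then show "((\<lambda>j::int. \<phi> ((2 powr (- of_int j)) *\<^sub>R ?e)) has_sum 1) UNIV"
      using \<phi> unfolding LP_function_def by blast
    show "\<And>\<xi>. 0 \<le> \<phi> \<xi>" "Ck 0 \<phi>"
      using \<phi> unfolding LP_function_def smooth_def by blast+
  qed
  obtain j :: int where j: "\<phi> ((2 powr (- of_int j)) *\<^sub>R ?e) \<noteq> 0"
  proof (rule ccontr)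
    assume "\<not> thesis"
    then have "\<phi> ((2 powr (- of_int j)) *\<^sub>R ?e) = 0" for j :: int
      using that by blast
    then have "((\<lambda>j::int. 0::real) has_sum 1) UNIV"
      using hs by simp
    then show False
      using has_sum_unique[OF has_sum_0, of UNIV "\<lambda>j::int. 0::real" 1] by auto
  qed
  define w where "w \<xi> = (\<phi> ((2 powr (- of_int j)) *\<^sub>R \<xi>))\<^sup>2" for \<xi>
  have cont: "continuous_on UNIV w"
  proof -
    have "continuous_on UNIV \<phi>" using Ck by simp
    then have "continuous_on UNIV (\<lambda>\<xi>. \<phi> ((2 powr (- of_int j)) *\<^sub>R \<xi>))"
      by (rule continuous_on_compose2) (auto intro!: continuous_intros)
    then show ?thesis
      unfolding w_def by (rule continuous_on_power)
  qed
  have we: "0 < w ?e"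
    using j by (simp add: w_def)
  define \<delta> where "\<delta> = w ?e / 2"
  have \<delta>: "0 < \<delta>" "\<delta> < w ?e" using we by (auto simp: \<delta>_def)
  have "open {\<xi>. \<delta> < w \<xi>}"
    using cont by (intro open_Collect_less) auto
  then obtain r0 where r0: "0 < r0" "ball ?e r0 \<subseteq> {\<xi>. \<delta> < w \<xi>}"
    using \<delta>(2) unfolding open_contains_ball by blast
  define r where "r = min r0 (1/2)"
  have r: "0 < r" "r \<le> 1/2" "\<And>\<xi>. \<xi> \<in> ball ?e r \<Longrightarrow> \<delta> \<le> w \<xi>"
    using r0 by (auto simp: r_def intro!: less_imp_le)
  obtain p where p: "0 < p" "ennreal p \<le> (\<integral>\<^sup>+\<eta>. ennreal (indicator (ball ?e r) \<eta> * profile \<eta>) \<partial>lborel)"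
    using profile_ball_positive[OF r(1,2)] by blast
  define l where "l = (2::real) powr (of_int j * (1/2))"
  have l: "0 < l" by (simp add: l_def)
  show ?thesis
  proof (rule not_bounded_wrtI)
    show "0 < l\<^sup>2 * (\<delta> * p)" using l \<delta> p by simp
    fix a :: real assume a: "0 < a"
    obtain u where u: "u \<in> Gamma_2d \<nu>" "is_L2 u" and mass: "spectral_mass_near_e1 (a\<^sup>2) u"
      using Gamma_2d_contains_large_fields[OF \<nu> a] by blast
    have "ennreal (a\<^sup>2 * (l\<^sup>2 * (\<delta> * p))) = ennreal (l\<^sup>2) * (ennreal (a\<^sup>2 * \<delta>) * ennreal p)"
      using p \<delta> by (simp add: mult_ac flip: ennreal_mult)
    also have "\<dots> \<le> ennreal (l\<^sup>2) * (ennreal (a\<^sup>2 * \<delta>) * (\<integral>\<^sup>+\<eta>. ennreal (indicator (ball ?e r) \<eta> * profile \<eta>) \<partial>lborel))"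
      by (intro mult_left_mono p) auto
    also have "\<dots> \<le> ennreal (l\<^sup>2) * (\<integral>\<^sup>+\<xi>. ennreal (w \<xi> * (norm (fourier u \<xi>))\<^sup>2) \<partial>lborel)"
      by (intro mult_left_mono spectral_mass_near_e1D[OF mass] \<delta> r borel_measurable_continuous_onI cont) (auto simp: w_def)
    also have "\<dots> = (ennreal l * Lp_norm 2 (LP_block \<phi> j u))\<^sup>2"
      unfolding w_def LP_block_L2[OF u(2) \<phi>, symmetric] using l by (simp add: power_mult_distrib ennreal_power)
    also have "\<dots> \<le> (besov_norm \<phi> (1/2) 2 u)\<^sup>2"
    proof (rule power_mono_ennreal)
      show "ennreal l * Lp_norm 2 (LP_block \<phi> j u) \<le> besov_norm \<phi> (1/2) 2 u"
        unfolding besov_norm_def l_def by (auto intro!: SUP_upper2[of j])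
    qed
    finally show "\<exists>u\<in>Gamma_2d \<nu>. ennreal (a\<^sup>2 * (l\<^sup>2 * (\<delta> * p))) \<le> (besov_norm \<phi> (1/2) 2 u)\<^sup>2"
      using u(1) by blast
  qed
qed

theorem theorem1p11:
  fixes \<nu> :: real
  assumes "\<nu> > 0"
  shows "\<not> bounded_wrt (Hdot_norm (1/2)) (Gamma_2d \<nu>) \<and>
         (\<forall>\<phi>. LP_function \<phi> \<longrightarrow>
            \<not> bounded_wrt (besov_norm \<phi> (1/2) 2) (Gamma_2d \<nu>) \<and>
            (\<forall>p::ennreal. 2 < p \<longrightarrow>
               bounded_wrt (besov_norm \<phi> (- 1 + enn2real (3 / p)) p) (Gamma_2d \<nu>)))"
  using Gamma_2d_unbounded_Hdot[OF assms] Gamma_2d_unbounded_Besov[OF assms] Gamma_2d_bounded_Besov[OF assms]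
  by blast

end
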